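(* Let $\alpha,w_0\in\mathbb C\setminus\{0\}$ and let $\Omega\subset\hat{\mathbb C}$ be an unbounded simply connected domain with $0\notin\Omega$. Then $\Omega\in\mathrm{QD}_0\big(\frac{\alpha}{w-w_0}\big)$ if and only if there exist $c>0$, $\lambda\in\mathbb C$ and $z_1\in\mathbb C$ with $|z_1|>1$ such that the map $$\varphi(z)=c\,z\,\exp\Big(\frac{\lambda}{1-z\bar z_1}\Big)$$ is univalent on $\mathbb D^*$, $\Omega=\varphi(\mathbb D^* )$, $\varphi(z_1)=w_0$, and $\lambda=\dfrac{\bar\alpha\,\bar w_0}{\bar z_1\,\overline{\varphi'(z_1)}}$.
   Context: $\hat{\mathbb C}$ is the Riemann sphere; a domain is a connected open subset of $\hat{\mathbb C}$. For $\Omega\subset\hat{\mathbb C}$, $\overline{\Omega}$ is its closure. $\mathbb D^*=\{|z|>1\}\cup\{\infty\}$. $dA=dx\,dy/\pi$ is normalized area measure; integrals over unbounded sets are principal values $\lim_{R\to\infty}\int_{\cdot\,\cap\{|w|<R\}}$. Contour integrals are normalized: $\oint_{\partial\Omega}$ means $\frac{1}{2\pi i}\int_{\partial\Omega}$ with $\partial\Omega$ positively oriented with respect to $\Omega$. $A(\Omega)$ denotes functions analytic in $\Omega$ and continuous on $\overline\Omega$ (in $\hat{\mathbb C}$); $\mathrm{Rat}(\Omega)$ denotes rational functions all of whose poles lie in $\Omega$, and $\mathrm{Rat}_0(\Omega)$ those vanishing at $\infty$. Let $\rho_0(w)=|w|^{-2}$ and $L^1_a(\Omega;\rho_0)=\{f\in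 A(\Omega):\int_\Omega|f|\rho_0\,dA<\infty\}$. A rectifiable domain $\Omega\subset\hat{\mathbb C}$ with $0,\infty\notin\partial\Omega$ and $\Omega=\mathrm{Int}(\overline\Omega)$ is a log-weighted quadrature domain (LQD) with quadrature function $h$, written $\Omega\in\mathrm{QD}_0(h)$, if $h\in\mathrm{Rat}_0(\Omega)$ when $\Omega$ is bounded, $h\in\mathrm{Rat}(\Omega)$ when $\Omega$ is unbounded, and $\int_\Omega f(w)|w|^{-2}dA(w)=\oint_{\partial\Omega}f(w)h(w)\,dw$ for all $f\in L^1_a(\Omega;\rho_0)$. *)

theory Defs
  imports "HOL-Complex_Analysis.Complex_Analysis" "HOL-Computational_Algebra.Polynomial"
begin

datatype csph = Fin complex | Infty

instantiation csph :: topological_space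
begin

definition open_csph_def:
  "open (U :: csph set) \<longleftrightarrow>
     open {z. Fin z \<in> U} \<and> (Infty \<in> U \<longrightarrow> (\<exists>R. \<forall>z. R < cmod z \<longrightarrow> Fin z \<in> U))"

instance
proof
  show "open (UNIV :: csph set)" by (simp add: open_csph_def)
next
  fix S T :: "csph set"
  assume S: "open S" and T: "open T"
  have "{z. Fin z \<in> S \<inter> T} = {z. Fin z \<in> S} \<inter> {z. Fin z \<in> T}" by auto
  moreover have "Infty \<in> S \<inter> T \<longrightarrow> (\<exists>R. \<forall>z. R < cmod z \<longrightarrow> Fin z \<in> S \<inter> T)"
  proof
    assume "Infty \<in> S \<inter> T"
    then obtain R1 R2 where "\<forall>z. R1 < cmod z \<longrightarrow> Fin z \<in> S" "\<forall>z. R2 < cmod z \<longrightarrow> Fin z \<in> T"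
      using S T by (auto simp: open_csph_def)
    then show "\<exists>R. \<forall>z. R < cmod z \<longrightarrow> Fin z \<in> S \<inter> T"
      by (intro exI[of _ "max R1 R2"]) auto
  qed
  ultimately show "open (S \<inter> T)" using S T by (auto simp: open_csph_def)
next
  fix K :: "csph set set"
  assume K: "\<forall>S\<in>K. open S"
  have "{z. Fin z \<in> \<Union>K} = (\<Union>S\<in>K. {z. Fin z \<in> S})" by auto
  moreover have "open (\<Union>S\<in>K. {z. Fin z \<in> S})" using K by (auto simp: open_csph_def)
  moreover have "Infty \<in> \<Union>K \<longrightarrow> (\<exists>R. \<forall>z. R < cmod z \<longrightarrow> Fin z \<in> \<Union>K)"
  proof
    assume "Infty \<in> \<Union>K"
    then obtain S where "S \<in> K" "Infty \<in> S" by auto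
    then obtain R where "\<forall>z. R < cmod z \<longrightarrow> Fin z \<in> S" using K by (auto simp: open_csph_def)
    then show "\<exists>R. \<forall>z. R < cmod z \<longrightarrow> Fin z \<in> \<Union>K" using \<open>S \<in> K\<close> by blast
  qed
  ultimately show "open (\<Union>K)" by (simp add: open_csph_def)
qed

end

definition fin_part :: "csph set \<Rightarrow> complex set" where
  "fin_part S = {z. Fin z \<in> S}"

definition sph_bounded :: "csph set \<Rightarrow> bool" where
  "sph_bounded S \<longleftrightarrow> Infty \<notin> S \<and> bounded (fin_part S)"

definition sph_domain :: "csph set \<Rightarrow> bool" where
  "sph_domain S \<longleftrightarrow> open S \<and> connected S"

definition Dstar :: "csph set" where
  "Dstar = insert Infty (Fin ` {z. 1 < cmod z})"

definition rectifiable_loop :: "(real \<Rightarrow> complex) \<Rightarrow> bool" where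
  "rectifiable_loop \<gamma> \<longleftrightarrow> path \<gamma> \<and> pathfinish \<gamma> = pathstart \<gamma> \<and>
     (\<exists>B. \<forall>(n::nat) (t::nat \<Rightarrow> real). t 0 = 0 \<and> t n = 1 \<and> (\<forall>i<n. t i \<le> t (Suc i)) \<longrightarrow>
          (\<Sum>i<n. cmod (\<gamma> (t (Suc i)) - \<gamma> (t i))) \<le> B)"

definition rs_has_integral :: "(complex \<Rightarrow> complex) \<Rightarrow> (real \<Rightarrow> complex) \<Rightarrow> complex \<Rightarrow> bool" where
  "rs_has_integral g \<gamma> I \<longleftrightarrow>
     (\<forall>\<epsilon>>0. \<exists>\<delta>>0. \<forall>(n::nat) (t::nat \<Rightarrow> real) (s::nat \<Rightarrow> real).
        t 0 = 0 \<and> t n = 1 \<and>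
        (\<forall>i<n. t i < t (Suc i) \<and> t (Suc i) - t i < \<delta> \<and> t i \<le> s i \<and> s i \<le> t (Suc i)) \<longrightarrow>
        cmod ((\<Sum>i<n. g (\<gamma> (s i)) * (\<gamma> (t (Suc i)) - \<gamma> (t i))) - I) < \<epsilon>)"

definition cycle_has_integral :: "(complex \<Rightarrow> complex) \<Rightarrow> (real \<Rightarrow> complex) list \<Rightarrow> complex \<Rightarrow> bool" where
  "cycle_has_integral g \<Gamma> I \<longleftrightarrow>
     (\<exists>Is. length Is = length \<Gamma> \<and> (\<forall>k<length \<Gamma>. rs_has_integral g (\<Gamma>!k) (Is!k)) \<and> I = sum_list Is)"

text \<open>\<open>\<Gamma>\<close> is a finite family of closed rectifiable curves whose union is \<open>\<partial>\<Omega>\<close> (which must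
  not contain \<open>\<infinity>\<close>), positively oriented with respect to \<open>\<Omega>\<close>: the total winding number
  about a finite point off \<open>\<partial>\<Omega>\<close> is \<open>[z\<in>\<Omega>] - [\<infinity>\<in>\<Omega>]\<close>.\<close>
definition boundary_cycle :: "csph set \<Rightarrow> (real \<Rightarrow> complex) list \<Rightarrow> bool" where
  "boundary_cycle \<Omega> \<Gamma> \<longleftrightarrow>
     Infty \<notin> frontier \<Omega> \<and>
     (\<forall>\<gamma>\<in>set \<Gamma>. rectifiable_loop \<gamma>) \<and>
     (\<Union>\<gamma>\<in>set \<Gamma>. path_image \<gamma>) = fin_part (frontier \<Omega>) \<and>
     (\<forall>z. Fin z \<notin> frontier \<Omega> \<longrightarrow>
        (\<Sum>\<gamma>\<leftarrow>\<Gamma>. winding_number \<gamma> z) =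
          (if Fin z \<in> \<Omega> then 1 else 0) - (if Infty \<in> \<Omega> then 1 else 0))"

definition rectifiable_domain :: "csph set \<Rightarrow> bool" where
  "rectifiable_domain \<Omega> \<longleftrightarrow> sph_domain \<Omega> \<and> (\<exists>\<Gamma>. boundary_cycle \<Omega> \<Gamma>)"

definition sph_analytic_in :: "(csph \<Rightarrow> complex) \<Rightarrow> csph set \<Rightarrow> bool" where
  "sph_analytic_in f \<Omega> \<longleftrightarrow>
     (\<lambda>z. f (Fin z)) holomorphic_on fin_part \<Omega> \<and>
     (Infty \<in> \<Omega> \<longrightarrow> (\<exists>r>0. (\<lambda>z. if z = 0 then f Infty else f (Fin (inverse z))) holomorphic_on ball 0 r))"

definition A_class :: "csph set \<Rightarrow> (csph \<Rightarrow> complex) set" where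
  "A_class \<Omega> = {f. sph_analytic_in f \<Omega> \<and> continuous_on (closure \<Omega>) f}"

definition L1a_rho0 :: "csph set \<Rightarrow> (csph \<Rightarrow> complex) set" where
  "L1a_rho0 \<Omega> = {f \<in> A_class \<Omega>. (\<lambda>w. cmod (f (Fin w)) / (cmod w)\<^sup>2) integrable_on fin_part \<Omega>}"

text \<open>\<open>Rat(\<Omega>)\<close>: rational functions all of whose poles (in the sphere) lie in \<open>\<Omega>\<close>;
  represented by a reduced quotient \<open>p/q\<close>; values at poles are irrelevant.
  \<open>Rat\<^sub>0(\<Omega>)\<close>: additionally vanishing at \<open>\<infinity>\<close>.\<close>
definition Rat_in :: "csph set \<Rightarrow> (complex \<Rightarrow> complex) set" where
  "Rat_in \<Omega> = {h. \<exists>p q :: complex poly. q \<noteq> 0 \<and> coprime p q \<and>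
       (\<forall>z. poly q z \<noteq> 0 \<longrightarrow> h z = poly p z / poly q z) \<and>
       (\<forall>z. poly q z = 0 \<longrightarrow> Fin z \<in> \<Omega>) \<and>
       (degree q < degree p \<longrightarrow> Infty \<in> \<Omega>)}"

definition Rat0_in :: "csph set \<Rightarrow> (complex \<Rightarrow> complex) set" where
  "Rat0_in \<Omega> = {h. \<exists>p q :: complex poly. q \<noteq> 0 \<and> coprime p q \<and>
       (\<forall>z. poly q z \<noteq> 0 \<longrightarrow> h z = poly p z / poly q z) \<and>
       (\<forall>z. poly q z = 0 \<longrightarrow> Fin z \<in> \<Omega>) \<and>
       (degree p < degree q \<or> p = 0)}"

text \<open>$\Omega\in QD_0(h)$. The area integral $\int_\Omega f |w|^{-2} dA$ ($dA = dx\,dy/\pi$) is the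
  principal value $\lim_{R\to\infty}\int_{\Omega\cap\{|w|<R\}}$; the boundary integral is
  normalised by $1/(2\pi i)$.\<close>
definition QD0 :: "(complex \<Rightarrow> complex) \<Rightarrow> csph set set" where
  "QD0 h = {\<Omega>. rectifiable_domain \<Omega> \<and> Fin 0 \<notin> frontier \<Omega> \<and> Infty \<notin> frontier \<Omega> \<and>
       \<Omega> = interior (closure \<Omega>) \<and>
       (if sph_bounded \<Omega> then h \<in> Rat0_in \<Omega> else h \<in> Rat_in \<Omega>) \<and>
       (\<forall>\<Gamma>. boundary_cycle \<Omega> \<Gamma> \<longrightarrow>
          (\<forall>f \<in> L1a_rho0 \<Omega>. \<exists>I. cycle_has_integral (\<lambda>w. f (Fin w) * h w) \<Gamma> I \<and>
             ((\<lambda>R. integral (fin_part \<Omega> \<inter> ball 0 R) (\<lambda>w. f (Fin w) / (of_real ((cmod w)\<^sup>2))) / of_real pi)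
                \<longlongrightarrow> I / (2 * of_real pi * \<i>)) at_top))}"

end

(* In the coordinate u = 1/z at infinity, with a = cnj z1, the map is kappa(u) = c exp(lam u / (u - a)) / u.

   (<=) Pulling both sides of the quadrature identity back to the unit disc, the area integral in
   polar coordinates is, circle by circle, a Cauchy integral around the reflected pole r^2 / cnj a,
   and the boundary integral is the residue at the preimage of w0; the relation for lam equates them.
   The boundary has no slits, since otherwise kappa would trace an arc twice, and an analytic
   identity on that arc fails at the essential singularity a. Boundary integrals depend on the
   cycle only through its winding numbers off a null set, by Stone-Weierstrass and the Cauchy transform.

   (=>) Testing the identity with 1/(w - a) for a outside the closure, and letting a tend to the
   boundary, gives 2 ln|w| = const - w N(w) - alpha w / (w0 - w) there, with N holomorphic in the domain.
   For the Riemann map g of the inverted domain, 2 ln|g(u)| is thus asymptotic, as |u| tends to 1, to a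
   meromorphic function with a single simple pole, at the preimage of 1/w0. Comparing Fourier
   modes reflects that pole in the circle and determines ln(g(u)/u). *)
theory Submission imports Defs begin

section \<open>Conformal change of variables and polar coordinates\<close>

text \<open>In the forward direction nothing is known about the boundary of the domain, and the
  Riemann map is not extended to the circle: boundary identities are used only as limits for |u|
  tending to 1, uniform by compactness. In the backward direction the boundary curve is explicit,
  but \<open>QD0\<close> asks for the identity along every \<open>boundary_cycle\<close>, that is,
  along any finite list of rectifiable loops with the prescribed union and winding numbers. This
  forces the comparison of cycles. It is carried out on sums over uniform partitions, which are
  linear and can be exchanged with area integrals before any limit is taken. The weight |w|^-2 is
  not integrable at infinity, so every admissible test function vanishes there. Hence its pullback
  to the disc is divisible by u, and no residue arises at u = 0, neither in the boundary integral
  nor in the area integral. In the forward direction the same weight produces the logarithm: its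
  Cauchy transform over |w| > \<delta> is an explicit multiple of (ln |a| - ln \<delta>) /
  a.\<close>

definition complex_of_vec :: "real^2 \<Rightarrow> complex" where
  "complex_of_vec v = Complex (v$1) (v$2)"

definition vec_of_complex :: "complex \<Rightarrow> real^2" where
  "vec_of_complex z = (\<chi> i. if i = 1 then Re z else Im z)"

lemma vec_of_complex_nth [simp]: "vec_of_complex z $ 1 = Re z" "vec_of_complex z $ 2 = Im z"
  by (simp_all add: vec_of_complex_def)

lemma complex_of_vec_inverse [simp]: "vec_of_complex (complex_of_vec v) = v"
  by (simp add: vec_eq_iff forall_2 complex_of_vec_def)

lemma vec_of_complex_inverse [simp]: "complex_of_vec (vec_of_complex z) = z"
  by (simp add: complex_of_vec_def)

lemma bounded_linear_complex_of_vec: "bounded_linear complex_of_vec"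
  by (intro linear_conv_bounded_linear[THEN iffD1] linearI)
     (simp_all add: complex_of_vec_def complex_eq_iff)

lemma bounded_linear_vec_of_complex: "bounded_linear vec_of_complex"
  by (intro linear_conv_bounded_linear[THEN iffD1] linearI)
     (simp_all add: vec_eq_iff forall_2)

lemma measurable_complex_of_vec [measurable]: "complex_of_vec \<in> borel_measurable borel"
  by (intro borel_measurable_continuous_onI linear_continuous_on bounded_linear_complex_of_vec)

lemma image_vec_of_complex: "vec_of_complex ` B = complex_of_vec -` B"
  by (auto simp: image_iff) (metis complex_of_vec_inverse)

text \<open>Boxes determine Lebesgue measure, so it suffices to match the side lengths. The copy of
  the plane in \<open>real^2\<close> serves because change of variables with Jacobian determinants
  is formulated there.\<close>

lemma lborel_complex_of_vec: "lborel = distr lborel borel complex_of_vec"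
proof (rule lborel_eqI)
  fix l u :: complex
  assume le: "\<And>b. b \<in> Basis \<Longrightarrow> l \<bullet> b \<le> u \<bullet> b"
  have pre: "complex_of_vec -` box l u = box (vec_of_complex l) (vec_of_complex u)"
    by (auto simp: box_def Basis_complex_def Basis_vec_def complex_of_vec_def inner_axis
        UNIV_2 exI all_conj_distrib)
  have B: "(Basis::(real^2) set) = {axis 1 1, axis 2 1}" "axis 1 (1::real) \<noteq> (axis 2 1::real^2)"
    by (auto simp: Basis_vec_def UNIV_2 axis_eq_axis)
  have "emeasure lborel (box (vec_of_complex l) (vec_of_complex u))
        = (\<Prod>b\<in>Basis. (vec_of_complex u - vec_of_complex l) \<bullet> b)"
    using le[of 1] le[of \<i>] by (intro emeasure_lborel_box)
      (auto simp: Basis_vec_def UNIV_2 Basis_complex_def inner_axis)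
  also have "\<dots> = (\<Prod>b\<in>Basis. (u - l) \<bullet> b)"
    unfolding B(1) Basis_complex_def using B(2) by (simp add: inner_axis complex_eq_iff)
  finally show "emeasure (distr lborel borel complex_of_vec) (box l u) = (\<Prod>b\<in>Basis. (u - l) \<bullet> b)"
    by (simp add: emeasure_distr pre)
qed simp

lemma lborel_Complex:
  "lborel = distr (lborel \<Otimes>\<^sub>M lborel) borel (\<lambda>(x, y). Complex x y)"
proof (rule lborel_eqI)
  fix l u :: complex
  assume le: "\<And>b. b \<in> Basis \<Longrightarrow> l \<bullet> b \<le> u \<bullet> b"
  have le': "Re l \<le> Re u" "Im l \<le> Im u"
    using le[of 1] le[of \<i>] by (simp_all add: Basis_complex_def)
  have [measurable]: "(\<lambda>(x, y). Complex x y) \<in> borel_measurable (lborel \<Otimes>\<^sub>M lborel)"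
    unfolding lborel_prod
    by (simp add: borel_measurable_continuous_onI case_prod_unfold Complex_eq continuous_intros)
  have pre: "(\<lambda>(x, y). Complex x y) -` box l u = {Re l<..<Re u} \<times> {Im l<..<Im u}"
    by (auto simp: box_def Basis_complex_def)
  have "emeasure (lborel \<Otimes>\<^sub>M lborel) ({Re l<..<Re u} \<times> {Im l<..<Im u})
     = ennreal (Re u - Re l) * ennreal (Im u - Im l)"
    using le' by (subst lborel.emeasure_pair_measure_Times) auto
  also have "\<dots> = (\<Prod>b\<in>Basis. (u - l) \<bullet> b)"
    using le' by (simp add: Basis_complex_def complex_eq_iff ennreal_mult'')
  finally show "emeasure (distr (lborel \<Otimes>\<^sub>M lborel) borel (\<lambda>(x, y). Complex x y)) (box l u)
      = (\<Prod>b\<in>Basis. (u - l) \<bullet> b)"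
    by (simp add: emeasure_distr pre space_pair_measure)
qed simp

text \<open>As a real map, multiplication by \<open>a\<close> is a rotation followed by a dilation.
  A holomorphic derivative has this form, so no other determinant occurs.\<close>

lemma det_complex_mult:
  "det (matrix (vec_of_complex \<circ> (*) a \<circ> complex_of_vec)) = (cmod a)\<^sup>2"
  by (simp add: det_2 matrix_def complex_of_vec_def axis_def cmod_power2)
    (simp add: power2_eq_square)

text \<open>The Jacobian of a holomorphic map is |g'|^2. The formula on \<open>real^2\<close>
  relates finite measure of the image to integrability of the Jacobian in both directions, so the
  infinite case follows: an integrable Jacobian would give the image finite measure.\<close>

lemma nn_integral_holomorphic_image:
  assumes S: "open S" and g: "g holomorphic_on S" and inj: "inj_on g S"
    and B: "B \<subseteq> S" and [measurable]: "B \<in> sets borel"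
  shows "g ` B \<in> sets borel"
    and "emeasure lborel (g ` B) = (\<integral>\<^sup>+z. ennreal ((cmod (deriv g z))\<^sup>2 * indicator B z) \<partial>lborel)"
proof -
  obtain h where h: "h holomorphic_on g ` S" "\<And>z. z \<in> S \<Longrightarrow> h (g z) = z"
    using holomorphic_has_inverse[OF g S inj] by metis
  have T: "open (g ` S)"
    using open_mapping_thm3[OF g S inj] .
  \<comment> \<open>Measurability of the image comes from the holomorphic, hence continuous, inverse
    \<open>h\<close>: images under \<open>g\<close> are preimages under \<open>h\<close>.\<close>
  have "g ` B = g ` S \<inter> h -` B"
    using h B by (auto simp: image_iff)
  also have "\<dots> \<in> sets borel"
  proof -
    have "h -` B \<inter> space (restrict_space borel (g ` S)) \<in> sets (restrict_space borel (g ` S))"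
      using borel_measurable_continuous_on_restrict[OF holomorphic_on_imp_continuous_on[OF h(1)]]
      by (rule measurable_sets) simp
    then show ?thesis
      using T by (simp add: sets_restrict_space_iff space_restrict_space Int_commute)
  qed
  finally show im: "g ` B \<in> sets borel" .
  define g2 where "g2 = vec_of_complex \<circ> g \<circ> complex_of_vec"
  define g2' where "g2' = (\<lambda>v. vec_of_complex \<circ> (*) (deriv g (complex_of_vec v)) \<circ> complex_of_vec)"
  define B2 where "B2 = vec_of_complex ` B"
  have B2: "B2 \<in> sets borel"
    unfolding B2_def image_vec_of_complex
    using measurable_sets[OF measurable_complex_of_vec \<open>B \<in> sets borel\<close>] by simp
  have der: "(g2 has_derivative g2' v) (at v within B2)" if "v \<in> B2" for v
  proof -
    have "complex_of_vec v \<in> S" using that B by (auto simp: B2_def)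
    then have "(g has_field_derivative deriv g (complex_of_vec v)) (at (complex_of_vec v))"
      using g S by (simp add: holomorphic_derivI)
    then have 1: "(g has_derivative (*) (deriv g (complex_of_vec v))) (at (complex_of_vec v))"
      by (simp add: has_field_derivative_def)
    have "(g \<circ> complex_of_vec has_derivative (*) (deriv g (complex_of_vec v)) \<circ> complex_of_vec) (at v)"
      by (intro diff_chain_at bounded_linear_imp_has_derivative[OF bounded_linear_complex_of_vec] 1)
    from diff_chain_at[OF this bounded_linear_imp_has_derivative[OF bounded_linear_vec_of_complex]]
    show ?thesis unfolding g2_def g2'_def by (simp add: comp_assoc has_derivative_at_withinI)
  qed
  have inj2: "inj_on g2 B2"
  proof (rule inj_onI)
    fix x y assume xy: "x \<in> B2" "y \<in> B2" "g2 x = g2 y"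
    then have "g (complex_of_vec x) = g (complex_of_vec y)"
      by (metis comp_apply g2_def vec_of_complex_inverse)
    moreover have "complex_of_vec x \<in> S" "complex_of_vec y \<in> S" using xy B by (auto simp: B2_def)
    ultimately show "x = y" using inj by (metis complex_of_vec_inverse inj_on_def)
  qed
  have im2: "g2 ` B2 = vec_of_complex ` (g ` B)"
    by (auto simp: g2_def B2_def image_iff)
  have im2b: "g2 ` B2 \<in> sets borel"
    unfolding im2 unfolding image_vec_of_complex
    using measurable_sets[OF measurable_complex_of_vec im] by simp
  have e1: "emeasure lborel (g ` B) = emeasure lborel (g2 ` B2)"
    unfolding im2 image_vec_of_complex
    by (subst lborel_complex_of_vec) (use im in \<open>simp add: emeasure_distr\<close>)
  define F where "F = (\<lambda>z. (cmod (deriv g z))\<^sup>2 * indicator B z)"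
  have F: "F \<in> borel_measurable borel"
  proof -
    have "continuous_on S (\<lambda>z. (cmod (deriv g z))\<^sup>2)"
      using g S by (intro continuous_intros holomorphic_on_imp_continuous_on holomorphic_deriv)
    from borel_measurable_continuous_on_indicator[OF _ this] S
    have "(\<lambda>z. indicator S z *\<^sub>R (cmod (deriv g z))\<^sup>2) \<in> borel_measurable borel" by simp
    from borel_measurable_times[OF this, of "indicator B"]
    have "(\<lambda>z. indicator S z *\<^sub>R (cmod (deriv g z))\<^sup>2 * indicator B z) \<in> borel_measurable borel"
      by simp
    also have "(\<lambda>z. indicator S z *\<^sub>R (cmod (deriv g z))\<^sup>2 * indicator B z) = F"
      using B by (auto simp: F_def indicator_def fun_eq_iff)
    finally show ?thesis .
  qed
  have F0: "F z \<ge> 0" for z by (simp add: F_def)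
  have e2: "(\<integral>\<^sup>+z. ennreal (F z) \<partial>lborel) = (\<integral>\<^sup>+v. ennreal (F (complex_of_vec v)) \<partial>lborel)"
    by (subst lborel_complex_of_vec) (use F in \<open>simp add: nn_integral_distr\<close>)
  have det: "\<bar>det (matrix (g2' v))\<bar> = (cmod (deriv g (complex_of_vec v)))\<^sup>2" for v
    unfolding g2'_def det_complex_mult by simp
  have Feq: "F (complex_of_vec v) = (if v \<in> B2 then \<bar>det (matrix (g2' v))\<bar> else 0)" for v
    by (simp add: F_def det B2_def image_vec_of_complex indicator_def)
  have key: "g2 ` B2 \<in> lmeasurable \<and> measure lebesgue (g2 ` B2) = m \<longleftrightarrow>
      ((\<lambda>v. F (complex_of_vec v)) has_integral m) UNIV" for m
    unfolding Feq has_integral_restrict_UNIV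
    by (rule has_measure_differentiable_image[OF _ der inj2]) (use B2 in auto)
  have Fm: "(\<lambda>v. F (complex_of_vec v)) \<in> borel_measurable borel"
    using measurable_compose[OF measurable_complex_of_vec F] by simp
  have "emeasure lborel (g2 ` B2) = (\<integral>\<^sup>+v. ennreal (F (complex_of_vec v)) \<partial>lborel)"
  proof (cases "g2 ` B2 \<in> lmeasurable")
    case True
    then have "((\<lambda>v. F (complex_of_vec v)) has_integral measure lebesgue (g2 ` B2)) UNIV"
      using key by blast
    from nn_integral_has_integral_lborel[OF Fm F0 this]
    have "(\<integral>\<^sup>+v. ennreal (F (complex_of_vec v)) \<partial>lborel) = measure lebesgue (g2 ` B2)" .
    also have "\<dots> = emeasure lebesgue (g2 ` B2)"
      using True by (simp add: emeasure_eq_measure2)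
    finally show ?thesis using im2b by simp
  next
    case False
    then have "emeasure lborel (g2 ` B2) = \<infinity>"
      using im2b by (auto simp: fmeasurable_def) (metis top.not_eq_extremum)
    moreover have "(\<integral>\<^sup>+v. ennreal (F (complex_of_vec v)) \<partial>lborel) = \<infinity>"
    proof (rule ccontr)
      assume "(\<integral>\<^sup>+v. ennreal (F (complex_of_vec v)) \<partial>lborel) \<noteq> \<infinity>"
      then have "(\<lambda>v. F (complex_of_vec v)) integrable_on UNIV"
        by (intro nn_integral_integrable_on Fm F0) (simp add: top.not_eq_extremum)
      then show False using key False by (auto simp: integrable_on_def)
    qed
    ultimately show ?thesis by simp
  qed
  then show "emeasure lborel (g ` B) = (\<integral>\<^sup>+z. ennreal ((cmod (deriv g z))\<^sup>2 * indicator B z) \<partial>lborel)"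
    using e1 e2 by (simp add: F_def)
qed

text \<open>Stated as an equality of measures, the formula carries over integrability and integrals
  of arbitrary functions by the rules for \<open>distr\<close> and \<open>density\<close>. The
  factor \<open>indicator S z\<close> extends \<open>g\<close> by 0 off \<open>S\<close>, which
  makes it a total measurable map.\<close>

theorem conformal_change_of_variables:
  assumes S: "open S" and g: "g holomorphic_on S" and inj: "inj_on g S"
  shows "density lborel (indicator (g ` S))
    = distr (density lborel (\<lambda>z. ennreal ((cmod (deriv g z))\<^sup>2 * indicator S z))) borel
        (\<lambda>z. indicator S z *\<^sub>R g z)"
    and "(\<lambda>z. indicator S z *\<^sub>R g z) \<in> borel_measurable borel"
    and "(\<lambda>z. (cmod (deriv g z))\<^sup>2 * indicator S z) \<in> borel_measurable borel"
proof -
  show m[measurable]: "(\<lambda>z. indicator S z *\<^sub>R g z) \<in> borel_measurable borel"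
    using borel_measurable_continuous_on_indicator[OF _ holomorphic_on_imp_continuous_on[OF g]] S by simp
  have "continuous_on S (\<lambda>z. (cmod (deriv g z))\<^sup>2)"
    using g S by (intro continuous_intros holomorphic_on_imp_continuous_on holomorphic_deriv)
  from borel_measurable_continuous_on_indicator[OF _ this] S
  show F[measurable]: "(\<lambda>z. (cmod (deriv g z))\<^sup>2 * indicator S z) \<in> borel_measurable borel"
    by (simp add: mult.commute)
  have oT: "open (g ` S)"
    using open_mapping_thm3[OF g S inj] .
  have [measurable]: "S \<in> sets borel" "g ` S \<in> sets borel" using S oT by auto
  show "density lborel (indicator (g ` S))
    = distr (density lborel (\<lambda>z. ennreal ((cmod (deriv g z))\<^sup>2 * indicator S z))) borel
        (\<lambda>z. indicator S z *\<^sub>R g z)" (is "?L = ?R")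
  proof (rule measure_eqI)
    fix A assume "A \<in> sets ?L"
    then have A[measurable]: "A \<in> sets borel" by simp
    define B where "B = S \<inter> (\<lambda>z. indicator S z *\<^sub>R g z) -` A"
    have B: "B \<in> sets borel" "B \<subseteq> S"
      using measurable_sets[OF m A] by (auto simp: B_def)
    have gB: "g ` B = A \<inter> g ` S" by (auto simp: B_def)
    have "emeasure ?R A = (\<integral>\<^sup>+z. ennreal ((cmod (deriv g z))\<^sup>2 * indicator S z)
        * indicator ((\<lambda>z. indicator S z *\<^sub>R g z) -` A) z \<partial>lborel)"
      using measurable_sets[OF m A] by (simp add: emeasure_distr emeasure_density)
    also have "\<dots> = (\<integral>\<^sup>+z. ennreal ((cmod (deriv g z))\<^sup>2 * indicator B z) \<partial>lborel)"
      by (intro nn_integral_cong) (auto simp: B_def indicator_def)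
    also have "\<dots> = emeasure lborel (g ` B)"
      using nn_integral_holomorphic_image(2)[OF S g inj B(2) B(1)] by simp
    also have "\<dots> = (\<integral>\<^sup>+z. indicator (A \<inter> g ` S) z \<partial>lborel)"
      by (subst nn_integral_indicator) (simp_all add: gB)
    also have "\<dots> = (\<integral>\<^sup>+z. indicator (g ` S) z * indicator A z \<partial>lborel)"
      by (intro nn_integral_cong) (auto simp: indicator_def)
    also have "\<dots> = emeasure ?L A"
      by (simp add: emeasure_density)
    finally show "emeasure ?L A = emeasure ?R A" by simp
  qed simp
qed

text \<open>This is the conformal formula for exp on the strip 0 < Im < 2 pi, with Jacobian |exp|^2.
  The image misses only part of the real axis, a null set. The radial coordinate is x = ln r; in it
  the radial integrals below become integrals of exponentials or exact derivatives.\<close>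

theorem lborel_polar:
  "lborel = distr (density (lborel \<Otimes>\<^sub>M lborel)
      (\<lambda>(x, t). ennreal (exp (2 * x) * indicator {0<..<2*pi} t))) borel (\<lambda>(x, t). exp (Complex x t))"
    (is "_ = distr ?D _ ?e")
  and measurable_polar: "(\<lambda>(x, t). exp (Complex x t)) \<in> borel_measurable (lborel \<Otimes>\<^sub>M lborel)"
proof -
  have mC[measurable]: "(\<lambda>(x, y). Complex x y) \<in> borel_measurable (lborel \<Otimes>\<^sub>M lborel)"
    unfolding lborel_prod
    by (simp add: borel_measurable_continuous_onI case_prod_unfold Complex_eq continuous_intros)
  show m[measurable]: "?e \<in> borel_measurable (lborel \<Otimes>\<^sub>M lborel)"
    unfolding lborel_prod
    by (simp add: borel_measurable_continuous_onI case_prod_unfold Complex_eq continuous_intros)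
  define S where "S = {\<zeta>. 0 < Im \<zeta>} \<inter> {\<zeta>. Im \<zeta> < 2 * pi}"
  have S: "open S" unfolding S_def
    by (intro open_Int open_Collect_less continuous_intros)
  have [measurable]: "S \<in> sets borel" using S by simp
  have hol: "exp holomorphic_on S" by (intro holomorphic_intros)
  have inj: "inj_on exp S"
  proof (rule inj_onI)
    fix x y assume xy: "x \<in> S" "y \<in> S" "exp x = exp y"
    then show "x = y" by (auto simp: S_def exp_complex_eqI)
  qed
  have im: "- {z. Im z = 0} \<subseteq> exp ` S"
  proof
    fix z assume z: "z \<in> - {z. Im z = 0}"
    then have "z \<noteq> 0" by auto
    \<comment> \<open>The branch of the logarithm with argument between 0 and 2 pi; off the real
      axis the bounds are strict.\<close>
    define w where "w = (if Im (Ln z) > 0 then Ln z else Ln z + 2 * of_real pi * \<i>)"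
    have "exp w = z" using \<open>z \<noteq> 0\<close> by (simp add: w_def exp_add)
    moreover have "Im (Ln z) \<noteq> 0"
    proof
      assume "Im (Ln z) = 0"
      then have "Ln z = of_real (Re (Ln z))" by (simp add: complex_eq_iff)
      then have "z = of_real (exp (Re (Ln z)))" using \<open>z \<noteq> 0\<close> by (metis exp_Ln exp_of_real)
      then have "Im z = 0" by (metis Im_complex_of_real)
      then show False using z by simp
    qed
    then have "w \<in> S" using mpi_less_Im_Ln[OF \<open>z \<noteq> 0\<close>] Im_Ln_le_pi[OF \<open>z \<noteq> 0\<close>]
      by (auto simp: w_def S_def)
    ultimately show "z \<in> exp ` S" by blast
  qed
  have null: "emeasure lborel (A - exp ` S) = 0" if "A \<in> sets borel" for A
  proof -
    have "negligible {z::complex. \<i> \<bullet> z = 0}" by (intro negligible_hyperplane) auto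
    also have "{z::complex. \<i> \<bullet> z = 0} = {z. Im z = 0}" by (auto simp: inner_complex_def)
    finally have "negligible (A - exp ` S)" by (rule negligible_subset) (use im in auto)
    moreover have "exp ` S \<in> sets borel" using open_mapping_thm3[OF hol S inj] by simp
    ultimately show ?thesis using that
      by (simp add: negligible_iff_null_sets null_sets_def)
  qed
  show "lborel = distr ?D borel ?e"
  proof (rule measure_eqI)
    fix A :: "complex set" assume "A \<in> sets lborel"
    then have A[measurable]: "A \<in> sets borel" by simp
    define B where "B = S \<inter> exp -` A"
    have "exp -` A \<in> sets (borel::complex measure)"
      using measurable_sets[of "exp::complex\<Rightarrow>complex" borel borel A] A
      by (simp add: borel_measurable_continuous_onI continuous_on_exp)
    then have B: "B \<in> sets borel" "B \<subseteq> S" by (auto simp: B_def)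
    have gB: "exp ` B = A \<inter> exp ` S" by (auto simp: B_def)
    have oT: "exp ` S \<in> sets borel" using open_mapping_thm3[OF hol S inj] by simp
    have mf: "(\<lambda>z. ennreal (exp (2 * Re z) * indicator B z)) \<in> borel_measurable borel"
      using B(1) by measurable
    have "emeasure lborel A = emeasure lborel (A \<inter> exp ` S) + emeasure lborel (A - exp ` S)"
      by (subst plus_emeasure) (use A oT in \<open>auto intro!: arg_cong[of _ _ "emeasure lborel"]\<close>)
    also have "\<dots> = emeasure lborel (exp ` B)" by (simp add: null A gB)
    also have "\<dots> = (\<integral>\<^sup>+z. ennreal (exp (2 * Re z) * indicator B z) \<partial>lborel)"
    proof -
      have "deriv exp z = exp z" for z :: complex by (rule DERIV_imp_deriv) (rule DERIV_exp)
      then show ?thesis unfolding nn_integral_holomorphic_image(2)[OF S hol inj B(2,1)]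
        by (simp add: power2_eq_square flip: exp_add)
    qed
    also have "\<dots> = (\<integral>\<^sup>+(x, t). ennreal (exp (2 * x) * indicator B (Complex x t)) \<partial>(lborel \<Otimes>\<^sub>M lborel))"
      by (subst lborel_Complex, subst nn_integral_distr) (use mf in \<open>auto simp: case_prod_unfold\<close>)
    also have "\<dots> = (\<integral>\<^sup>+p. (case p of (x, t) \<Rightarrow> ennreal (exp (2 * x) * indicator {0<..<2*pi} t)) *
         indicator (?e -` A \<inter> space ?D) p \<partial>(lborel \<Otimes>\<^sub>M lborel))"
      by (intro nn_integral_cong) (auto simp: B_def S_def indicator_def space_pair_measure)
    also have "\<dots> = emeasure ?D (?e -` A \<inter> space ?D)"
      by (subst emeasure_density) (use measurable_sets[OF m A] in auto)
    also have "\<dots> = emeasure (distr ?D borel ?e) A"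
      by (subst emeasure_distr) auto
    finally show "emeasure lborel A = emeasure (distr ?D borel ?e) A" .
  qed simp
qed

lemma nn_integral_polar:
  assumes [measurable]: "f \<in> borel_measurable borel"
  shows "(\<integral>\<^sup>+w. f w \<partial>lborel) =
    (\<integral>\<^sup>+x. \<integral>\<^sup>+t. ennreal (exp (2 * x) * indicator {0<..<2*pi} t) * f (exp (Complex x t)) \<partial>lborel \<partial>lborel)"
proof -
  note [measurable] = measurable_polar
  have "(\<integral>\<^sup>+w. f w \<partial>lborel) = (\<integral>\<^sup>+(x, t). ennreal (exp (2 * x) * indicator {0<..<2*pi} t) *
      f (exp (Complex x t)) \<partial>(lborel \<Otimes>\<^sub>M lborel))"
    by (subst lborel_polar, subst nn_integral_distr)
      (auto simp: nn_integral_density case_prod_unfold)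
  also have "\<dots> = (\<integral>\<^sup>+x. \<integral>\<^sup>+t. ennreal (exp (2 * x) * indicator {0<..<2*pi} t) * f (exp (Complex x t)) \<partial>lborel \<partial>lborel)"
    by (subst lborel.nn_integral_fst[symmetric]) (auto simp: case_prod_unfold)
  finally show ?thesis .
qed

lemma nn_integral_polar_radial:
  assumes [measurable]: "h \<in> borel_measurable borel"
  shows "(\<integral>\<^sup>+w. h (cmod w) \<partial>lborel) = (\<integral>\<^sup>+x. ennreal (2 * pi * exp (2 * x)) * h (exp x) \<partial>lborel)"
proof -
  have "(\<integral>\<^sup>+t. ennreal (exp (2 * x) * indicator {0<..<2*pi} t) * h (cmod (exp (Complex x t))) \<partial>lborel)
     = ennreal (2 * pi * exp (2 * x)) * h (exp x)" for x
  proof -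
    have "(\<integral>\<^sup>+t. ennreal (exp (2 * x) * indicator {0<..<2*pi} t) * h (cmod (exp (Complex x t))) \<partial>lborel)
      = (\<integral>\<^sup>+t. (ennreal (exp (2 * x)) * h (exp x)) * indicator {0<..<2*pi} t \<partial>lborel)"
      by (intro nn_integral_cong) (auto simp: indicator_def)
    also have "\<dots> = ennreal (exp (2 * x)) * h (exp x) * ennreal (2 * pi)"
      by (subst nn_integral_cmult_indicator) auto
    finally show ?thesis by (simp add: ennreal_mult'' mult_ac)
  qed
  then show ?thesis by (subst nn_integral_polar) simp_all
qed

text \<open>Fubini in the coordinates of \<open>lborel_polar\<close>. The angular integral is kept
  as the inner one because it is an integral over a circle, accessible to Cauchy's formula.\<close>

lemma polar_integrable:
  fixes f :: "complex \<Rightarrow> complex"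
  assumes f: "integrable lborel f" and [measurable]: "f \<in> borel_measurable borel"
  shows "integrable lborel (\<lambda>x. exp (2 * x) *\<^sub>R (LINT t:{0<..<2*pi}|lborel. f (exp (Complex x t))))"
    and "(LINT w|lborel. f w) = (LINT x|lborel. exp (2 * x) *\<^sub>R (LINT t:{0<..<2*pi}|lborel. f (exp (Complex x t))))"
proof -
  note [measurable] = measurable_polar
  let ?h = "\<lambda>(x, t). (exp (2 * x) * indicator {0<..<2*pi} t) *\<^sub>R f (exp (Complex x t))"
  have d: "(\<lambda>(x, t). ennreal (exp (2 * x) * indicator {0<..<2*pi} t)) =
      (\<lambda>p. ennreal ((\<lambda>(x, t). exp (2 * x) * indicator {0<..<2*pi} t) p))"
    by (auto simp: fun_eq_iff)
  have 1: "integrable (lborel \<Otimes>\<^sub>M lborel) ?h"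
    using f by (subst (asm) lborel_polar, subst (asm) integrable_distr_eq, simp, simp, subst (asm) d,
        subst (asm) integrable_density) (auto simp: case_prod_unfold)
  have 2: "(LINT w|lborel. f w) = (LINT p|(lborel \<Otimes>\<^sub>M lborel). ?h p)"
    by (subst lborel_polar, subst integral_distr, simp, simp, subst d, subst integral_density)
      (auto simp: case_prod_unfold)
  have 3: "(LINT t|lborel. ?h (x, t)) = exp (2 * x) *\<^sub>R (LINT t:{0<..<2*pi}|lborel. f (exp (Complex x t)))" for x
    unfolding set_lebesgue_integral_def by (simp flip: integral_scaleR_right)
  show "integrable lborel (\<lambda>x. exp (2 * x) *\<^sub>R (LINT t:{0<..<2*pi}|lborel. f (exp (Complex x t))))"
    using lborel_pair.integrable_fst'[OF 1] unfolding 3 .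
  show "(LINT w|lborel. f w) = (LINT x|lborel. exp (2 * x) *\<^sub>R (LINT t:{0<..<2*pi}|lborel. f (exp (Complex x t))))"
    using lborel_pair.integral_fst'[OF 1] unfolding 3 2 by simp
qed

section \<open>The Cauchy transform\<close>

text \<open>On the circle du = i u dt, so the angular integral is the contour integral of G(u) / u
  divided by i. The open interval of angles, imposed by \<open>lborel_polar\<close>, differs from
  the closed one by a null set.\<close>

lemma circle_lebesgue_integral:
  assumes "r > 0" "continuous_on (sphere 0 r) G" and I: "((\<lambda>u. G u / u) has_contour_integral I) (circlepath 0 r)"
  shows "(LINT t:{0<..<2*pi}|lborel. G (of_real r * cis t)) = - \<i> * I"
proof -
  have c: "continuous_on {0..2*pi} (\<lambda>t. G (of_real r * cis t))"
    using assms(1) by (intro continuous_on_compose2[OF assms(2)] continuous_intros) (auto simp: norm_mult)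
  have "((\<lambda>t. G (r * cis t) / (r * cis t) * r * \<i> * cis t) has_integral I) {0..2*pi}"
    using I unfolding circlepath_def by (subst (asm) has_contour_integral_part_circlepath_iff) auto
  also have "(\<lambda>t. G (r * cis t) / (r * cis t) * r * \<i> * cis t) = (\<lambda>t. \<i> * G (of_real r * cis t))"
    using assms(1) by (auto simp: fun_eq_iff)
  finally have "((\<lambda>t. - \<i> * (\<i> * G (of_real r * cis t))) has_integral - \<i> * I) {0..2*pi}"
    by (rule has_integral_mult_right)
  then have h: "((\<lambda>t. G (of_real r * cis t)) has_integral - \<i> * I) {0..2*pi}" by simp
  have "set_integrable lborel {0..2*pi} (\<lambda>t. G (of_real r * cis t))"
    by (rule borel_integrable_atLeastAtMost'[OF c])
  from set_borel_integral_eq_integral(2)[OF this]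
  have "(LINT t:{0..2*pi}|lborel. G (of_real r * cis t)) = - \<i> * I"
    using h by (simp add: integral_unique)
  moreover have "(LINT t:{0..2*pi}|lborel. G (of_real r * cis t)) = (LINT t:{0<..<2*pi}|lborel. G (of_real r * cis t))"
    unfolding set_lebesgue_integral_def
  proof (rule integral_cong_AE)
    have "(\<lambda>t. indicator {0..2*pi} t *\<^sub>R G (of_real r * cis t)) \<in> borel_measurable borel"
      using borel_measurable_continuous_on_indicator[OF _ c] by simp
    then show "(\<lambda>t. indicator {0..2*pi} t *\<^sub>R G (of_real r * cis t)) \<in> borel_measurable lborel" by simp
    have "(\<lambda>t. indicator {0<..<2*pi} t *\<^sub>R G (of_real r * cis t)) \<in> borel_measurable borel"
      using borel_measurable_continuous_on_indicator[OF _ continuous_on_subset[OF c], of "{0<..<2*pi}"] by force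
    then show "(\<lambda>t. indicator {0<..<2*pi} t *\<^sub>R G (of_real r * cis t)) \<in> borel_measurable lborel" by simp
    have "AE t in lborel. t \<noteq> 0 \<and> t \<noteq> 2 * pi"
      by (intro AE_conjI AE_lborel_singleton)
    then show "AE t in lborel. indicator {0..2*pi} t *\<^sub>R G (of_real r * cis t) =
        indicator {0<..<2*pi} t *\<^sub>R G (of_real r * cis t)"
      by eventually_elim (auto simp: indicator_def)
  qed
  ultimately show ?thesis by simp
qed

lemma circle_mean_value:
  assumes "r > 0" "continuous_on (cball 0 r) F" "F holomorphic_on ball 0 r"
  shows "(LINT t:{0<..<2*pi}|lborel. F (of_real r * cis t)) = 2 * of_real pi * F 0"
proof -
  have "((\<lambda>u. F u / u) has_contour_integral (2 * of_real pi * \<i> * F 0)) (circlepath 0 r)"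
    using Cauchy_integral_circlepath[OF assms(2,3), of 0] assms(1) by simp
  from circle_lebesgue_integral[OF assms(1) continuous_on_subset[OF assms(2)] this]
  show ?thesis by (simp add: sphere_cball)
qed

lemma circle_integral_cnj:
  fixes F :: "real \<Rightarrow> complex"
  shows "(LINT t:{0<..<2*pi}|lborel. cnj (F t)) = cnj (LINT t:{0<..<2*pi}|lborel. F t)"
proof -
  have "indicator S t *\<^sub>R cnj (F t) = cnj (indicator S t *\<^sub>R F t)" for S :: "real set" and t
    by (simp add: scaleR_conv_of_real)
  then show ?thesis unfolding set_lebesgue_integral_def by (simp only: Bochner_Integration.integral_cnj)
qed

text \<open>The conjugate of the integrand is holomorphic in the disc off the point \<open>r\<^sup>2 / cnj z\<close>, since
  \<open>cnj w = r\<^sup>2 / w\<close> on the circle.\<close>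
lemma circle_integral_cauchy_kernel:
  assumes "r > 0" "r \<noteq> cmod z"
  shows "(LINT t:{0<..<2*pi}|lborel. cnj (of_real r * cis t) ^ n / (z - of_real r * cis t))
     = (if r < cmod z then 2 * of_real pi * of_real r ^ (2 * n) / z ^ Suc n else 0)"
proof (cases "z = 0")
  case True
  have "cnj (of_real r * cis t) ^ n / (z - of_real r * cis t) = cnj (- ((of_real r * cis t) ^ Suc n / of_real (r\<^sup>2)))" for t
  proof -
    let ?w = "of_real r * cis t"
    have "?w \<noteq> 0" "?w * cnj ?w = of_real r ^ 2"
      using assms complex_norm_square[of ?w] by (simp_all add: norm_mult)
    then show ?thesis using assms(1) True by (simp add: divide_simps) (simp add: algebra_simps)
  qed
  then have "(LINT t:{0<..<2*pi}|lborel. cnj (of_real r * cis t) ^ n / (z - of_real r * cis t))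
    = cnj (LINT t:{0<..<2*pi}|lborel. - ((of_real r * cis t) ^ Suc n / of_real (r\<^sup>2)))"
    unfolding circle_integral_cnj[symmetric] by simp
  also have "(LINT t:{0<..<2*pi}|lborel. - ((of_real r * cis t) ^ Suc n / of_real (r\<^sup>2)))
     = 2 * of_real pi * - (0 ^ Suc n / of_real (r\<^sup>2))"
    by (rule circle_mean_value[where F = "\<lambda>w. - (w ^ Suc n / of_real (r\<^sup>2))"])
      (use assms in \<open>auto intro!: continuous_intros holomorphic_intros\<close>)
  finally show ?thesis using True assms by simp
next
  case z: False
  define b where "b = of_real r ^ 2 / cnj z"
  have zn: "cnj z \<noteq> 0" using z by simp
  have ker: "cnj (w ^ n / (cnj z - cnj w)) = cnj w ^ n / (z - w)" for w by simp
  have onc: "(of_real r * cis t) ^ n / (cnj z - cnj (of_real r * cis t)) =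
     (of_real r * cis t) ^ Suc n / (cnj z * (of_real r * cis t - b))" (is "?l = ?r") for t
  proof -
    let ?w = "of_real r * cis t"
    have w: "?w \<noteq> 0" "?w * cnj ?w = of_real r ^ 2"
      using assms complex_norm_square[of ?w] by (simp_all add: norm_mult)
    have "cnj z * (?w - b) = ?w * (cnj z - cnj ?w)"
      using zn w(2) by (simp add: b_def algebra_simps)
    then show ?thesis using w(1) by simp
  qed
  have eq: "(LINT t:{0<..<2*pi}|lborel. cnj (of_real r * cis t) ^ n / (z - of_real r * cis t)) =
     cnj (LINT t:{0<..<2*pi}|lborel. (of_real r * cis t) ^ Suc n / (cnj z * (of_real r * cis t - b)))"
    unfolding circle_integral_cnj[symmetric] onc[symmetric] ker by simp
  have nb: "cmod b = r\<^sup>2 / cmod z" by (simp add: b_def norm_divide norm_power)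
  \<comment> \<open>The reflected point \<open>b\<close> lies inside the circle exactly when
    \<open>z\<close> lies outside. In the other case the integrand is holomorphic in the disc and
    vanishes at the centre because of the factor \<open>w ^ Suc n\<close>.\<close>
  show ?thesis
  proof (cases "r < cmod z")
    case True
    then have bl: "cmod b < r" using assms by (simp add: nb power2_eq_square divide_less_eq)
    have "((\<lambda>u. u ^ n / cnj z / (u - b)) has_contour_integral (2 * of_real pi * \<i> * (b ^ n / cnj z))) (circlepath 0 r)"
      using bl zn by (intro Cauchy_integral_circlepath continuous_intros holomorphic_intros) auto
    then have "((\<lambda>u. u ^ Suc n / (cnj z * (u - b)) / u) has_contour_integral (2 * of_real pi * \<i> * (b ^ n / cnj z))) (circlepath 0 r)"
      by (rule has_contour_integral_eq) (use zn \<open>r > 0\<close> in auto)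
    then have "(LINT t:{0<..<2*pi}|lborel. (of_real r * cis t) ^ Suc n / (cnj z * (of_real r * cis t - b)))
      = - \<i> * (2 * of_real pi * \<i> * (b ^ n / cnj z))"
      using bl zn by (intro circle_lebesgue_integral \<open>r > 0\<close> continuous_intros) auto
    also have "- \<i> * (2 * p * \<i> * X) = 2 * p * X" for p X :: complex
      using i_squared by algebra
    finally have "(LINT t:{0<..<2*pi}|lborel. (of_real r * cis t) ^ Suc n / (cnj z * (of_real r * cis t - b)))
      = 2 * of_real pi * (b ^ n / cnj z)" .
    then show ?thesis unfolding eq using True
      by (simp add: b_def power_divide mult.commute flip: power_mult)
  next
    case False
    then have bg: "cmod b > r" using assms z by (simp add: nb power2_eq_square less_divide_eq)
    have "(LINT t:{0<..<2*pi}|lborel. (of_real r * cis t) ^ Suc n / (cnj z * (of_real r * cis t - b)))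
        = 2 * of_real pi * (0 ^ Suc n / (cnj z * (0 - b)))"
      using bg zn by (intro circle_mean_value \<open>r > 0\<close> continuous_intros holomorphic_intros) auto
    then show ?thesis unfolding eq using False z by simp
  qed
qed

text \<open>The polar Jacobian r cancels the singularity 1/r, so only 2 pi times the radius
  remains.\<close>

lemma nn_integral_inverse_dist:
  assumes "\<eta> > 0"
  shows "(\<integral>\<^sup>+w. ennreal (indicator (ball a \<eta>) w / cmod (w - a)) \<partial>lborel) = ennreal (2 * pi * \<eta>)"
proof -
  have "(\<integral>\<^sup>+w. ennreal (indicator (ball a \<eta>) w / cmod (w - a)) \<partial>lborel) =
    (\<integral>\<^sup>+w. ennreal (indicator {..<\<eta>} (cmod w) / cmod w) \<partial>lborel)"
    by (subst lborel_distr_plus[of a, symmetric], subst nn_integral_distr)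
      (auto intro!: nn_integral_cong simp: indicator_def dist_norm)
  also have "\<dots> = (\<integral>\<^sup>+x. ennreal (2 * pi * exp (2 * x)) * ennreal (indicator {..<\<eta>} (exp x) / exp x) \<partial>lborel)"
    by (subst nn_integral_polar_radial[of "\<lambda>s. ennreal (indicator {..<\<eta>} s / s)"]) auto
  also have "\<dots> = (\<integral>\<^sup>+x. ennreal (2 * pi * exp x * indicator {..<ln \<eta>} x) \<partial>lborel)"
    using assms ln_ge_iff[of \<eta>]
    by (intro nn_integral_cong)
      (auto simp: indicator_def exp_double power2_eq_square ln_less_cancel_iff[symmetric] simp flip: ennreal_mult'')
  also have "\<dots> = (\<integral>\<^sup>+x. ennreal (2 * pi * exp (- x) * indicator {..<ln \<eta>} (- x)) \<partial>lborel)"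
    by (subst nn_integral_real_affine[where c = "-1" and t = 0]) auto
  also have "\<dots> = (\<integral>\<^sup>+x. ennreal (2 * pi * exp (- x)) * indicator {- ln \<eta><..} x \<partial>lborel)"
    by (intro nn_integral_cong) (auto simp: indicator_def)
  also have "\<dots> = ennreal (2 * pi * \<eta>)"
  proof -
    have "((\<lambda>x. exp (- 1 * x)) has_integral exp (- 1 * (- ln \<eta>)) / 1) {- ln \<eta>..}"
      by (rule has_integral_exp_minus_to_infinity) simp
    then have "((\<lambda>x. 2 * pi * exp (- x)) has_integral 2 * pi * \<eta>) {- ln \<eta>..}"
      using assms by (intro has_integral_mult_right) simp
    then have "((\<lambda>x. 2 * pi * exp (- x)) has_integral 2 * pi * \<eta>) {- ln \<eta><..}"
      by (rule has_integral_spike_set_eq[THEN iffD1, rotated -1]) (auto intro: negligible_subset[of "{- ln \<eta>}"])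
    from nn_integral_has_integral_lebesgue'[OF _ this]
    show ?thesis by simp
  qed
  finally show ?thesis .
qed

lemma
  assumes "\<eta> > 0"
  shows integrable_inverse_dist: "integrable lborel (\<lambda>w. indicator (ball a \<eta>) w / cmod (w - a))"
    and integral_inverse_dist: "(LINT w|lborel. indicator (ball a \<eta>) w / cmod (w - a)) = 2 * pi * \<eta>"
proof -
  have [measurable]: "(\<lambda>w. indicator (ball a \<eta>) w / cmod (w - a)) \<in> borel_measurable borel"
    by (intro borel_measurable_divide borel_measurable_indicator borel_measurable_continuous_onI
        continuous_intros) auto
  have "has_bochner_integral lborel (\<lambda>w. indicator (ball a \<eta>) w / cmod (w - a)) (2 * pi * \<eta>)"
    by (rule has_bochner_integral_nn_integral) (use assms nn_integral_inverse_dist[OF assms] in auto)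
  then show "integrable lborel (\<lambda>w. indicator (ball a \<eta>) w / cmod (w - a))"
     "(LINT w|lborel. indicator (ball a \<eta>) w / cmod (w - a)) = 2 * pi * \<eta>"
    by (auto simp: has_bochner_integral_iff)
qed

text \<open>Within distance \<eta> of \<open>a\<close> the kernel is integrable, farther away it is
  at most 1/\<eta>. The radius \<eta> is left free: when the measure of \<open>E\<close> is at most
  \<eta>^2, the bound is of order \<eta>, uniformly in \<open>a\<close>.\<close>

lemma
  fixes \<mu> :: "complex \<Rightarrow> complex"
  assumes [measurable]: "E \<in> sets borel" "\<mu> \<in> borel_measurable borel"
    and fin: "emeasure lborel E < \<infinity>" and M: "\<And>w. w \<in> E \<Longrightarrow> cmod (\<mu> w) \<le> M" "0 \<le> M" and "\<eta> > 0"
  shows integrable_cauchy_kernel: "integrable lborel (\<lambda>w. indicator E w *\<^sub>R (\<mu> w / (w - a)))"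
    and integral_cauchy_kernel_bound:
      "cmod (LINT w|lborel. indicator E w *\<^sub>R (\<mu> w / (w - a))) \<le> M * (2 * pi * \<eta> + measure lborel E / \<eta>)"
proof -
  let ?b = "\<lambda>w. M * (indicator (ball a \<eta>) w / cmod (w - a) + indicator E w / \<eta>)"
  have iE: "integrable lborel (indicator E :: complex \<Rightarrow> real)" using fin by simp
  have ib: "integrable lborel ?b"
    using iE integrable_inverse_dist[OF \<open>\<eta> > 0\<close>] by simp
  have bd: "cmod (indicator E w *\<^sub>R (\<mu> w / (w - a))) \<le> ?b w" for w
  proof (cases "w \<in> E")
    case True
    have "cmod (\<mu> w / (w - a)) \<le> M * (1 / cmod (w - a))"
      using M(1)[OF True] by (simp add: norm_divide divide_right_mono)
    also have "\<dots> \<le> M * (indicator (ball a \<eta>) w / cmod (w - a) + 1 / \<eta>)"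
    proof (intro mult_left_mono \<open>0 \<le> M\<close>)
      show "1 / cmod (w - a) \<le> indicator (ball a \<eta>) w / cmod (w - a) + 1 / \<eta>"
        using \<open>\<eta> > 0\<close> by (auto simp: indicator_def dist_norm norm_minus_commute intro!: divide_left_mono mult_pos_pos)
    qed
    finally show ?thesis using True by simp
  qed (use M \<open>\<eta> > 0\<close> in \<open>auto intro!: mult_nonneg_nonneg\<close>)
  show i: "integrable lborel (\<lambda>w. indicator E w *\<^sub>R (\<mu> w / (w - a)))"
    by (rule Bochner_Integration.integrable_bound[OF ib]) (use bd in \<open>auto intro!: AE_I2 order_trans[OF _ abs_ge_self]\<close>)
  have "cmod (LINT w|lborel. indicator E w *\<^sub>R (\<mu> w / (w - a))) \<le> (LINT w|lborel. ?b w)"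
    by (rule Bochner_Integration.integral_norm_bound_integral[OF i ib]) (use bd in auto)
  also have "\<dots> = M * (2 * pi * \<eta> + measure lborel E / \<eta>)"
    using iE integrable_inverse_dist[OF \<open>\<eta> > 0\<close>, of a] integral_inverse_dist[OF \<open>\<eta> > 0\<close>, of a]
    by simp
  finally show "cmod (LINT w|lborel. indicator E w *\<^sub>R (\<mu> w / (w - a))) \<le> M * (2 * pi * \<eta> + measure lborel E / \<eta>)" .
qed

lemma has_bochner_integral_exp_right:
  assumes "c > (0::real)"
  shows "has_bochner_integral lborel (\<lambda>x. indicator {b<..} x * exp (- c * x)) (exp (- c * b) / c)"
proof (rule has_bochner_integral_nn_integral)
  have "((\<lambda>x. exp (- c * x)) has_integral exp (- c * b) / c) {b..}"
    by (rule has_integral_exp_minus_to_infinity[OF assms])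
  then have "((\<lambda>x. exp (- c * x)) has_integral exp (- c * b) / c) {b<..}"
    by (rule has_integral_spike_set_eq[THEN iffD1, rotated -1]) (auto intro: negligible_subset[of "{b}"])
  from nn_integral_has_integral_lebesgue[OF _ this]
  show "(\<integral>\<^sup>+x. ennreal (indicator {b<..} x * exp (- c * x)) \<partial>lborel) = ennreal (exp (- c * b) / c)"
    by simp
qed (use assms in auto)

lemma has_bochner_integral_exp_left:
  assumes "c > (0::real)"
  shows "has_bochner_integral lborel (\<lambda>x. indicator {..<b} x * exp (c * x)) (exp (c * b) / c)"
proof -
  have "has_bochner_integral lborel (\<lambda>x. indicator {-b<..} (0 + -1 * x) * exp (- c * (0 + -1 * x))) (exp (- c * - b) / c /\<^sub>R \<bar>-1\<bar>)"
    by (rule lborel_has_bochner_integral_real_affine_iff[THEN iffD1, OF _ has_bochner_integral_exp_right[OF assms]]) simp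
  also have "(\<lambda>x. indicator {-b<..} (0 + -1 * x) * exp (- c * (0 + -1 * x))) = (\<lambda>x. indicator {..<b} x * exp (c * x))"
    by (auto simp: fun_eq_iff indicator_def)
  finally show ?thesis by simp
qed

lemma exp_Complex: "exp (Complex x t) = of_real (exp x) * cis t"
  by (simp add: exp_eq_polar)

text \<open>Only circles of radius below |z| contribute, each the amount given by
  \<open>circle_integral_cauchy_kernel\<close>, and the radial integral of r^(2n+1) is elementary.
  The result is an explicit antiderivative of cnj z ^ n with respect to cnj z, which later turns
  polynomials in z and cnj z into Cauchy transforms.\<close>

theorem integral_cauchy_kernel_cnj_power:
  assumes "cmod z < R"
  shows "(LINT a|lborel. indicator (ball 0 R) a *\<^sub>R (cnj a ^ n / (z - a))) = of_real pi * cnj z ^ Suc n / of_nat (Suc n)"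
proof -
  let ?f = "\<lambda>a. indicator (ball 0 R) a *\<^sub>R (cnj a ^ n / (z - a))"
  have R: "R > 0" using assms by (meson norm_ge_zero le_less_trans)
  have [measurable]: "(\<lambda>a. cnj a ^ n) \<in> borel_measurable borel"
    by (intro borel_measurable_continuous_onI continuous_intros)
  have "integrable lborel (\<lambda>w. indicator (ball 0 R) w *\<^sub>R ((- (cnj w ^ n)) / (w - z)))"
    by (rule integrable_cauchy_kernel[where M = "R ^ n" and \<eta> = 1])
      (use R emeasure_lborel_ball_finite[of "0::complex" R] in \<open>auto intro!: power_mono simp: norm_power\<close>)
  also have "(\<lambda>w. indicator (ball 0 R) w *\<^sub>R ((- (cnj w ^ n)) / (w - z))) = ?f"
    by (intro ext arg_cong2[where f = scaleR] refl) (metis minus_diff_eq minus_divide_divide)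
  finally have int: "integrable lborel ?f" .
  have inner: "(LINT t:{0<..<2*pi}|lborel. ?f (exp (Complex x t))) =
     (indicator {..<ln (cmod z)} x * exp (2 * real n * x)) *\<^sub>R (2 * of_real pi / z ^ Suc n)"
    if x: "x \<noteq> ln (cmod z)" "z \<noteq> 0" for x
  proof -
    have "(LINT t:{0<..<2*pi}|lborel. ?f (exp (Complex x t))) =
       indicator {..<R} (exp x) *\<^sub>R (LINT t:{0<..<2*pi}|lborel. cnj (of_real (exp x) * cis t) ^ n / (z - of_real (exp x) * cis t))"
      unfolding set_lebesgue_integral_def exp_Complex
      by (subst integral_scaleR_right[symmetric], rule Bochner_Integration.integral_cong)
        (auto simp: indicator_def norm_mult)
    also have "exp x \<noteq> cmod z" using x by (metis ln_exp)
    note circle_integral_cauchy_kernel[OF exp_gt_zero this, of n]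
    also have "indicator {..<R} (exp x) *\<^sub>R (if exp x < cmod z then 2 * of_real pi * of_real (exp x) ^ (2 * n) / z ^ Suc n else 0)
      = (indicator {..<ln (cmod z)} x * exp (2 * real n * x)) *\<^sub>R (2 * of_real pi / z ^ Suc n)"
    proof -
      have "exp x < cmod z \<longleftrightarrow> x < ln (cmod z)" using x by (metis exp_less_cancel_iff exp_ln zero_less_norm_iff)
      moreover have "exp (2 * real n * x) = exp x ^ (2 * n)"
        by (simp add: exp_of_nat_mult[symmetric])
      ultimately show ?thesis using assms by (auto simp: indicator_def scaleR_conv_of_real)
    qed
    finally show ?thesis .
  qed
  show ?thesis
  proof (cases "z = 0")
    case True
    have "(LINT t:{0<..<2*pi}|lborel. ?f (exp (Complex x t))) = 0" for x
    proof -
      have "(LINT t:{0<..<2*pi}|lborel. ?f (exp (Complex x t))) =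
         indicator {..<R} (exp x) *\<^sub>R (LINT t:{0<..<2*pi}|lborel. cnj (of_real (exp x) * cis t) ^ n / (z - of_real (exp x) * cis t))"
        unfolding set_lebesgue_integral_def exp_Complex
        by (subst integral_scaleR_right[symmetric], rule Bochner_Integration.integral_cong)
          (auto simp: indicator_def norm_mult)
      then show ?thesis using True circle_integral_cauchy_kernel[of "exp x" z n] by simp
    qed
    then show ?thesis using polar_integrable(2)[OF int] True int by (simp add: borel_measurable_integrable)
  next
    case False
    have "(LINT a|lborel. ?f a) = (LINT x|lborel. exp (2 * x) *\<^sub>R (LINT t:{0<..<2*pi}|lborel. ?f (exp (Complex x t))))"
      using polar_integrable(2)[OF int] int by (simp add: borel_measurable_integrable)
    also have "\<dots> = (LINT x|lborel. (indicator {..<ln (cmod z)} x * exp ((2 * real n + 2) * x)) *\<^sub>R (2 * of_real pi / z ^ Suc n))"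
    proof (rule integral_cong_AE)
      show "(\<lambda>x. exp (2 * x) *\<^sub>R (LINT t:{0<..<2*pi}|lborel. ?f (exp (Complex x t)))) \<in> borel_measurable lborel"
        using polar_integrable(1)[OF int] int by (simp add: borel_measurable_integrable)
      have "AE x in lborel. x \<noteq> ln (cmod z)" by (rule AE_lborel_singleton)
      then show "AE x in lborel. exp (2 * x) *\<^sub>R (LINT t:{0<..<2*pi}|lborel. ?f (exp (Complex x t))) =
         (indicator {..<ln (cmod z)} x * exp ((2 * real n + 2) * x)) *\<^sub>R (2 * of_real pi / z ^ Suc n)"
        by eventually_elim (simp add: inner False distrib_right exp_add)
    qed simp
    also have "\<dots> = (exp ((2 * real n + 2) * ln (cmod z)) / (2 * real n + 2)) *\<^sub>R (2 * of_real pi / z ^ Suc n)"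
      using has_bochner_integral_exp_left[of "2 * real n + 2" "ln (cmod z)"]
      by (subst integral_scaleR_left) (auto simp: has_bochner_integral_iff)
    also have "exp ((2 * real n + 2) * ln (cmod z)) = (cmod z ^ 2) ^ Suc n"
    proof -
      have "(2 * real n + 2) * ln (cmod z) = real (2 * Suc n) * ln (cmod z)" by simp
      then show ?thesis using False by (simp only: exp_of_nat_mult exp_ln zero_less_norm_iff power_mult) simp
    qed
    also have "((cmod z ^ 2) ^ Suc n / (2 * real n + 2)) *\<^sub>R (2 * of_real pi / z ^ Suc n)
      = of_real pi * cnj z ^ Suc n / of_nat (Suc n)"
    proof -
      have "complex_of_real ((cmod z ^ 2) ^ Suc n) = z ^ Suc n * cnj z ^ Suc n"
        unfolding of_real_power[of "(cmod z)\<^sup>2"] complex_norm_square of_real_power[symmetric]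
        by (simp only: complex_norm_square power_mult_distrib flip: of_real_power)
      moreover have "complex_of_real (2 * real n + 2) = 2 * of_nat (Suc n)" by simp
      ultimately show ?thesis using False
        by (simp add: scaleR_conv_of_real del: power_Suc of_nat_Suc)
    qed
    finally show ?thesis .
  qed
qed

text \<open>The weight is constant on each circle, so this is the case n = 0 of
  \<open>circle_integral_cauchy_kernel\<close>. Circles of radius beyond |a| contribute nothing
  because \<open>a\<close> then lies inside them.\<close>

lemma integral_polar_indicator_kernel:
  assumes "\<delta> > 0" "cmod a > \<delta>" "x \<noteq> ln (cmod a)"
  shows "(LINT t:{0<..<2*pi}|lborel. indicator {w. \<delta> < cmod w} (exp (Complex x t)) *\<^sub>R
            (1 / ((exp (Complex x t) - a) * of_real ((cmod (exp (Complex x t)))\<^sup>2))))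
      = (indicator {ln \<delta><..<ln (cmod a)} x * exp (-2 * x)) *\<^sub>R (- 2 * of_real pi / a)" (is "?L = ?R")
proof -
  have a: "a \<noteq> 0" using assms by auto
  have "indicator {w. \<delta> < cmod w} (exp (Complex x t)) *\<^sub>R
            (1 / ((exp (Complex x t) - a) * of_real ((cmod (exp (Complex x t)))\<^sup>2)))
     = (- indicator {ln \<delta><..} x * exp (-2 * x)) *\<^sub>R (cnj (of_real (exp x) * cis t) ^ 0 / (a - of_real (exp x) * cis t))"
     (is "?l t = ?r t") for t
  proof -
    have "\<delta> < exp x \<longleftrightarrow> ln \<delta> < x" using assms by (metis exp_less_cancel_iff exp_ln)
    then have 1: "indicator {w. \<delta> < cmod w} (exp (Complex x t)) = (indicator {ln \<delta><..} x :: real)"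
      by (simp add: indicator_def exp_Complex norm_mult)
    have 2: "1 / ((exp (Complex x t) - a) * of_real ((cmod (exp (Complex x t)))\<^sup>2))
       = - of_real (exp (- 2 * x)) / (a - of_real (exp x) * cis t)"
    proof -
      have "complex_of_real (exp (- 2 * x)) = 1 / of_real ((cmod (exp (Complex x t)))\<^sup>2)"
        using exp_double[of x] by (simp add: exp_Complex norm_mult exp_minus inverse_eq_divide)
      moreover have "1 / ((e - a) * C) = - (1 / C) / (a - e)" for e C :: complex
        using minus_divide_divide[of "1 / C" "e - a"] by (simp add: mult.commute)
      ultimately show ?thesis by (simp only: exp_Complex)
    qed
    show ?thesis unfolding 1 2 by (simp add: scaleR_conv_of_real)
  qed
  then have "?L = (- indicator {ln \<delta><..} x * exp (-2 * x)) *\<^sub>R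
      (LINT t:{0<..<2*pi}|lborel. cnj (of_real (exp x) * cis t) ^ 0 / (a - of_real (exp x) * cis t))"
    unfolding set_lebesgue_integral_def
    by (subst integral_scaleR_right[symmetric], intro Bochner_Integration.integral_cong) (auto simp: scaleR_left_commute)
  also have "exp x \<noteq> cmod a" using assms by (metis ln_exp)
  note circle_integral_cauchy_kernel[OF exp_gt_zero this, of 0]
  also have "exp x < cmod a \<longleftrightarrow> x < ln (cmod a)"
    using a by (metis exp_less_cancel_iff exp_ln zero_less_norm_iff)
  finally show ?thesis by (simp add: indicator_def scaleR_conv_of_real)
qed

text \<open>The cutoff \<open>\<delta>\<close> keeps the weight bounded, the singularity at
  \<open>a\<close> is locally integrable, and at infinity the integrand decays like |w|^-3. Without
  the factor 1 / (w - a) the weight itself would fail to be integrable there.\<close>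

lemma integrable_cauchy_kernel_weight:
  assumes "\<delta> > 0"
  shows "integrable lborel (\<lambda>w. indicator {w. \<delta> < cmod w} w *\<^sub>R (1 / ((w - a) * of_real ((cmod w)\<^sup>2))))"
proof -
  \<comment> \<open>For |w| at least this \<open>R\<close> one has |w - a| at least |w| / 2, which
    gives the decay; the second summand only ensures \<delta> < R.\<close>
  define R where "R = 2 * cmod a + 2 * \<delta>"
  have R: "R > 0" "R > \<delta>" unfolding R_def using assms norm_ge_zero[of a] by linarith+
  have m1[measurable]: "{w::complex. \<delta> < cmod w} \<in> sets borel" "{w::complex. R \<le> cmod w} \<in> sets borel"
     "{w::complex. \<delta> < cmod w \<and> cmod w < R} \<in> sets borel"
    by (intro borel_open borel_closed open_Collect_less closed_Collect_le open_Collect_conj continuous_intros)+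
  have m2[measurable]: "(\<lambda>w. 1 / complex_of_real ((cmod w)\<^sup>2)) \<in> borel_measurable borel"
    by (intro borel_measurable_divide borel_measurable_continuous_onI continuous_intros)
  have i1: "integrable lborel (\<lambda>w. indicator {w. \<delta> < cmod w \<and> cmod w < R} w *\<^sub>R ((1 / of_real ((cmod w)\<^sup>2)) / (w - a)))"
  proof (rule integrable_cauchy_kernel[where M = "1 / \<delta>\<^sup>2" and \<eta> = 1])
    have "emeasure lborel {w::complex. \<delta> < cmod w \<and> cmod w < R} \<le> emeasure lborel (ball (0::complex) R)"
      by (intro emeasure_mono) auto
    then show "emeasure lborel {w::complex. \<delta> < cmod w \<and> cmod w < R} < \<infinity>"
      using emeasure_lborel_ball_finite[of "0::complex" R] by (metis le_less_trans)
    show "cmod (1 / of_real ((cmod w)\<^sup>2)) \<le> 1 / \<delta>\<^sup>2" if "w \<in> {w. \<delta> < cmod w \<and> cmod w < R}" for w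
      using that assms by (auto simp: norm_divide norm_power intro!: divide_left_mono power_mono mult_pos_pos)
  qed auto
  have i3: "integrable lborel (\<lambda>w. indicator {R..} (cmod w) * (2 / cmod w ^ 3))"
  proof (rule integrableI_nonneg)
    have "(\<integral>\<^sup>+w. ennreal (indicator {R..} (cmod w) * (2 / cmod w ^ 3)) \<partial>lborel) =
      (\<integral>\<^sup>+x. ennreal (2 * pi * exp (2 * x)) * ennreal (indicator {R..} (exp x) * (2 / exp x ^ 3)) \<partial>lborel)"
      by (rule nn_integral_polar_radial[of "\<lambda>s. ennreal (indicator {R..} s * (2 / s ^ 3))"]) auto
    also have "\<dots> \<le> (\<integral>\<^sup>+x. ennreal (4 * pi * (indicator {ln R - 1<..} x * exp (- 1 * x))) \<partial>lborel)"
    proof (intro nn_integral_mono)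
      fix x :: real
      have e: "exp (2 * x) * (2 / exp x ^ 3) = 2 * exp (- x)"
      proof -
        have "exp x ^ 3 = exp (3 * x)" using exp_of_nat_mult[of 3 x] by simp
        then have "exp (2 * x) * (2 / exp x ^ 3) = 2 * exp (2 * x - 3 * x)"
          by (simp only: exp_diff) simp
        then show ?thesis by simp
      qed
      have "R \<le> exp x \<Longrightarrow> ln R - 1 < x"
        using R ln_le_cancel_iff[of R "exp x"] by simp
      then have ind: "(indicator {R..} (exp x) :: real) \<le> indicator {ln R - 1<..} x" by (auto simp: indicator_def)
      have "ennreal (2 * pi * exp (2 * x)) * ennreal (indicator {R..} (exp x) * (2 / exp x ^ 3))
        = ennreal ((2 * pi * exp (2 * x)) * (indicator {R..} (exp x) * (2 / exp x ^ 3)))"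
        by (rule ennreal_mult[symmetric]) auto
      also have "(2 * pi * exp (2 * x)) * (indicator {R..} (exp x) * (2 / exp x ^ 3))
        = 2 * pi * indicator {R..} (exp x) * (exp (2 * x) * (2 / exp x ^ 3))" by (simp only: mult_ac)
      also have "\<dots> = 4 * pi * (indicator {R..} (exp x) * exp (- 1 * x))" unfolding e by simp
      also have "ennreal \<dots> \<le> ennreal (4 * pi * (indicator {ln R - 1<..} x * exp (- 1 * x)))"
        by (intro ennreal_leI mult_left_mono mult_right_mono ind) auto
      finally show "ennreal (2 * pi * exp (2 * x)) * ennreal (indicator {R..} (exp x) * (2 / exp x ^ 3))
         \<le> ennreal (4 * pi * (indicator {ln R - 1<..} x * exp (- 1 * x)))" .
    qed
    also have "\<dots> < \<infinity>"
    proof -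
      have "integrable lborel (\<lambda>x. 4 * pi * (indicator {ln R - 1<..} x * exp (- 1 * x)))"
        using has_bochner_integral_exp_right[of 1 "ln R - 1"] by (auto simp: has_bochner_integral_iff)
      then show ?thesis unfolding integrable_iff_bounded by (simp add: abs_mult)
    qed
    finally show "(\<integral>\<^sup>+w. ennreal (indicator {R..} (cmod w) * (2 / cmod w ^ 3)) \<partial>lborel) < \<infinity>" .
  qed (use R in \<open>auto simp: indicator_def\<close>)
  have i2: "integrable lborel (\<lambda>w. indicator {w. R \<le> cmod w} w *\<^sub>R (1 / ((w - a) * of_real ((cmod w)\<^sup>2))))"
  proof (rule Bochner_Integration.integrable_bound[OF i3])
    have "cmod (indicator {w. R \<le> cmod w} w *\<^sub>R (1 / ((w - a) * of_real ((cmod w)\<^sup>2))))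
       \<le> indicator {R..} (cmod w) * (2 / cmod w ^ 3)" for w
    proof (cases "R \<le> cmod w")
      case True
      have "cmod w / 2 \<le> cmod (w - a)" using norm_triangle_ineq2[of w a] True assms by (simp add: R_def)
      then have "cmod w ^ 3 / 2 \<le> cmod (w - a) * (cmod w)\<^sup>2"
        using mult_right_mono[of "cmod w / 2" "cmod (w - a)" "(cmod w)\<^sup>2"] by (simp add: power3_eq_cube power2_eq_square)
      moreover have "cmod w > 0" using True R by linarith
      ultimately have "1 / (cmod (w - a) * (cmod w)\<^sup>2) \<le> 1 / (cmod w ^ 3 / 2)"
        by (intro frac_le) auto
      then show ?thesis using True by (simp add: norm_divide norm_mult norm_power)
    qed auto
    then show "AE w in lborel. cmod (indicator {w. R \<le> cmod w} w *\<^sub>R (1 / ((w - a) * of_real ((cmod w)\<^sup>2))))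
       \<le> norm (indicator {R..} (cmod w) * (2 / cmod w ^ 3))"
      by (intro AE_I2) (auto intro: order_trans[OF _ abs_ge_self])
  qed auto
  from Bochner_Integration.integrable_add[OF i1 i2]
  show ?thesis
    by (rule Bochner_Integration.integrable_cong[THEN iffD1, rotated -1])
      (use R in \<open>auto simp: indicator_def field_simps\<close>)
qed

text \<open>In the logarithmic radius, the Jacobian exp(2x) cancels the weight and every circle
  between \<delta> and |a| contributes the same constant. The integral therefore measures the
  interval from ln \<delta> to ln |a|; this is the origin of ln |a| in the boundary
  identity.\<close>

theorem integral_cauchy_kernel_weight:
  assumes "\<delta> > 0" "cmod a > \<delta>"
  shows "(LINT w|lborel. indicator {w. \<delta> < cmod w} w *\<^sub>R (1 / ((w - a) * of_real ((cmod w)\<^sup>2))))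
     = - 2 * of_real pi * of_real (ln (cmod a) - ln \<delta>) / a"
proof -
  let ?f = "\<lambda>w. indicator {w. \<delta> < cmod w} w *\<^sub>R (1 / ((w - a) * of_real ((cmod w)\<^sup>2)))"
  note int = integrable_cauchy_kernel_weight[OF assms(1), of a]
  have m: "?f \<in> borel_measurable borel" using int by (simp add: borel_measurable_integrable)
  have "(LINT w|lborel. ?f w) = (LINT x|lborel. exp (2 * x) *\<^sub>R (LINT t:{0<..<2*pi}|lborel. ?f (exp (Complex x t))))"
    by (rule polar_integrable(2)[OF int m])
  also have "\<dots> = (LINT x|lborel. indicator {ln \<delta><..<ln (cmod a)} x *\<^sub>R (- 2 * of_real pi / a))"
  proof (rule integral_cong_AE)
    show "(\<lambda>x. exp (2 * x) *\<^sub>R (LINT t:{0<..<2*pi}|lborel. ?f (exp (Complex x t)))) \<in> borel_measurable lborel"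
      using polar_integrable(1)[OF int m] by (simp add: borel_measurable_integrable)
    have "AE x in lborel. x \<noteq> ln (cmod a)" by (rule AE_lborel_singleton)
    then show "AE x in lborel. exp (2 * x) *\<^sub>R (LINT t:{0<..<2*pi}|lborel. ?f (exp (Complex x t))) =
       indicator {ln \<delta><..<ln (cmod a)} x *\<^sub>R (- 2 * of_real pi / a)"
    proof eventually_elim
      fix x assume "x \<noteq> ln (cmod a)"
      have "exp (2 * x) * exp (-2 * x) = 1" by (simp flip: exp_add)
      then show "exp (2 * x) *\<^sub>R (LINT t:{0<..<2*pi}|lborel. ?f (exp (Complex x t))) =
        indicator {ln \<delta><..<ln (cmod a)} x *\<^sub>R (- 2 * of_real pi / a)"
        unfolding integral_polar_indicator_kernel[OF assms \<open>x \<noteq> ln (cmod a)\<close>]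
        by (simp add: indicator_def)
    qed
  qed simp
  also have "\<dots> = (ln (cmod a) - ln \<delta>) *\<^sub>R (- 2 * of_real pi / a)"
    using assms by (subst integral_scaleR_left) auto
  finally show ?thesis by (simp add: scaleR_conv_of_real)
qed

text \<open>In the logarithmic radius the integrand is the constant 2 pi on a half-line. The
  divergence is what forces test functions to vanish at infinity.\<close>

lemma not_integrable_inverse_square:
  assumes "R > 0"
  shows "(\<integral>\<^sup>+w. ennreal (indicator {w. R < cmod w} w / (cmod w)\<^sup>2) \<partial>lborel) = \<infinity>"
proof -
  have "(\<integral>\<^sup>+w. ennreal (indicator {w. R < cmod w} w / (cmod w)\<^sup>2) \<partial>lborel) =
     (\<integral>\<^sup>+w. ennreal (indicator {R<..} (cmod w) / (cmod w)\<^sup>2) \<partial>lborel)"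
    by (intro nn_integral_cong) (simp add: indicator_def)
  also have "\<dots> = (\<integral>\<^sup>+x. ennreal (2 * pi * exp (2 * x)) * ennreal (indicator {R<..} (exp x) / (exp x)\<^sup>2) \<partial>lborel)"
    by (rule nn_integral_polar_radial[of "\<lambda>s. ennreal (indicator {R<..} s / s\<^sup>2)"]) auto
  also have "\<dots> = (\<integral>\<^sup>+x. ennreal (2 * pi) * indicator {ln R<..} x \<partial>lborel)"
  proof (intro nn_integral_cong)
    fix x :: real
    have "R < exp x \<longleftrightarrow> ln R < x" using assms by (metis exp_less_cancel_iff exp_ln)
    then show "ennreal (2 * pi * exp (2 * x)) * ennreal (indicator {R<..} (exp x) / (exp x)\<^sup>2) =
       ennreal (2 * pi) * indicator {ln R<..} x"
      by (auto simp: indicator_def exp_double simp flip: ennreal_mult'')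
  qed
  also have "emeasure lborel {ln R<..} = \<infinity>"
  proof (rule ccontr)
    assume "emeasure lborel {ln R<..} \<noteq> \<infinity>"
    then obtain r where r: "emeasure lborel {ln R<..} = ennreal r" "r \<ge> 0"
      by (cases "emeasure lborel {ln R<..}" rule: ennreal_cases) auto
    have "emeasure lborel {ln R<..<ln R + (r + 1)} \<le> emeasure lborel {ln R<..}"
      by (intro emeasure_mono) auto
    then show False using r by (simp del: emeasure_lborel_Ioo) (simp add: ennreal_le_iff)
  qed
  then have "(\<integral>\<^sup>+x. ennreal (2 * pi) * indicator {ln R<..} x \<partial>lborel) = \<infinity>"
    by (subst nn_integral_cmult_indicator) (auto simp: ennreal_mult_top)
  finally show ?thesis .
qed

text \<open>No factor 1/pi, and the kernel is 1 / (w - a) with the integration variable first. With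
  this convention the derivative with respect to the conjugate variable is -pi \<mu>, which explains
  the signs and the factors pi below.\<close>

definition cauchy_transform :: "complex set \<Rightarrow> (complex \<Rightarrow> complex) \<Rightarrow> complex \<Rightarrow> complex" where
  "cauchy_transform E \<mu> a = (LINT w|lborel. indicator E w *\<^sub>R (\<mu> w / (w - a)))"

lemma integral_cauchy_kernel_bound_ball:
  fixes \<mu> :: "complex \<Rightarrow> complex"
  assumes [measurable]: "E \<in> sets borel" "\<mu> \<in> borel_measurable borel"
    and E: "E \<subseteq> ball a \<eta>" and M: "\<And>w. w \<in> E \<Longrightarrow> cmod (\<mu> w) \<le> M" "0 \<le> M" and "\<eta> > 0"
  shows "cmod (LINT w|lborel. indicator E w *\<^sub>R (\<mu> w / (w - a))) \<le> M * (2 * pi * \<eta>)"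
proof -
  have fin: "emeasure lborel E < \<infinity>"
    using emeasure_mono[OF E, of lborel] emeasure_lborel_ball_finite[of a \<eta>] by (simp add: le_less_trans)
  have "cmod (LINT w|lborel. indicator E w *\<^sub>R (\<mu> w / (w - a))) \<le>
     (LINT w|lborel. M * (indicator (ball a \<eta>) w / cmod (w - a)))"
  proof (rule Bochner_Integration.integral_norm_bound_integral)
    show "integrable lborel (\<lambda>w. indicator E w *\<^sub>R (\<mu> w / (w - a)))"
      by (rule integrable_cauchy_kernel[OF assms(1,2) fin M]) (use \<open>\<eta> > 0\<close> in auto)
    show "integrable lborel (\<lambda>w. M * (indicator (ball a \<eta>) w / cmod (w - a)))"
      using integrable_inverse_dist[OF \<open>\<eta> > 0\<close>, of a] by (rule integrable_mult_right)
    show "cmod (indicator E w *\<^sub>R (\<mu> w / (w - a))) \<le> M * (indicator (ball a \<eta>) w / cmod (w - a))" for w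
      using E M(1)[of w] M(2) by (cases "w \<in> E") (auto simp: norm_divide subset_iff dist_norm intro!: divide_right_mono)
  qed
  also have "\<dots> = M * (2 * pi * \<eta>)"
    by (simp only: integral_mult_right_zero integral_inverse_dist[OF \<open>\<eta> > 0\<close>, of a])
  finally show ?thesis .
qed

lemma measure_integral_bound:
  fixes f :: "complex \<Rightarrow> complex"
  assumes E: "E \<in> sets borel" "emeasure lborel E < \<infinity>"
    and f: "f \<in> borel_measurable borel" "\<And>w. w \<in> E \<Longrightarrow> cmod (f w) \<le> C"
  shows "integrable lborel (\<lambda>w. indicator E w *\<^sub>R f w)"
    and "cmod (LINT w|lborel. indicator E w *\<^sub>R f w) \<le> C * measure lborel E"
proof -
  have i: "integrable lborel (\<lambda>w. C * indicator E w :: real)" using E by simp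
  have b: "cmod (indicator E w *\<^sub>R f w) \<le> C * indicator E w" for w
    using f(2) by (auto simp: indicator_def)
  show j: "integrable lborel (\<lambda>w. indicator E w *\<^sub>R f w)"
    by (rule Bochner_Integration.integrable_bound[OF i])
      (use E f b in \<open>auto intro!: AE_I2 order_trans[OF _ abs_ge_self]\<close>)
  have "cmod (LINT w|lborel. indicator E w *\<^sub>R f w) \<le> (LINT w|lborel. C * indicator E w)"
    by (rule Bochner_Integration.integral_norm_bound_integral[OF j i b])
  then show "cmod (LINT w|lborel. indicator E w *\<^sub>R f w) \<le> C * measure lborel E" by simp
qed

context
  fixes E :: "complex set" and \<mu> :: "complex \<Rightarrow> complex" and M :: real
  assumes E[measurable]: "E \<in> sets borel" and \<mu>[measurable]: "\<mu> \<in> borel_measurable borel"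
    and fin: "emeasure lborel E < \<infinity>" and M: "\<And>w. w \<in> E \<Longrightarrow> cmod (\<mu> w) \<le> M" "0 \<le> M"
begin

lemma measurable_divide_diff: "(\<lambda>w. \<mu> w / (w - a)) \<in> borel_measurable borel"
  by (intro borel_measurable_divide \<mu> borel_measurable_continuous_onI continuous_intros)

text \<open>The part of \<open>E\<close> near \<open>a\<close> contributes O(\<eta>) to the values
  at \<open>a\<close> and at a nearby \<open>b\<close> alike, by
  \<open>integral_cauchy_kernel_bound_ball\<close>. On the rest the kernel is Lipschitz in the
  parameter. This continuity across the boundary of \<open>E\<close> is what carries the exterior
  identity to the frontier.\<close>

lemma continuous_cauchy_transform: "continuous_on UNIV (cauchy_transform E \<mu>)"
proof (rule continuous_at_imp_continuous_on, rule ballI)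
  fix a
  show "isCont (cauchy_transform E \<mu>) a"
    unfolding continuous_at_eps_delta
  proof (intro allI impI)
    fix e :: real assume "e > 0"
    \<comment> \<open>The near parts at \<open>a\<close> and \<open>b\<close> cost 2 pi M times the
      radii 2\<eta> and 3\<eta>, in all 10 pi M \<eta>, and this is to stay below e/2. The summand 1
      in M + 1 covers M = 0.\<close>
    define \<eta> where "\<eta> = e / (2 * (M + 1) * 10 * pi)"
    have "\<eta> > 0" using \<open>e > 0\<close> M(2) by (simp add: \<eta>_def)
    define C where "C = M * (measure lborel E + 1) / (2 * \<eta>\<^sup>2)"
    have C: "C \<ge> 0" using M(2) by (simp add: C_def)
    define d where "d = min \<eta> (e / (2 * (C + 1)))"
    have d: "d > 0" "d \<le> \<eta>" "C * d < e / 2"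
    proof -
      show "d > 0" "d \<le> \<eta>" using \<open>\<eta> > 0\<close> \<open>e > 0\<close> C by (auto simp: d_def)
      have "C * d \<le> C * (e / (2 * (C + 1)))" using C by (intro mult_left_mono) (auto simp: d_def)
      also have "\<dots> < e / 2" using C \<open>e > 0\<close> by (simp add: field_simps)
      finally show "C * d < e / 2" .
    qed
    show "\<exists>d>0. \<forall>b. dist b a < d \<longrightarrow> dist (cauchy_transform E \<mu> b) (cauchy_transform E \<mu> a) < e"
    proof (intro exI[of _ d] conjI allI impI \<open>d > 0\<close>)
      fix b assume b: "dist b a < d"
      define E1 E2 where "E1 = E \<inter> ball a (2 * \<eta>)" and "E2 = E - ball a (2 * \<eta>)"
      have [measurable]: "E1 \<in> sets borel" "E2 \<in> sets borel" by (auto simp: E1_def E2_def)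
      have fin2: "emeasure lborel E1 < \<infinity>" "emeasure lborel E2 < \<infinity>"
        using emeasure_mono[of E1 E lborel] emeasure_mono[of E2 E lborel] fin
        by (auto simp: E1_def E2_def intro: le_less_trans)
      have M1: "\<And>w. w \<in> E1 \<Longrightarrow> cmod (\<mu> w) \<le> M" "\<And>w. w \<in> E2 \<Longrightarrow> cmod (\<mu> w) \<le> M"
        using M by (auto simp: E1_def E2_def)
      have split: "cauchy_transform E \<mu> c = cauchy_transform E1 \<mu> c + cauchy_transform E2 \<mu> c" for c
      proof -
        have "indicator E w *\<^sub>R (\<mu> w / (w - c)) = indicator E1 w *\<^sub>R (\<mu> w / (w - c)) + indicator E2 w *\<^sub>R (\<mu> w / (w - c))" for w
          by (auto simp: E1_def E2_def indicator_def)
        then show ?thesis unfolding cauchy_transform_def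
          by (simp only:) (intro Bochner_Integration.integral_add integrable_cauchy_kernel[where M = M and \<eta> = 1] \<mu> fin2 M1 M(2); simp)
      qed
      have 1: "cmod (cauchy_transform E1 \<mu> a) \<le> M * (2 * pi * (2 * \<eta>))"
        unfolding cauchy_transform_def
        by (rule integral_cauchy_kernel_bound_ball) (use M1 M \<open>\<eta> > 0\<close> in \<open>auto simp: E1_def\<close>)
      have "ball a (2 * \<eta>) \<subseteq> ball b (3 * \<eta>)"
      proof
        fix x assume "x \<in> ball a (2 * \<eta>)"
        then show "x \<in> ball b (3 * \<eta>)" using b d dist_triangle[of b x a] by simp
      qed
      then have 2: "cmod (cauchy_transform E1 \<mu> b) \<le> M * (2 * pi * (3 * \<eta>))"
        unfolding cauchy_transform_def
        by (intro integral_cauchy_kernel_bound_ball \<mu> M1 M(2)) (use \<open>\<eta> > 0\<close> in \<open>auto simp: E1_def\<close>)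
      have "cauchy_transform E2 \<mu> b - cauchy_transform E2 \<mu> a =
         (LINT w|lborel. indicator E2 w *\<^sub>R (\<mu> w / (w - b) - \<mu> w / (w - a)))"
        unfolding cauchy_transform_def scaleR_diff_right
        by (intro Bochner_Integration.integral_diff[symmetric] integrable_cauchy_kernel[where M = M and \<eta> = 1] \<mu> fin2 M1 M(2); simp)
      also have "cmod \<dots> \<le> (M * cmod (b - a) / (2 * \<eta>\<^sup>2)) * measure lborel E2"
      proof (rule measure_integral_bound)
        show "(\<lambda>w. \<mu> w / (w - b) - \<mu> w / (w - a)) \<in> borel_measurable borel"
          by (intro borel_measurable_diff measurable_divide_diff)
        fix w assume w: "w \<in> E2"
        have wa: "cmod (w - a) \<ge> 2 * \<eta>" using w by (auto simp: E2_def dist_norm norm_minus_commute)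
        then have wb: "cmod (w - b) \<ge> \<eta>"
          using b d norm_triangle_ineq4[of "w - b" "a - b"] by (simp add: dist_norm norm_minus_commute)
        have nz: "w \<noteq> a" "w \<noteq> b" using wa wb \<open>\<eta> > 0\<close> by auto
        then have "\<mu> w / (w - b) - \<mu> w / (w - a) = \<mu> w * (b - a) / ((w - a) * (w - b))"
          by (simp add: field_simps)
        then have "cmod (\<mu> w / (w - b) - \<mu> w / (w - a)) = cmod (\<mu> w) * cmod (b - a) / (cmod (w - a) * cmod (w - b))"
          by (simp add: norm_mult norm_divide)
        also have "\<dots> \<le> M * cmod (b - a) / (2 * \<eta> * \<eta>)"
          using wa wb M1(2)[OF w] M(2) \<open>\<eta> > 0\<close> by (intro frac_le mult_mono) auto
        finally show "cmod (\<mu> w / (w - b) - \<mu> w / (w - a)) \<le> M * cmod (b - a) / (2 * \<eta>\<^sup>2)"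
          by (simp add: power2_eq_square)
      qed (use fin2 in auto)
      also have "\<dots> \<le> (M * cmod (b - a) / (2 * \<eta>\<^sup>2)) * (measure lborel E + 1)"
      proof (intro mult_left_mono)
        have "measure lborel E2 \<le> measure lborel E"
          using fin by (intro measure_mono_fmeasurable) (auto simp: E2_def fmeasurable_def)
        then show "measure lborel E2 \<le> measure lborel E + 1" by simp
      qed (use M(2) in auto)
      also have "\<dots> = C * cmod (b - a)" by (simp add: C_def)
      also have "\<dots> \<le> C * d" using b C by (intro mult_left_mono) (auto simp: dist_norm)
      finally have 3: "cmod (cauchy_transform E2 \<mu> b - cauchy_transform E2 \<mu> a) < e / 2" using d by simp
      have "M * (2 * pi * (2 * \<eta>)) + M * (2 * pi * (3 * \<eta>)) = M * (10 * pi * \<eta>)" by (simp add: algebra_simps)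
      also have "\<dots> \<le> (M + 1) * (10 * pi * \<eta>)" using \<open>\<eta> > 0\<close> by (intro mult_right_mono) auto
      also have "\<dots> = e / 2"
      proof -
        have "M + 1 \<noteq> 0" using M(2) by simp
        then show ?thesis by (simp add: \<eta>_def divide_simps)
      qed
      finally have 4: "M * (2 * pi * (2 * \<eta>)) + M * (2 * pi * (3 * \<eta>)) \<le> e / 2" .
      have "dist (cauchy_transform E \<mu> b) (cauchy_transform E \<mu> a) =
        cmod ((cauchy_transform E1 \<mu> b - cauchy_transform E1 \<mu> a) + (cauchy_transform E2 \<mu> b - cauchy_transform E2 \<mu> a))"
        unfolding split dist_norm by (simp add: algebra_simps)
      also have "\<dots> \<le> (cmod (cauchy_transform E1 \<mu> b) + cmod (cauchy_transform E1 \<mu> a)) + cmod (cauchy_transform E2 \<mu> b - cauchy_transform E2 \<mu> a)"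
        by (intro order_trans[OF norm_triangle_ineq] add_mono norm_triangle_ineq4) auto
      also have "\<dots> < e" using 1 2 3 4 by linarith
      finally show "dist (cauchy_transform E \<mu> b) (cauchy_transform E \<mu> a) < e" .
    qed
  qed
qed

text \<open>Off \<open>C\<close> the distance to \<open>E\<close> is at least some d > 0. The
  difference quotient of the kernel minus its derivative then has an explicit remainder of size O(|b
  - a|), uniform over \<open>E\<close>, and integrates to the same order.\<close>

lemma holomorphic_cauchy_transform:
  assumes cl: "closed C" "E \<subseteq> C"
  shows "cauchy_transform E \<mu> holomorphic_on - C"
proof -
  have "(cauchy_transform E \<mu> has_field_derivative (LINT w|lborel. indicator E w *\<^sub>R (\<mu> w / (w - a) / (w - a)))) (at a)"
    if a: "a \<notin> C" for a
  proof -
    obtain d where d: "d > 0" "\<And>w. w \<in> E \<Longrightarrow> d \<le> cmod (w - a)"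
      using separate_point_closed[OF cl(1) a] cl(2) by (metis dist_commute dist_norm subsetD)
    define D where "D = (LINT w|lborel. indicator E w *\<^sub>R (\<mu> w / (w - a) / (w - a)))"
    define B where "B = M / (d * d * (d / 2)) * measure lborel E"
    have est: "cmod ((cauchy_transform E \<mu> b - cauchy_transform E \<mu> a) / (b - a) - D) \<le> B * cmod (b - a)"
      if b: "b \<noteq> a" "cmod (b - a) < d / 2" for b
    proof -
      have db: "d / 2 \<le> cmod (w - b)" if "w \<in> E" for w
        using d(2)[OF that] b norm_triangle_ineq4[of "w - b" "a - b"] by (simp add: norm_minus_commute)
      have m: "(\<lambda>w. \<mu> w / (w - b)) \<in> borel_measurable borel" "(\<lambda>w. \<mu> w / (w - a)) \<in> borel_measurable borel"
         "(\<lambda>w. \<mu> w / (w - a) / (w - a)) \<in> borel_measurable borel"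
        by (intro borel_measurable_divide \<mu> borel_measurable_continuous_onI continuous_intros)+
      have bnd1: "cmod (\<mu> w / (w - b)) \<le> M / (d / 2)" if "w \<in> E" for w
        unfolding norm_divide using d(1) db[OF that] M(1)[OF that] M(2) by (intro frac_le) auto
      have bnd2: "cmod (\<mu> w / (w - a)) \<le> M / d" if "w \<in> E" for w
        unfolding norm_divide using d(1) d(2)[OF that] M(1)[OF that] M(2) by (intro frac_le) auto
      have bnd3: "cmod (\<mu> w / (w - a) / (w - a)) \<le> M / d / d" if "w \<in> E" for w
        unfolding norm_divide[of "\<mu> w / (w - a)"]
        using d(1) d(2)[OF that] M(2) by (intro frac_le[OF _ bnd2[OF that]]) auto
      note i = measure_integral_bound(1)[OF E fin m(1) bnd1] measure_integral_bound(1)[OF E fin m(2) bnd2]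
         measure_integral_bound(1)[OF E fin m(3) bnd3]
      have "(cauchy_transform E \<mu> b - cauchy_transform E \<mu> a) / (b - a) - D =
        (LINT w|lborel. (indicator E w *\<^sub>R (\<mu> w / (w - b)) - indicator E w *\<^sub>R (\<mu> w / (w - a))) / (b - a)
            - indicator E w *\<^sub>R (\<mu> w / (w - a) / (w - a)))"
        unfolding cauchy_transform_def D_def using i by simp
      also have "\<dots> = (LINT w|lborel. indicator E w *\<^sub>R
          ((\<mu> w / (w - b) - \<mu> w / (w - a)) / (b - a) - \<mu> w / (w - a) / (w - a)))"
        by (intro Bochner_Integration.integral_cong) (auto simp: indicator_def)
      also have "cmod \<dots> \<le> (M * cmod (b - a) / (d * d * (d / 2))) * measure lborel E"
      proof (rule measure_integral_bound(2)[OF E fin])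
        show "(\<lambda>w. (\<mu> w / (w - b) - \<mu> w / (w - a)) / (b - a) - \<mu> w / (w - a) / (w - a)) \<in> borel_measurable borel"
          by (intro borel_measurable_diff borel_measurable_divide m) auto
        fix w assume w: "w \<in> E"
        have nz: "w - a \<noteq> 0" "w - b \<noteq> 0" "b - a \<noteq> 0" using d(2)[OF w] db[OF w] d(1) b by auto
        have "(m / (x - h) - m / x) / h - m / x / x = m * h / (x * x * (x - h))"
          if "x \<noteq> 0" "x - h \<noteq> 0" "h \<noteq> 0" for m x h :: complex
          using that by (simp add: divide_simps) (simp add: algebra_simps)
        from this[of "w - a" "b - a" "\<mu> w"] nz
        have "(\<mu> w / (w - b) - \<mu> w / (w - a)) / (b - a) - \<mu> w / (w - a) / (w - a)
           = \<mu> w * (b - a) / ((w - a) * (w - a) * (w - b))" by simp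
        then have "cmod ((\<mu> w / (w - b) - \<mu> w / (w - a)) / (b - a) - \<mu> w / (w - a) / (w - a))
           = cmod (\<mu> w) * cmod (b - a) / (cmod (w - a) * cmod (w - a) * cmod (w - b))"
          by (simp add: norm_mult norm_divide)
        also have "\<dots> \<le> M * cmod (b - a) / (d * d * (d / 2))"
          using d(2)[OF w] db[OF w] d(1) M(1)[OF w] M(2) by (intro frac_le mult_mono) auto
        finally show "cmod ((\<mu> w / (w - b) - \<mu> w / (w - a)) / (b - a) - \<mu> w / (w - a) / (w - a))
           \<le> M * cmod (b - a) / (d * d * (d / 2))" .
      qed
      finally show ?thesis by (simp add: B_def mult.commute mult.left_commute)
    qed
    have "((\<lambda>b. (cauchy_transform E \<mu> b - cauchy_transform E \<mu> a) / (b - a) - D) \<longlongrightarrow> 0) (at a)"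
    proof (rule Lim_null_comparison)
      show "\<forall>\<^sub>F b in at a. cmod ((cauchy_transform E \<mu> b - cauchy_transform E \<mu> a) / (b - a) - D) \<le> B * cmod (b - a)"
        unfolding eventually_at using est d(1)
        by (intro exI[of _ "d / 2"]) (auto simp: dist_norm)
      show "((\<lambda>b. B * cmod (b - a)) \<longlongrightarrow> 0) (at a)"
        by (auto intro!: tendsto_eq_intros)
    qed
    then show ?thesis unfolding has_field_derivative_iff D_def[symmetric] by (simp add: LIM_zero_iff)
  qed
  then show ?thesis unfolding holomorphic_on_def field_differentiable_def
    using DERIV_subset by blast
qed

text \<open>Boundedness of a times the transform near infinity makes the pullback to the disc
  bounded near the preimage of infinity, so that the singularity there is removable.\<close>

lemma cauchy_transform_at_infinity:
  assumes R: "\<And>w. w \<in> E \<Longrightarrow> cmod w \<le> R" "R > 0" and a: "cmod a \<ge> 2 * R"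
  shows "cmod (a * cauchy_transform E \<mu> a) \<le> 2 * M * measure lborel E"
proof -
  have an: "cmod a > 0" using R a by linarith
  have "cmod (cauchy_transform E \<mu> a) \<le> M / (cmod a / 2) * measure lborel E"
    unfolding cauchy_transform_def
  proof (rule measure_integral_bound(2)[OF E fin measurable_divide_diff])
    fix w assume w: "w \<in> E"
    have "cmod a / 2 \<le> cmod (w - a)" using R(1)[OF w] a norm_triangle_ineq2[of a w] by (simp add: norm_minus_commute)
    then show "cmod (\<mu> w / (w - a)) \<le> M / (cmod a / 2)"
      unfolding norm_divide using M(1)[OF w] M(2) an by (intro frac_le) auto
  qed
  then have "cmod a * cmod (cauchy_transform E \<mu> a) \<le> cmod a * (M / (cmod a / 2) * measure lborel E)"
    by (intro mult_left_mono) auto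
  also have "\<dots> = 2 * M * measure lborel E" using an by simp
  finally show ?thesis by (simp add: norm_mult)
qed

end

section \<open>Riemann--Stieltjes integrals along rectifiable loops\<close>

text \<open>Uniform partitions with left tags give one concrete sequence that converges to the
  integral whenever it exists. Limits along it replace the epsilon-delta definition, and each term
  is linear in the integrand.\<close>

definition rs_sum :: "(complex \<Rightarrow> complex) \<Rightarrow> (real \<Rightarrow> complex) \<Rightarrow> nat \<Rightarrow> complex" where
  "rs_sum g \<gamma> N = (\<Sum>j<N. g (\<gamma> (real j / real N)) * (\<gamma> (real (Suc j) / real N) - \<gamma> (real j / real N)))"

definition variation_bound :: "(real \<Rightarrow> complex) \<Rightarrow> real \<Rightarrow> bool" where
  "variation_bound \<gamma> V \<longleftrightarrow> (\<forall>(n::nat) (t::nat \<Rightarrow> real). t 0 = 0 \<and> t n = 1 \<and> (\<forall>i<n. t i \<le> t (Suc i)) \<longrightarrow>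
          (\<Sum>i<n. cmod (\<gamma> (t (Suc i)) - \<gamma> (t i))) \<le> V)"

lemma rectifiable_loop_variation_bound:
  assumes "rectifiable_loop \<gamma>"
  obtains V where "V > 0" "variation_bound \<gamma> V"
proof -
  obtain B where B: "variation_bound \<gamma> B"
    using assms unfolding rectifiable_loop_def variation_bound_def by blast
  then have "variation_bound \<gamma> (max B 1)"
    unfolding variation_bound_def by (meson max.coboundedI1)
  then show ?thesis using that[of "max B 1"] by simp
qed

lemma variation_bound_uniform:
  assumes "variation_bound \<gamma> V" "N > 0"
  shows "(\<Sum>j<N. cmod (\<gamma> (real (Suc j) / real N) - \<gamma> (real j / real N))) \<le> V"
  using assms(1)[unfolded variation_bound_def, rule_format, of "\<lambda>j. real j / real N" N] assms(2)
  by (simp add: divide_right_mono)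

lemma partition_increasing:
  assumes "\<forall>i<n. t i < (t (Suc i)::real)" "i \<le> j" "j \<le> n"
  shows "t i \<le> t j"
  using assms(2,3)
proof (induction j rule: dec_induct)
  case (step j)
  then have "t i \<le> t j" "t j < t (Suc j)" using assms(1) by auto
  then show ?case by simp
qed simp

text \<open>Comparing a tagged partition with the uniform partitions, instead of with another tagged
  partition, avoids common refinements: the uniform nodes are grouped by the cells of the
  given partition, and only the \<open>n\<close> cell boundaries contribute a mismatch, which vanishes as
  \<open>N \<rightarrow> \<infinity>\<close>.\<close>
lemma rs_sum_compare:
  assumes \<gamma>: "continuous_on {0..1} \<gamma>" and V: "variation_bound \<gamma> V"
    and g: "continuous_on (\<gamma> ` {0..1}) g"
    and t: "t 0 = 0" "t n = 1"
    and part: "\<forall>i<n. t i < t (Suc i) \<and> t (Suc i) - t i < \<delta> \<and> t i \<le> s i \<and> s i \<le> t (Suc i)"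
    and \<delta>: "\<And>x y. \<lbrakk>x \<in> {0..1}; y \<in> {0..1}; \<bar>x - y\<bar> < \<delta>\<rbrakk> \<Longrightarrow> cmod (g (\<gamma> x) - g (\<gamma> y)) \<le> e"
    and "0 < d" "0 \<le> e"
  shows "\<forall>\<^sub>F N in sequentially.
     cmod ((\<Sum>i<n. g (\<gamma> (s i)) * (\<gamma> (t (Suc i)) - \<gamma> (t i))) - rs_sum g \<gamma> N) \<le> e * V + d"
proof -
  have tmono: "t i \<le> t j" if "i \<le> j" "j \<le> n" for i j
    using partition_increasing[of n t i j] part that by blast
  have t01: "t i \<in> {0..1}" if "i \<le> n" for i
    using tmono[of 0 i] tmono[of i n] that t by auto
  have s01: "s i \<in> {0..1}" if "i < n" for i
  proof -
    have "t i \<le> s i" "s i \<le> t (Suc i)" using part that by auto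
    then show ?thesis using t01[of i] t01[of "Suc i"] that by simp
  qed
  have "compact (g ` \<gamma> ` {0..1})"
    by (intro compact_continuous_image g \<gamma> compact_Icc)
  then obtain M where M: "M > 0" "\<And>x. x \<in> {0..1} \<Longrightarrow> cmod (g (\<gamma> x)) \<le> M"
    using bounded_pos[of "g ` \<gamma> ` {0..1}"] compact_imp_bounded by auto
  \<comment> \<open>\<open>j N i\<close> is the first index k with k/N at or beyond
    \<open>t i\<close>. The indices from \<open>j N i\<close> up to but excluding
    \<open>j N (Suc i)\<close> are therefore those whose nodes lie in the half-open cell from
    \<open>t i\<close> to \<open>t (Suc i)\<close>.\<close>
  define j where "j = (\<lambda>N i. nat \<lceil>real N * t i\<rceil>)"
  \<comment> \<open>Each of the n cells has two ends, each displaced by less than \<eta> along the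
    curve, at a cost of 2 M \<eta> per cell; the total stays below d.\<close>
  define \<eta> where "\<eta> = d / (2 * M * (real n + 1))"
  have "\<eta> > 0" using M(1) \<open>0 < d\<close> by (simp add: \<eta>_def)
  have "uniformly_continuous_on {0..1} \<gamma>"
    using \<gamma> compact_uniformly_continuous by blast
  then obtain \<xi> where \<xi>: "\<xi> > 0"
    "\<And>x y. \<lbrakk>x \<in> {0..1}; y \<in> {0..1}; \<bar>x - y\<bar> < \<xi>\<rbrakk> \<Longrightarrow> cmod (\<gamma> x - \<gamma> y) < \<eta>"
    using \<open>\<eta> > 0\<close> unfolding uniformly_continuous_on_def dist_norm real_norm_def by metis
  have "n > 0" using t by (cases n) auto
  obtain N0 :: nat where N0: "1 / real N0 < \<xi>" "N0 > 0"
    using \<open>\<xi> > 0\<close> by (metis ex_inverse_of_nat_less inverse_eq_divide)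
  show ?thesis
  proof (rule eventually_sequentiallyI)
    fix N assume "N0 \<le> N"
    then have N: "N > 0" "1 / real N < \<xi>"
      using N0 le_less_trans[OF frac_le[of 1 1 "real N0" "real N"]] by auto
    define u where "u = (\<lambda>k. real k / real N)"
    have jN: "real N * t i \<le> real (j N i)" "real (j N i) < real N * t i + 1" if "i \<le> n" for i
      using t01[OF that] by (simp_all add: j_def of_nat_nat ceiling_correct) linarith
    have jmono: "j N i \<le> j N (Suc i)" if "i < n" for i
      using tmono[of i "Suc i"] that unfolding j_def
      by (intro nat_mono ceiling_mono mult_left_mono) auto
    have j0: "j N 0 = 0" "j N n = N" using t by (simp_all add: j_def)
    have jle: "j N i \<le> N" if "i \<le> n" for i
      using t01[OF that] j_def by (simp add: ceiling_le_iff nat_le_iff mult_left_le)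
    have close: "cmod (\<gamma> (u (j N i)) - \<gamma> (t i)) < \<eta>" if "i \<le> n" for i
    proof (rule \<xi>(2))
      show "u (j N i) \<in> {0..1}" using jle[OF that] N by (simp add: u_def)
      show "t i \<in> {0..1}" using t01 that by blast
      have "\<bar>u (j N i) - t i\<bar> < 1 / real N"
      proof -
        have "\<bar>real N * (u (j N i) - t i)\<bar> < 1" using jN[OF that] N by (simp add: u_def right_diff_distrib)
        then show ?thesis using N by (simp add: abs_mult pos_less_divide_eq mult.commute)
      qed
      then show "\<bar>u (j N i) - t i\<bar> < \<xi>" using N by linarith
    qed
    define D where "D = (\<lambda>k. \<gamma> (u (Suc k)) - \<gamma> (u k))"
    have split: "(\<Sum>k<N. F k) = (\<Sum>i<n. \<Sum>k\<in>{j N i..<j N (Suc i)}. F k)" for F :: "nat \<Rightarrow> complex"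
    proof -
      have "m \<le> n \<Longrightarrow> (\<Sum>k<j N m. F k) = (\<Sum>i<m. \<Sum>k\<in>{j N i..<j N (Suc i)}. F k)" for m
      proof (induction m)
        case 0 then show ?case by (simp add: j0)
      next
        case (Suc m)
        have "(\<Sum>k<j N (Suc m). F k) = (\<Sum>k<j N m. F k) + (\<Sum>k\<in>{j N m..<j N (Suc m)}. F k)"
          using jmono[of m] Suc.prems
          by (simp add: sum.atLeastLessThan_concat lessThan_atLeast0)
        then show ?case using Suc by simp
      qed
      from this[of n] show ?thesis by (simp add: j0)
    qed
    have splitr: "(\<Sum>k<N. F k) = (\<Sum>i<n. \<Sum>k\<in>{j N i..<j N (Suc i)}. F k)" for F :: "nat \<Rightarrow> real"
      using split[of "\<lambda>k. complex_of_real (F k)"] by (simp flip: of_real_sum)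
    have tel: "(\<Sum>k\<in>{j N i..<j N (Suc i)}. D k) = \<gamma> (u (j N (Suc i))) - \<gamma> (u (j N i))" if "i < n" for i
      unfolding D_def using sum_Suc_diff'[OF jmono[OF that], of "\<lambda>k. \<gamma> (u k)"] by simp
    have "cmod ((\<Sum>i<n. g (\<gamma> (s i)) * (\<gamma> (t (Suc i)) - \<gamma> (t i))) -
        (\<Sum>i<n. g (\<gamma> (s i)) * (\<Sum>k\<in>{j N i..<j N (Suc i)}. D k))) \<le> (\<Sum>i<n. M * (2 * \<eta>))"
      unfolding sum_subtractf[symmetric]
    proof (rule sum_norm_le)
      fix i assume "i \<in> {..<n}"
      then have i: "i < n" by simp
      have "cmod (g (\<gamma> (s i)) * (\<gamma> (t (Suc i)) - \<gamma> (t i)) - g (\<gamma> (s i)) * (\<Sum>k\<in>{j N i..<j N (Suc i)}. D k))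
         = cmod (g (\<gamma> (s i))) * cmod ((\<gamma> (u (j N i)) - \<gamma> (t i)) - (\<gamma> (u (j N (Suc i))) - \<gamma> (t (Suc i))))"
        unfolding tel[OF i] by (simp flip: norm_mult add: algebra_simps)
      also have "\<dots> \<le> M * (\<eta> + \<eta>)"
        using close[of i] close[of "Suc i"] i M s01[OF i]
        by (intro mult_mono norm_triangle_le_diff) auto
      finally show "cmod (g (\<gamma> (s i)) * (\<gamma> (t (Suc i)) - \<gamma> (t i)) -
          g (\<gamma> (s i)) * (\<Sum>k\<in>{j N i..<j N (Suc i)}. D k)) \<le> M * (2 * \<eta>)" by simp
    qed
    also have "\<dots> = d * (real n / (real n + 1))" using M(1) by (simp add: \<eta>_def)
    also have "\<dots> \<le> d * 1" using \<open>0 < d\<close> by (intro mult_left_mono) auto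
    also have "\<dots> = d" by simp
    finally have 1: "cmod ((\<Sum>i<n. g (\<gamma> (s i)) * (\<gamma> (t (Suc i)) - \<gamma> (t i))) -
        (\<Sum>i<n. g (\<gamma> (s i)) * (\<Sum>k\<in>{j N i..<j N (Suc i)}. D k))) \<le> d" .
    have "rs_sum g \<gamma> N = (\<Sum>i<n. \<Sum>k\<in>{j N i..<j N (Suc i)}. g (\<gamma> (u k)) * D k)"
      unfolding rs_sum_def split[symmetric] by (simp add: D_def u_def)
    then have "(\<Sum>i<n. g (\<gamma> (s i)) * (\<Sum>k\<in>{j N i..<j N (Suc i)}. D k)) - rs_sum g \<gamma> N
       = (\<Sum>i<n. \<Sum>k\<in>{j N i..<j N (Suc i)}. (g (\<gamma> (s i)) - g (\<gamma> (u k))) * D k)"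
      unfolding left_diff_distrib sum_subtractf sum_distrib_left by simp
    then have "cmod ((\<Sum>i<n. g (\<gamma> (s i)) * (\<Sum>k\<in>{j N i..<j N (Suc i)}. D k)) - rs_sum g \<gamma> N)
       = cmod (\<Sum>i<n. \<Sum>k\<in>{j N i..<j N (Suc i)}. (g (\<gamma> (s i)) - g (\<gamma> (u k))) * D k)"
      by (rule arg_cong)
    also have "\<dots> \<le> (\<Sum>i<n. \<Sum>k\<in>{j N i..<j N (Suc i)}. e * cmod (D k))"
    proof (intro sum_norm_le)
      fix i k assume ik: "i \<in> {..<n}" "k \<in> {j N i..<j N (Suc i)}"
      then have i: "i < n" by simp
      have k1: "real N * t i \<le> real k" using jN(1)[of i] i ik by auto
      have k2: "real k < real N * t (Suc i)"
      proof -
        have "real k + 1 \<le> real (j N (Suc i))" using ik by auto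
        then show ?thesis using jN(2)[of "Suc i"] i by linarith
      qed
      have k01: "u k \<in> {0..1}" using ik jle[of "Suc i"] N i by (auto simp: u_def)
      have "t i \<le> u k" "u k < t (Suc i)" using k1 k2 N by (simp_all add: u_def field_simps)
      moreover have "t i \<le> s i" "s i \<le> t (Suc i)" "t (Suc i) - t i < \<delta>" using part i by auto
      ultimately have "\<bar>s i - u k\<bar> < \<delta>" by linarith
      then have "cmod (g (\<gamma> (s i)) - g (\<gamma> (u k))) \<le> e" using \<delta> s01 k01 i by blast
      then show "cmod ((g (\<gamma> (s i)) - g (\<gamma> (u k))) * D k) \<le> e * cmod (D k)"
        by (simp add: norm_mult mult_right_mono)
    qed
    also have "\<dots> = e * (\<Sum>k<N. cmod (D k))"
      unfolding splitr by (simp add: sum_distrib_left)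
    also have "\<dots> \<le> e * V"
      using variation_bound_uniform[OF V N(1)] \<open>0 \<le> e\<close>
      by (intro mult_left_mono) (auto simp: D_def u_def)
    finally have 2: "cmod ((\<Sum>i<n. g (\<gamma> (s i)) * (\<Sum>k\<in>{j N i..<j N (Suc i)}. D k)) - rs_sum g \<gamma> N) \<le> e * V" .
    show "cmod ((\<Sum>i<n. g (\<gamma> (s i)) * (\<gamma> (t (Suc i)) - \<gamma> (t i))) - rs_sum g \<gamma> N) \<le> e * V + d"
      using norm_diff_triangle_le[OF 1 2] add.commute[of d "e * V"] by metis
  qed
qed

lemma rs_has_integral_rs_sum:
  assumes "rs_has_integral g \<gamma> I"
  shows "rs_sum g \<gamma> \<longlonglongrightarrow> I"
proof (rule LIMSEQ_I)
  fix r :: real assume "r > 0"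
  then obtain \<delta> where \<delta>: "\<delta> > 0" "\<And>n t s. t 0 = 0 \<Longrightarrow> t n = 1 \<Longrightarrow>
        \<forall>i<n. t i < t (Suc i) \<and> t (Suc i) - t i < \<delta> \<and> t i \<le> s i \<and> s i \<le> t (Suc i) \<Longrightarrow>
        cmod ((\<Sum>i<n. g (\<gamma> (s i)) * (\<gamma> (t (Suc i)) - \<gamma> (t i))) - I) < r"
    using assms unfolding rs_has_integral_def by (elim allE[of _ r] impE) blast+
  obtain N0 :: nat where N0: "1 / real N0 < \<delta>" "N0 > 0"
    using \<open>\<delta> > 0\<close> by (metis ex_inverse_of_nat_less inverse_eq_divide)
  show "\<exists>no. \<forall>n\<ge>no. cmod (rs_sum g \<gamma> n - I) < r"
  proof (intro exI allI impI)
    fix N assume "N0 \<le> N"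
    then have N: "N > 0" "1 / real N < \<delta>"
      using N0 le_less_trans[OF frac_le[of 1 1 "real N0" "real N"]] by auto
    show "cmod (rs_sum g \<gamma> N - I) < r"
      unfolding rs_sum_def using N
      by (intro \<delta>(2)[of "\<lambda>j. real j / real N" N "\<lambda>j. real j / real N"])
        (auto simp: divide_simps)
  qed
qed

text \<open>A single fine partition is eventually close to all uniform sums, by
  \<open>rs_sum_compare\<close>; so these form a Cauchy sequence. Passing to the limit in the same
  estimate shows that every fine tagged sum is close to its limit.\<close>

lemma rs_has_integral_continuous:
  assumes \<gamma>: "rectifiable_loop \<gamma>" and g: "continuous_on (path_image \<gamma>) g"
  obtains I where "rs_has_integral g \<gamma> I"
proof -
  have c: "continuous_on {0..1} \<gamma>" using \<gamma> by (simp add: rectifiable_loop_def path_def)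
  have g': "continuous_on (\<gamma> ` {0..1}) g" using g by (simp add: path_image_def)
  obtain V where V: "V > 0" "variation_bound \<gamma> V" using rectifiable_loop_variation_bound[OF \<gamma>] .
  have "continuous_on {0..1} (\<lambda>x. g (\<gamma> x))"
    using continuous_on_compose2[OF g' c] by blast
  then have uc: "uniformly_continuous_on {0..1} (\<lambda>x. g (\<gamma> x))"
    using compact_uniformly_continuous by blast
  have mod: "\<exists>\<delta>>0. \<forall>x\<in>{0..1}. \<forall>y\<in>{0..1}. \<bar>x - y\<bar> < \<delta> \<longrightarrow> cmod (g (\<gamma> x) - g (\<gamma> y)) \<le> e" if "e > 0" for e
    using uc that unfolding uniformly_continuous_on_def dist_norm real_norm_def
    by (meson less_imp_le)
  have key: "\<exists>\<delta>>0. \<forall>n t s. t 0 = 0 \<and> t n = 1 \<and>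
        (\<forall>i<n. t i < t (Suc i) \<and> t (Suc i) - t i < \<delta> \<and> t i \<le> s i \<and> s i \<le> t (Suc i)) \<longrightarrow>
     (\<forall>\<^sub>F N in sequentially. cmod ((\<Sum>i<n. g (\<gamma> (s i)) * (\<gamma> (t (Suc i)) - \<gamma> (t i))) - rs_sum g \<gamma> N) \<le> r)"
    if "r > 0" for r
  proof -
    obtain \<delta> where \<delta>: "\<delta> > 0" "\<forall>x\<in>{0..1}. \<forall>y\<in>{0..1}. \<bar>x - y\<bar> < \<delta> \<longrightarrow> cmod (g (\<gamma> x) - g (\<gamma> y)) \<le> r / (2 * V)"
      using mod[of "r / (2 * V)"] \<open>r > 0\<close> V(1) by auto
    show ?thesis
    proof (intro exI[of _ \<delta>] conjI allI impI \<open>\<delta> > 0\<close>)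
      fix n t s
      assume *: "t 0 = 0 \<and> t n = 1 \<and> (\<forall>i<n. t i < t (Suc i) \<and> t (Suc i) - t i < \<delta> \<and> t i \<le> s i \<and> s i \<le> t (Suc i))"
      have "r / (2 * V) * V + r / 2 = r" using V(1) by simp
      with rs_sum_compare[OF c V(2) g', of t n \<delta> s "r / (2 * V)" "r / 2"] * \<delta> \<open>r > 0\<close> V(1)
      show "\<forall>\<^sub>F N in sequentially. cmod ((\<Sum>i<n. g (\<gamma> (s i)) * (\<gamma> (t (Suc i)) - \<gamma> (t i))) - rs_sum g \<gamma> N) \<le> r"
        by auto
    qed
  qed
  have "Cauchy (rs_sum g \<gamma>)"
  proof (rule metric_CauchyI)
    fix r :: real assume "r > 0"
    from key[of "r / 3"] \<open>r > 0\<close> obtain \<delta> where \<delta>: "\<delta> > 0" "\<And>n t s. t 0 = 0 \<and> t n = 1 \<and>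
        (\<forall>i<n. t i < t (Suc i) \<and> t (Suc i) - t i < \<delta> \<and> t i \<le> s i \<and> s i \<le> t (Suc i)) \<Longrightarrow>
     (\<forall>\<^sub>F N in sequentially. cmod ((\<Sum>i<n. g (\<gamma> (s i)) * (\<gamma> (t (Suc i)) - \<gamma> (t i))) - rs_sum g \<gamma> N) \<le> r / 3)"
      by auto
    obtain N0 :: nat where N0: "1 / real N0 < \<delta>" "N0 > 0"
      using \<open>\<delta> > 0\<close> by (metis ex_inverse_of_nat_less inverse_eq_divide)
    have "\<forall>\<^sub>F N in sequentially. cmod (rs_sum g \<gamma> N0 - rs_sum g \<gamma> N) \<le> r / 3"
      unfolding rs_sum_def[of g \<gamma> N0] using N0
      by (intro \<delta>(2)[of "\<lambda>j. real j / real N0" N0 "\<lambda>j. real j / real N0"])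
        (auto simp: divide_simps)
    then obtain M where M: "\<And>N. N \<ge> M \<Longrightarrow> cmod (rs_sum g \<gamma> N0 - rs_sum g \<gamma> N) \<le> r / 3"
      by (auto simp: eventually_sequentially)
    show "\<exists>M. \<forall>m\<ge>M. \<forall>n\<ge>M. dist (rs_sum g \<gamma> m) (rs_sum g \<gamma> n) < r"
    proof (intro exI[of _ M] allI impI)
      fix m n assume "m \<ge> M" "n \<ge> M"
      then show "dist (rs_sum g \<gamma> m) (rs_sum g \<gamma> n) < r"
        using M[of m] M[of n] \<open>r > 0\<close>
          norm_triangle_ineq4[of "rs_sum g \<gamma> N0 - rs_sum g \<gamma> n" "rs_sum g \<gamma> N0 - rs_sum g \<gamma> m"]
        unfolding dist_norm by (simp add: algebra_simps)
    qed
  qed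
  then obtain I where I: "rs_sum g \<gamma> \<longlonglongrightarrow> I"
    using Cauchy_convergent convergent_def by blast
  have "rs_has_integral g \<gamma> I"
    unfolding rs_has_integral_def
  proof (intro allI impI)
    fix r :: real assume "r > 0"
    from key[of "r / 2"] \<open>r > 0\<close> obtain \<delta> where \<delta>: "\<delta> > 0" "\<And>n t s. t 0 = 0 \<and> t n = 1 \<and>
        (\<forall>i<n. t i < t (Suc i) \<and> t (Suc i) - t i < \<delta> \<and> t i \<le> s i \<and> s i \<le> t (Suc i)) \<Longrightarrow>
     (\<forall>\<^sub>F N in sequentially. cmod ((\<Sum>i<n. g (\<gamma> (s i)) * (\<gamma> (t (Suc i)) - \<gamma> (t i))) - rs_sum g \<gamma> N) \<le> r / 2)"
      by auto
    show "\<exists>\<delta>>0. \<forall>n t s. t 0 = 0 \<and> t n = 1 \<and>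
        (\<forall>i<n. t i < t (Suc i) \<and> t (Suc i) - t i < \<delta> \<and> t i \<le> s i \<and> s i \<le> t (Suc i)) \<longrightarrow>
        cmod ((\<Sum>i<n. g (\<gamma> (s i)) * (\<gamma> (t (Suc i)) - \<gamma> (t i))) - I) < r"
    proof (intro exI[of _ \<delta>] conjI allI impI \<delta>(1))
      fix n t s
      assume "t 0 = 0 \<and> t n = 1 \<and> (\<forall>i<n. t i < t (Suc i) \<and> t (Suc i) - t i < \<delta> \<and> t i \<le> s i \<and> s i \<le> t (Suc i))"
      from \<delta>(2)[OF this]
      have "cmod ((\<Sum>i<n. g (\<gamma> (s i)) * (\<gamma> (t (Suc i)) - \<gamma> (t i))) - I) \<le> r / 2"
        by (rule tendsto_upperbound[rotated]) (auto intro!: tendsto_intros I)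
      then show "cmod ((\<Sum>i<n. g (\<gamma> (s i)) * (\<gamma> (t (Suc i)) - \<gamma> (t i))) - I) < r"
        using \<open>r > 0\<close> by simp
    qed
  qed
  then show ?thesis using that by blast
qed

lemma rs_sum_bound:
  assumes V: "variation_bound \<gamma> V" and "N > 0" and g: "\<And>w. w \<in> path_image \<gamma> \<Longrightarrow> cmod (g w) \<le> M" and "0 \<le> M"
  shows "cmod (rs_sum g \<gamma> N) \<le> M * V"
proof -
  have "cmod (rs_sum g \<gamma> N) \<le> (\<Sum>j<N. M * cmod (\<gamma> (real (Suc j) / real N) - \<gamma> (real j / real N)))"
    unfolding rs_sum_def
  proof (rule sum_norm_le)
    fix j assume "j \<in> {..<N}"
    then have "\<gamma> (real j / real N) \<in> path_image \<gamma>" by (auto simp: path_image_def)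
    then show "cmod (g (\<gamma> (real j / real N)) * (\<gamma> (real (Suc j) / real N) - \<gamma> (real j / real N)))
      \<le> M * cmod (\<gamma> (real (Suc j) / real N) - \<gamma> (real j / real N))"
      unfolding norm_mult by (intro mult_right_mono g) auto
  qed
  also have "\<dots> \<le> M * V"
    using variation_bound_uniform[OF V \<open>N > 0\<close>] \<open>0 \<le> M\<close>
    unfolding sum_distrib_left[symmetric] by (intro mult_left_mono)
  finally show ?thesis .
qed

lemma rs_sum_add: "rs_sum (\<lambda>w. f w + g w) \<gamma> N = rs_sum f \<gamma> N + rs_sum g \<gamma> N"
  by (simp only: rs_sum_def distrib_right sum.distrib)

lemma rs_sum_cmult: "rs_sum (\<lambda>w. c * f w) \<gamma> N = c * rs_sum f \<gamma> N"
  by (simp add: rs_sum_def sum_distrib_left algebra_simps)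

lemma rs_sum_diff: "rs_sum (\<lambda>w. f w - g w) \<gamma> N = rs_sum f \<gamma> N - rs_sum g \<gamma> N"
  by (simp only: rs_sum_def left_diff_distrib sum_subtractf)

lemma uniform_nodes_close:
  assumes "continuous_on {0..1} (q :: real \<Rightarrow> complex)" "e > 0"
  shows "\<forall>\<^sub>F N in sequentially. N > 0 \<and> (\<forall>j<N. cmod (q (real (Suc j) / real N) - q (real j / real N)) < e)"
proof -
  have "uniformly_continuous_on {0..1} q"
    using assms(1) compact_uniformly_continuous by blast
  then obtain \<xi> where \<xi>: "\<xi> > 0"
    "\<And>x y. \<lbrakk>x \<in> {0..1}; y \<in> {0..1}; \<bar>x - y\<bar> < \<xi>\<rbrakk> \<Longrightarrow> cmod (q x - q y) < e"
    using assms(2) unfolding uniformly_continuous_on_def dist_norm real_norm_def by metis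
  obtain N0 :: nat where N0: "1 / real N0 < \<xi>" "N0 > 0"
    using \<open>\<xi> > 0\<close> by (metis ex_inverse_of_nat_less inverse_eq_divide)
  show ?thesis
  proof (rule eventually_sequentiallyI)
    fix N assume "N0 \<le> N"
    then have N: "N > 0" "1 / real N < \<xi>"
      using N0 le_less_trans[OF frac_le[of 1 1 "real N0" "real N"]] by auto
    have "cmod (q (real (Suc j) / real N) - q (real j / real N)) < e" if "j < N" for j
    proof (rule \<xi>(2))
      have "real (Suc j) / real N - real j / real N = 1 / real N"
        by (simp add: diff_divide_distrib[symmetric])
      then show "\<bar>real (Suc j) / real N - real j / real N\<bar> < \<xi>" using N by simp
    qed (use that N in auto)
    then show "N > 0 \<and> (\<forall>j<N. cmod (q (real (Suc j) / real N) - q (real j / real N)) < e)"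
      using N by blast
  qed
qed

text \<open>The increments of a primitive \<open>q\<close> telescope, so it is enough that each
  term of the sum is close to such an increment.\<close>
lemma rs_sum_tendsto_telescope:
  assumes V: "\<And>N. N > 0 \<Longrightarrow> (\<Sum>j<N. D N j) \<le> V"
    and close: "\<And>e. e > 0 \<Longrightarrow> \<forall>\<^sub>F N in sequentially. N > 0 \<and> (\<forall>j<N.
      cmod (g (\<gamma> (real j / real N)) * (\<gamma> (real (Suc j) / real N) - \<gamma> (real j / real N))
         - (q (real (Suc j) / real N) - q (real j / real N))) \<le> e * D N j)"
  shows "rs_sum g \<gamma> \<longlonglongrightarrow> q 1 - q 0"
proof (rule tendstoI)
  fix r :: real assume "r > 0"
  define e where "e = r / (\<bar>V\<bar> + 1)"
  have e: "e > 0" "e * V < r"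
  proof -
    show "e > 0" using \<open>r > 0\<close> by (simp add: e_def)
    then have "e * V < e * (\<bar>V\<bar> + 1)" by (intro mult_strict_left_mono) auto
    then show "e * V < r" by (simp add: e_def)
  qed
  from close[OF e(1)]
  show "\<forall>\<^sub>F N in sequentially. dist (rs_sum g \<gamma> N) (q 1 - q 0) < r"
  proof eventually_elim
    fix N assume N: "N > 0 \<and> (\<forall>j<N.
      cmod (g (\<gamma> (real j / real N)) * (\<gamma> (real (Suc j) / real N) - \<gamma> (real j / real N))
         - (q (real (Suc j) / real N) - q (real j / real N))) \<le> e * D N j)"
    have tel: "(\<Sum>j<N. q (real (Suc j) / real N) - q (real j / real N)) = q 1 - q 0"
      using sum_lessThan_telescope[of "\<lambda>j. q (real j / real N)" N] N by simp
    have "dist (rs_sum g \<gamma> N) (q 1 - q 0) =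
       cmod (\<Sum>j<N. g (\<gamma> (real j / real N)) * (\<gamma> (real (Suc j) / real N) - \<gamma> (real j / real N))
         - (q (real (Suc j) / real N) - q (real j / real N)))"
      unfolding tel[symmetric] rs_sum_def dist_norm by (subst (2) sum_subtractf) (rule refl)
    also have "\<dots> \<le> (\<Sum>j<N. e * D N j)"
      by (rule sum_norm_le) (use N in auto)
    also have "\<dots> \<le> e * V"
      using V[of N] N e
      unfolding sum_distrib_left[symmetric] by (intro mult_left_mono) auto
    also have "\<dots> < r" by (rule e)
    finally show "dist (rs_sum g \<gamma> N) (q 1 - q 0) < r" .
  qed
qed

text \<open>With a continuous logarithm \<open>q\<close> of \<gamma> - z, the relative increment of
  \<gamma> on a step is exp(d) - 1, where d is the increment of \<open>q\<close>. It equals d up to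
  a quadratic error, and the increments of \<open>q\<close> add up to 2 pi i times the winding
  number. No differentiability of \<gamma> enters.\<close>

lemma rs_sum_winding_number:
  assumes \<gamma>: "rectifiable_loop \<gamma>" and z: "z \<notin> path_image \<gamma>"
  shows "rs_sum (\<lambda>w. 1 / (w - z)) \<gamma> \<longlonglongrightarrow> 2 * of_real pi * \<i> * winding_number \<gamma> z"
proof -
  have p: "path \<gamma>" using \<gamma> by (simp add: rectifiable_loop_def)
  obtain V where V: "V > 0" "variation_bound \<gamma> V" using rectifiable_loop_variation_bound[OF \<gamma>] .
  obtain q where q: "path q" "pathfinish q - pathstart q = 2 * of_real pi * \<i> * winding_number \<gamma> z"
     "\<And>t. t \<in> {0..1} \<Longrightarrow> \<gamma> t = z + exp (q t)"
    using winding_number_as_continuous_log[OF p z] by metis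
  obtain m where m: "m > 0" "\<And>t. t \<in> {0..1} \<Longrightarrow> m \<le> cmod (\<gamma> t - z)"
  proof -
    have "closed (path_image \<gamma>)" using p by (simp add: closed_path_image)
    from separate_point_closed[OF this z] obtain m where m: "m > 0" "\<And>x. x \<in> path_image \<gamma> \<Longrightarrow> m \<le> dist z x"
      by blast
    have "m \<le> cmod (\<gamma> t - z)" if "t \<in> {0..1}" for t
      using m(2)[of "\<gamma> t"] that by (simp add: path_image_def dist_norm norm_minus_commute)
    then show ?thesis using that[OF m(1)] by blast
  qed
  have "rs_sum (\<lambda>w. 1 / (w - z)) \<gamma> \<longlonglongrightarrow> q 1 - q 0"
  proof (rule rs_sum_tendsto_telescope[OF variation_bound_uniform[OF V(2)]])
    fix e :: real assume "e > 0"
    \<comment> \<open>The bound 1/4 keeps exp(|d|) below 2 and makes the quadratic error at most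
      half of |d|; the other bound yields 4 e' / m \<le> e in the final estimate.\<close>
    define e' where "e' = min (1/4) (e * m / 8)"
    have e': "e' > 0" "e' \<le> 1/4" "8 * e' \<le> e * m" using \<open>e > 0\<close> m(1) by (auto simp: e'_def)
    have "continuous_on {0..1} q" using q(1) by (simp add: path_def)
    from uniform_nodes_close[OF this e'(1)]
    show "\<forall>\<^sub>F N in sequentially. N > 0 \<and> (\<forall>j<N.
      cmod (1 / (\<gamma> (real j / real N) - z) * (\<gamma> (real (Suc j) / real N) - \<gamma> (real j / real N))
         - (q (real (Suc j) / real N) - q (real j / real N)))
       \<le> e * cmod (\<gamma> (real (Suc j) / real N) - \<gamma> (real j / real N)))"
    proof eventually_elim
      fix N assume N: "N > 0 \<and> (\<forall>j<N. cmod (q (real (Suc j) / real N) - q (real j / real N)) < e')"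
      show "N > 0 \<and> (\<forall>j<N.
        cmod (1 / (\<gamma> (real j / real N) - z) * (\<gamma> (real (Suc j) / real N) - \<gamma> (real j / real N))
         - (q (real (Suc j) / real N) - q (real j / real N)))
         \<le> e * cmod (\<gamma> (real (Suc j) / real N) - \<gamma> (real j / real N)))"
      proof (intro conjI allI impI)
        fix j assume "j < N"
        define a b where "a = real j / real N" and "b = real (Suc j) / real N"
        have ab: "a \<in> {0..1}" "b \<in> {0..1}" using \<open>j < N\<close> by (auto simp: a_def b_def)
        define d where "d = q b - q a"
        have d: "cmod d < e'" using N \<open>j < N\<close> by (simp add: d_def a_def b_def)
        have quot: "(\<gamma> b - \<gamma> a) / (\<gamma> a - z) = exp d - 1"
          using q(3)[OF ab(1)] q(3)[OF ab(2)] by (simp add: d_def exp_diff diff_divide_distrib)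
        have "cmod (exp d - 1 - d) \<le> exp (cmod d) * (cmod d)\<^sup>2"
          using Taylor_exp_field[of d 1] by (simp add: numeral_2_eq_2 algebra_simps)
        also have "\<dots> \<le> 2 * (cmod d)\<^sup>2"
        proof -
          have "exp (cmod d) \<le> 1 + cmod d + (cmod d)\<^sup>2" using d e' by (intro exp_bound) auto
          also have "\<dots> \<le> 1 + 1/4 + (1/4)\<^sup>2" using d e' by (intro add_mono power_mono) auto
          finally show ?thesis by (intro mult_right_mono) (auto simp: power2_eq_square)
        qed
        finally have 1: "cmod (exp d - 1 - d) \<le> 2 * (cmod d)\<^sup>2" .
        also have "\<dots> \<le> 2 * e' * cmod d" using d by (simp add: power2_eq_square mult_right_mono)
        finally have 2: "cmod (exp d - 1 - d) \<le> 2 * e' * cmod d" .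
        also have "\<dots> \<le> 1/2 * cmod d" using e' by (intro mult_right_mono) auto
        \<comment> \<open>Bounded variation is known for \<gamma> but not for \<open>q\<close>, so
          |d| has to be estimated back by the increment of \<gamma> before summing.\<close>
        finally have "cmod d \<le> 2 * cmod (exp d - 1)"
          using norm_triangle_ineq4[of "exp d - 1" "exp d - 1 - d"] by simp
        then have "2 * e' * cmod d \<le> 2 * e' * (2 * cmod (exp d - 1))"
          using e' by (intro mult_left_mono) auto
        also have "cmod (exp d - 1) \<le> cmod (\<gamma> b - \<gamma> a) / m"
          unfolding quot[symmetric] norm_divide using m ab by (intro divide_left_mono mult_pos_pos less_le_trans[OF m(1) m(2)]) auto
        then have "2 * e' * (2 * cmod (exp d - 1)) \<le> 2 * e' * (2 * (cmod (\<gamma> b - \<gamma> a) / m))"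
          using e' by (intro mult_left_mono) auto
        also have "\<dots> = (4 * e' / m) * cmod (\<gamma> b - \<gamma> a)" by simp
        also have "\<dots> \<le> e * cmod (\<gamma> b - \<gamma> a)"
          using e' m(1) by (intro mult_right_mono) (auto simp: pos_divide_le_eq)
        finally have "2 * e' * cmod d \<le> e * cmod (\<gamma> b - \<gamma> a)" .
        with 2 have "cmod ((\<gamma> b - \<gamma> a) / (\<gamma> a - z) - (q b - q a)) \<le> e * cmod (\<gamma> b - \<gamma> a)"
          unfolding quot d_def[symmetric] by simp
        then show "cmod (1 / (\<gamma> (real j / real N) - z) * (\<gamma> (real (Suc j) / real N) - \<gamma> (real j / real N))
         - (q (real (Suc j) / real N) - q (real j / real N)))
         \<le> e * cmod (\<gamma> (real (Suc j) / real N) - \<gamma> (real j / real N))"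
          unfolding a_def b_def by simp
      qed (use N in auto)
    qed
  qed
  then show ?thesis using q(2) by (simp add: pathfinish_def pathstart_def)
qed

text \<open>The primitive w^(k+1) / (k+1) takes the same value at both ends of a closed curve. On a
  short step its increment differs from the term of the sum by a small multiple of the
  chord.\<close>

lemma rs_sum_power:
  assumes \<gamma>: "rectifiable_loop \<gamma>"
  shows "rs_sum (\<lambda>w. w ^ k) \<gamma> \<longlonglongrightarrow> 0"
proof -
  have p: "path \<gamma>" and cl: "\<gamma> 1 = \<gamma> 0"
    using \<gamma> by (simp_all add: rectifiable_loop_def pathfinish_def pathstart_def)
  obtain V where V: "V > 0" "variation_bound \<gamma> V" using rectifiable_loop_variation_bound[OF \<gamma>] .
  obtain R where R: "\<And>w. w \<in> path_image \<gamma> \<Longrightarrow> cmod w \<le> R"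
    using bounded_path_image[OF p] unfolding bounded_iff by blast
  define q where "q = (\<lambda>t. \<gamma> t ^ Suc k / of_nat (Suc k))"
  have "rs_sum (\<lambda>w. w ^ k) \<gamma> \<longlonglongrightarrow> q 1 - q 0"
  proof (rule rs_sum_tendsto_telescope[OF variation_bound_uniform[OF V(2)]])
    fix e :: real assume "e > 0"
    have "uniformly_continuous_on (cball 0 R) (\<lambda>w::complex. w ^ k)"
      by (intro compact_uniformly_continuous continuous_intros) auto
    then obtain \<xi> where \<xi>: "\<xi> > 0"
      "\<And>x y::complex. \<lbrakk>x \<in> cball 0 R; y \<in> cball 0 R; cmod (x - y) < \<xi>\<rbrakk> \<Longrightarrow> cmod (x^k - y^k) < e"
      using \<open>e > 0\<close> unfolding uniformly_continuous_on_def dist_norm by metis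
    have "continuous_on {0..1} \<gamma>" using p by (simp add: path_def)
    from uniform_nodes_close[OF this \<xi>(1)]
    show "\<forall>\<^sub>F N in sequentially. N > 0 \<and> (\<forall>j<N.
      cmod (\<gamma> (real j / real N) ^ k * (\<gamma> (real (Suc j) / real N) - \<gamma> (real j / real N))
         - (q (real (Suc j) / real N) - q (real j / real N)))
       \<le> e * cmod (\<gamma> (real (Suc j) / real N) - \<gamma> (real j / real N)))"
    proof eventually_elim
      fix N assume N: "N > 0 \<and> (\<forall>j<N. cmod (\<gamma> (real (Suc j) / real N) - \<gamma> (real j / real N)) < \<xi>)"
      show "N > 0 \<and> (\<forall>j<N.
        cmod (\<gamma> (real j / real N) ^ k * (\<gamma> (real (Suc j) / real N) - \<gamma> (real j / real N))
         - (q (real (Suc j) / real N) - q (real j / real N)))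
         \<le> e * cmod (\<gamma> (real (Suc j) / real N) - \<gamma> (real j / real N)))"
      proof (intro conjI allI impI)
        fix j assume "j < N"
        define a b where "a = \<gamma> (real j / real N)" and "b = \<gamma> (real (Suc j) / real N)"
        have ab: "a \<in> cball 0 R" "b \<in> cball 0 R" "cmod (b - a) < \<xi>"
          using N \<open>j < N\<close> R by (auto simp: a_def b_def path_image_def)
        \<comment> \<open>The derivative of \<open>F\<close> is a^k - w^k, small along the segment,
          so the mean value inequality bounds the error of one step.\<close>
        define F where "F = (\<lambda>w. a ^ k * w - w ^ Suc k / of_nat (Suc k))"
        have "cmod (F b - F a) \<le> e * cmod (b - a)"
        proof (rule field_differentiable_bound[where S = "closed_segment a b"])
          fix w assume w: "w \<in> closed_segment a b"
          show "(F has_field_derivative (a ^ k - w ^ k)) (at w within closed_segment a b)"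
          proof -
            have "((\<lambda>w. w ^ Suc k) has_field_derivative of_nat (Suc k) * w ^ k) (at w within closed_segment a b)"
              by (rule DERIV_cong[OF DERIV_power_Suc[OF DERIV_ident]]) simp
            from DERIV_cdivide[OF this, of "of_nat (Suc k)"]
            have "((\<lambda>w. w ^ Suc k / of_nat (Suc k)) has_field_derivative w ^ k) (at w within closed_segment a b)"
              by (simp only: nonzero_mult_div_cancel_left of_nat_eq_0_iff nat.distinct(2) not_False_eq_True)
            from DERIV_diff[OF DERIV_cmult_Id[of "a ^ k"] this]
            show ?thesis unfolding F_def .
          qed
          have "w \<in> cball 0 R"
            using w ab closed_segment_subset[OF ab(1,2) convex_cball] by blast
          moreover have "cmod (a - w) < \<xi>"
            using segment_bound1[OF w] ab by (simp add: norm_minus_commute)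
          ultimately show "cmod (a ^ k - w ^ k) \<le> e" using \<xi>(2) ab by (simp add: less_imp_le)
        qed auto
        moreover have "F b - F a = a ^ k * (b - a) - (b ^ Suc k / of_nat (Suc k) - a ^ Suc k / of_nat (Suc k))"
          by (simp add: F_def right_diff_distrib)
        ultimately show "cmod (\<gamma> (real j / real N) ^ k * (\<gamma> (real (Suc j) / real N) - \<gamma> (real j / real N))
         - (q (real (Suc j) / real N) - q (real j / real N)))
         \<le> e * cmod (\<gamma> (real (Suc j) / real N) - \<gamma> (real j / real N))"
          by (simp only: a_def b_def q_def)
      qed (use N in auto)
    qed
  qed
  then show ?thesis by (simp add: q_def cl)
qed

section \<open>Uniqueness of boundary integrals\<close>

definition cycle_sum :: "(complex \<Rightarrow> complex) \<Rightarrow> (real \<Rightarrow> complex) list \<Rightarrow> nat \<Rightarrow> complex" where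
  "cycle_sum g \<Gamma> N = (\<Sum>\<gamma>\<leftarrow>\<Gamma>. rs_sum g \<gamma> N)"

lemma cycle_has_integral_cycle_sum:
  assumes "cycle_has_integral g \<Gamma> I"
  shows "cycle_sum g \<Gamma> \<longlonglongrightarrow> I"
proof -
  obtain Is where Is: "length Is = length \<Gamma>" "\<forall>k<length \<Gamma>. rs_has_integral g (\<Gamma>!k) (Is!k)" "I = sum_list Is"
    using assms unfolding cycle_has_integral_def by blast
  have "list_all2 (\<lambda>I \<gamma>. rs_has_integral g \<gamma> I) Is \<Gamma>"
    using Is by (simp add: list_all2_conv_all_nth)
  then have "cycle_sum g \<Gamma> \<longlonglongrightarrow> sum_list Is"
    unfolding cycle_sum_def
    by (induction rule: list_all2_induct) (auto intro!: tendsto_intros rs_has_integral_rs_sum)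
  then show ?thesis using Is by simp
qed

lemma cycle_has_integral_continuous:
  assumes "\<And>\<gamma>. \<gamma> \<in> set \<Gamma> \<Longrightarrow> rectifiable_loop \<gamma>" "\<And>\<gamma>. \<gamma> \<in> set \<Gamma> \<Longrightarrow> continuous_on (path_image \<gamma>) g"
  obtains I where "cycle_has_integral g \<Gamma> I"
proof -
  have "\<exists>I. rs_has_integral g \<gamma> I" if "\<gamma> \<in> set \<Gamma>" for \<gamma>
    using rs_has_integral_continuous[OF assms(1)[OF that] assms(2)[OF that]] by blast
  then obtain J where J: "\<And>\<gamma>. \<gamma> \<in> set \<Gamma> \<Longrightarrow> rs_has_integral g \<gamma> (J \<gamma>)" by metis
  have "cycle_has_integral g \<Gamma> (sum_list (map J \<Gamma>))"
    unfolding cycle_has_integral_def by (intro exI[of _ "map J \<Gamma>"]) (auto intro: J)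
  then show ?thesis using that by blast
qed

lemma cycle_sum_winding_number:
  assumes "\<And>\<gamma>. \<gamma> \<in> set \<Gamma> \<Longrightarrow> rectifiable_loop \<gamma>" "\<And>\<gamma>. \<gamma> \<in> set \<Gamma> \<Longrightarrow> z \<notin> path_image \<gamma>"
  shows "cycle_sum (\<lambda>w. 1 / (w - z)) \<Gamma> \<longlonglongrightarrow> 2 * of_real pi * \<i> * (\<Sum>\<gamma>\<leftarrow>\<Gamma>. winding_number \<gamma> z)"
  using assms unfolding cycle_sum_def
proof (induction \<Gamma>)
  case (Cons \<gamma> \<Gamma>)
  have "(\<lambda>N. rs_sum (\<lambda>w. 1 / (w - z)) \<gamma> N + (\<Sum>\<gamma>\<leftarrow>\<Gamma>. rs_sum (\<lambda>w. 1 / (w - z)) \<gamma> N)) \<longlonglongrightarrow>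
     2 * of_real pi * \<i> * winding_number \<gamma> z + 2 * of_real pi * \<i> * (\<Sum>\<gamma>\<leftarrow>\<Gamma>. winding_number \<gamma> z)"
    using Cons by (intro tendsto_add rs_sum_winding_number) auto
  then show ?case by (simp add: distrib_left)
qed simp

lemma cycle_sum_power:
  assumes "\<And>\<gamma>. \<gamma> \<in> set \<Gamma> \<Longrightarrow> rectifiable_loop \<gamma>"
  shows "cycle_sum (\<lambda>w. w ^ k) \<Gamma> \<longlonglongrightarrow> 0"
  using assms unfolding cycle_sum_def
proof (induction \<Gamma>)
  case (Cons \<gamma> \<Gamma>)
  have "(\<lambda>N. rs_sum (\<lambda>w. w ^ k) \<gamma> N + (\<Sum>\<gamma>\<leftarrow>\<Gamma>. rs_sum (\<lambda>w. w ^ k) \<gamma> N)) \<longlonglongrightarrow> 0 + 0"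
    using Cons by (intro tendsto_add rs_sum_power) auto
  then show ?case by simp
qed simp

lemma cycle_sum_add: "cycle_sum (\<lambda>w. f w + g w) \<Gamma> N = cycle_sum f \<Gamma> N + cycle_sum g \<Gamma> N"
  by (simp add: cycle_sum_def rs_sum_add sum_list_addf)

lemma cycle_sum_diff: "cycle_sum (\<lambda>w. f w - g w) \<Gamma> N = cycle_sum f \<Gamma> N - cycle_sum g \<Gamma> N"
  by (simp add: cycle_sum_def rs_sum_diff sum_list_subtractf)

lemma cycle_sum_cmult: "cycle_sum (\<lambda>w. c * f w) \<Gamma> N = c * cycle_sum f \<Gamma> N"
  by (simp add: cycle_sum_def rs_sum_cmult sum_list_const_mult)

lemma rs_sum_cong: "(\<And>w. w \<in> path_image \<gamma> \<Longrightarrow> f w = g w) \<Longrightarrow> rs_sum f \<gamma> N = rs_sum g \<gamma> N"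
  unfolding rs_sum_def by (intro sum.cong refl arg_cong2[where f = "(*)"]) (auto simp: path_image_def)

lemma cycle_sum_cong:
  assumes "\<And>\<gamma> w. \<gamma> \<in> set \<Gamma> \<Longrightarrow> w \<in> path_image \<gamma> \<Longrightarrow> f w = g w"
  shows "cycle_sum f \<Gamma> N = cycle_sum g \<Gamma> N"
  unfolding cycle_sum_def using assms
  by (intro arg_cong[of _ _ sum_list] map_cong refl rs_sum_cong) auto

text \<open>The constant \<open>W\<close> is independent of N and of the integrand, so the sums are
  equicontinuous for the uniform norm on the curves. This is what density arguments require.\<close>

lemma cycle_sum_bound:
  assumes "\<And>\<gamma>. \<gamma> \<in> set \<Gamma> \<Longrightarrow> rectifiable_loop \<gamma>"
  obtains W where "W > 0" "\<And>g M N. \<lbrakk>\<And>\<gamma> w. \<gamma> \<in> set \<Gamma> \<Longrightarrow> w \<in> path_image \<gamma> \<Longrightarrow> cmod (g w) \<le> M; 0 \<le> M\<rbrakk> \<Longrightarrow>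
     cmod (cycle_sum g \<Gamma> N) \<le> M * W"
proof -
  have "\<exists>W>0. \<forall>g M N. (\<forall>\<gamma>\<in>set \<Gamma>. \<forall>w\<in>path_image \<gamma>. cmod (g w) \<le> M) \<and> 0 \<le> M \<longrightarrow>
     cmod (cycle_sum g \<Gamma> N) \<le> M * W"
    using assms
  proof (induction \<Gamma>)
    case Nil
    then show ?case by (auto simp: cycle_sum_def intro!: exI[of _ 1])
  next
    case (Cons \<gamma> \<Gamma>)
    then have "\<exists>W>0. \<forall>g M N. (\<forall>\<gamma>\<in>set \<Gamma>. \<forall>w\<in>path_image \<gamma>. cmod (g w) \<le> M) \<and> 0 \<le> M \<longrightarrow>
      cmod (cycle_sum g \<Gamma> N) \<le> M * W" by (meson list.set_intros(2))
    then obtain W where W: "W > 0" "\<And>g M N. (\<forall>\<gamma>\<in>set \<Gamma>. \<forall>w\<in>path_image \<gamma>. cmod (g w) \<le> M) \<and> 0 \<le> M \<Longrightarrow>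
      cmod (cycle_sum g \<Gamma> N) \<le> M * W" by blast
    obtain V where V: "V > 0" "variation_bound \<gamma> V"
      using rectifiable_loop_variation_bound[OF Cons.prems[OF list.set_intros(1)]] .
    show ?case
    proof (intro exI[of _ "V + W"] conjI allI impI)
      fix g M N
      assume *: "(\<forall>\<gamma>\<in>set (\<gamma> # \<Gamma>). \<forall>w\<in>path_image \<gamma>. cmod (g w) \<le> M) \<and> 0 \<le> M"
      have "cmod (rs_sum g \<gamma> N) \<le> M * V"
      proof (cases "N = 0")
        case True then show ?thesis using * V by (simp add: rs_sum_def)
      next
        case False then show ?thesis using * by (intro rs_sum_bound[OF V(2)]) auto
      qed
      moreover have "cmod (cycle_sum g \<Gamma> N) \<le> M * W" using * by (intro W(2)) auto
      ultimately show "cmod (cycle_sum g (\<gamma> # \<Gamma>) N) \<le> M * (V + W)"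
        using norm_triangle_ineq[of "rs_sum g \<gamma> N" "cycle_sum g \<Gamma> N"]
        by (simp add: cycle_sum_def distrib_left)
    qed (use V W in auto)
  qed
  then obtain W where W: "W > 0" "\<forall>g M N. (\<forall>\<gamma>\<in>set \<Gamma>. \<forall>w\<in>path_image \<gamma>. cmod (g w) \<le> M) \<and> 0 \<le> M \<longrightarrow>
     cmod (cycle_sum g \<Gamma> N) \<le> M * W" by blast
  show ?thesis by (rule that[OF W(1)]) (use W(2) in blast)
qed

text \<open>Before the limit a boundary integral is a finite sum, so exchanging it with an area
  integral is mere linearity; the limit itself is handled later by dominated convergence.\<close>

lemma rs_sum_integral:
  fixes F :: "'a::euclidean_space \<Rightarrow> complex \<Rightarrow> complex"
  assumes "\<And>\<zeta>. \<zeta> \<in> path_image \<gamma> \<Longrightarrow> integrable lborel (\<lambda>w. F w \<zeta>)"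
  shows "integrable lborel (\<lambda>w. rs_sum (F w) \<gamma> N)"
    and "rs_sum (\<lambda>\<zeta>. LINT w|lborel. F w \<zeta>) \<gamma> N = (LINT w|lborel. rs_sum (F w) \<gamma> N)"
proof -
  have i: "integrable lborel (\<lambda>w. F w (\<gamma> (real j / real N)))" if "j < N" for j
    using that by (intro assms) (auto simp: path_image_def)
  show "integrable lborel (\<lambda>w. rs_sum (F w) \<gamma> N)"
    unfolding rs_sum_def using i by (intro Bochner_Integration.integrable_sum integrable_mult_left) auto
  show "rs_sum (\<lambda>\<zeta>. LINT w|lborel. F w \<zeta>) \<gamma> N = (LINT w|lborel. rs_sum (F w) \<gamma> N)"
    unfolding rs_sum_def using i
    by (subst Bochner_Integration.integral_sum) (auto intro!: sum.cong)
qed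

lemma cycle_sum_integral:
  fixes F :: "'a::euclidean_space \<Rightarrow> complex \<Rightarrow> complex"
  assumes "\<And>\<gamma> \<zeta>. \<gamma> \<in> set \<Gamma> \<Longrightarrow> \<zeta> \<in> path_image \<gamma> \<Longrightarrow> integrable lborel (\<lambda>w. F w \<zeta>)"
  shows "integrable lborel (\<lambda>w. cycle_sum (F w) \<Gamma> N) \<and>
    cycle_sum (\<lambda>\<zeta>. LINT w|lborel. F w \<zeta>) \<Gamma> N = (LINT w|lborel. cycle_sum (F w) \<Gamma> N)"
  using assms unfolding cycle_sum_def
proof (induction \<Gamma>)
  case (Cons \<gamma> \<Gamma>)
  then have "integrable lborel (\<lambda>w. \<Sum>\<gamma>\<leftarrow>\<Gamma>. rs_sum (F w) \<gamma> N)"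
    "(\<Sum>\<gamma>\<leftarrow>\<Gamma>. rs_sum (\<lambda>\<zeta>. LINT w|lborel. F w \<zeta>) \<gamma> N) = (LINT w|lborel. (\<Sum>\<gamma>\<leftarrow>\<Gamma>. rs_sum (F w) \<gamma> N))"
    by auto
  moreover have "integrable lborel (\<lambda>w. rs_sum (F w) \<gamma> N)"
    "rs_sum (\<lambda>\<zeta>. LINT w|lborel. F w \<zeta>) \<gamma> N = (LINT w|lborel. rs_sum (F w) \<gamma> N)"
    using rs_sum_integral[of \<gamma> F N] Cons.prems by auto
  ultimately show ?case by (simp add: Bochner_Integration.integral_add)
qed simp

text \<open>Polynomials in z and cnj z, the complex form of the polynomial functions on the plane
  that Stone-Weierstrass supplies. Generation by monomials and sums reduces a linear claim to a
  single monomial; closure under products is proved separately.\<close>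

inductive bipoly :: "(complex \<Rightarrow> complex) \<Rightarrow> bool" where
  monomial: "bipoly (\<lambda>z. c * (z ^ m * cnj z ^ n))"
| add: "bipoly f \<Longrightarrow> bipoly g \<Longrightarrow> bipoly (\<lambda>z. f z + g z)"

lemma bipoly_mult:
  assumes "bipoly f" "bipoly g"
  shows "bipoly (\<lambda>z. f z * g z)"
  using assms(1)
proof induction
  case (monomial c m n)
  from assms(2) show ?case
  proof induction
    case (monomial d k l)
    have "(\<lambda>z. c * (z ^ m * cnj z ^ n) * (d * (z ^ k * cnj z ^ l))) = (\<lambda>z. (c * d) * (z ^ (m + k) * cnj z ^ (n + l)))"
      by (auto simp: power_add)
    then show ?case by (simp only: bipoly.monomial)
  qed (auto simp: distrib_left intro: bipoly.add)
qed (auto simp: distrib_right intro: bipoly.add)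

lemma bipoly_real_polynomial_function:
  assumes "real_polynomial_function p"
  shows "bipoly (\<lambda>z. complex_of_real (p z))"
  using assms
proof induction
  case (linear f)
  have "f z = Re z * f 1 + Im z * f \<i>" for z
  proof -
    have "z = Re z *\<^sub>R 1 + Im z *\<^sub>R \<i>" by (simp add: complex_eq_iff)
    then have "f z = f (Re z *\<^sub>R 1 + Im z *\<^sub>R \<i>)" by (rule arg_cong)
    also have "\<dots> = Re z * f 1 + Im z * f \<i>"
      using linear by (simp add: bounded_linear.linear linear_add linear_scale)
    finally show ?thesis .
  qed
  then have "complex_of_real (f z) = complex_of_real (Re z * f 1 + Im z * f \<i>)" for z by (rule arg_cong)
  then have 1: "complex_of_real (f z) = of_real (Re z) * of_real (f 1) + of_real (Im z) * of_real (f \<i>)" for z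
    unfolding of_real_mult of_real_add .
  have 2: "complex_of_real (Re z) = (z + cnj z) / 2" "complex_of_real (Im z) = (z - cnj z) / (2 * \<i>)" for z
    by (simp_all add: complex_add_cnj complex_diff_cnj field_simps)
  have 3: "(z + y) / 2 * A + (z - y) / (2 * \<i>) * B = (A / 2 + B / (2 * \<i>)) * z + (A / 2 - B / (2 * \<i>)) * y"
    for z y A B :: complex unfolding divide_inverse by algebra
  have "complex_of_real (f z) = (of_real (f 1) / 2 + of_real (f \<i>) / (2 * \<i>)) * (z ^ 1 * cnj z ^ 0)
      + (of_real (f 1) / 2 - of_real (f \<i>) / (2 * \<i>)) * (z ^ 0 * cnj z ^ 1)" for z
    unfolding 1[of z] 2 by (simp only: power_one_right power_0 mult_1_right mult_1_left 3)
  then have eq: "(\<lambda>z. complex_of_real (f z)) = (\<lambda>z. (of_real (f 1) / 2 + of_real (f \<i>) / (2 * \<i>)) * (z ^ 1 * cnj z ^ 0)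
      + (of_real (f 1) / 2 - of_real (f \<i>) / (2 * \<i>)) * (z ^ 0 * cnj z ^ 1))" by (rule ext)
  show ?case by (subst eq) (intro bipoly.intros)
next
  case (const c)
  show ?case using bipoly.monomial[of "of_real c" 0 0] by simp
qed (auto intro: bipoly.add bipoly_mult)

lemma bipoly_polynomial_function:
  assumes "polynomial_function (g :: complex \<Rightarrow> complex)"
  shows "bipoly g"
proof -
  have "real_polynomial_function (\<lambda>z. Re (g z))" "real_polynomial_function (\<lambda>z. Im (g z))"
    using assms bounded_linear_Re bounded_linear_Im by (auto simp: polynomial_function_def o_def)
  then have "bipoly (\<lambda>z. of_real (Re (g z)) + (\<i> * (z ^ 0 * cnj z ^ 0)) * of_real (Im (g z)))"
    by (intro bipoly.intros bipoly_mult bipoly_real_polynomial_function)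
  also have "(\<lambda>z. of_real (Re (g z)) + (\<i> * (z ^ 0 * cnj z ^ 0)) * of_real (Im (g z))) = g"
    by (simp add: complex_eq[symmetric])
  finally show ?thesis .
qed

text \<open>The Cauchy transform of \<open>w^m (cnj w)^n\<close> over a disc is, up to a polynomial, the solution
  \<open>z^m (cnj z)^(n+1) / (n+1)\<close> of the inhomogeneous Cauchy--Riemann equation.\<close>
lemma cauchy_transform_bipoly:
  fixes R :: real
  assumes "R > 0"
  shows "\<exists>c. \<forall>z. cmod z < R \<longrightarrow> cauchy_transform (ball 0 R) (\<lambda>w. w ^ m * cnj w ^ n) z =
     - (of_real pi / of_nat (Suc n)) * (z ^ m * cnj z ^ Suc n) + (\<Sum>i<m. c i * z ^ (m - Suc i))"
proof (intro exI allI impI)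
  define c where "c = (\<lambda>i. LINT w|lborel. indicator (ball 0 R) w *\<^sub>R (cnj w ^ n * w ^ i))"
  fix z :: complex assume z: "cmod z < R"
  have fin: "emeasure lborel (ball (0::complex) R) < \<infinity>" by (rule emeasure_lborel_ball_finite)
  have m1: "(\<lambda>w. cnj w ^ n) \<in> borel_measurable borel"
    by (intro borel_measurable_continuous_onI continuous_intros)
  have i1: "integrable lborel (\<lambda>w. indicator (ball 0 R) w *\<^sub>R (cnj w ^ n / (w - z)))"
    by (rule integrable_cauchy_kernel[where M = "R ^ n" and \<eta> = 1, OF _ m1 fin])
      (use assms in \<open>auto intro!: power_mono simp: norm_power\<close>)
  have i2: "integrable lborel (\<lambda>w. indicator (ball 0 R) w *\<^sub>R (cnj w ^ n * w ^ i))" for i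
  proof (rule measure_integral_bound(1)[where C = "R ^ n * R ^ i", OF _ fin])
    show "(\<lambda>w. cnj w ^ n * w ^ i) \<in> borel_measurable borel"
      by (intro borel_measurable_continuous_onI continuous_intros)
  qed (use assms in \<open>auto intro!: power_mono mult_mono simp: norm_power norm_mult\<close>)
  have "cauchy_transform (ball 0 R) (\<lambda>w. w ^ m * cnj w ^ n) z =
    (LINT w|lborel. z ^ m * (indicator (ball 0 R) w *\<^sub>R (cnj w ^ n / (w - z)))
       + (\<Sum>i<m. (indicator (ball 0 R) w *\<^sub>R (cnj w ^ n * w ^ i)) * z ^ (m - Suc i)))"
    unfolding cauchy_transform_def
  proof (rule integral_cong_AE)
    have "AE w in lborel. w \<noteq> z" by (rule AE_lborel_singleton)
    then show "AE w in lborel. indicator (ball 0 R) w *\<^sub>R (w ^ m * cnj w ^ n / (w - z)) =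
       z ^ m * (indicator (ball 0 R) w *\<^sub>R (cnj w ^ n / (w - z)))
       + (\<Sum>i<m. (indicator (ball 0 R) w *\<^sub>R (cnj w ^ n * w ^ i)) * z ^ (m - Suc i))"
    proof eventually_elim
      fix w assume w: "w \<noteq> z"
      \<comment> \<open>Since w^m - z^m is divisible by w - z, the kernel with w^m equals z^m times
        the kernel without it, plus a polynomial in z whose coefficients integrate to the moments
        \<open>c i\<close>.\<close>
      have "w ^ m = z ^ m + (w - z) * (\<Sum>i<m. z ^ (m - Suc i) * w ^ i)"
        using power_diff_sumr2[of w m z] by (simp add: algebra_simps)
      then have "w ^ m * cnj w ^ n / (w - z) = z ^ m * (cnj w ^ n / (w - z)) + (\<Sum>i<m. z ^ (m - Suc i) * w ^ i) * cnj w ^ n"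
        using w by (simp add: add_divide_distrib distrib_right)
      then show "indicator (ball 0 R) w *\<^sub>R (w ^ m * cnj w ^ n / (w - z)) =
       z ^ m * (indicator (ball 0 R) w *\<^sub>R (cnj w ^ n / (w - z)))
       + (\<Sum>i<m. (indicator (ball 0 R) w *\<^sub>R (cnj w ^ n * w ^ i)) * z ^ (m - Suc i))"
        by (auto simp: indicator_def sum_distrib_left sum_distrib_right mult_ac)
    qed
    have "(\<lambda>w. w ^ m * cnj w ^ n / (w - z)) \<in> borel_measurable borel"
      by (intro borel_measurable_divide borel_measurable_continuous_onI continuous_intros)
    then show "(\<lambda>w. indicator (ball 0 R) w *\<^sub>R (w ^ m * cnj w ^ n / (w - z))) \<in> borel_measurable lborel"
      by (intro borel_measurable_scaleR borel_measurable_indicator) auto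
    show "(\<lambda>w. z ^ m * (indicator (ball 0 R) w *\<^sub>R (cnj w ^ n / (w - z)))
       + (\<Sum>i<m. (indicator (ball 0 R) w *\<^sub>R (cnj w ^ n * w ^ i)) * z ^ (m - Suc i))) \<in> borel_measurable lborel"
      using i1 i2 by (intro borel_measurable_integrable Bochner_Integration.integrable_add
          integrable_mult_right Bochner_Integration.integrable_sum integrable_mult_left) auto
  qed
  also have "\<dots> = z ^ m * (LINT w|lborel. indicator (ball 0 R) w *\<^sub>R (cnj w ^ n / (w - z)))
       + (\<Sum>i<m. c i * z ^ (m - Suc i))"
  proof -
    have "integrable lborel (\<lambda>w. z ^ m * (indicator (ball 0 R) w *\<^sub>R (cnj w ^ n / (w - z))))"
      by (intro integrable_mult_right i1)
    moreover have "integrable lborel (\<lambda>w. (\<Sum>i<m. (indicator (ball 0 R) w *\<^sub>R (cnj w ^ n * w ^ i)) * z ^ (m - Suc i)))"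
      by (intro Bochner_Integration.integrable_sum integrable_mult_left i2)
    ultimately have "(LINT w|lborel. z ^ m * (indicator (ball 0 R) w *\<^sub>R (cnj w ^ n / (w - z)))
         + (\<Sum>i<m. (indicator (ball 0 R) w *\<^sub>R (cnj w ^ n * w ^ i)) * z ^ (m - Suc i)))
      = (LINT w|lborel. z ^ m * (indicator (ball 0 R) w *\<^sub>R (cnj w ^ n / (w - z))))
       + (LINT w|lborel. (\<Sum>i<m. (indicator (ball 0 R) w *\<^sub>R (cnj w ^ n * w ^ i)) * z ^ (m - Suc i)))"
      by (rule Bochner_Integration.integral_add)
    also have "(LINT w|lborel. (\<Sum>i<m. (indicator (ball 0 R) w *\<^sub>R (cnj w ^ n * w ^ i)) * z ^ (m - Suc i)))
       = (\<Sum>i<m. (LINT w|lborel. (indicator (ball 0 R) w *\<^sub>R (cnj w ^ n * w ^ i)) * z ^ (m - Suc i)))"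
      by (intro Bochner_Integration.integral_sum integrable_mult_left i2)
    finally show ?thesis by (simp only: c_def integral_mult_left_zero integral_mult_right_zero)
  qed
  also have "(LINT w|lborel. indicator (ball 0 R) w *\<^sub>R (cnj w ^ n / (w - z))) =
     - (LINT w|lborel. indicator (ball 0 R) w *\<^sub>R (cnj w ^ n / (z - w)))"
    unfolding Bochner_Integration.integral_minus[symmetric] scaleR_minus_right[symmetric] minus_divide_right
    by simp
  finally show "cauchy_transform (ball 0 R) (\<lambda>w. w ^ m * cnj w ^ n) z =
     - (of_real pi / of_nat (Suc n)) * (z ^ m * cnj z ^ Suc n) + (\<Sum>i<m. c i * z ^ (m - Suc i))"
    unfolding integral_cauchy_kernel_cnj_power[OF z] by simp
qed

section \<open>Two cycles with the same winding numbers off a null set\<close>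

context
  fixes \<Gamma>1 \<Gamma>2 :: "(real \<Rightarrow> complex) list" and K :: "complex set"
  assumes rect: "\<And>\<gamma>. \<gamma> \<in> set \<Gamma>1 \<union> set \<Gamma>2 \<Longrightarrow> rectifiable_loop \<gamma>"
    and image: "\<And>\<gamma>. \<gamma> \<in> set \<Gamma>1 \<union> set \<Gamma>2 \<Longrightarrow> path_image \<gamma> \<subseteq> K"
    and K: "compact K" "negligible K"
    and wind: "\<And>z. z \<notin> K \<Longrightarrow> (\<Sum>\<gamma>\<leftarrow>\<Gamma>1. winding_number \<gamma> z) = (\<Sum>\<gamma>\<leftarrow>\<Gamma>2. winding_number \<gamma> z)"
begin

private definition L :: "(complex \<Rightarrow> complex) \<Rightarrow> nat \<Rightarrow> complex" where
  "L g N = cycle_sum g \<Gamma>1 N - cycle_sum g \<Gamma>2 N"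

private lemma L_add: "L (\<lambda>w. f w + g w) N = L f N + L g N"
  and L_diff: "L (\<lambda>w. f w - g w) N = L f N - L g N"
  and L_cmult: "L (\<lambda>w. c * f w) N = c * L f N"
  by (simp_all add: L_def cycle_sum_add cycle_sum_diff cycle_sum_cmult algebra_simps)

private lemma L_zero: "L (\<lambda>w. 0) N = 0"
  using L_cmult[of 0 "\<lambda>w. 0"] by simp

private lemma L_cong:
  assumes "\<And>w. w \<in> K \<Longrightarrow> f w = g w"
  shows "L f = L g"
proof
  fix N
  have "cycle_sum f \<Gamma>1 N = cycle_sum g \<Gamma>1 N" "cycle_sum f \<Gamma>2 N = cycle_sum g \<Gamma>2 N"
    using image assms by (auto intro!: cycle_sum_cong)
  then show "L f N = L g N" by (simp add: L_def)
qed

private lemma L_bound: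
  obtains W where "W > 0" "\<And>g M N. \<lbrakk>\<And>w. w \<in> K \<Longrightarrow> cmod (g w) \<le> M; 0 \<le> M\<rbrakk> \<Longrightarrow> cmod (L g N) \<le> M * W"
proof -
  obtain W1 where W1: "W1 > 0" "\<And>g M N. \<lbrakk>\<And>\<gamma> w. \<gamma> \<in> set \<Gamma>1 \<Longrightarrow> w \<in> path_image \<gamma> \<Longrightarrow> cmod (g w) \<le> M; 0 \<le> M\<rbrakk> \<Longrightarrow>
     cmod (cycle_sum g \<Gamma>1 N) \<le> M * W1" using cycle_sum_bound[of \<Gamma>1] rect by (metis UnCI)
  obtain W2 where W2: "W2 > 0" "\<And>g M N. \<lbrakk>\<And>\<gamma> w. \<gamma> \<in> set \<Gamma>2 \<Longrightarrow> w \<in> path_image \<gamma> \<Longrightarrow> cmod (g w) \<le> M; 0 \<le> M\<rbrakk> \<Longrightarrow>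
     cmod (cycle_sum g \<Gamma>2 N) \<le> M * W2" using cycle_sum_bound[of \<Gamma>2] rect by (metis UnCI)
  show ?thesis
  proof (rule that[of "W1 + W2"])
    fix g M N assume *: "\<And>w. w \<in> K \<Longrightarrow> cmod (g w) \<le> M" "(0::real) \<le> M"
    have "cmod (cycle_sum g \<Gamma>1 N) \<le> M * W1" "cmod (cycle_sum g \<Gamma>2 N) \<le> M * W2"
      using * image by (auto intro!: W1(2) W2(2))
    then show "cmod (L g N) \<le> M * (W1 + W2)"
      using norm_triangle_ineq4[of "cycle_sum g \<Gamma>1 N" "cycle_sum g \<Gamma>2 N"] by (simp add: L_def distrib_left)
  qed (use W1 W2 in auto)
qed

text \<open>The bound for \<open>L\<close> is uniform in N, so convergence to 0 passes to uniform
  limits on \<open>K\<close>. It is used twice: to cut off the densities of Cauchy transforms near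
  \<open>K\<close>, and to pass from polynomials to continuous functions.\<close>

private lemma L_closed:
  assumes "\<And>e. e > 0 \<Longrightarrow> \<exists>h. L h \<longlonglongrightarrow> 0 \<and> (\<forall>w\<in>K. cmod (g w - h w) \<le> e)"
  shows "L g \<longlonglongrightarrow> 0"
proof (rule tendstoI)
  fix r :: real assume "r > 0"
  obtain W where W: "W > 0" "\<And>g M N. \<lbrakk>\<And>w. w \<in> K \<Longrightarrow> cmod (g w) \<le> M; 0 \<le> M\<rbrakk> \<Longrightarrow> cmod (L g N) \<le> M * W"
    using L_bound by blast
  obtain h where h: "L h \<longlonglongrightarrow> 0" "\<forall>w\<in>K. cmod (g w - h w) \<le> r / (2 * W)"
    using assms[of "r / (2 * W)"] \<open>r > 0\<close> W(1) by auto
  have d: "cmod (L (\<lambda>w. g w - h w) N) \<le> r / 2" for N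
    using W(2)[of "\<lambda>w. g w - h w" "r / (2 * W)" N] h(2) \<open>r > 0\<close> W(1) by simp
  have "\<forall>\<^sub>F N in sequentially. dist (L h N) 0 < r / 2"
    using tendstoD[OF h(1), of "r / 2"] \<open>r > 0\<close> by simp
  then show "\<forall>\<^sub>F N in sequentially. dist (L g N) 0 < r"
  proof eventually_elim
    fix N assume "dist (L h N) 0 < r / 2"
    then show "dist (L g N) 0 < r"
      using d[of N] norm_triangle_ineq[of "L g N - L h N" "L h N"] by (simp add: L_diff)
  qed
qed

text \<open>The point where the equality of winding numbers enters; all other integrands are reduced
  to such kernels and to powers.\<close>

private lemma L_kernel:
  assumes "a \<notin> K"
  shows "L (\<lambda>w. 1 / (w - a)) \<longlonglongrightarrow> 0"
proof -
  have "cycle_sum (\<lambda>w. 1 / (w - a)) \<Gamma>1 \<longlonglongrightarrow> 2 * of_real pi * \<i> * (\<Sum>\<gamma>\<leftarrow>\<Gamma>1. winding_number \<gamma> a)"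
    "cycle_sum (\<lambda>w. 1 / (w - a)) \<Gamma>2 \<longlonglongrightarrow> 2 * of_real pi * \<i> * (\<Sum>\<gamma>\<leftarrow>\<Gamma>2. winding_number \<gamma> a)"
    using rect image assms by (auto intro!: cycle_sum_winding_number)
  from tendsto_diff[OF this] show ?thesis by (simp add: L_def[abs_def] wind[OF assms])
qed

private lemma L_power: "L (\<lambda>w. w ^ k) \<longlonglongrightarrow> 0"
proof -
  have "cycle_sum (\<lambda>w. w ^ k) \<Gamma>1 \<longlonglongrightarrow> 0" "cycle_sum (\<lambda>w. w ^ k) \<Gamma>2 \<longlonglongrightarrow> 0"
    using rect by (auto intro!: cycle_sum_power)
  from tendsto_diff[OF this] show ?thesis by (simp add: L_def[abs_def])
qed

text \<open>When the density lives at distance d from \<open>K\<close>, its transform is a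
  superposition of kernels with poles off \<open>K\<close>. The distance bounds these kernels
  uniformly on \<open>K\<close>, which dominates the sums and lets the limit pass inside the area
  integral.\<close>

private lemma L_cauchy_transform_off:
  assumes B[measurable]: "B \<in> sets borel" and fin: "emeasure lborel B < \<infinity>"
    and \<mu>[measurable]: "\<mu> \<in> borel_measurable borel" and M: "\<And>w. w \<in> B \<Longrightarrow> cmod (\<mu> w) \<le> M" "0 \<le> M"
    and d: "d > 0" "\<And>w \<zeta>. w \<in> B \<Longrightarrow> \<zeta> \<in> K \<Longrightarrow> d \<le> cmod (w - \<zeta>)"
  shows "L (cauchy_transform B \<mu>) \<longlonglongrightarrow> 0"
proof -
  obtain W where W: "W > 0" "\<And>g M N. \<lbrakk>\<And>w. w \<in> K \<Longrightarrow> cmod (g w) \<le> M; 0 \<le> M\<rbrakk> \<Longrightarrow> cmod (L g N) \<le> M * W"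
    using L_bound by blast
  define F where "F = (\<lambda>w \<zeta>. indicator B w *\<^sub>R (\<mu> w / (w - \<zeta>)))"
  have iF: "integrable lborel (\<lambda>w. F w \<zeta>)" for \<zeta>
    unfolding F_def by (rule integrable_cauchy_kernel[OF B \<mu> fin M, where \<eta> = 1]) auto
  have F: "F w = (\<lambda>\<zeta>. (indicator B w *\<^sub>R - \<mu> w) * (1 / (\<zeta> - w)))" for w
  proof
    fix \<zeta>
    show "F w \<zeta> = (indicator B w *\<^sub>R - \<mu> w) * (1 / (\<zeta> - w))"
      using minus_divide_divide[of "\<mu> w" "w - \<zeta>"] by (simp add: F_def indicator_def)
  qed
  have int: "integrable lborel (\<lambda>w. L (F w) N)" "L (cauchy_transform B \<mu>) N = (LINT w|lborel. L (F w) N)" for N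
    unfolding L_def using cycle_sum_integral[of \<Gamma>1 F N] cycle_sum_integral[of \<Gamma>2 F N] iF
    by (simp_all add: cauchy_transform_def[abs_def] F_def)
  have "(\<lambda>N. LINT w|lborel. L (F w) N) \<longlonglongrightarrow> (LINT w|(lborel :: complex measure). 0)"
  proof (rule integral_dominated_convergence)
    show "integrable lborel (\<lambda>w. indicator B w * (M / d * W))"
      using fin by simp
    show "AE w in lborel. (\<lambda>N. L (F w) N) \<longlonglongrightarrow> 0"
    proof (rule AE_I2)
      fix w
      show "(\<lambda>N. L (F w) N) \<longlonglongrightarrow> 0"
      proof (cases "w \<in> B")
        case True
        then have "w \<notin> K" using d by force
        from tendsto_mult_right_zero[OF L_kernel[OF this]] show ?thesis unfolding F L_cmult .
      qed (simp add: F L_zero)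
    qed
    show "AE w in lborel. norm (L (F w) N) \<le> indicator B w * (M / d * W)" for N
    proof (rule AE_I2)
      fix w
      show "norm (L (F w) N) \<le> indicator B w * (M / d * W)"
      proof (cases "w \<in> B")
        case True
        have "cmod (F w \<zeta>) \<le> M / d" if "\<zeta> \<in> K" for \<zeta>
          using d True that M by (auto simp: F_def norm_divide intro!: frac_le)
        then show ?thesis using W(2)[of "F w" "M / d" N] True M d by simp
      qed (simp add: F L_zero)
    qed
  qed (use int(1) in auto)
  moreover have "L (cauchy_transform B \<mu>) = (\<lambda>N. LINT w|lborel. L (F w) N)" using int(2) by (rule ext)
  ultimately show ?thesis by simp
qed

text \<open>Negligibility of \<open>K\<close> enters here. An open neighbourhood \<open>U\<close> of
  \<open>K\<close> of measure at most \<eta>^2 splits the disc: the part off \<open>U\<close> is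
  covered by \<open>L_cauchy_transform_off\<close>, and the transform of the part in
  \<open>U\<close> is at most M (2 pi + 1) \<eta> everywhere on \<open>K\<close>.\<close>

private lemma L_cauchy_transform:
  assumes \<mu>[measurable]: "\<mu> \<in> borel_measurable borel" and M: "\<And>w. w \<in> ball 0 R \<Longrightarrow> cmod (\<mu> w) \<le> M" "0 \<le> M"
  shows "L (cauchy_transform (ball 0 R) \<mu>) \<longlonglongrightarrow> 0"
proof (rule L_closed)
  fix e :: real assume "e > 0"
  define \<eta> where "\<eta> = e / ((M + 1) * (2 * pi + 1))"
  have "M + 1 > 0" using M by simp
  then have \<eta>: "\<eta> > 0" using \<open>e > 0\<close> by (auto simp: \<eta>_def intro!: divide_pos_pos mult_pos_pos add_pos_pos)
  have "emeasure lborel K = 0"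
    using K by (simp add: negligible_iff_null_sets null_sets_def compact_imp_closed)
  \<comment> \<open>The measure \<eta>^2 balances the two terms 2 pi \<eta> and measure / \<eta> of
    \<open>integral_cauchy_kernel_bound\<close>.\<close>
  moreover obtain U where U: "open U" "K \<subseteq> U" "emeasure lborel (U - K) < ennreal (\<eta>\<^sup>2)"
    using outer_regular_lborel[of K "\<eta>\<^sup>2"] K \<eta> by (metis compact_imp_closed borel_closed zero_less_power)
  ultimately have mU: "emeasure lborel U < ennreal (\<eta>\<^sup>2)"
  proof -
    have [measurable]: "U \<in> sets borel" "K \<in> sets borel" using U(1) K by (auto simp: compact_imp_closed)
    have "emeasure lborel U \<le> emeasure lborel K + emeasure lborel (U - K)"
      using emeasure_subadditive[of K lborel "U - K"] U(2) by (simp add: Un_absorb1)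
    then show ?thesis using U(3) \<open>emeasure lborel K = 0\<close> by simp
  qed
  obtain d where d: "d > 0" "\<And>w \<zeta>. w \<in> - U \<Longrightarrow> \<zeta> \<in> K \<Longrightarrow> d \<le> cmod (w - \<zeta>)"
  proof -
    have "closed (- U)" "K \<inter> (- U) = {}" using U by auto
    from separate_compact_closed[OF K(1) this] obtain d where "d > 0" "\<forall>x\<in>K. \<forall>y\<in>-U. d \<le> dist x y" by blast
    then show ?thesis using that[of d] by (metis dist_commute dist_norm)
  qed
  define B1 B2 where "B1 = ball (0::complex) R - U" and "B2 = ball (0::complex) R \<inter> U"
  have B12[measurable]: "B1 \<in> sets borel" "B2 \<in> sets borel" using U(1) by (auto simp: B1_def B2_def)
  have fin: "emeasure lborel B1 < \<infinity>" "emeasure lborel B2 < \<infinity>"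
    using emeasure_mono[of B1 "ball 0 R" lborel] emeasure_mono[of B2 "ball 0 R" lborel]
      emeasure_lborel_ball_finite[of "0::complex" R]
    by (auto simp: B1_def B2_def intro: le_less_trans)
  have M12: "\<And>w. w \<in> B1 \<Longrightarrow> cmod (\<mu> w) \<le> M" "\<And>w. w \<in> B2 \<Longrightarrow> cmod (\<mu> w) \<le> M"
    using M by (auto simp: B1_def B2_def)
  have split: "cauchy_transform (ball 0 R) \<mu> c - cauchy_transform B1 \<mu> c = cauchy_transform B2 \<mu> c" for c
  proof -
    have "indicator (ball 0 R) w *\<^sub>R (\<mu> w / (w - c)) = indicator B1 w *\<^sub>R (\<mu> w / (w - c)) + indicator B2 w *\<^sub>R (\<mu> w / (w - c))" for w
      by (auto simp: B1_def B2_def indicator_def)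
    then have "cauchy_transform (ball 0 R) \<mu> c = cauchy_transform B1 \<mu> c + cauchy_transform B2 \<mu> c"
      unfolding cauchy_transform_def
      by (simp only:) (intro Bochner_Integration.integral_add integrable_cauchy_kernel[where M = M and \<eta> = 1] \<mu> fin M12 M(2); simp)
    then show ?thesis by simp
  qed
  have mB2: "measure lborel B2 \<le> \<eta>\<^sup>2"
  proof -
    have "emeasure lborel B2 \<le> ennreal (\<eta>\<^sup>2)"
      using emeasure_mono[of B2 U lborel] mU U(1) by (auto simp: B2_def)
    then show ?thesis by (simp add: measure_def enn2real_leI)
  qed
  show "\<exists>h. L h \<longlonglongrightarrow> 0 \<and> (\<forall>w\<in>K. cmod (cauchy_transform (ball 0 R) \<mu> w - h w) \<le> e)"
  proof (intro exI conjI ballI)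
    show "L (cauchy_transform B1 \<mu>) \<longlonglongrightarrow> 0"
      by (rule L_cauchy_transform_off[OF B12(1) fin(1) \<mu> M12(1) M(2) d(1)]) (use d(2) in \<open>auto simp: B1_def\<close>)
    fix c assume "c \<in> K"
    have "cmod (cauchy_transform B2 \<mu> c) \<le> M * (2 * pi * \<eta> + measure lborel B2 / \<eta>)"
      unfolding cauchy_transform_def
      by (rule integral_cauchy_kernel_bound[OF B12(2) \<mu> fin(2) M12(2) M(2) \<eta>])
    also have "\<dots> \<le> M * (2 * pi * \<eta> + \<eta>)"
      using mB2 \<eta> M(2) by (intro mult_left_mono add_left_mono) (auto simp: divide_le_eq power2_eq_square)
    also have "\<dots> = M * ((2 * pi + 1) * \<eta>)" by (simp add: algebra_simps)
    also have "\<dots> \<le> (M + 1) * ((2 * pi + 1) * \<eta>)"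
      using \<eta> by (intro mult_right_mono) auto
    also have "\<dots> = e"
    proof -
      have "(M + 1) * (2 * pi + 1) \<noteq> 0" using \<open>M + 1 > 0\<close> pi_gt_zero by (simp add: add_pos_pos less_imp_neq[THEN not_sym] del: pi_gt_zero)
      then show ?thesis unfolding \<eta>_def mult.assoc[symmetric] times_divide_eq_right
        by (rule nonzero_mult_div_cancel_left)
    qed
    finally show "cmod (cauchy_transform (ball 0 R) \<mu> c - cauchy_transform B1 \<mu> c) \<le> e" by (simp add: split)
  qed
qed

text \<open>Powers of z are exact and integrate to 0 over each loop. A monomial with a factor cnj z
  is, by \<open>cauchy_transform_bipoly\<close> on a disc containing \<open>K\<close>, a multiple of
  a Cauchy transform minus a polynomial in z.\<close>

private lemma L_bipoly:
  assumes "bipoly f"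
  shows "L f \<longlonglongrightarrow> 0"
  using assms
proof induction
  case (monomial c m n)
  have "L (\<lambda>z. z ^ m * cnj z ^ n) \<longlonglongrightarrow> 0"
  proof (cases n)
    case 0
    then show ?thesis using L_power[of m] by simp
  next
    case (Suc k)
    obtain R where R: "R > 0" "K \<subseteq> ball 0 R"
      using compact_imp_bounded[OF K(1)] bounded_subset_ballD by blast
    obtain c where c: "\<And>z. cmod z < R \<Longrightarrow> cauchy_transform (ball 0 R) (\<lambda>w. w ^ m * cnj w ^ k) z =
     - (of_real pi / of_nat (Suc k)) * (z ^ m * cnj z ^ Suc k) + (\<Sum>i<m. c i * z ^ (m - Suc i))"
      using cauchy_transform_bipoly[OF R(1), of m k] by blast
    define p where "p = (\<lambda>z. \<Sum>i<m. c i * z ^ (m - Suc i))"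
    have Lp: "L p \<longlonglongrightarrow> 0"
    proof -
      have "L (\<lambda>z. \<Sum>i<j. c i * z ^ (m - Suc i)) \<longlonglongrightarrow> 0" for j
      proof (induction j)
        case 0
        show ?case using L_cmult[of 0 "\<lambda>w. 0"] by simp
      next
        case (Suc j)
        from tendsto_add[OF Suc tendsto_mult_right_zero[OF L_power[of "m - Suc j"], of "c j"]]
        show ?case by (simp add: L_add[abs_def] L_cmult)
      qed
      then show ?thesis by (simp add: p_def)
    qed
    have Lt: "L (cauchy_transform (ball 0 R) (\<lambda>w. w ^ m * cnj w ^ k)) \<longlonglongrightarrow> 0"
    proof (rule L_cauchy_transform[where M = "R ^ m * R ^ k"])
      show "(\<lambda>w. w ^ m * cnj w ^ k) \<in> borel_measurable borel"
        by (intro borel_measurable_continuous_onI continuous_intros)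
    qed (use R in \<open>auto simp: norm_mult norm_power intro!: mult_mono power_mono\<close>)
    \<comment> \<open>The reciprocal of the factor in front of the monomial in
      \<open>cauchy_transform_bipoly\<close>; the index there is \<open>k\<close>, the predecessor
      of \<open>n\<close>.\<close>
    define s where "s = - (of_nat (Suc k) / complex_of_real pi)"
    have "z ^ m * cnj z ^ n = s * (cauchy_transform (ball 0 R) (\<lambda>w. w ^ m * cnj w ^ k) z - p z)" if "z \<in> K" for z
    proof -
      have "s * (- (of_real pi / of_nat (Suc k))) = 1" by (simp add: s_def del: of_nat_Suc)
      moreover have "cauchy_transform (ball 0 R) (\<lambda>w. w ^ m * cnj w ^ k) z - p z =
         (- (of_real pi / of_nat (Suc k))) * (z ^ m * cnj z ^ n)"
        using that R c[of z] by (auto simp: p_def Suc)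
      ultimately show ?thesis by (metis mult.assoc mult_1)
    qed
    then have "L (\<lambda>z. z ^ m * cnj z ^ n) = L (\<lambda>z. s * (cauchy_transform (ball 0 R) (\<lambda>w. w ^ m * cnj w ^ k) z - p z))"
      by (rule L_cong)
    also have "\<dots> \<longlonglongrightarrow> 0"
      using tendsto_mult_right_zero[OF tendsto_diff[OF Lt Lp, simplified], of s]
      by (simp add: L_cmult[abs_def] L_diff[abs_def])
    finally show ?thesis .
  qed
  from tendsto_mult_right_zero[OF this, of c] show ?case by (simp add: L_cmult[abs_def])
next
  case (add f g)
  from tendsto_add[OF add.IH] show ?case by (simp add: L_add[abs_def])
qed

theorem cycle_integral_eq:
  assumes g: "continuous_on K g" and I: "cycle_has_integral g \<Gamma>1 I1" "cycle_has_integral g \<Gamma>2 I2"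
  shows "I1 = I2"
proof -
  have "L g \<longlonglongrightarrow> 0"
  proof (rule L_closed)
    fix e :: real assume "e > 0"
    obtain h where h: "polynomial_function h" "\<forall>x\<in>K. cmod (g x - h x) < e"
      using Stone_Weierstrass_polynomial_function[OF K(1) g \<open>e > 0\<close>] by blast
    then show "\<exists>h. L h \<longlonglongrightarrow> 0 \<and> (\<forall>w\<in>K. cmod (g w - h w) \<le> e)"
      using L_bipoly[OF bipoly_polynomial_function[OF h(1)]] by (meson less_imp_le)
  qed
  moreover have "L g \<longlonglongrightarrow> I1 - I2"
    unfolding L_def[abs_def] by (intro tendsto_diff cycle_has_integral_cycle_sum I)
  ultimately show ?thesis using LIMSEQ_unique by fastforce
qed

end

section \<open>The sphere and inversion\<close>

lemma open_fin_part: "open U \<Longrightarrow> open (fin_part U)"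
  by (simp add: open_csph_def fin_part_def)

lemma open_Fin_image: "open U \<Longrightarrow> open (Fin ` U)"
proof -
  have "{z. Fin z \<in> Fin ` U} = U" by auto
  then show "open U \<Longrightarrow> open (Fin ` U)" by (auto simp: open_csph_def)
qed

lemma fin_part_interior: "fin_part (interior S) = interior (fin_part S)"
proof
  show "fin_part (interior S) \<subseteq> interior (fin_part S)"
    by (rule interior_maximal) (use interior_subset in \<open>auto simp: fin_part_def intro!: open_fin_part[unfolded fin_part_def]\<close>)
  have "Fin ` interior (fin_part S) \<subseteq> interior S"
    by (rule interior_maximal) (use interior_subset[of "fin_part S"] in \<open>auto simp: fin_part_def intro!: open_Fin_image\<close>)
  then show "interior (fin_part S) \<subseteq> fin_part (interior S)" by (auto simp: fin_part_def)
qed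

lemma fin_part_closure: "fin_part (closure S) = closure (fin_part S)"
proof -
  have "fin_part (- T) = - fin_part T" for T by (auto simp: fin_part_def)
  then show ?thesis by (simp add: closure_interior fin_part_interior)
qed

lemma fin_part_frontier: "fin_part (frontier S) = frontier (fin_part S)"
  by (simp add: frontier_def flip: fin_part_interior fin_part_closure) (auto simp: fin_part_def)

lemma Infty_interior: "Infty \<in> interior S \<longleftrightarrow> Infty \<in> S \<and> (\<exists>R. \<forall>z. R < cmod z \<longrightarrow> Fin z \<in> S)"
proof
  assume "Infty \<in> interior S"
  then show "Infty \<in> S \<and> (\<exists>R. \<forall>z. R < cmod z \<longrightarrow> Fin z \<in> S)"
    using open_interior[of S] interior_subset[of S] unfolding open_csph_def by blast
next
  assume *: "Infty \<in> S \<and> (\<exists>R. \<forall>z. R < cmod z \<longrightarrow> Fin z \<in> S)"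
  then obtain R where R: "\<And>z. R < cmod z \<Longrightarrow> Fin z \<in> S" by blast
  define T where "T = insert Infty (Fin ` {z. R < cmod z})"
  have "{z. Fin z \<in> T} = {z. R < cmod z}" by (auto simp: T_def)
  moreover have "open {z::complex. R < cmod z}" by (intro open_Collect_less continuous_intros)
  ultimately have "open T" by (auto simp: open_csph_def T_def)
  moreover have "T \<subseteq> S" using * R by (auto simp: T_def)
  ultimately have "T \<subseteq> interior S" by (rule interior_maximal[rotated])
  then show "Infty \<in> interior S" by (auto simp: T_def)
qed

text \<open>A set can fail to be bounded because its finite part is unbounded although infinity is
  not a member. Then infinity would be a frontier point, which is excluded.\<close>

lemma Infty_mem_of_unbounded:
  assumes "open \<Omega>" "Infty \<notin> frontier \<Omega>" "\<not> sph_bounded \<Omega>"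
  shows "Infty \<in> \<Omega>"
proof (rule ccontr)
  assume n: "Infty \<notin> \<Omega>"
  then have "Infty \<notin> interior \<Omega>" using interior_subset by blast
  then have "Infty \<in> interior (- \<Omega>)" using assms(2) by (simp add: frontier_def closure_interior)
  then obtain R where "\<And>z. R < cmod z \<Longrightarrow> Fin z \<in> - \<Omega>" unfolding Infty_interior by blast
  then have "fin_part \<Omega> \<subseteq> cball 0 R" by (force simp: fin_part_def not_less[symmetric])
  then show False using assms(3) n bounded_subset[OF bounded_cball] by (auto simp: sph_bounded_def)
qed

text \<open>The chart at infinity, a homeomorphism of the plane onto the sphere without
  \<open>Fin 0\<close>. A domain that omits 0 and contains infinity becomes a plane domain around 0,
  to which the Riemann mapping theorem applies.\<close>

definition inversion :: "complex \<Rightarrow> csph" where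
  "inversion v = (if v = 0 then Infty else Fin (inverse v))"

text \<open>Since \<open>inverse 0 = 0\<close>, the points \<open>Fin 0\<close> and
  \<open>Infty\<close> receive the same value; hence the exclusion of \<open>Fin 0\<close> from the
  inverse law and from the domain of continuity.\<close>

definition coinversion :: "csph \<Rightarrow> complex" where
  "coinversion p = (case p of Fin z \<Rightarrow> inverse z | Infty \<Rightarrow> 0)"

lemma coinversion_inversion [simp]: "coinversion (inversion v) = v"
  by (simp add: coinversion_def inversion_def)

lemma inversion_coinversion: "p \<noteq> Fin 0 \<Longrightarrow> inversion (coinversion p) = p"
  by (cases p) (auto simp: coinversion_def inversion_def)

lemma open_vimage_inversion:
  assumes "open U"
  shows "open (inversion -` U)"
proof -
  have o: "open {z. Fin z \<in> U}" using assms by (simp add: open_csph_def)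
  have "open (- {0::complex} \<inter> inverse -` {z. Fin z \<in> U})"
    by (rule continuous_open_preimage[OF _ _ o]) (auto intro!: continuous_intros)
  also have "- {0::complex} \<inter> inverse -` {z. Fin z \<in> U} = inversion -` U - {0}"
    by (auto simp: inversion_def)
  finally have o1: "open (inversion -` U - {0})" .
  show ?thesis
  proof (cases "Infty \<in> U")
    case False
    then have "inversion -` U - {0} = inversion -` U" by (auto simp: inversion_def)
    then show ?thesis using o1 by simp
  next
    case True
    then obtain R where R: "\<And>z. R < cmod z \<Longrightarrow> Fin z \<in> U" using assms by (auto simp: open_csph_def)
    define d where "d = 1 / (\<bar>R\<bar> + 1)"
    have d: "d > 0" by (simp add: d_def)
    have "v \<in> inversion -` U" if "v \<in> ball 0 d" for v
    proof (cases "v = 0")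
      case False
      have "cmod v < 1 / (\<bar>R\<bar> + 1)" using that by (simp add: d_def)
      then have "\<bar>R\<bar> + 1 < cmod (inverse v)" using False by (simp add: norm_divide inverse_eq_divide pos_less_divide_eq mult.commute)
      then have "Fin (inverse v) \<in> U" by (intro R) simp
      then show ?thesis using False by (simp add: inversion_def)
    qed (use True in \<open>simp add: inversion_def\<close>)
    then have "inversion -` U = (inversion -` U - {0}) \<union> ball 0 d" using d by auto
    then show ?thesis using o1 by (metis open_Un open_ball)
  qed
qed

lemma continuous_on_inversion: "continuous_on S inversion"
  by (rule continuous_on_subset[of UNIV]) (auto simp: continuous_on_open_vimage open_vimage_inversion)

lemma continuous_on_coinversion: "continuous_on (- {Fin 0}) coinversion"
proof -
  have o: "open (- {Fin 0})"
  proof -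
    have "{z. Fin z \<in> - {Fin 0}} = - {0}" by auto
    then have "open {z. Fin z \<in> - {Fin 0}}" by (simp only: open_Compl closed_singleton)
    moreover have "\<forall>z. 0 < cmod z \<longrightarrow> Fin z \<in> - {Fin 0}" by simp
    ultimately show ?thesis unfolding open_csph_def by blast
  qed
  have "open (coinversion -` B \<inter> - {Fin 0})" if B: "open B" for B
  proof -
    have "open (- {0::complex} \<inter> inverse -` B)"
      by (rule continuous_open_preimage[OF _ _ B]) (auto intro!: continuous_intros)
    moreover have "{z. Fin z \<in> coinversion -` B \<inter> - {Fin 0}} = - {0} \<inter> inverse -` B"
      by (auto simp: coinversion_def)
    moreover have "\<exists>R. \<forall>z. R < cmod z \<longrightarrow> Fin z \<in> coinversion -` B \<inter> - {Fin 0}" if zero: "0 \<in> B"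
    proof -
      obtain e where e: "e > 0" "ball 0 e \<subseteq> B" using openE[OF B zero] .
      have "Fin z \<in> coinversion -` B \<inter> - {Fin 0}" if "1 / e < cmod z" for z
      proof -
        have "cmod z > 0" using that e(1) by (meson divide_pos_pos less_trans zero_less_one)
        then have "z \<noteq> 0" by simp
        moreover have "cmod (inverse z) < e" using that e(1) \<open>z \<noteq> 0\<close> by (simp add: norm_divide field_simps)
        ultimately show ?thesis using e(2) by (auto simp: coinversion_def)
      qed
      then show ?thesis by blast
    qed
    ultimately show ?thesis by (auto simp: open_csph_def coinversion_def)
  qed
  then show ?thesis using o by (simp add: continuous_on_open_vimage)
qed

lemma simply_connected_inversion:
  assumes "simply_connected \<Omega>" "Fin 0 \<notin> \<Omega>"
  shows "simply_connected (inversion -` \<Omega>)"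
proof (rule simply_connected_retraction_gen[OF assms(1) _ _ continuous_on_inversion])
  show "continuous_on \<Omega> coinversion"
    by (rule continuous_on_subset[OF continuous_on_coinversion]) (use assms in auto)
  have "inversion (coinversion p) = p" if "p \<in> \<Omega>" for p
    using that assms(2) by (metis inversion_coinversion)
  then show "coinversion ` \<Omega> = inversion -` \<Omega>"
    by (auto simp: image_iff) (metis coinversion_inversion)
qed auto

section \<open>From the quadrature identity to the exterior map\<close>

text \<open>The negative Fourier modes of \<open>K + cnj l\<close> on the circle \<open>|u| = r\<close> are \<open>\<beta> b^(n-1)\<close> from the pole
  and \<open>r^(2n)\<close> times the conjugate Taylor coefficients of \<open>l\<close>; letting \<open>r \<rightarrow> 1\<close> determines \<open>l\<close>.\<close>
lemma pole_reflection:
  fixes l K0 :: "complex \<Rightarrow> complex"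
  assumes l: "l holomorphic_on ball 0 1" and K0: "K0 holomorphic_on ball 0 1"
    and b: "cmod b < 1"
    and lim: "\<And>e. e > 0 \<Longrightarrow> \<exists>r0<1. \<forall>u. r0 < cmod u \<and> cmod u < 1 \<longrightarrow> cmod (K0 u + \<beta> / (u - b) + cnj (l u)) < e"
    and u: "cmod u < 1"
  shows "l u = l 0 - cnj \<beta> * u / (1 - cnj b * u)"
proof -
  define a where "a = (\<lambda>n. (deriv ^^ n) l 0 / fact n)"
  have coef: "cnj (a (Suc n)) = - \<beta> * b ^ n" for n
  proof -
    have est: "cmod (cnj (a (Suc n)) * of_real r ^ (2 * Suc n) + \<beta> * b ^ n) \<le> e"
      if r: "cmod b < r" "r < 1" "0 < r" and e: "0 \<le> e"
        "\<And>u. cmod u = r \<Longrightarrow> cmod (K0 u + \<beta> / (u - b) + cnj (l u)) \<le> e" for r e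
    proof -
      let ?F = "\<lambda>u. (K0 u + \<beta> / (u - b) + cnj (l u)) * u ^ n"
      have sub: "cball (0::complex) r \<subseteq> ball 0 1" "ball (0::complex) r \<subseteq> ball 0 1" using r by auto
      have cK: "continuous_on (cball 0 r) K0" "K0 holomorphic_on ball 0 r"
        using holomorphic_on_subset[OF K0] sub by (auto intro!: holomorphic_on_imp_continuous_on)
      have cl: "continuous_on (cball 0 r) l" "l holomorphic_on ball 0 r"
        using holomorphic_on_subset[OF l] sub by (auto intro!: holomorphic_on_imp_continuous_on)
      have i1: "((\<lambda>u. K0 u * u ^ n) has_contour_integral 0) (circlepath 0 r)"
      proof -
        have "((\<lambda>u. (K0 u * u ^ Suc n) / (u - 0)) has_contour_integral (2 * of_real pi * \<i> * (K0 0 * 0 ^ Suc n))) (circlepath 0 r)"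
          using cK r by (intro Cauchy_integral_circlepath continuous_intros holomorphic_intros) auto
        then have "((\<lambda>u. (K0 u * u ^ Suc n) / (u - 0)) has_contour_integral 0) (circlepath 0 r)" by simp
        then show ?thesis by (rule has_contour_integral_eq) (use r in auto)
      qed
      have i2: "((\<lambda>u. \<beta> * u ^ n / (u - b)) has_contour_integral (2 * of_real pi * \<i> * (\<beta> * b ^ n))) (circlepath 0 r)"
        using r by (intro Cauchy_integral_circlepath continuous_intros holomorphic_intros) auto
      \<comment> \<open>The Taylor coefficient of order n + 1 of \<open>l\<close> as a contour
        integral, conjugated. On the circle w cnj w = r^2, so after multiplication by -r^(2n+2) the
        conjugate of du / u^(n+2) becomes u^n du; the sign comes from conjugating the factor i in
        du.\<close>
      have i3: "((\<lambda>u. cnj (l u) * u ^ n) has_contour_integral (2 * of_real pi * \<i> * (cnj (a (Suc n)) * of_real r ^ (2 * Suc n)))) (circlepath 0 r)"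
      proof -
        have "((\<lambda>u. l u / (u - 0) ^ Suc (Suc n)) has_contour_integral ((2 * pi * \<i>) / fact (Suc n) * (deriv ^^ Suc n) l 0)) (circlepath 0 r)"
          using cl r by (intro Cauchy_has_contour_integral_higher_derivative_circlepath) auto
        then have "((\<lambda>u. l u / u ^ Suc (Suc n)) has_contour_integral (2 * pi * \<i> * a (Suc n))) (circlepath 0 r)"
          by (simp add: a_def del: power_Suc fact_Suc funpow.simps)
        then have "((\<lambda>t. l (r * cis t) / (r * cis t) ^ Suc (Suc n) * r * \<i> * cis t) has_integral (2 * pi * \<i> * a (Suc n))) {0..2*pi}"
          unfolding circlepath_def by (subst (asm) has_contour_integral_part_circlepath_iff) auto
        then have "((\<lambda>t. cnj (l (r * cis t) / (r * cis t) ^ Suc (Suc n) * r * \<i> * cis t)) has_integral cnj (2 * pi * \<i> * a (Suc n))) {0..2*pi}"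
          by (subst (asm) has_integral_cnj[symmetric]) (simp only: comp_def)
        then have "((\<lambda>t. - (of_real r ^ (2 * Suc n)) * cnj (l (r * cis t) / (r * cis t) ^ Suc (Suc n) * r * \<i> * cis t)) has_integral
            (- (of_real r ^ (2 * Suc n)) * cnj (2 * pi * \<i> * a (Suc n)))) {0..2*pi}"
          by (rule has_integral_mult_right)
        moreover have "- (of_real r ^ (2 * Suc n)) * cnj (l (r * cis t) / (r * cis t) ^ Suc (Suc n) * r * \<i> * cis t) =
            cnj (l (r * cis t)) * (r * cis t) ^ n * r * \<i> * cis t" for t
        proof -
          define w where "w = complex_of_real r * cis t"
          have w: "w \<noteq> 0" "w * cnj w = of_real r ^ 2"
            using r complex_norm_square[of w] by (simp_all add: norm_mult w_def)
          have "complex_of_real r ^ (2 * Suc n) = w ^ Suc n * cnj w ^ Suc n"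
            by (simp only: power_mult w(2)[symmetric] power_mult_distrib)
          then have "- (of_real r ^ (2 * Suc n)) * cnj (l w / w ^ Suc (Suc n) * \<i> * w) = cnj (l w) * w ^ n * \<i> * w"
            using w(1) by simp
          moreover have rw: "x * complex_of_real r * \<i> * cis t = x * \<i> * w" for x
            by (simp add: w_def mult_ac)
          ultimately show ?thesis by (simp only: w_def[symmetric] rw)
        qed
        ultimately have "((\<lambda>t. cnj (l (r * cis t)) * (r * cis t) ^ n * r * \<i> * cis t) has_integral
            (- (of_real r ^ (2 * Suc n)) * cnj (2 * pi * \<i> * a (Suc n)))) {0..2*pi}" by (simp only:)
        then have "((\<lambda>u. cnj (l u) * u ^ n) has_contour_integral (- (of_real r ^ (2 * Suc n)) * cnj (2 * pi * \<i> * a (Suc n)))) (circlepath 0 r)"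
          unfolding circlepath_def by (subst has_contour_integral_part_circlepath_iff) auto
        then show ?thesis by (simp add: mult_ac)
      qed
      have "(?F has_contour_integral (0 + 2 * of_real pi * \<i> * (\<beta> * b ^ n) + 2 * of_real pi * \<i> * (cnj (a (Suc n)) * of_real r ^ (2 * Suc n)))) (circlepath 0 r)"
        using has_contour_integral_add[OF has_contour_integral_add[OF i1 i2] i3]
        by (rule has_contour_integral_eq) (simp add: algebra_simps)
      then have "cmod (0 + 2 * of_real pi * \<i> * (\<beta> * b ^ n) + 2 * of_real pi * \<i> * (cnj (a (Suc n)) * of_real r ^ (2 * Suc n))) \<le> e * (2 * pi * r)"
      proof (rule has_contour_integral_bound_circlepath)
        fix x assume x: "cmod (x - 0) = r"
        have "cmod (K0 x + \<beta> / (x - b) + cnj (l x)) * cmod x ^ n \<le> e * 1"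
          using x r e by (intro mult_mono power_le_one) auto
        then show "cmod (?F x) \<le> e" by (simp add: norm_mult norm_power)
      qed (use r e in auto)
      also have "\<dots> \<le> e * (2 * pi * 1)" using r e by (intro mult_left_mono) auto
      also have "0 + 2 * of_real pi * \<i> * (\<beta> * b ^ n) + 2 * of_real pi * \<i> * (cnj (a (Suc n)) * of_real r ^ (2 * Suc n))
         = (2 * of_real pi * \<i>) * (cnj (a (Suc n)) * of_real r ^ (2 * Suc n) + \<beta> * b ^ n)"
        by (simp add: algebra_simps)
      finally show ?thesis by (simp add: norm_mult)
    qed
    have "cmod (cnj (a (Suc n)) + \<beta> * b ^ n) \<le> e" if "e > 0" for e
    proof -
      obtain r0 where r0: "r0 < 1" "\<And>u. r0 < cmod u \<and> cmod u < 1 \<Longrightarrow> cmod (K0 u + \<beta> / (u - b) + cnj (l u)) < e"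
        using lim[OF \<open>e > 0\<close>] by blast
      define m where "m = max (max r0 (cmod b)) (1/2)"
      have m: "m < 1" "m > 0" using r0 b by (auto simp: m_def)
      have ev: "\<forall>\<^sub>F r in at_left 1. m < r \<and> r < 1"
        using m eventually_at_left_real[of m 1] by (auto elim: eventually_mono)
      have "((\<lambda>r. cmod (cnj (a (Suc n)) * of_real r ^ (2 * Suc n) + \<beta> * b ^ n)) \<longlongrightarrow>
          cmod (cnj (a (Suc n)) * of_real 1 ^ (2 * Suc n) + \<beta> * b ^ n)) (at_left (1::real))"
        by (intro tendsto_intros)
      moreover have "\<forall>\<^sub>F r in at_left 1. cmod (cnj (a (Suc n)) * of_real r ^ (2 * Suc n) + \<beta> * b ^ n) \<le> e"
        using ev
      proof eventually_elim
        fix r assume r: "m < r \<and> r < 1"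
        show "cmod (cnj (a (Suc n)) * of_real r ^ (2 * Suc n) + \<beta> * b ^ n) \<le> e"
          by (rule est) (use r m r0 \<open>e > 0\<close> in \<open>auto simp: m_def intro!: less_imp_le[OF r0(2)]\<close>)
      qed
      ultimately have "cmod (cnj (a (Suc n)) * of_real 1 ^ (2 * Suc n) + \<beta> * b ^ n) \<le> e"
        by (rule tendsto_upperbound) simp
      then show ?thesis by (simp only: of_real_1 power_one mult_1_right)
    qed
    \<comment> \<open>In the limit the coefficients of \<open>l\<close> turn out to be geometric;
      summing the series produces the simple rational function with its pole at the reflected point
      1 / cnj b.\<close>
    then have "cmod (cnj (a (Suc n)) + \<beta> * b ^ n) \<le> 0" by (metis dense_ge)
    then show ?thesis by (simp add: add_eq_0_iff2)
  qed
  have s1: "(\<lambda>n. a n * u ^ n) sums l u"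
    using holomorphic_power_series[OF l, of u] u by (simp add: a_def)
  then have "(\<lambda>n. a (Suc n) * u ^ Suc n) sums (l u - a 0 * u ^ 0)"
    using sums_Suc_iff[of "\<lambda>n. a n * u ^ n" "l u - a 0 * u ^ 0"] by simp
  moreover have "(\<lambda>n. (- cnj \<beta> * u) * (cnj b * u) ^ n) sums ((- cnj \<beta> * u) * (1 / (1 - cnj b * u)))"
  proof (intro sums_mult geometric_sums)
    have "cmod b * cmod u \<le> cmod b * 1" using u by (intro mult_left_mono) auto
    then show "norm (cnj b * u) < 1" using b by (simp add: norm_mult)
  qed
  moreover have "a (Suc n) * u ^ Suc n = (- cnj \<beta> * u) * (cnj b * u) ^ n" for n
  proof -
    have "a (Suc n) = cnj (- \<beta> * b ^ n)" using coef[of n] by (metis complex_cnj_cnj)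
    then show ?thesis by (simp add: power_mult_distrib)
  qed
  ultimately have "l u - a 0 * u ^ 0 = (- cnj \<beta> * u) * (1 / (1 - cnj b * u))"
    by (simp only:) (metis sums_unique2)
  then show ?thesis by (simp add: a_def algebra_simps)
qed

text \<open>Univalence makes the zero of g - p at \<open>u1\<close> simple and unique, so (g - p) /
  (u - u1) has a holomorphic reciprocal. Its value at \<open>u1\<close> is the residue and its
  difference quotient at \<open>u1\<close> is the holomorphic part \<open>h\<close>.\<close>

lemma simple_pole_split:
  assumes g: "g holomorphic_on S" "open S" "inj_on g S" and u1: "u1 \<in> S" "g u1 = p"
  obtains h where "h holomorphic_on S" "\<And>u. u \<in> S \<Longrightarrow> u \<noteq> u1 \<Longrightarrow> 1 / (g u - p) = h u + (1 / deriv g u1) / (u - u1)"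
proof -
  define q where "q = (\<lambda>u. if u = u1 then deriv g u1 else (g u - g u1) / (u - u1))"
  have q: "q holomorphic_on S" unfolding q_def by (rule pole_lemma_open[OF g(1,2)])
  have d: "deriv g u1 \<noteq> 0" using holomorphic_injective_imp_regular[OF g u1(1)] .
  have q0: "q u \<noteq> 0" if "u \<in> S" for u
    using that d g(3) u1 by (auto simp: q_def inj_on_def)
  define F where "F = (\<lambda>u. inverse (q u))"
  have F: "F holomorphic_on S" unfolding F_def using q q0 by (intro holomorphic_intros) auto
  define h where "h = (\<lambda>u. if u = u1 then deriv F u1 else (F u - F u1) / (u - u1))"
  have "h holomorphic_on S" unfolding h_def by (rule pole_lemma_open[OF F g(2)])
  moreover have "1 / (g u - p) = h u + (1 / deriv g u1) / (u - u1)" if "u \<in> S" "u \<noteq> u1" for u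
    using that q0[OF that(1)] u1 d by (simp add: h_def F_def q_def divide_simps)
  ultimately show ?thesis using that by blast
qed

text \<open>With l = log(g(u) / u), the term 2 ln |g| equals 2 ln |u| + l + cnj l, and ln |u| tends
  to 0 at the circle. The hypothesis thus takes the form treated by \<open>pole_reflection\<close>:
  holomorphic function plus simple pole plus cnj l tends to 0.\<close>

lemma univalent_map_formula:
  fixes g M :: "complex \<Rightarrow> complex" and \<alpha> w0 u1 :: complex and d \<delta> :: real
  assumes g: "g holomorphic_on ball 0 1" "inj_on g (ball 0 1)" "g 0 = 0" "deriv g 0 = of_real d" "d > 0"
    and u1: "cmod u1 < 1" "g u1 = 1 / w0" "w0 \<noteq> 0"
    and M: "M holomorphic_on ball 0 1"
    and lim: "\<And>e. e > 0 \<Longrightarrow> \<exists>r0<1. \<forall>u. r0 < cmod u \<and> cmod u < 1 \<longrightarrow>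
      cmod (2 * of_real (ln \<delta>) + 2 * of_real (ln (cmod (g u))) - M u - \<alpha> / (w0 * g u - 1)) < e"
    and u: "cmod u < 1"
  shows "g u = of_real d * u * exp (cnj (\<alpha> / (w0 * deriv g u1)) * u / (1 - cnj u1 * u))"
proof -
  define g1 where "g1 = (\<lambda>u. if u = 0 then deriv g 0 else (g u - g 0) / (u - 0))"
  have g1: "g1 holomorphic_on ball 0 1" unfolding g1_def by (rule pole_lemma_open[OF g(1)]) simp
  have gg: "g u = u * g1 u" for u using g(3) by (simp add: g1_def)
  have nz: "g u \<noteq> 0" if "u \<in> ball 0 1" "u \<noteq> 0" for u
    using g(2,3) that by (metis centre_in_ball inj_onD zero_less_one)
  have g1nz: "g1 u \<noteq> 0" if "u \<in> ball 0 1" for u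
    using nz[OF that] g(4,5) by (auto simp: g1_def g(3))
  have "simply_connected (ball (0::complex) 1)" by (intro convex_imp_simply_connected) auto
  then obtain l0 where l0: "l0 holomorphic_on ball 0 1" "\<And>u. u \<in> ball 0 1 \<Longrightarrow> g1 u = exp (l0 u)"
    using simply_connected_eq_holomorphic_log[OF open_ball] g1 g1nz by metis
  \<comment> \<open>The branch is fixed by l(0) = ln d, real because g'(0) = d > 0; this yields the
    positive real factor in the formula.\<close>
  define l where "l = (\<lambda>u. l0 u - l0 0 + of_real (ln d))"
  have l: "l holomorphic_on ball 0 1" unfolding l_def by (intro holomorphic_intros l0)
  have el: "exp (l u) = g1 u" if "u \<in> ball 0 1" for u
  proof -
    have "exp (l0 0) = of_real d" using l0(2)[of 0] g(4) by (simp add: g1_def)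
    moreover have "exp (complex_of_real (ln d)) = of_real d" using g(5) by (simp add: exp_of_real)
    ultimately show ?thesis using l0(2)[OF that] g(5) by (simp add: l_def exp_add exp_diff)
  qed
  \<comment> \<open>The residue at \<open>u1\<close> of -\<alpha> / (w0 g(u) - 1), since w0 g(u) - 1
    vanishes there with derivative w0 g'(u1).\<close>
  define \<beta> where "\<beta> = - (\<alpha> / (w0 * deriv g u1))"
  obtain h where h: "h holomorphic_on ball 0 1"
    "\<And>u. u \<in> ball 0 1 \<Longrightarrow> u \<noteq> u1 \<Longrightarrow> 1 / (g u - 1 / w0) = h u + (1 / deriv g u1) / (u - u1)"
    using simple_pole_split[OF g(1) open_ball g(2) _ u1(2)] u1(1) by (metis mem_ball_0)
  define K0 where "K0 = (\<lambda>u. 2 * of_real (ln \<delta>) - M u - \<alpha> / w0 * h u + l u)"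
  have K0: "K0 holomorphic_on ball 0 1" unfolding K0_def by (intro holomorphic_intros M h(1) l)
  have key: "K0 u + \<beta> / (u - u1) + cnj (l u) =
     (2 * of_real (ln \<delta>) + 2 * of_real (ln (cmod (g u))) - M u - \<alpha> / (w0 * g u - 1)) - 2 * of_real (ln (cmod u))"
    if "u \<in> ball 0 1" "u \<noteq> 0" "u \<noteq> u1" for u
  proof -
    have "\<alpha> / (w0 * g u - 1) = \<alpha> / w0 * (1 / (g u - 1 / w0))"
      using u1(3) by (simp add: divide_simps) (auto simp: algebra_simps)
    also have "\<dots> = \<alpha> / w0 * h u - \<beta> / (u - u1)"
      unfolding h(2)[OF that(1,3)] by (simp add: \<beta>_def algebra_simps)
    finally have 1: "\<alpha> / (w0 * g u - 1) = \<alpha> / w0 * h u - \<beta> / (u - u1)" .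
    have "cmod (g u) = cmod u * exp (Re (l u))"
      using el[OF that(1)] by (simp add: gg norm_mult flip: norm_exp_eq_Re)
    then have "ln (cmod (g u)) = ln (cmod u) + Re (l u)" using that(2) by (simp add: ln_mult)
    moreover have "l u + cnj (l u) = 2 * of_real (Re (l u))" by (simp add: complex_add_cnj)
    ultimately have 2: "2 * complex_of_real (ln (cmod (g u))) = 2 * of_real (ln (cmod u)) + (l u + cnj (l u))" by simp
    show ?thesis unfolding K0_def 1 2 by simp
  qed
  have klim: "\<exists>r0<1. \<forall>u. r0 < cmod u \<and> cmod u < 1 \<longrightarrow> cmod (K0 u + \<beta> / (u - u1) + cnj (l u)) < e" if "e > 0" for e
  proof -
    obtain r1 where r1: "r1 < 1" "\<And>u. r1 < cmod u \<and> cmod u < 1 \<Longrightarrow>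
      cmod (2 * of_real (ln \<delta>) + 2 * of_real (ln (cmod (g u))) - M u - \<alpha> / (w0 * g u - 1)) < e / 2"
      using lim[of "e / 2"] \<open>e > 0\<close> by auto
    \<comment> \<open>The entry exp(-e/4) makes |2 ln |u|| at most e/2, and 1/2 keeps u away from
      0.\<close>
    define r0 where "r0 = Max {r1, cmod u1, exp (- (e / 4)), 1/2}"
    have r0: "r0 < 1" "r1 \<le> r0" "cmod u1 \<le> r0" "exp (- (e / 4)) \<le> r0" "1/2 \<le> r0"
      using r1(1) u1(1) \<open>e > 0\<close> by (auto simp: r0_def)
    have "cmod (K0 u + \<beta> / (u - u1) + cnj (l u)) < e" if u: "r0 < cmod u" "cmod u < 1" for u
    proof -
      have un: "u \<in> ball 0 1" "u \<noteq> 0" "u \<noteq> u1" using u r0 by auto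
      have "exp (- (e / 4)) \<le> cmod u" using u r0 by linarith
      then have "- (e / 4) \<le> ln (cmod u)" using un(2) by (simp add: ln_ge_iff)
      moreover have "ln (cmod u) \<le> 0" using u un(2) by simp
      ultimately have "cmod (2 * complex_of_real (ln (cmod u))) \<le> e / 2" by (simp add: norm_mult)
      moreover have "cmod (2 * of_real (ln \<delta>) + 2 * of_real (ln (cmod (g u))) - M u - \<alpha> / (w0 * g u - 1)) < e / 2"
        using r1(2) u r0 by auto
      ultimately show ?thesis unfolding key[OF un]
        using norm_triangle_ineq4[of "2 * of_real (ln \<delta>) + 2 * of_real (ln (cmod (g u))) - M u - \<alpha> / (w0 * g u - 1)" "2 * complex_of_real (ln (cmod u))"]
        by linarith
    qed
    then show ?thesis using r0(1) by blast
  qed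
  have "l u = l 0 - cnj \<beta> * u / (1 - cnj u1 * u)"
    by (rule pole_reflection[OF l K0 u1(1) klim u])
  also have "l 0 = of_real (ln d)" by (simp add: l_def)
  finally have "exp (l u) = exp (of_real (ln d)) * exp (- (cnj \<beta> * u / (1 - cnj u1 * u)))"
    by (simp only: diff_conv_add_uminus exp_add)
  also have "exp (of_real (ln d)) = complex_of_real d" using g(5) by (simp add: exp_of_real)
  finally have "exp (l u) = of_real d * exp (- (cnj \<beta> * u / (1 - cnj u1 * u)))" .
  then show ?thesis using el[of u] u by (simp add: gg \<beta>_def mult_ac)
qed

section \<open>Testing the quadrature identity with Cauchy kernels\<close>

lemma tendsto_truncated_integral:
  fixes F :: "complex \<Rightarrow> complex"
  assumes S: "S \<in> sets borel" and F: "integrable lborel (\<lambda>w. indicator S w *\<^sub>R F w)"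
  shows "((\<lambda>R. integral (S \<inter> ball 0 R) F) \<longlongrightarrow> (LINT w|lborel. indicator S w *\<^sub>R F w)) at_top"
proof -
  have i: "integrable lborel (\<lambda>w. indicator (S \<inter> ball 0 R) w *\<^sub>R F w)" for R
  proof -
    have "integrable lborel (\<lambda>w. indicator (ball 0 R) w *\<^sub>R (indicator S w *\<^sub>R F w))"
      by (rule integrable_mult_indicator[OF _ F]) simp
    then show ?thesis by (simp add: indicator_inter_arith mult.commute)
  qed
  have "((\<lambda>R. LINT w|lborel. indicator (S \<inter> ball 0 R) w *\<^sub>R F w) \<longlongrightarrow> (LINT w|lborel. indicator S w *\<^sub>R F w)) at_top"
  proof (rule integral_dominated_convergence_at_top)
    show "integrable lborel (\<lambda>w. norm (indicator S w *\<^sub>R F w))" using F by (rule integrable_norm)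
    show "\<forall>\<^sub>F R in at_top. AE w in lborel. norm (indicator (S \<inter> ball 0 R) w *\<^sub>R F w) \<le> norm (indicator S w *\<^sub>R F w)"
      by (auto intro!: always_eventually AE_I2 simp: indicator_def)
    show "AE w in lborel. ((\<lambda>R. indicator (S \<inter> ball 0 R) w *\<^sub>R F w) \<longlongrightarrow> indicator S w *\<^sub>R F w) at_top"
    proof (rule AE_I2)
      fix w
      have "\<forall>\<^sub>F R in at_top. indicator S w *\<^sub>R F w = indicator (S \<inter> ball 0 R) w *\<^sub>R F w"
        using eventually_gt_at_top[of "cmod w"] by eventually_elim (auto simp: indicator_def)
      then show "((\<lambda>R. indicator (S \<inter> ball 0 R) w *\<^sub>R F w) \<longlongrightarrow> indicator S w *\<^sub>R F w) at_top"
        by (rule tendsto_cong[THEN iffD1]) (rule tendsto_const)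
    qed
  qed (use i F in \<open>auto intro: borel_measurable_integrable\<close>)
  moreover have "(LINT w|lborel. indicator (S \<inter> ball 0 R) w *\<^sub>R F w) = integral (S \<inter> ball 0 R) F" for R
    using set_borel_integral_eq_integral(2)[of "S \<inter> ball 0 R" F] i[of R]
    by (simp add: set_integrable_def set_lebesgue_integral_def)
  ultimately show ?thesis by simp
qed

text \<open>\<open>Rat_in\<close> constrains values only where the denominator \<open>q\<close> is
  nonzero, so the pole has to be found from polynomials: \<alpha> q and p (w - w0) agree off a
  finite set, hence identically, and evaluation at \<open>w0\<close> gives q(w0) = 0.\<close>

lemma pole_mem_of_Rat_in:
  assumes "(\<lambda>w. \<alpha> / (w - w0)) \<in> Rat_in \<Omega>" "\<alpha> \<noteq> 0"
  shows "Fin w0 \<in> \<Omega>"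
proof -
  obtain p q :: "complex poly" where pq: "q \<noteq> 0" "\<forall>z. poly q z \<noteq> 0 \<longrightarrow> \<alpha> / (z - w0) = poly p z / poly q z"
     "\<forall>z. poly q z = 0 \<longrightarrow> Fin z \<in> \<Omega>"
    using assms(1) unfolding Rat_in_def by blast
  have "poly q w0 = 0"
  proof (rule ccontr)
    assume n: "poly q w0 \<noteq> 0"
    define d where "d = smult \<alpha> q - p * [:- w0, 1:]"
    have "poly (d * (q * [:- w0, 1:])) z = 0" for z
    proof (cases "poly q z = 0 \<or> z = w0")
      case False
      then have "\<alpha> / (z - w0) = poly p z / poly q z" using pq by blast
      then have "\<alpha> * poly q z = poly p z * (z - w0)" using False by (simp add: divide_simps)
      then have "poly d z = 0" by (simp add: d_def algebra_simps)
      then show ?thesis by simp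
    qed auto
    then have "d * (q * [:- w0, 1:]) = 0" using poly_all_0_iff_0 by blast
    moreover have "[:- w0, 1:] \<noteq> 0" by simp
    ultimately have "d = 0" using pq(1) mult_eq_0_iff by blast
    then have "poly (smult \<alpha> q) w0 = poly (p * [:- w0, 1:]) w0" by (simp add: d_def)
    then show False using n assms(2) by simp
  qed
  then show ?thesis using pq by blast
qed

definition cauchy_test :: "complex \<Rightarrow> csph \<Rightarrow> complex" where
  "cauchy_test a p = (case p of Fin w \<Rightarrow> 1 / (w - a) | Infty \<Rightarrow> 0)"

text \<open>In the coordinate z = 1/w the kernel is z / (1 - a z), which settles analyticity and
  continuity at infinity. Its zero there is what makes it integrable against the weight.\<close>

lemma cauchy_test_L1a:
  assumes \<Omega>: "open \<Omega>" and \<delta>: "\<delta> > 0" "\<And>w. w \<in> closure (fin_part \<Omega>) \<Longrightarrow> \<delta> < cmod w"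
    and a: "a \<notin> closure (fin_part \<Omega>)"
  shows "cauchy_test a \<in> L1a_rho0 \<Omega>"
    and "integrable lborel (\<lambda>w. indicator (fin_part \<Omega>) w *\<^sub>R (1 / ((w - a) * of_real ((cmod w)\<^sup>2))))"
proof -
  let ?U = "fin_part \<Omega>"
  have O: "open ?U" using open_fin_part[OF \<Omega>] .
  have sub: "?U \<subseteq> {w. \<delta> < cmod w}" using \<delta>(2) closure_subset[of ?U] by blast
  have "integrable lborel (\<lambda>w. indicator ?U w *\<^sub>R (indicator {w. \<delta> < cmod w} w *\<^sub>R (1 / ((w - a) * of_real ((cmod w)\<^sup>2)))))"
    using O by (intro integrable_mult_indicator integrable_cauchy_kernel_weight \<delta>(1)) auto
  also have "(\<lambda>w. indicator ?U w *\<^sub>R (indicator {w. \<delta> < cmod w} w *\<^sub>R (1 / ((w - a) * of_real ((cmod w)\<^sup>2))))) =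
     (\<lambda>w. indicator ?U w *\<^sub>R (1 / ((w - a) * of_real ((cmod w)\<^sup>2))))"
    using sub by (auto simp: indicator_def fun_eq_iff)
  finally show int: "integrable lborel (\<lambda>w. indicator ?U w *\<^sub>R (1 / ((w - a) * of_real ((cmod w)\<^sup>2))))" .
  have "integrable lborel (\<lambda>w. indicator ?U w *\<^sub>R (cmod (cauchy_test a (Fin w)) / (cmod w)\<^sup>2))"
    using integrable_norm[OF int] by (simp add: cauchy_test_def norm_divide norm_mult norm_power)
  then have "(\<lambda>w. cmod (cauchy_test a (Fin w)) / (cmod w)\<^sup>2) integrable_on ?U"
    by (intro set_borel_integral_eq_integral(1)) (simp add: set_integrable_def)
  moreover have "sph_analytic_in (cauchy_test a) \<Omega>"
    unfolding sph_analytic_in_def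
  proof (intro conjI impI)
    show "(\<lambda>z. cauchy_test a (Fin z)) holomorphic_on ?U"
      unfolding cauchy_test_def using a closure_subset[of ?U] by (auto intro!: holomorphic_intros)
    \<comment> \<open>For |z| < r the product |a z| stays below 1, so the denominator 1 - a z has no
      zero.\<close>
    define r where "r = 1 / (cmod a + 1)"
    have "(\<lambda>z. z / (1 - a * z)) holomorphic_on ball 0 r"
    proof (intro holomorphic_intros)
      fix z :: complex assume "z \<in> ball 0 r"
      then have "cmod z < 1 / (cmod a + 1)" by (simp add: r_def)
      then have "cmod z * (cmod a + 1) < 1" by (simp add: pos_less_divide_eq add_nonneg_pos)
      moreover have "cmod z * cmod a \<le> cmod z * (cmod a + 1)" by (intro mult_left_mono) auto
      ultimately have "cmod (a * z) < 1" by (simp add: norm_mult mult.commute)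
      then show "1 - a * z \<noteq> 0" by auto
    qed
    then have "(\<lambda>z. if z = 0 then cauchy_test a Infty else cauchy_test a (Fin (inverse z))) holomorphic_on ball 0 r"
      by (rule holomorphic_transform) (auto simp: cauchy_test_def field_simps)
    moreover have "r > 0" by (simp add: r_def add_nonneg_pos)
    ultimately show "\<exists>r>0. (\<lambda>z. if z = 0 then cauchy_test a Infty else cauchy_test a (Fin (inverse z))) holomorphic_on ball 0 r"
      by blast
  qed
  moreover have "continuous_on (closure \<Omega>) (cauchy_test a)"
  proof -
    have cl: "p \<noteq> Fin 0" "p \<noteq> Fin a" if "p \<in> closure \<Omega>" for p
      using that \<delta> a unfolding fin_part_closure[symmetric] by (force simp: fin_part_def)+
    have eq: "cauchy_test a p = coinversion p / (1 - a * coinversion p)" if "p \<in> closure \<Omega>" for p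
      using cl[OF that] by (cases p) (auto simp: cauchy_test_def coinversion_def field_simps)
    have nz: "1 - a * coinversion p \<noteq> 0" if "p \<in> closure \<Omega>" for p
      using cl[OF that] by (cases p) (auto simp: coinversion_def field_simps)
    have "continuous_on (closure \<Omega>) coinversion"
      by (rule continuous_on_subset[OF continuous_on_coinversion]) (use cl in auto)
    then have "continuous_on (closure \<Omega>) (\<lambda>p. coinversion p / (1 - a * coinversion p))"
      using nz by (intro continuous_intros) auto
    then show ?thesis by (rule continuous_on_eq) (simp add: eq)
  qed
  ultimately show "cauchy_test a \<in> L1a_rho0 \<Omega>"
    by (simp add: L1a_rho0_def A_class_def)
qed

text \<open>Partial fractions split the integrand into kernels with poles at \<open>w0\<close> and
  \<open>a\<close>. Because the domain contains infinity, the total winding number is 0 at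
  \<open>w0\<close> inside and -1 at \<open>a\<close> outside, so only the second kernel
  contributes. The area integral converges absolutely and equals its principal value.\<close>

lemma quadrature_cauchy_test:
  assumes QD: "\<Omega> \<in> QD0 (\<lambda>w. \<alpha> / (w - w0))" and \<alpha>: "\<alpha> \<noteq> 0" and inf: "Infty \<in> \<Omega>"
    and \<delta>: "\<delta> > 0" "\<And>w. w \<in> closure (fin_part \<Omega>) \<Longrightarrow> \<delta> < cmod w"
    and a: "a \<notin> closure (fin_part \<Omega>)"
  shows "(LINT w|lborel. indicator (fin_part \<Omega>) w *\<^sub>R (1 / ((w - a) * of_real ((cmod w)\<^sup>2)))) = of_real pi * (\<alpha> / (w0 - a))"
proof -
  let ?U = "fin_part \<Omega>"
  have op: "open \<Omega>" using QD by (auto simp: QD0_def rectifiable_domain_def sph_domain_def)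
  have O: "open ?U" using open_fin_part[OF op] .
  have "Fin w0 \<in> \<Omega>" using QD inf \<alpha> pole_mem_of_Rat_in by (auto simp: QD0_def sph_bounded_def)
  then have w0: "w0 \<in> ?U" by (simp add: fin_part_def)
  obtain \<Gamma> where \<Gamma>: "boundary_cycle \<Omega> \<Gamma>" using QD by (auto simp: QD0_def rectifiable_domain_def)
  have "cauchy_test a \<in> L1a_rho0 \<Omega>" by (rule cauchy_test_L1a[OF op \<delta> a])
  then obtain I where I: "cycle_has_integral (\<lambda>w. cauchy_test a (Fin w) * (\<alpha> / (w - w0))) \<Gamma> I"
    "((\<lambda>R. integral (?U \<inter> ball 0 R) (\<lambda>w. cauchy_test a (Fin w) / (of_real ((cmod w)\<^sup>2))) / of_real pi)
                \<longlongrightarrow> I / (2 * of_real pi * \<i>)) at_top"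
    using QD \<Gamma> unfolding QD0_def by blast
  have img: "path_image \<gamma> \<subseteq> frontier ?U" if "\<gamma> \<in> set \<Gamma>" for \<gamma>
    using \<Gamma> that unfolding boundary_cycle_def fin_part_frontier by blast
  have wf: "w0 \<notin> frontier ?U" using w0 O frontier_disjoint_eq[of ?U] by blast
  have af: "a \<notin> frontier ?U" using a by (auto simp: frontier_def)
  have an: "a \<notin> ?U" using a closure_subset by blast
  have rect: "rectifiable_loop \<gamma>" if "\<gamma> \<in> set \<Gamma>" for \<gamma> using \<Gamma> that by (simp add: boundary_cycle_def)
  have wn: "(\<Sum>\<gamma>\<leftarrow>\<Gamma>. winding_number \<gamma> z) = (if z \<in> ?U then 1 else 0) - 1" if "z \<notin> frontier ?U" for z
    using \<Gamma> that inf unfolding boundary_cycle_def fin_part_frontier[symmetric] by (auto simp: fin_part_def)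
  have "w0 \<noteq> a" using w0 an by blast
  define C where "C = \<alpha> / (w0 - a)"
  have "cycle_sum (\<lambda>w. C * (1 / (w - w0) - 1 / (w - a))) \<Gamma> \<longlonglongrightarrow>
     C * (2 * of_real pi * \<i> * (\<Sum>\<gamma>\<leftarrow>\<Gamma>. winding_number \<gamma> w0) - 2 * of_real pi * \<i> * (\<Sum>\<gamma>\<leftarrow>\<Gamma>. winding_number \<gamma> a))"
    unfolding cycle_sum_cmult[abs_def] cycle_sum_diff[abs_def]
    by (intro tendsto_mult_left tendsto_diff cycle_sum_winding_number rect) (use img wf af in auto)
  moreover have "cycle_sum (\<lambda>w. C * (1 / (w - w0) - 1 / (w - a))) \<Gamma> =
      cycle_sum (\<lambda>w. cauchy_test a (Fin w) * (\<alpha> / (w - w0))) \<Gamma>"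
  proof (intro ext cycle_sum_cong)
    fix \<gamma> w assume "\<gamma> \<in> set \<Gamma>" "w \<in> path_image \<gamma>"
    then have "w \<noteq> w0" "w \<noteq> a" using img wf af by auto
    then show "C * (1 / (w - w0) - 1 / (w - a)) = cauchy_test a (Fin w) * (\<alpha> / (w - w0))"
      using \<open>w0 \<noteq> a\<close> by (simp add: C_def cauchy_test_def divide_simps)
  qed
  ultimately have "I = C * (2 * of_real pi * \<i>)"
    using LIMSEQ_unique[OF cycle_has_integral_cycle_sum[OF I(1)]] wn[OF wf] wn[OF af] w0 an by simp
  then have IC: "I / (2 * of_real pi * \<i>) = C" by simp
  have int: "integrable lborel (\<lambda>w. indicator ?U w *\<^sub>R (1 / ((w - a) * of_real ((cmod w)\<^sup>2))))"
    by (rule cauchy_test_L1a[OF op \<delta> a])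
  have "((\<lambda>R. integral (?U \<inter> ball 0 R) (\<lambda>w. 1 / ((w - a) * of_real ((cmod w)\<^sup>2)))) \<longlongrightarrow>
     (LINT w|lborel. indicator ?U w *\<^sub>R (1 / ((w - a) * of_real ((cmod w)\<^sup>2))))) at_top"
    by (rule tendsto_truncated_integral[OF _ int]) (use O in auto)
  then have "((\<lambda>R. integral (?U \<inter> ball 0 R) (\<lambda>w. 1 / ((w - a) * of_real ((cmod w)\<^sup>2))) / of_real pi) \<longlongrightarrow>
     (LINT w|lborel. indicator ?U w *\<^sub>R (1 / ((w - a) * of_real ((cmod w)\<^sup>2)))) / of_real pi) at_top"
    by (intro tendsto_divide tendsto_const) auto
  moreover have eq: "(\<lambda>w. cauchy_test a (Fin w) / (of_real ((cmod w)\<^sup>2))) = (\<lambda>w. 1 / ((w - a) * of_real ((cmod w)\<^sup>2)))"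
    by (simp add: cauchy_test_def)
  note I(2)[unfolded IC eq]
  ultimately have "(LINT w|lborel. indicator ?U w *\<^sub>R (1 / ((w - a) * of_real ((cmod w)\<^sup>2)))) / of_real pi = C"
    by (rule tendsto_unique[OF trivial_limit_at_top_linorder])
  then show ?thesis by (simp add: C_def field_simps)
qed

text \<open>Since \<open>{|w| > \<delta>} = \<Omega> \<union> E\<close> with \<open>E\<close> bounded, the Cauchy transform of \<open>|w|^-2\<close> over \<open>\<Omega>\<close> is the explicit one
  over \<open>{|w| > \<delta>}\<close> minus the one over \<open>E\<close>, which is holomorphic in \<open>\<Omega>\<close>.\<close>
lemma quadrature_boundary_identity:
  assumes QD: "\<Omega> \<in> QD0 (\<lambda>w. \<alpha> / (w - w0))" and \<alpha>: "\<alpha> \<noteq> 0" and inf: "Infty \<in> \<Omega>"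
    and \<delta>: "\<delta> > 0" "\<And>w. w \<in> closure (fin_part \<Omega>) \<Longrightarrow> \<delta> < cmod w"
  obtains N R B where "N holomorphic_on fin_part \<Omega>" "R > 0" "\<And>a. cmod a \<ge> R \<Longrightarrow> cmod (a * N a) \<le> B"
    "continuous_on UNIV N"
    "\<And>a. a \<in> frontier (fin_part \<Omega>) \<Longrightarrow>
       2 * of_real (ln \<delta>) - 2 * of_real (ln (cmod a)) - a * N a - a * \<alpha> / (w0 - a) = 0"
proof -
  let ?U = "fin_part \<Omega>"
  have op: "open \<Omega>" using QD by (auto simp: QD0_def rectifiable_domain_def sph_domain_def)
  have U: "open ?U" using open_fin_part[OF op] .
  have reg: "?U = interior (closure ?U)"
    using QD fin_part_interior[of "closure \<Omega>"] by (auto simp: QD0_def fin_part_closure)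
  have "Fin w0 \<in> \<Omega>" using QD inf \<alpha> pole_mem_of_Rat_in by (auto simp: QD0_def sph_bounded_def)
  then have w0: "w0 \<in> ?U" by (simp add: fin_part_def)
  obtain R0 where R0: "\<And>z. R0 < cmod z \<Longrightarrow> z \<in> ?U"
    using op inf by (auto simp: open_csph_def fin_part_def)
  define R where "R = \<bar>R0\<bar> + 1"
  have R: "R > 0" "\<And>z. z \<notin> ?U \<Longrightarrow> cmod z \<le> R"
    using R0 by (auto simp: R_def not_less[symmetric])
  define E where "E = {w. \<delta> < cmod w} - ?U"
  \<comment> \<open>\<open>E\<close> need not be closed, because of the circle |w| = \<delta>.
    \<open>C\<close> is a closed superset that still avoids the domain, so the transform is
    holomorphic on the domain.\<close>
  define C where "C = {w. \<delta> \<le> cmod w} - ?U"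
  define \<mu> where "\<mu> = (\<lambda>w. 1 / complex_of_real ((cmod w)\<^sup>2))"
  have od: "open {w::complex. \<delta> < cmod w}" by (intro open_Collect_less continuous_intros)
  have "closed {w::complex. \<delta> \<le> cmod w}" by (intro closed_Collect_le continuous_intros)
  then have C: "closed C" "E \<subseteq> C" using U by (auto simp: C_def E_def intro: closed_Diff)
  have E: "E \<in> sets borel" using od U by (auto simp: E_def)
  have \<mu>: "\<mu> \<in> borel_measurable borel"
    unfolding \<mu>_def by (intro borel_measurable_divide borel_measurable_continuous_onI continuous_intros)
  have fin: "emeasure lborel E < \<infinity>"
  proof -
    have "E \<subseteq> cball 0 R" using R by (auto simp: E_def)
    then have "emeasure lborel E \<le> emeasure lborel (cball (0::complex) R)" by (intro emeasure_mono) auto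
    also have "\<dots> < \<infinity>" using emeasure_lborel_cball_finite by blast
    finally show ?thesis .
  qed
  have M: "cmod (\<mu> w) \<le> 1 / \<delta>\<^sup>2" if "w \<in> E" for w
    using that \<delta>(1) by (auto simp: E_def \<mu>_def norm_divide norm_power intro!: divide_left_mono power_mono mult_pos_pos)
  have M0: "0 \<le> 1 / \<delta>\<^sup>2" by simp
  define N where "N = (\<lambda>a. cauchy_transform E \<mu> a / of_real pi)"
  have "cauchy_transform E \<mu> holomorphic_on - C"
    by (rule holomorphic_cauchy_transform[OF E \<mu> fin M M0 C])
  then have "N holomorphic_on ?U" unfolding N_def
    by (intro holomorphic_intros) (auto simp: C_def elim: holomorphic_on_subset)
  moreover have "cmod (a * N a) \<le> 2 * (1 / \<delta>\<^sup>2) * measure lborel E / pi" if "2 * R \<le> cmod a" for a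
  proof -
    have "cmod (a * cauchy_transform E \<mu> a) \<le> 2 * (1 / \<delta>\<^sup>2) * measure lborel E"
      by (rule cauchy_transform_at_infinity[OF E \<mu> fin M M0 _ R(1) that]) (use R in \<open>auto simp: E_def\<close>)
    then have "cmod (a * cauchy_transform E \<mu> a) / pi \<le> 2 * (1 / \<delta>\<^sup>2) * measure lborel E / pi"
      by (rule divide_right_mono) simp
    then show ?thesis by (simp only: N_def norm_divide norm_mult times_divide_eq_right norm_of_real) simp
  qed
  moreover have cN: "continuous_on UNIV N" unfolding N_def
    by (intro continuous_intros continuous_cauchy_transform[OF E \<mu> fin M M0]) auto
  moreover
  define \<Theta> where "\<Theta> = (\<lambda>a. 2 * of_real (ln \<delta>) - 2 * of_real (ln (cmod a)) - a * N a - a * \<alpha> / (w0 - a))"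
  have ext: "\<Theta> a = 0" if a: "a \<notin> closure ?U" "\<delta> < cmod a" for a
  proof -
    let ?k = "\<lambda>w. 1 / ((w - a) * of_real ((cmod w)\<^sup>2))"
    have i1: "integrable lborel (\<lambda>w. indicator ?U w *\<^sub>R ?k w)"
      by (rule cauchy_test_L1a[OF op \<delta> a(1)])
    have kE: "?k w = \<mu> w / (w - a)" for w by (simp add: \<mu>_def)
    have i2: "integrable lborel (\<lambda>w. indicator E w *\<^sub>R ?k w)"
      unfolding kE by (rule integrable_cauchy_kernel[OF E \<mu> fin M M0 zero_less_one])
    have sub: "?U \<subseteq> {w. \<delta> < cmod w}" using \<delta>(2) closure_subset by blast
    have "(LINT w|lborel. indicator {w. \<delta> < cmod w} w *\<^sub>R ?k w) =
       (LINT w|lborel. indicator ?U w *\<^sub>R ?k w + indicator E w *\<^sub>R ?k w)"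
      using sub by (intro Bochner_Integration.integral_cong) (auto simp: E_def indicator_def)
    also have "\<dots> = (LINT w|lborel. indicator ?U w *\<^sub>R ?k w) + (LINT w|lborel. indicator E w *\<^sub>R ?k w)"
      by (rule Bochner_Integration.integral_add[OF i1 i2])
    also have "(LINT w|lborel. indicator E w *\<^sub>R ?k w) = of_real pi * N a"
      unfolding kE N_def cauchy_transform_def by simp
    also have "(LINT w|lborel. indicator ?U w *\<^sub>R ?k w) = of_real pi * (\<alpha> / (w0 - a))"
      by (rule quadrature_cauchy_test[OF QD \<alpha> inf \<delta> a(1)])
    finally have "- 2 * of_real pi * of_real (ln (cmod a) - ln \<delta>) / a = of_real pi * (\<alpha> / (w0 - a)) + of_real pi * N a"
      unfolding integral_cauchy_kernel_weight[OF \<delta>(1) a(2)] .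
    then have "of_real pi * (- 2 * of_real (ln (cmod a) - ln \<delta>) / a) = of_real pi * (\<alpha> / (w0 - a) + N a)"
      by (simp only: distrib_left times_divide_eq_right mult_ac)
    then have "- 2 * of_real (ln (cmod a) - ln \<delta>) / a = \<alpha> / (w0 - a) + N a"
      by (simp only: mult_cancel_left of_real_eq_0_iff pi_neq_zero simp_thms)
    moreover have "a \<noteq> 0" using a(2) \<delta>(1) by auto
    ultimately have "- 2 * of_real (ln (cmod a) - ln \<delta>) = (\<alpha> / (w0 - a) + N a) * a"
      by (simp add: divide_eq_eq)
    then show ?thesis by (simp add: \<Theta>_def algebra_simps)
  qed
  have "\<Theta> a = 0" if a: "a \<in> frontier ?U" for a
  proof -
    have ac: "a \<in> closure ?U" "a \<notin> ?U" using a U frontier_disjoint_eq[of ?U] by (auto simp: frontier_def interior_open)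
    have da: "\<delta> < cmod a" using \<delta>(2) ac by blast
    \<comment> \<open>Here the condition \<Omega> = Int(closure) enters: every frontier point is a
      limit of exterior points, where the identity \<Theta> = 0 is already known.\<close>
    have "a \<in> closure (- closure ?U)" using ac(2) reg by (simp add: closure_interior[of "- closure ?U"])
    then obtain x where x: "\<And>n. x n \<in> - closure ?U" "x \<longlonglongrightarrow> a" unfolding closure_sequential by blast
    have "(\<lambda>n. cmod (x n)) \<longlonglongrightarrow> cmod a" by (intro tendsto_intros x)
    then have "\<forall>\<^sub>F n in sequentially. \<delta> < cmod (x n)" using da by (rule order_tendstoD)
    then have ev: "\<forall>\<^sub>F n in sequentially. \<Theta> (x n) = 0"
      by eventually_elim (use x ext in auto)
    have "isCont N a" using cN by (simp add: continuous_on_eq_continuous_at)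
    then have "(\<lambda>n. N (x n)) \<longlonglongrightarrow> N a" using x(2) by (rule isCont_tendsto_compose)
    moreover have "a \<noteq> w0" "cmod a \<noteq> 0" using ac w0 da \<delta>(1) by auto
    ultimately have "(\<lambda>n. \<Theta> (x n)) \<longlonglongrightarrow> \<Theta> a"
      unfolding \<Theta>_def using x(2) by (intro tendsto_intros) auto
    moreover have "(\<lambda>n. \<Theta> (x n)) \<longlonglongrightarrow> 0"
      using ev by (rule tendsto_eventually)
    ultimately show ?thesis by (rule LIMSEQ_unique)
  qed
  ultimately show ?thesis using that[of N "2 * R" "2 * (1 / \<delta>\<^sup>2) * measure lborel E / pi"] R(1) by (simp add: \<Theta>_def)
qed

section \<open>The Riemann map of the inverted domain\<close>

lemma normalized_riemann_map:
  assumes V: "open V" "simply_connected V" "0 \<in> V" "V \<noteq> UNIV"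
  obtains f g :: "complex \<Rightarrow> complex" and d :: real where
    "f holomorphic_on V" "g holomorphic_on ball 0 1" "\<forall>p\<in>V. f p \<in> ball 0 1 \<and> g (f p) = p"
    "\<forall>u\<in>ball 0 1. g u \<in> V \<and> f (g u) = u" "g 0 = 0" "d > 0" "deriv g 0 = of_real d"
proof -
  obtain f0 g0 where f0: "f0 holomorphic_on V" "\<forall>z\<in>V. f0 z \<in> ball 0 1 \<and> g0 (f0 z) = z"
    and g0: "g0 holomorphic_on ball 0 1" "\<forall>z\<in>ball 0 1. g0 z \<in> V \<and> f0 (g0 z) = z"
    using Riemann_mapping_theorem[of V] V by blast
  obtain F G where F: "F (f0 0) = 0" "F holomorphic_on ball 0 1" "F ` ball 0 1 \<subseteq> ball 0 1"
     "\<And>z. z \<in> ball 0 1 \<Longrightarrow> F (G z) = z" and G: "G holomorphic_on ball 0 1" "G ` ball 0 1 \<subseteq> ball 0 1"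
     "\<And>z. z \<in> ball 0 1 \<Longrightarrow> G (F z) = z"
    using ball_biholomorphism_exists[of "f0 0"] f0 V(3) by metis
  define g1 where "g1 = g0 \<circ> G"
  define f1 where "f1 = F \<circ> f0"
  have g1: "g1 holomorphic_on ball 0 1" unfolding g1_def
    by (rule holomorphic_on_compose_gen[OF G(1) g0(1) G(2)])
  have f1: "f1 holomorphic_on V" unfolding f1_def
    by (rule holomorphic_on_compose_gen[OF f0(1) F(2)]) (use f0 in auto)
  have fg1: "f1 p \<in> ball 0 1 \<and> g1 (f1 p) = p" if "p \<in> V" for p
  proof -
    have "f0 p \<in> ball 0 1" "g0 (f0 p) = p" using that f0(2) by auto
    moreover from this have "F (f0 p) \<in> ball 0 1" using F(3) by blast
    ultimately show ?thesis using G(3)[of "f0 p"] by (simp add: f1_def g1_def)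
  qed
  have gf1: "g1 u \<in> V \<and> f1 (g1 u) = u" if "u \<in> ball 0 1" for u
  proof -
    have "G u \<in> ball 0 1" using G(2) that by blast
    then show ?thesis using that g0(2) F(4) by (simp add: f1_def g1_def)
  qed
  have "f1 0 = 0" using F(1) by (simp add: f1_def)
  then have g10: "g1 0 = 0" using fg1[OF V(3)] by simp
  have inj1: "inj_on g1 (ball 0 1)" using gf1 by (metis inj_onI)
  define D where "D = deriv g1 0"
  have D: "D \<noteq> 0" unfolding D_def using holomorphic_injective_imp_regular[OF g1 open_ball inj1] by simp
  \<comment> \<open>Precomposing with the rotation u -> e u multiplies the derivative D at 0 by e
    and turns it into |D|.\<close>
  define e where "e = cnj D / of_real (cmod D)"
  have e: "cmod e = 1" "D * e = of_real (cmod D)" "cnj e * e = 1"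
  proof -
    show "cmod e = 1" using D by (simp add: e_def norm_divide)
    then show "cnj e * e = 1" using complex_norm_square[of e] by (simp add: mult.commute)
    show "D * e = of_real (cmod D)"
      using D complex_norm_square[of D] by (simp add: e_def power2_eq_square field_simps)
  qed
  define g where "g = (\<lambda>u. g1 (e * u))"
  define f where "f = (\<lambda>p. cnj e * f1 p)"
  have eb: "e * u \<in> ball 0 1 \<longleftrightarrow> u \<in> ball 0 1" "cnj e * u \<in> ball 0 1 \<longleftrightarrow> u \<in> ball 0 1" for u
    using e(1) by (simp_all add: norm_mult)
  show ?thesis
  proof
    show "f holomorphic_on V" unfolding f_def by (intro holomorphic_intros f1)
    have "(g1 \<circ> (\<lambda>u. e * u)) holomorphic_on ball 0 1"
      by (rule holomorphic_on_compose_gen[OF _ g1]) (use eb in \<open>auto intro!: holomorphic_intros\<close>)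
    then show "g holomorphic_on ball 0 1" by (simp add: g_def comp_def)
    have "f p \<in> ball 0 1 \<and> g (f p) = p" if "p \<in> V" for p
    proof -
      have c1: "e * (cnj e * f1 p) = f1 p" using e(3) by (metis mult.assoc mult.commute mult_1)
      show ?thesis using fg1[OF that] eb(2)[of "f1 p"] unfolding f_def g_def c1 by blast
    qed
    then show "\<forall>p\<in>V. f p \<in> ball 0 1 \<and> g (f p) = p" by blast
    have "g u \<in> V \<and> f (g u) = u" if "u \<in> ball 0 1" for u
    proof -
      have "e * u \<in> ball 0 1" using that eb by simp
      then show ?thesis using gf1[of "e * u"] e(3) by (simp add: f_def g_def mult.assoc[symmetric])
    qed
    then show "\<forall>u\<in>ball 0 1. g u \<in> V \<and> f (g u) = u" by blast
    show "g 0 = 0" using g10 by (simp add: g_def)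
    show "cmod D > 0" using D by simp
    have "(g1 has_field_derivative D) (at (e * 0))"
      unfolding D_def using holomorphic_derivI[OF g1 open_ball, of 0] by simp
    then have "((\<lambda>u. g1 (e * u)) has_field_derivative D * e) (at 0)"
      by (rule DERIV_chain2) (auto intro!: derivative_eq_intros)
    then show "deriv g 0 = of_real (cmod D)" using e(2) by (simp add: g_def DERIV_imp_deriv)
  qed
qed

text \<open>The inverse \<open>f\<close> maps every point of V into the open disc and is continuous,
  so if |u| tends to 1, the points g(u) can accumulate only on the frontier. Compactness of the
  closure of V makes the convergence uniform, although \<open>g\<close> itself may have no limits at
  the circle.\<close>

lemma tendsto_boundary_of_riemann_map:
  fixes f g h :: "complex \<Rightarrow> complex"
  assumes V: "open V" "bounded V" and f: "continuous_on V f" "\<And>p. p \<in> V \<Longrightarrow> f p \<in> ball 0 1"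
    and g: "\<And>u. u \<in> ball 0 1 \<Longrightarrow> g u \<in> V \<and> f (g u) = u"
    and h: "\<And>p x. \<lbrakk>p \<in> frontier V; \<And>n. x n \<in> V; x \<longlonglongrightarrow> p\<rbrakk> \<Longrightarrow> (\<lambda>n::nat. h (x n)) \<longlonglongrightarrow> 0"
    and "e > 0"
  shows "\<exists>r0<1. \<forall>u. r0 < cmod u \<and> cmod u < 1 \<longrightarrow> cmod (h (g u)) < e"
proof (rule ccontr)
  assume neg: "\<not> ?thesis"
  have "\<exists>u. 1 - inverse (real (Suc n)) < cmod u \<and> cmod u < 1 \<and> \<not> cmod (h (g u)) < e" for n
  proof -
    have "1 - inverse (real (Suc n)) < 1" by simp
    then show ?thesis using neg by blast
  qed
  then obtain x where x: "\<And>n. 1 - inverse (real (Suc n)) < cmod (x n)" "\<And>n. cmod (x n) < 1"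
    "\<And>n. \<not> cmod (h (g (x n))) < e" by metis
  have gx: "g (x n) \<in> V" "f (g (x n)) = x n" for n using g[of "x n"] x(2) by auto
  have "compact (closure V)" using V(2) by simp
  then obtain p r where p: "p \<in> closure V" "strict_mono r" "((\<lambda>n. g (x n)) \<circ> r) \<longlonglongrightarrow> p"
    using gx closure_subset unfolding compact_def by (metis (no_types, lifting) subsetD)
  then have lim: "(\<lambda>n. g (x (r n))) \<longlonglongrightarrow> p" by (simp add: comp_def)
  have "(\<lambda>n. 1 - inverse (real (Suc n))) \<longlonglongrightarrow> 1 - 0"
    by (intro tendsto_intros LIMSEQ_inverse_real_of_nat)
  then have l1: "(\<lambda>n. 1 - inverse (real (Suc n))) \<longlonglongrightarrow> 1" by simp
  have "\<forall>\<^sub>F n in sequentially. 1 - inverse (real (Suc n)) \<le> cmod (x n)"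
    "\<forall>\<^sub>F n in sequentially. cmod (x n) \<le> 1"
    using x(1,2) by (auto intro!: always_eventually less_imp_le simp del: of_nat_Suc)
  from tendsto_sandwich[OF this l1 tendsto_const] have "(\<lambda>n. cmod (x n)) \<longlonglongrightarrow> 1" .
  then have nx: "(\<lambda>n. cmod (x (r n))) \<longlonglongrightarrow> 1" using p(2) LIMSEQ_subseq_LIMSEQ by (fastforce simp: comp_def)
  have "p \<notin> V"
  proof
    assume pV: "p \<in> V"
    then have "isCont f p" using f(1) V(1) by (simp add: continuous_on_eq_continuous_at)
    then have "(\<lambda>n. f (g (x (r n)))) \<longlonglongrightarrow> f p" using lim by (rule isCont_tendsto_compose)
    then have "(\<lambda>n. cmod (x (r n))) \<longlonglongrightarrow> cmod (f p)" unfolding gx by (rule tendsto_norm)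
    then have "cmod (f p) = 1" using nx LIMSEQ_unique by blast
    then show False using f(2)[OF pV] by simp
  qed
  then have "p \<in> frontier V" using p(1) V(1) by (simp add: frontier_def interior_open)
  then have "(\<lambda>n. h (g (x (r n)))) \<longlonglongrightarrow> 0" by (rule h[OF _ gx(1) lim])
  then have "\<forall>\<^sub>F n in sequentially. dist (h (g (x (r n)))) 0 < e" using \<open>e > 0\<close> tendstoD by blast
  then show False using x(3) by (auto simp: eventually_sequentially)
qed

text \<open>The conclusion exports \<open>g\<close> next to the formula: injectivity and image of
  the exterior map and its derivative at \<open>z1\<close> are all read off from
  \<open>g\<close>.\<close>

theorem quadrature_domain_imp_map:
  assumes \<alpha>: "\<alpha> \<noteq> 0" and w0n: "w0 \<noteq> 0" and dom: "sph_domain \<Omega>" and ub: "\<not> sph_bounded \<Omega>"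
    and sc: "simply_connected \<Omega>" and z\<Omega>: "Fin 0 \<notin> \<Omega>"
    and QD: "\<Omega> \<in> QD0 (\<lambda>w. \<alpha> / (w - w0))"
  obtains c :: real and lam z1 :: complex and g where "c > 0" "cmod z1 > 1"
    "g holomorphic_on ball 0 1" "inj_on g (ball 0 1)" "g 0 = 0" "g ` ball 0 1 = inversion -` \<Omega>" "g (1 / z1) = 1 / w0"
    "\<And>z. cmod z > 1 \<Longrightarrow> of_real c * z * exp (lam / (1 - z * cnj z1)) = 1 / g (1 / z)"
    "lam = cnj (\<alpha> * z1 / (w0 * deriv g (1 / z1)))"
proof -
  have op: "open \<Omega>" using dom by (simp add: sph_domain_def)
  have fr: "Fin 0 \<notin> frontier \<Omega>" "Infty \<notin> frontier \<Omega>" using QD by (auto simp: QD0_def)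
  have inf: "Infty \<in> \<Omega>" by (rule Infty_mem_of_unbounded[OF op fr(2) ub])
  let ?U = "fin_part \<Omega>"
  have U: "open ?U" by (rule open_fin_part[OF op])
  have "0 \<notin> closure ?U"
    using fr(1) z\<Omega> interior_subset[of \<Omega>] unfolding fin_part_closure[symmetric] by (auto simp: fin_part_def frontier_def)
  then obtain \<delta>' where \<delta>': "\<delta>' > 0" "\<And>w. w \<in> closure ?U \<Longrightarrow> \<delta>' \<le> cmod w"
    using separate_point_closed[OF closed_closure] by (metis dist_0_norm)
  \<comment> \<open>Halving the distance gives a strict inequality on the closure, as the cutoff |w|
    > \<delta> requires.\<close>
  define \<delta> where "\<delta> = \<delta>' / 2"
  have \<delta>: "\<delta> > 0" "\<And>w. w \<in> closure ?U \<Longrightarrow> \<delta> < cmod w" using \<delta>' by (force simp: \<delta>_def)+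
  obtain N R B where N: "N holomorphic_on ?U" "R > 0" "\<And>a. cmod a \<ge> R \<Longrightarrow> cmod (a * N a) \<le> B"
    "continuous_on UNIV N"
    and bd: "\<And>a. a \<in> frontier ?U \<Longrightarrow>
       2 * of_real (ln \<delta>) - 2 * of_real (ln (cmod a)) - a * N a - a * \<alpha> / (w0 - a) = 0"
    using quadrature_boundary_identity[OF QD \<alpha> inf \<delta>] by metis
  have "Fin w0 \<in> \<Omega>" using QD inf \<alpha> pole_mem_of_Rat_in by (auto simp: QD0_def sph_bounded_def)
  define V where "V = inversion -` \<Omega>"
  have V0: "0 \<in> V" using inf by (simp add: V_def inversion_def)
  have VU: "inverse v \<in> ?U" if "v \<in> V" "v \<noteq> 0" for v using that by (simp add: V_def inversion_def fin_part_def)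
  have UV: "inverse w \<in> V" "w \<noteq> 0" if "w \<in> ?U" for w
  proof -
    show "w \<noteq> 0" using that z\<Omega> by (auto simp: fin_part_def)
    then show "inverse w \<in> V" using that by (simp add: V_def inversion_def fin_part_def)
  qed
  have oV: "open V" unfolding V_def by (rule open_vimage_inversion[OF op])
  have Vb: "cmod v < 1 / \<delta>" if "v \<in> V" for v
  proof (cases "v = 0")
    case False
    have "\<delta> < cmod (inverse v)" using VU[OF that False] \<delta>(2) closure_subset by blast
    then show ?thesis using False \<delta>(1) by (simp add: norm_divide field_simps)
  qed (use \<delta>(1) in simp)
  have "complex_of_real (1 / \<delta>) \<notin> V" using Vb[of "complex_of_real (1 / \<delta>)"] \<delta>(1) by (auto simp: norm_divide)
  then have "V \<noteq> UNIV" by blast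
  have "simply_connected V" using simply_connected_inversion[OF sc z\<Omega>] by (simp add: V_def)
  then obtain f g d where fg: "f holomorphic_on V" "g holomorphic_on ball 0 1"
    "\<forall>p\<in>V. f p \<in> ball 0 1 \<and> g (f p) = p" "\<forall>u\<in>ball 0 1. g u \<in> V \<and> f (g u) = u" "g 0 = 0"
    and d: "d > 0" "deriv g 0 = complex_of_real d"
    using normalized_riemann_map[OF oV _ V0 \<open>V \<noteq> UNIV\<close>] by blast
  have f: "f holomorphic_on V" "\<And>p. p \<in> V \<Longrightarrow> f p \<in> ball 0 1 \<and> g (f p) = p"
    and g: "g holomorphic_on ball 0 1" "\<And>u. u \<in> ball 0 1 \<Longrightarrow> g u \<in> V \<and> f (g u) = u" "g 0 = 0"
    using fg by blast+
  have inj: "inj_on g (ball 0 1)" using g(2) by (metis inj_onI)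
  have gnz: "g u \<noteq> 0" if "u \<in> ball 0 1" "u \<noteq> 0" for u
    using inj g(3) that by (metis centre_in_ball inj_onD zero_less_one)
  have gV: "g ` ball 0 1 = V"
  proof (intro equalityI subsetI)
    fix p assume "p \<in> V"
    then show "p \<in> g ` ball 0 1" using f(2)[of p] by (intro image_eqI[of p g "f p"]) auto
  qed (use g(2) in blast)
  define u1 where "u1 = f (1 / w0)"
  have "1 / w0 \<in> V" using UV(1)[of w0] \<open>Fin w0 \<in> \<Omega>\<close> by (simp add: fin_part_def inverse_eq_divide)
  then have u1: "cmod u1 < 1" "g u1 = 1 / w0" using f(2)[of "1 / w0"] by (simp_all add: u1_def)
  have u1n: "u1 \<noteq> 0" using u1(2) g(3) w0n by auto
  \<comment> \<open>The pullback of a N(a) along a = 1 / g(u). At u = 0, the preimage of infinity,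
    it is meaningless but bounded nearby, and so extends holomorphically to
    \<open>M\<close>.\<close>
  define M0 where "M0 = (\<lambda>u. inverse (g u) * N (inverse (g u)))"
  have M0h: "M0 holomorphic_on ball 0 1 - {0}"
  proof -
    have i: "(\<lambda>u. inverse (g u)) holomorphic_on ball 0 1 - {0}"
      using gnz by (intro holomorphic_intros holomorphic_on_subset[OF g(1)]) auto
    have "(N \<circ> (\<lambda>u. inverse (g u))) holomorphic_on ball 0 1 - {0}"
    proof (rule holomorphic_on_compose_gen[OF i N(1)])
      have "inverse (g u) \<in> ?U" if "u \<in> ball 0 1 - {0}" for u
        using VU[of "g u"] g(2)[of u] gnz[of u] that by blast
      then show "(\<lambda>u. inverse (g u)) ` (ball 0 1 - {0}) \<subseteq> ?U" by blast
    qed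
    from holomorphic_on_mult[OF i this] show ?thesis by (simp add: M0_def comp_def)
  qed
  have "\<exists>B. \<forall>\<^sub>F u in at 0. cmod (M0 u) \<le> B"
  proof -
    have "isCont g 0"
      using holomorphic_on_imp_continuous_on[OF g(1)] by (simp add: continuous_on_eq_continuous_at)
    then have "(g \<longlongrightarrow> 0) (at 0)" using g(3) by (simp add: isCont_def)
    then have "\<forall>\<^sub>F u in at 0. dist (g u) 0 < 1 / R" using N(2) by (intro tendstoD) auto
    moreover have "\<forall>\<^sub>F u in at 0. u \<in> ball 0 1 - {0::complex}"
      using eventually_at_in_open[of "ball 0 1" "0::complex"] by simp
    ultimately have "\<forall>\<^sub>F u in at 0. cmod (M0 u) \<le> B"
    proof eventually_elim
      fix u assume u: "dist (g u) 0 < 1 / R" "u \<in> ball 0 1 - {0}"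
      then have "g u \<noteq> 0" using gnz by blast
      then have "R \<le> cmod (inverse (g u))" using u(1) N(2) by (simp add: norm_divide field_simps)
      then show "cmod (M0 u) \<le> B" unfolding M0_def by (rule N(3))
    qed
    then show ?thesis by blast
  qed
  then obtain M where M: "M holomorphic_on ball 0 1" "\<forall>z\<in>ball 0 1 - {0}. M z = M0 z"
    using holomorphic_on_extend_bounded[OF M0h] by auto
  \<comment> \<open>The expression in \<open>bd\<close> rewritten for v = 1/a, where ln |a| = -ln
    |v| and a \<alpha> / (w0 - a) = \<alpha> / (w0 v - 1).\<close>
  define h where "h = (\<lambda>v. 2 * of_real (ln \<delta>) + 2 * of_real (ln (cmod v)) - inverse v * N (inverse v) - \<alpha> / (w0 * v - 1))"
  have hlim: "(\<lambda>n. h (x n)) \<longlonglongrightarrow> 0" if p: "p \<in> frontier V" and x: "\<And>n. x n \<in> V" "x \<longlonglongrightarrow> p" for p and x :: "nat \<Rightarrow> complex"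
  proof -
    have pV: "p \<notin> V" using p oV frontier_disjoint_eq by blast
    then have pn: "p \<noteq> 0" using V0 by auto
    have iU: "inverse p \<notin> ?U" using UV(1)[of "inverse p"] pV by auto
    have "\<forall>\<^sub>F n in sequentially. x n \<noteq> 0" using x(2) pn by (rule tendsto_imp_eventually_ne)
    then have "\<forall>\<^sub>F n in sequentially. inverse (x n) \<in> closure ?U"
      by eventually_elim (use VU x(1) closure_subset in blast)
    moreover have ix: "(\<lambda>n. inverse (x n)) \<longlonglongrightarrow> inverse p" using x(2) pn by (intro tendsto_intros)
    ultimately have "inverse p \<in> closure ?U"
      by (intro Lim_in_closed_set[OF closed_closure]) auto
    then have fp: "inverse p \<in> frontier ?U" using iU U by (simp add: frontier_def interior_open)
    have pw: "w0 * p \<noteq> 1"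
    proof
      assume "w0 * p = 1"
      then have "p = 1 / w0" using w0n by (simp add: field_simps)
      then show False using pV \<open>1 / w0 \<in> V\<close> by simp
    qed
    have "isCont N (inverse p)" using N(4) by (simp add: continuous_on_eq_continuous_at)
    then have "(\<lambda>n. N (inverse (x n))) \<longlonglongrightarrow> N (inverse p)" using ix by (rule isCont_tendsto_compose)
    then have "(\<lambda>n. h (x n)) \<longlonglongrightarrow> h p"
      unfolding h_def using x(2) pn pw by (intro tendsto_intros) auto
    moreover have "h p = 0"
    proof -
      have "inverse p * \<alpha> / (w0 - inverse p) = \<alpha> / (w0 * p - 1)"
        using pn pw by (simp add: divide_simps)
      moreover have "ln (cmod (inverse p)) = - ln (cmod p)" using pn by (simp add: norm_inverse ln_inverse)
      ultimately show ?thesis using bd[OF fp] by (simp add: h_def)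
    qed
    ultimately show ?thesis by simp
  qed
  have lim: "\<exists>r0<1. \<forall>u. r0 < cmod u \<and> cmod u < 1 \<longrightarrow>
      cmod (2 * of_real (ln \<delta>) + 2 * of_real (ln (cmod (g u))) - M u - \<alpha> / (w0 * g u - 1)) < e" if "e > 0" for e
  proof -
    have "bounded V" using Vb by (intro boundedI[of _ "1 / \<delta>"]) (auto intro: less_imp_le)
    have "\<exists>r0<1. \<forall>u. r0 < cmod u \<and> cmod u < 1 \<longrightarrow> cmod (h (g u)) < e"
    proof (rule tendsto_boundary_of_riemann_map[where g = g and h = h, OF oV \<open>bounded V\<close> holomorphic_on_imp_continuous_on[OF f(1)]])
      show "f p \<in> ball 0 1" if "p \<in> V" for p using f(2)[OF that] by blast
      show "g u \<in> V \<and> f (g u) = u" if "u \<in> ball 0 1" for u using g(2)[OF that] .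
      show "(\<lambda>n. h (x n)) \<longlonglongrightarrow> 0" if "p \<in> frontier V" "\<And>n. x n \<in> V" "x \<longlonglongrightarrow> p" for p and x :: "nat \<Rightarrow> complex"
        by (rule hlim[OF that])
    qed fact
    then obtain r0 where r0: "r0 < 1" "\<And>u. r0 < cmod u \<and> cmod u < 1 \<Longrightarrow> cmod (h (g u)) < e" by blast
    have "M u = inverse (g u) * N (inverse (g u))" if "max r0 0 < cmod u" "cmod u < 1" for u
      using M(2) that by (force simp: M0_def)
    then show ?thesis using r0 by (intro exI[of _ "max r0 0"]) (auto simp: h_def)
  qed
  have formula: "g u = of_real d * u * exp (cnj (\<alpha> / (w0 * deriv g u1)) * u / (1 - cnj u1 * u))" if "cmod u < 1" for u
    by (rule univalent_map_formula[OF g(1) inj g(3) d(2,1) u1 w0n M(1) lim that])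
  define z1 where "z1 = 1 / u1"
  define lam where "lam = cnj (\<alpha> * z1 / (w0 * deriv g (1 / z1)))"
  have u1z: "1 / z1 = u1" by (simp add: z1_def)
  show ?thesis
  proof (rule that[of "1 / d" z1 g lam])
    show "1 / d > 0" using d by simp
    show "cmod z1 > 1" using u1(1) u1n by (simp add: z1_def norm_divide)
    show "of_real (1 / d) * z * exp (lam / (1 - z * cnj z1)) = 1 / g (1 / z)" if z: "cmod z > 1" for z
    proof -
      have zn: "z \<noteq> 0" using z by auto
      have "cmod (1 / z) < 1" using z zn by (simp add: norm_divide divide_less_eq_1)
      from formula[OF this] have g1: "g (1 / z) = of_real d * (1 / z) * exp (cnj (\<alpha> / (w0 * deriv g u1)) * (1 / z) / (1 - cnj u1 * (1 / z)))" .
      have "z \<noteq> cnj u1" using u1(1) z by auto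
      \<comment> \<open>The exponents are opposite because the exterior map is the reciprocal of
        g(1/z); for the same reason the leading constant is 1/d.\<close>
      then have "lam / (1 - z * cnj z1) = - (cnj (\<alpha> / (w0 * deriv g u1)) * (1 / z) / (1 - cnj u1 * (1 / z)))"
        unfolding lam_def u1z using zn u1n by (simp add: z1_def divide_simps) (auto simp: algebra_simps)
      then show ?thesis unfolding g1 using zn by (simp add: exp_minus field_simps)
    qed
  qed (use g inj gV u1 in \<open>auto simp: V_def u1z lam_def\<close>)
qed

section \<open>Continuously differentiable loops\<close>

context
  fixes \<gamma> \<gamma>' :: "real \<Rightarrow> complex"
  assumes der: "\<And>t. t \<in> {0..1} \<Longrightarrow> (\<gamma> has_vector_derivative \<gamma>' t) (at t within {0..1})"
    and cont: "continuous_on {0..1} \<gamma>'"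
begin

lemma C1_increment:
  assumes "0 \<le> a" "a \<le> b" "b \<le> 1"
  shows "(\<gamma>' has_integral (\<gamma> b - \<gamma> a)) {a..b}"
proof (rule fundamental_theorem_of_calculus[OF assms(2)])
  fix x assume "x \<in> {a..b}"
  then show "(\<gamma> has_vector_derivative \<gamma>' x) (at x within {a..b})"
    using assms by (intro has_vector_derivative_within_subset[OF der]) auto
qed

lemma C1_bound:
  "\<exists>B>0. (\<forall>t\<in>{0..1}. cmod (\<gamma>' t) \<le> B) \<and>
    (\<forall>a b. 0 \<le> a \<and> a \<le> b \<and> b \<le> 1 \<longrightarrow> cmod (\<gamma> b - \<gamma> a) \<le> B * (b - a))"
proof -
  have "bounded (\<gamma>' ` {0..1})" by (intro compact_imp_bounded compact_continuous_image cont) auto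
  then obtain B where B: "B > 0" "\<And>t. t \<in> {0..1} \<Longrightarrow> cmod (\<gamma>' t) \<le> B" by (auto simp: bounded_pos)
  have "cmod (\<gamma> b - \<gamma> a) \<le> B * (b - a)" if "0 \<le> a" "a \<le> b" "b \<le> 1" for a b
    using has_integral_bound[of B \<gamma>' "\<gamma> b - \<gamma> a" a b] C1_increment[OF that] B that by simp
  then show ?thesis using B by blast
qed

lemma C1_rectifiable_loop:
  assumes "\<gamma> 1 = \<gamma> 0"
  shows "rectifiable_loop \<gamma>"
proof -
  obtain B where B: "B > 0" "\<And>a b. 0 \<le> a \<Longrightarrow> a \<le> b \<Longrightarrow> b \<le> 1 \<Longrightarrow> cmod (\<gamma> b - \<gamma> a) \<le> B * (b - a)"
    using C1_bound by blast
  have "continuous_on {0..1} \<gamma>"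
    using der by (meson continuous_on_eq_continuous_within has_vector_derivative_continuous)
  then have "path \<gamma>" by (simp add: path_def)
  moreover have "(\<Sum>i<n. cmod (\<gamma> (t (Suc i)) - \<gamma> (t i))) \<le> B"
    if t: "t 0 = 0" "t n = 1" "\<forall>i<n. t i \<le> t (Suc i)" for n and t :: "nat \<Rightarrow> real"
  proof -
    have mono: "t i \<le> t j" if "i \<le> j" "j \<le> n" for i j
      using that
    proof (induction j rule: dec_induct)
      case (step j)
      then have "t i \<le> t j" "t j \<le> t (Suc j)" using t(3) by auto
      then show ?case by simp
    qed simp
    have "(\<Sum>i<n. cmod (\<gamma> (t (Suc i)) - \<gamma> (t i))) \<le> (\<Sum>i<n. B * (t (Suc i) - t i))"
    proof (rule sum_mono)
      fix i assume i: "i \<in> {..<n}"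
      then show "cmod (\<gamma> (t (Suc i)) - \<gamma> (t i)) \<le> B * (t (Suc i) - t i)"
        using mono[of 0 i] mono[of i "Suc i"] mono[of "Suc i" n] t by (intro B(2)) auto
    qed
    also have "\<dots> = B * (t n - t 0)"
      by (simp only: sum_distrib_left[symmetric] sum_lessThan_telescope)
    finally show ?thesis using t by simp
  qed
  ultimately show ?thesis
    using assms unfolding rectifiable_loop_def pathfinish_def pathstart_def by blast
qed

text \<open>The telescoping function is the indefinite integral of g(\<gamma>) \<gamma>', and the
  error on a step is at most e times the step length. The weights in
  \<open>rs_sum_tendsto_telescope\<close> are therefore 1/N instead of increments of
  \<gamma>.\<close>

lemma C1_rs_sum:
  assumes g: "continuous_on {0..1} (\<lambda>t. g (\<gamma> t))"
  shows "rs_sum g \<gamma> \<longlonglongrightarrow> integral {0..1} (\<lambda>t. g (\<gamma> t) * \<gamma>' t)"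
proof -
  obtain B where B: "B > 0" "\<And>t. t \<in> {0..1} \<Longrightarrow> cmod (\<gamma>' t) \<le> B"
    using C1_bound by blast
  define F where "F = (\<lambda>t. g (\<gamma> t) * \<gamma>' t)"
  define q where "q = (\<lambda>t. integral {0..t} F)"
  have cF: "continuous_on {0..1} F" unfolding F_def by (intro continuous_intros g cont)
  have inc: "(F has_integral q b - q a) {a..b}" if "0 \<le> a" "a \<le> b" "b \<le> 1" for a b
  proof -
    have i: "F integrable_on {0..b}" "F integrable_on {a..b}"
      using that by (auto intro!: integrable_continuous_interval continuous_on_subset[OF cF])
    have "integral {0..a} F + integral {a..b} F = integral {0..b} F"
      using that i by (intro Henstock_Kurzweil_Integration.integral_combine) auto
    then have "integral {a..b} F = q b - q a" by (simp add: q_def algebra_simps)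
    then show ?thesis using i(2) by (metis integrable_integral)
  qed
  have "rs_sum g \<gamma> \<longlonglongrightarrow> q 1 - q 0"
  proof (rule rs_sum_tendsto_telescope[where D = "\<lambda>N j. 1 / real N" and V = 1])
    fix e :: real assume "e > 0"
    from uniform_nodes_close[OF g]
    have "uniformly_continuous_on {0..1} (\<lambda>t. g (\<gamma> t))" using g compact_uniformly_continuous by blast
    then obtain \<xi> where \<xi>: "\<xi> > 0"
      "\<And>x y. \<lbrakk>x \<in> {0..1}; y \<in> {0..1}; \<bar>x - y\<bar> < \<xi>\<rbrakk> \<Longrightarrow> cmod (g (\<gamma> x) - g (\<gamma> y)) < e / B"
      using \<open>e > 0\<close> B(1) unfolding uniformly_continuous_on_def dist_norm real_norm_def
      by (metis divide_pos_pos)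
    obtain N0 :: nat where N0: "1 / real N0 < \<xi>" "N0 > 0"
      using \<open>\<xi> > 0\<close> by (metis ex_inverse_of_nat_less inverse_eq_divide)
    show "\<forall>\<^sub>F N in sequentially. N > 0 \<and> (\<forall>j<N.
      cmod (g (\<gamma> (real j / real N)) * (\<gamma> (real (Suc j) / real N) - \<gamma> (real j / real N))
         - (q (real (Suc j) / real N) - q (real j / real N))) \<le> e * (1 / real N))"
    proof (rule eventually_sequentiallyI, intro conjI allI impI)
      fix N assume "N0 \<le> N"
      then have N: "N > 0" "1 / real N < \<xi>"
        using N0 le_less_trans[OF frac_le[of 1 1 "real N0" "real N"]] by auto
      then show "N > 0" by simp
      fix j assume "j < N"
      define a b where "a = real j / real N" and "b = real (Suc j) / real N"
      have ab: "0 \<le> a" "a \<le> b" "b \<le> 1" "b - a = 1 / real N"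
        using \<open>j < N\<close> by (auto simp: a_def b_def divide_right_mono diff_divide_distrib[symmetric])
      have "((\<lambda>t. g (\<gamma> a) * \<gamma>' t - F t) has_integral (g (\<gamma> a) * (\<gamma> b - \<gamma> a) - (q b - q a))) {a..b}"
        using ab by (intro has_integral_diff has_integral_mult_right C1_increment inc)
      moreover have "cmod (g (\<gamma> a) * \<gamma>' t - F t) \<le> e" if t: "t \<in> cbox a b" for t
      proof -
        have "t \<in> {0..1}" "a \<in> {0..1}" "\<bar>a - t\<bar> < \<xi>" using t ab N by auto
        then have "cmod (g (\<gamma> a) - g (\<gamma> t)) * cmod (\<gamma>' t) \<le> e / B * B"
          using \<xi>(2)[of a t] B \<open>e > 0\<close> by (intro mult_mono) auto
        then show ?thesis using B(1) by (simp add: F_def norm_mult[symmetric] left_diff_distrib)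
      qed
      ultimately have "cmod (g (\<gamma> a) * (\<gamma> b - \<gamma> a) - (q b - q a)) \<le> e * Henstock_Kurzweil_Integration.content (cbox a b)"
        using \<open>e > 0\<close> by (intro has_integral_bound) auto
      then show "cmod (g (\<gamma> (real j / real N)) * (\<gamma> (real (Suc j) / real N) - \<gamma> (real j / real N))
         - (q (real (Suc j) / real N) - q (real j / real N))) \<le> e * (1 / real N)"
        using ab unfolding a_def[symmetric] b_def[symmetric] by simp
    qed
  qed simp
  then show ?thesis by (simp add: q_def F_def)
qed

end

section \<open>The exterior map in the coordinate at infinity\<close>

text \<open>At u = 0 division by zero gives the value 0 instead of the pole, which is why 0 is
  removed from the disc in what follows.\<close>

definition kmap :: "real \<Rightarrow> complex \<Rightarrow> complex \<Rightarrow> complex \<Rightarrow> complex" where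
  "kmap c a lam u = of_real c * exp (lam * u / (u - a)) / u"

locale exterior_map =
  fixes c :: real and a lam :: complex
  assumes c: "c > 0" and a: "cmod a > 1" and inj: "inj_on (kmap c a lam) (ball 0 1 - {0})"
begin

abbreviation \<kappa> :: "complex \<Rightarrow> complex" where "\<kappa> \<equiv> kmap c a lam"

definition W :: "complex set" where "W = \<kappa> ` (ball 0 1 - {0})"

lemma kmap_holomorphic: "\<kappa> holomorphic_on - {0, a}"
  unfolding kmap_def by (intro holomorphic_intros) auto

lemma kmap_isCont: "u \<noteq> 0 \<Longrightarrow> u \<noteq> a \<Longrightarrow> isCont \<kappa> u"
  using holomorphic_on_imp_continuous_on[OF kmap_holomorphic]
  by (simp add: continuous_on_eq_continuous_at open_Compl)

lemma cball_neq_a: "cmod u \<le> 1 \<Longrightarrow> u \<noteq> a"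
  using a by auto

lemma kmap_nonzero: "u \<noteq> 0 \<Longrightarrow> \<kappa> u \<noteq> 0"
  using c by (simp add: kmap_def)

lemma W_open: "open W"
  unfolding W_def using a
  by (intro open_mapping_thm3[OF holomorphic_on_subset[OF kmap_holomorphic] _ inj]) auto

text \<open>Injectivity is assumed only inside the disc. If a circle point v shared its value with
  an interior point u, then the image of a small ball at u would be a neighbourhood of that value
  and contain the values of interior points close to v, contradicting injectivity.\<close>

lemma kmap_sphere_disjoint:
  assumes v: "cmod v = 1" and u: "cmod u < 1" "u \<noteq> 0"
  shows "\<kappa> v \<noteq> \<kappa> u"
proof
  assume eq: "\<kappa> v = \<kappa> u"
  define r where "r = min (cmod u) ((1 - cmod u) / 2)"
  have r: "r > 0" "r \<le> cmod u" "cmod u + r < 1" using u by (auto simp: r_def min_def field_simps)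
  have sub: "ball u r \<subseteq> ball 0 1 - {0}"
  proof
    fix y assume "y \<in> ball u r"
    then have "cmod (u - y) < r" by (simp add: dist_norm)
    then have "cmod y < 1" "y \<noteq> 0" using r norm_triangle_ineq2[of y u] by (auto simp: norm_minus_commute)
    then show "y \<in> ball 0 1 - {0}" by simp
  qed
  have "open (\<kappa> ` ball u r)"
    using sub a by (intro open_mapping_thm3[OF holomorphic_on_subset[OF kmap_holomorphic] _ inj_on_subset[OF inj sub]]) auto
  moreover have "\<kappa> v \<in> \<kappa> ` ball u r" unfolding eq using r by auto
  moreover have "isCont \<kappa> v" using v cball_neq_a by (intro kmap_isCont) auto
  then have "(\<kappa> \<longlongrightarrow> \<kappa> v) (at v)" by (simp add: isCont_def)
  ultimately have "\<forall>\<^sub>F x in at v. \<kappa> x \<in> \<kappa> ` ball u r" using topological_tendstoD by blast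
  then obtain d where d: "d > 0" "\<And>x. x \<noteq> v \<Longrightarrow> dist x v < d \<Longrightarrow> \<kappa> x \<in> \<kappa> ` ball u r"
    unfolding eventually_at by blast
  \<comment> \<open>Close enough to 1 that s v is within d of v, and larger than |u| + r so that s v
    lies outside the ball around u.\<close>
  define s where "s = max (1 - d / 2) ((1 + (cmod u + r)) / 2)"
  have s: "0 < s" "s < 1" "1 - s < d" "cmod u + r < s" using d r by (auto simp: s_def max_def field_simps)
  define x where "x = of_real s * v"
  have x: "cmod x = s" using s v by (simp add: x_def norm_mult)
  have "x - v = of_real (s - 1) * v" by (simp add: x_def algebra_simps)
  then have "dist x v = 1 - s" using s v by (simp add: dist_norm norm_mult del: of_real_diff)
  moreover have "x \<noteq> v" using x s v by auto
  ultimately have "\<kappa> x \<in> \<kappa> ` ball u r" using s(3) by (intro d(2)) auto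
  then obtain y where y: "y \<in> ball u r" "\<kappa> x = \<kappa> y" by blast
  have "y \<in> ball 0 1 - {0}" using y(1) sub by blast
  moreover have "x \<in> ball 0 1 - {0}" using x s by auto
  ultimately have "x = y" using inj_onD[OF inj y(2)] by blast
  then have "cmod x < cmod u + r"
    using y(1) norm_triangle_ineq2[of x u] by (simp add: dist_norm norm_minus_commute)
  then show False using x s by simp
qed

text \<open>Preimages of a convergent sequence accumulate in the closed disc by compactness, and
  they stay away from 0 because u \<kappa>(u) tends to c > 0 there.\<close>

lemma closure_W: "closure W = W \<union> \<kappa> ` sphere 0 1"
proof
  have eq: "W \<union> \<kappa> ` sphere 0 1 = \<kappa> ` (cball 0 1 - {0})"
    unfolding W_def by (subst image_Un[symmetric], rule arg_cong[of _ _ "image \<kappa>"]) auto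
  show "closure W \<subseteq> W \<union> \<kappa> ` sphere 0 1"
  proof (rule closure_minimal)
    show "closed (W \<union> \<kappa> ` sphere 0 1)"
      unfolding closed_sequential_limits eq
    proof (intro allI impI, elim conjE)
      fix x p assume x: "\<forall>n. x n \<in> \<kappa> ` (cball 0 1 - {0})" and p: "x \<longlonglongrightarrow> p"
      then obtain y where y: "\<And>n. y n \<in> cball 0 1 - {0}" "\<And>n. x n = \<kappa> (y n)"
        unfolding image_iff by metis
      obtain u r where u: "u \<in> cball 0 1" "strict_mono r" "(y \<circ> r) \<longlonglongrightarrow> u"
        using compact_cball[of "0::complex" 1] y(1) unfolding compact_def by (metis DiffD1)
      have xr: "(\<lambda>n. x (r n)) \<longlonglongrightarrow> p" using LIMSEQ_subseq_LIMSEQ[OF p u(2)] by (simp add: comp_def)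
      have yr: "(\<lambda>n. y (r n)) \<longlonglongrightarrow> u" using u(3) by (simp add: comp_def)
      have ua: "u \<noteq> a" using u(1) cball_neq_a by simp
      have "u \<noteq> 0"
      proof
        assume u0: "u = 0"
        have "y (r n) * x (r n) = of_real c * exp (lam * y (r n) / (y (r n) - a))" for n
          using y(1)[of "r n"] y(2)[of "r n"] by (simp add: kmap_def)
        moreover have "(\<lambda>n. y (r n) * x (r n)) \<longlonglongrightarrow> 0 * p"
          using yr xr u0 by (intro tendsto_mult) auto
        moreover have "(\<lambda>n. of_real c * exp (lam * y (r n) / (y (r n) - a))) \<longlonglongrightarrow> of_real c * exp (lam * 0 / (0 - a))"
          using yr u0 ua by (intro tendsto_intros) auto
        ultimately have "0 = complex_of_real c" using LIMSEQ_unique by fastforce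
        then show False using c by simp
      qed
      then have "(\<lambda>n. \<kappa> (y (r n))) \<longlonglongrightarrow> \<kappa> u" using yr ua by (intro isCont_tendsto_compose[OF kmap_isCont])
      then have "p = \<kappa> u" using xr y(2) LIMSEQ_unique by simp
      then show "p \<in> \<kappa> ` (cball 0 1 - {0})" using u(1) \<open>u \<noteq> 0\<close> by blast
    qed
  qed simp
  have "\<kappa> v \<in> closure W" if v: "cmod v = 1" for v
    unfolding closure_sequential
  proof (intro exI conjI allI)
    define x where "x = (\<lambda>n. of_real (1 - inverse (real (Suc (Suc n)))) * v)"
    have m: "0 < 1 - inverse (real (Suc (Suc n)))" "1 - inverse (real (Suc (Suc n))) < 1" for n
      by (simp_all add: inverse_less_1_iff)
    have "x n \<in> ball 0 1 - {0}" for n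
      using m[of n] v by (auto simp: x_def norm_mult simp del: of_real_diff of_nat_Suc)
    then show "\<kappa> (x n) \<in> W" for n by (auto simp: W_def)
    have "(\<lambda>n. inverse (real (Suc (Suc n)))) \<longlonglongrightarrow> 0"
      using LIMSEQ_inverse_real_of_nat LIMSEQ_Suc by blast
    then have "x \<longlonglongrightarrow> of_real (1 - 0) * v" unfolding x_def by (intro tendsto_intros)
    then have "x \<longlonglongrightarrow> v" by simp
    then show "(\<lambda>n. \<kappa> (x n)) \<longlonglongrightarrow> \<kappa> v"
      using v cball_neq_a by (intro isCont_tendsto_compose[OF kmap_isCont]) auto
  qed
  then show "W \<union> \<kappa> ` sphere 0 1 \<subseteq> closure W" using closure_subset by auto
qed

lemma frontier_W: "frontier W = \<kappa> ` sphere 0 1"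
proof -
  have "\<kappa> v \<notin> W" if "v \<in> sphere 0 1" for v
    using kmap_sphere_disjoint[of v] that by (force simp: W_def)
  then show ?thesis unfolding frontier_def interior_open[OF W_open] closure_W by blast
qed

lemma kmap_has_field_derivative:
  assumes "u \<noteq> 0" "u \<noteq> a"
  shows "(\<kappa> has_field_derivative - \<kappa> u * (1 / u + lam * a / (u - a)\<^sup>2)) (at u)"
proof -
  have ua: "u - a \<noteq> 0" using assms by simp
  have "((\<lambda>u. lam * u / (u - a)) has_field_derivative (lam * (u - a) - lam * u * 1) / ((u - a) * (u - a))) (at u)"
    using ua by (auto intro!: derivative_eq_intros)
  also have "(lam * (u - a) - lam * u * 1) / ((u - a) * (u - a)) = - (lam * a / (u - a)\<^sup>2)"
    by (simp add: power2_eq_square algebra_simps)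
  finally have 1: "((\<lambda>u. lam * u / (u - a)) has_field_derivative - (lam * a / (u - a)\<^sup>2)) (at u)" .
  have 2: "((\<lambda>u. of_real c * exp (lam * u / (u - a))) has_field_derivative
      of_real c * (exp (lam * u / (u - a)) * - (lam * a / (u - a)\<^sup>2))) (at u)"
    by (intro DERIV_cmult DERIV_chain2[OF DERIV_exp 1])
  have "(\<kappa> has_field_derivative (of_real c * (exp (lam * u / (u - a)) * - (lam * a / (u - a)\<^sup>2)) * u -
      of_real c * exp (lam * u / (u - a)) * 1) / (u * u)) (at u)"
    unfolding kmap_def[abs_def] by (rule DERIV_divide[OF 2 DERIV_ident assms(1)])
  also have "(of_real c * (exp (lam * u / (u - a)) * - (lam * a / (u - a)\<^sup>2)) * u -
      of_real c * exp (lam * u / (u - a)) * 1) / (u * u) = - \<kappa> u * (1 / u + lam * a / (u - a)\<^sup>2)"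
    using assms(1) by (simp add: kmap_def field_simps)
  finally show ?thesis .
qed

lemma deriv_kmap: "u \<noteq> 0 \<Longrightarrow> u \<noteq> a \<Longrightarrow> deriv \<kappa> u = - \<kappa> u * (1 / u + lam * a / (u - a)\<^sup>2)"
  by (rule DERIV_imp_deriv) (rule kmap_has_field_derivative)

lemma kmap_deriv: "u \<noteq> 0 \<Longrightarrow> u \<noteq> a \<Longrightarrow> (\<kappa> has_field_derivative deriv \<kappa> u) (at u)"
  using kmap_has_field_derivative[of u] deriv_kmap[of u] by simp

lemma deriv_kmap_nonzero:
  assumes "cmod u < 1" "u \<noteq> 0"
  shows "deriv \<kappa> u \<noteq> 0"
proof (rule holomorphic_injective_imp_regular[OF _ _ inj])
  show "\<kappa> holomorphic_on ball 0 1 - {0}"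
    using a by (intro holomorphic_on_subset[OF kmap_holomorphic]) auto
qed (use assms in auto)

text \<open>Critical points solve the quadratic (u - a)^2 + lam a u = 0. Hence \<kappa> is locally
  injective at all but finitely many points of the circle.\<close>

lemma finite_deriv_kmap_zeros: "finite {u. u \<noteq> 0 \<and> u \<noteq> a \<and> deriv \<kappa> u = 0}"
proof (rule finite_subset)
  define p where "p = [:a\<^sup>2, lam * a - 2 * a, 1:]"
  show "finite {u. poly p u = 0}" by (rule poly_roots_finite) (simp add: p_def)
  show "{u. u \<noteq> 0 \<and> u \<noteq> a \<and> deriv \<kappa> u = 0} \<subseteq> {u. poly p u = 0}"
  proof safe
    fix u assume u: "u \<noteq> 0" "u \<noteq> a" "deriv \<kappa> u = 0"
    then have "1 / u + lam * a / (u - a)\<^sup>2 = 0" using deriv_kmap kmap_nonzero by auto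
    then have "(u - a)\<^sup>2 + lam * a * u = 0" using u by (simp add: add_frac_eq)
    then show "poly p u = 0" by (simp add: p_def power2_eq_square algebra_simps)
  qed
qed

section \<open>The boundary loop and its winding numbers\<close>

abbreviation boundary_loop :: "real \<Rightarrow> complex" where
  "boundary_loop \<equiv> \<kappa> \<circ> circlepath 0 1"

lemma circlepath_sphere: "t \<in> {0..1} \<Longrightarrow> cmod (circlepath 0 1 t) = 1"
  by (simp add: circlepath norm_mult)

lemma sphere_neq: "cmod v = 1 \<Longrightarrow> v \<noteq> 0 \<and> v \<noteq> a"
  using cball_neq_a[of v] by auto

lemma sphere_subset: "sphere 0 1 \<subseteq> - {0, a}"
  using a by auto

lemma closure_W_image: "closure W = \<kappa> ` (cball 0 1 - {0})"
proof -
  have "W \<union> \<kappa> ` sphere 0 1 = \<kappa> ` ((ball 0 1 - {0}) \<union> sphere 0 1)" unfolding W_def image_Un ..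
  also have "(ball 0 1 - {0}) \<union> sphere 0 1 = cball 0 1 - {0::complex}" by auto
  finally show ?thesis by (simp only: closure_W)
qed

lemma boundary_loop_C1:
  "t \<in> {0..1} \<Longrightarrow> (boundary_loop has_vector_derivative
      deriv \<kappa> (circlepath 0 1 t) * (2 * of_real pi * \<i> * circlepath 0 1 t)) (at t within {0..1})"
  "continuous_on {0..1} (\<lambda>t. deriv \<kappa> (circlepath 0 1 t) * (2 * of_real pi * \<i> * circlepath 0 1 t))"
proof -
  assume t: "t \<in> {0..1}"
  let ?u = "circlepath 0 1 t"
  have "?u \<noteq> 0" "?u \<noteq> a" using circlepath_sphere[OF t] sphere_neq by blast+
  then have "(\<kappa> has_field_derivative deriv \<kappa> ?u) (at ?u)" by (rule kmap_deriv)
  moreover have "(circlepath 0 1 has_vector_derivative 2 * of_real pi * \<i> * ?u) (at t within {0..1})"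
  proof -
    have "circlepath 0 1 t = exp (2 * of_real pi * \<i> * of_real t)" unfolding circlepath by simp
    then show ?thesis using has_vector_derivative_circlepath[of 0 1 t "{0..1}"] by simp
  qed
  ultimately have "(boundary_loop has_vector_derivative (2 * of_real pi * \<i> * ?u) * deriv \<kappa> ?u) (at t within {0..1})"
    by (intro field_vector_diff_chain_within[where g = \<kappa>]) (auto intro: has_field_derivative_at_within)
  then show "(boundary_loop has_vector_derivative deriv \<kappa> ?u * (2 * of_real pi * \<i> * ?u)) (at t within {0..1})"
    by (simp add: mult.commute)
next
  have "deriv \<kappa> holomorphic_on - {0, a}"
    by (intro holomorphic_deriv kmap_holomorphic) (simp add: open_Compl)
  then have cd: "continuous_on (sphere 0 1) (deriv \<kappa>)"
    using sphere_subset by (intro holomorphic_on_imp_continuous_on) (rule holomorphic_on_subset)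
  have cc: "continuous_on {0..1} (circlepath 0 1)"
    using path_circlepath[of 0 1] by (simp add: path_def)
  have "circlepath 0 1 ` {0..1} \<subseteq> sphere 0 1" using circlepath_sphere by fastforce
  from continuous_on_compose2[OF cd cc this]
  have "continuous_on {0..1} (\<lambda>t. deriv \<kappa> (circlepath 0 1 t))" .
  then show "continuous_on {0..1} (\<lambda>t. deriv \<kappa> (circlepath 0 1 t) * (2 * of_real pi * \<i> * circlepath 0 1 t))"
    by (intro continuous_intros cc)
qed

lemma rectifiable_boundary_loop: "rectifiable_loop boundary_loop"
  by (rule C1_rectifiable_loop[OF boundary_loop_C1]) (auto simp: circlepath)

lemma path_image_boundary_loop: "path_image boundary_loop = \<kappa> ` sphere 0 1"
  by (simp add: path_image_compose)

lemma contour_integral_boundary_loop: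
  "contour_integral boundary_loop g = contour_integral (circlepath 0 1) (\<lambda>w. deriv \<kappa> w * g (\<kappa> w))"
proof (rule contour_integral_comp_analyticW)
  show "\<kappa> analytic_on - {0, a}" using kmap_holomorphic by (simp add: analytic_on_open open_Compl)
  show "path_image (circlepath 0 1) \<subseteq> - {0, a}" using sphere_subset by simp
qed simp

lemma valid_path_boundary_loop: "valid_path boundary_loop"
  using sphere_subset by (intro valid_path_compose_holomorphic[OF _ kmap_holomorphic]) (simp_all add: open_Compl)

text \<open>On the circle \<open>\<kappa>'/(\<kappa> - p) = k'/k - 1/u\<close> with \<open>k(u) = u (\<kappa>(u) - p)\<close> holomorphic in the disc, so the
  winding number is the number of zeros of \<open>k\<close> minus one.\<close>
lemma winding_number_boundary_loop:
  assumes p: "p \<notin> \<kappa> ` sphere 0 1"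
  shows "winding_number boundary_loop p = (if p \<in> W then 1 else 0) - 1"
proof -
  define k where "k = (\<lambda>u. of_real c * exp (lam * u / (u - a)) - p * u)"
  define D where "D = ball (0::complex) (cmod a)"
  have Da: "u \<noteq> a" if "u \<in> D" for u using that by (auto simp: D_def)
  have sub: "cball (0::complex) 1 \<subseteq> D" "sphere (0::complex) 1 \<subseteq> D" using a by (auto simp: D_def)
  have oD: "open D" by (simp add: D_def)
  have k: "k holomorphic_on D" unfolding k_def using Da by (intro holomorphic_intros) auto
  have kk: "k u = u * (\<kappa> u - p)" if "u \<noteq> 0" for u using that by (simp add: k_def kmap_def algebra_simps)
  have k0: "k 0 \<noteq> 0" using c by (simp add: k_def)
  have zero: "u \<noteq> 0 \<and> cmod u < 1 \<and> \<kappa> u = p" if "u \<in> cball 0 1" "k u = 0" for u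
  proof -
    have "u \<noteq> 0" using that k0 by auto
    moreover from this have "\<kappa> u = p" using kk[of u] that by simp
    moreover have "cmod u \<noteq> 1" using p \<open>\<kappa> u = p\<close> by auto
    ultimately show ?thesis using that(1) by auto
  qed
  have dk: "deriv k u = \<kappa> u - p + u * deriv \<kappa> u" if "u \<noteq> 0" "u \<in> D" for u
  proof -
    have "((\<lambda>u. u * (\<kappa> u - p)) has_field_derivative (\<kappa> u - p + u * deriv \<kappa> u)) (at u)"
      using kmap_deriv[OF that(1) Da[OF that(2)]] by (auto intro!: derivative_eq_intros)
    then have "(k has_field_derivative (\<kappa> u - p + u * deriv \<kappa> u)) (at u)"
      by (rule has_field_derivative_transform_within_open[of _ _ _ "- {0}"]) (use that kk in auto)
    then show ?thesis by (rule DERIV_imp_deriv)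
  qed
  have quot: "deriv \<kappa> w * (1 / (\<kappa> w - p)) = deriv k w / k w - 1 / w" if "w \<in> sphere 0 1" for w
  proof -
    have "w \<noteq> 0" "w \<in> D" "\<kappa> w \<noteq> p" using that sub p by auto
    then show ?thesis using dk[of w] kk[of w] by (simp add: divide_simps)
  qed
  have i0: "((\<lambda>w. 1 / w) has_contour_integral 2 * of_real pi * \<i>) (circlepath 0 1)"
    using Cauchy_integral_circlepath[of 0 1 "\<lambda>_. 1" 0] by simp
  have cauchy: "((\<lambda>w. deriv q w / q w) has_contour_integral 0) (circlepath 0 1)"
    if q: "q holomorphic_on D" "\<And>u. u \<in> cball 0 1 \<Longrightarrow> q u \<noteq> 0" for q
  proof (rule Cauchy_theorem_convex_simple)
    show "(\<lambda>w. deriv q w / q w) holomorphic_on cball 0 1"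
      using q sub holomorphic_on_subset[OF q(1) sub(1)] holomorphic_on_subset[OF holomorphic_deriv[OF q(1) oD] sub(1)]
      by (intro holomorphic_on_divide) auto
  qed auto
  have ik: "((\<lambda>w. deriv k w / k w) has_contour_integral (if p \<in> W then 2 * of_real pi * \<i> else 0)) (circlepath 0 1)"
  proof (cases "p \<in> W")
    case False
    then have "k u \<noteq> 0" if "u \<in> cball 0 1" for u using zero[OF that] by (auto simp: W_def)
    then show ?thesis using cauchy[OF k] False by simp
  next
    case True
    then obtain b where "b \<in> ball 0 1 - {0}" "p = \<kappa> b" unfolding W_def by blast
    then have b: "b \<noteq> 0" "cmod b < 1" "\<kappa> b = p" by auto
    have bD: "b \<in> D" using b a by (auto simp: D_def)
    have kb: "k b = 0" using kk[OF b(1)] b by simp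
    \<comment> \<open>Dividing out the simple zero \<open>b\<close> leaves a function without zeros
      in the closed disc, so k'/k contributes exactly the residue of 1 / (w - b).\<close>
    define q where "q = (\<lambda>u. if u = b then deriv k b else (k u - k b) / (u - b))"
    have q: "q holomorphic_on D" unfolding q_def by (rule pole_lemma_open[OF k oD])
    have q0: "q u \<noteq> 0" if "u \<in> cball 0 1" for u
    proof (cases "u = b")
      case True
      then show ?thesis using dk[OF b(1) bD] b deriv_kmap_nonzero[OF b(2,1)] by (simp add: q_def)
    next
      case False
      have "k u \<noteq> 0"
      proof
        assume "k u = 0"
        from zero[OF that this] have u: "u \<in> ball 0 1 - {0}" "\<kappa> u = \<kappa> b" using b(3) by auto
        have "b \<in> ball 0 1 - {0}" using b by simp
        from inj_onD[OF inj u(2) u(1) this] show False using False by simp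
      qed
      then show ?thesis using False by (simp add: q_def kb)
    qed
    have kq: "k u = (u - b) * q u" for u by (simp add: q_def kb)
    have "deriv k w / k w = deriv q w / q w + 1 / (w - b)" if "w \<in> sphere 0 1" for w
    proof -
      have w: "w \<in> D" "w \<noteq> b" "q w \<noteq> 0" using that sub b q0[of w] by auto
      have "((\<lambda>u. (u - b) * q u) has_field_derivative (q w + (w - b) * deriv q w)) (at w)"
        using holomorphic_derivI[OF q oD w(1)] by (auto intro!: derivative_eq_intros)
      moreover have "(\<lambda>u. (u - b) * q u) = k" by (rule ext) (rule kq[symmetric])
      ultimately have "deriv k w = q w + (w - b) * deriv q w" by (simp only: DERIV_imp_deriv)
      then show ?thesis using w by (simp add: kq divide_simps)
    qed
    moreover have "((\<lambda>w. deriv q w / q w + 1 / (w - b)) has_contour_integral (0 + 2 * of_real pi * \<i> * 1)) (circlepath 0 1)"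
      using b Cauchy_integral_circlepath[of 0 1 "\<lambda>_. 1" b]
      by (intro has_contour_integral_add cauchy[OF q q0]) auto
    ultimately show ?thesis using True by (auto intro: has_contour_integral_eq)
  qed
  have pw: "p \<notin> path_image boundary_loop" using p by (simp add: path_image_boundary_loop)
  have "((\<lambda>w. deriv \<kappa> w * (1 / (\<kappa> w - p))) has_contour_integral
      ((if p \<in> W then 2 * of_real pi * \<i> else 0) - 2 * of_real pi * \<i>)) (circlepath 0 1)"
    by (rule has_contour_integral_eq[OF has_contour_integral_diff[OF ik i0]]) (use quot in auto)
  then have "contour_integral boundary_loop (\<lambda>w. 1 / (w - p)) = (if p \<in> W then 2 * of_real pi * \<i> else 0) - 2 * of_real pi * \<i>"
    unfolding contour_integral_boundary_loop by (rule contour_integral_unique)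
  then show ?thesis using winding_number_valid_path[OF valid_path_boundary_loop pw] by (auto simp: diff_divide_distrib)
qed

lemma negligible_boundary: "negligible (\<kappa> ` sphere 0 1)"
proof (rule negligible_differentiable_image_negligible)
  show "negligible (sphere (0::complex) 1)" by (rule negligible_sphere)
  show "\<kappa> differentiable_on sphere 0 1"
    unfolding differentiable_on_def
  proof
    fix v :: complex assume "v \<in> sphere 0 1"
    then have "v \<noteq> 0" "v \<noteq> a" using sphere_subset by auto
    from kmap_has_field_derivative[OF this] have "\<kappa> differentiable (at v)"
      unfolding has_field_derivative_def differentiable_def by blast
    then show "\<kappa> differentiable (at v within sphere 0 1)" by (rule differentiable_at_withinI)
  qed
qed simp

text \<open>Points x approaching v from outside the disc have values in the closure of W eventually,
  so each shares its value with some y in the closed disc. A limit of the y has the value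
  \<kappa>(v) and lies on the circle by \<open>kmap_sphere_disjoint\<close>; regularity of \<kappa>
  at v keeps it apart from v.\<close>

lemma boundary_double_point:
  assumes v: "cmod v = 1" "\<kappa> v \<in> interior (closure W)" "deriv \<kappa> v \<noteq> 0"
  obtains y where "cmod y = 1" "y \<noteq> v" "\<kappa> y = \<kappa> v"
proof -
  have va: "v \<noteq> 0" "v \<noteq> a" using sphere_neq v by auto
  obtain e where e: "e > 0" "inj_on \<kappa> (ball v e)"
    using has_complex_derivative_locally_injective[OF kmap_holomorphic _ _ v(3)] va by (auto simp: open_Compl)
  define x where "x = (\<lambda>n. of_real (1 + inverse (real (Suc n))) * v)"
  have xc: "cmod (x n) > 1" for n
    unfolding x_def norm_mult norm_of_real using v by (simp add: add_pos_pos)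
  have "x \<longlonglongrightarrow> of_real (1 + 0) * v"
    unfolding x_def by (intro tendsto_intros LIMSEQ_inverse_real_of_nat)
  then have xl: "x \<longlonglongrightarrow> v" by simp
  have kx: "(\<lambda>n. \<kappa> (x n)) \<longlonglongrightarrow> \<kappa> v" by (rule isCont_tendsto_compose[OF kmap_isCont[OF va] xl])
  have "\<forall>\<^sub>F n in sequentially. \<kappa> (x n) \<in> interior (closure W)"
    using topological_tendstoD[OF kx open_interior v(2)] .
  then obtain M where M: "\<And>n. n \<ge> M \<Longrightarrow> \<kappa> (x n) \<in> interior (closure W)" by (auto simp: eventually_sequentially)
  have "\<exists>y. y \<in> cball 0 1 - {0} \<and> \<kappa> (x (n + M)) = \<kappa> y" for n
  proof -
    have "\<kappa> (x (n + M)) \<in> \<kappa> ` (cball 0 1 - {0})"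
      using M[of "n + M"] interior_subset[of "closure W"] closure_W_image by auto
    then show ?thesis by blast
  qed
  then obtain y where y: "\<And>n. y n \<in> cball 0 1 - {0}" "\<And>n. \<kappa> (x (n + M)) = \<kappa> (y n)" by metis
  have xM: "(\<lambda>n. x (n + M)) \<longlonglongrightarrow> v" using xl by (rule LIMSEQ_ignore_initial_segment)
  obtain l r where l: "l \<in> cball 0 1" "strict_mono r" "(y \<circ> r) \<longlonglongrightarrow> l"
    using compact_cball[of "0::complex" 1] y(1) unfolding compact_def by (metis DiffD1)
  have yr: "(\<lambda>n. y (r n)) \<longlonglongrightarrow> l" using l(3) by (simp add: comp_def)
  have xr: "(\<lambda>n. x (r n + M)) \<longlonglongrightarrow> v" using LIMSEQ_subseq_LIMSEQ[OF xM l(2)] by (simp add: comp_def)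
  have kyr: "(\<lambda>n. \<kappa> (y (r n))) \<longlonglongrightarrow> \<kappa> v"
    using isCont_tendsto_compose[OF kmap_isCont[OF va] xr] y(2) by simp
  have la: "l \<noteq> a" using l(1) cball_neq_a by simp
  have "l \<noteq> 0"
  proof
    assume l0: "l = 0"
    have "y (r n) * \<kappa> (y (r n)) = of_real c * exp (lam * y (r n) / (y (r n) - a))" for n
      using y(1)[of "r n"] by (simp add: kmap_def)
    moreover have "(\<lambda>n. y (r n) * \<kappa> (y (r n))) \<longlonglongrightarrow> 0 * \<kappa> v"
      using yr kyr l0 by (intro tendsto_mult) auto
    moreover have "(\<lambda>n. of_real c * exp (lam * y (r n) / (y (r n) - a))) \<longlonglongrightarrow> of_real c * exp (lam * 0 / (0 - a))"
      using yr l0 la by (intro tendsto_intros) auto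
    ultimately have "0 = complex_of_real c" using LIMSEQ_unique by fastforce
    then show False using c by simp
  qed
  have "(\<lambda>n. \<kappa> (y (r n))) \<longlonglongrightarrow> \<kappa> l" by (rule isCont_tendsto_compose[OF kmap_isCont[OF \<open>l \<noteq> 0\<close> la] yr])
  then have kl: "\<kappa> l = \<kappa> v" using kyr LIMSEQ_unique by blast
  then have "cmod l = 1" using kmap_sphere_disjoint[OF v(1), of l] l(1) \<open>l \<noteq> 0\<close> by force
  \<comment> \<open>Otherwise x and y would both enter the ball around v on which \<kappa> is
    injective and hence coincide, although |x| > 1 and |y| \<le> 1.\<close>
  moreover have "l \<noteq> v"
  proof
    assume "l = v"
    then have "\<forall>\<^sub>F n in sequentially. y (r n) \<in> ball v e" "\<forall>\<^sub>F n in sequentially. x (r n + M) \<in> ball v e"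
      using topological_tendstoD[OF yr open_ball] topological_tendstoD[OF xr open_ball] e(1) by auto
    then have "\<forall>\<^sub>F n in sequentially. x (r n + M) = y (r n)"
      by eventually_elim (use inj_onD[OF e(2)] y(2) in auto)
    then obtain n where "x (r n + M) = y (r n)" by (auto simp: eventually_sequentially)
    then show False using xc[of "r n + M"] y(1)[of "r n"] by simp
  qed
  ultimately show ?thesis using that kl by blast
qed

text \<open>If a point of the boundary is interior to the closure, then an arc of the boundary is traced
  twice. Points of the circle with the same image are conjugate under a reflection \<open>\<eta> \<mapsto> cnj \<eta> = \<Lambda>\<^sup>2 / \<eta>\<close>,
  so that an identity between \<open>exp \<eta>\<close> and \<open>exp (\<Lambda>\<^sup>2 / \<eta>)\<close> holds on an arc and hence everywhere;
  this fails at the essential singularity \<open>\<eta> = \<infinity>\<close>.\<close>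
lemma interior_closure_W:
  assumes lam: "lam \<noteq> 0"
  shows "interior (closure W) = W"
proof (rule equalityI)
  show "W \<subseteq> interior (closure W)" by (rule interior_maximal[OF closure_subset W_open])
  show "interior (closure W) \<subseteq> W"
  proof (rule ccontr)
    assume "\<not> interior (closure W) \<subseteq> W"
    then obtain p where p: "p \<in> interior (closure W)" "p \<notin> W" by blast
    then have "p \<in> \<kappa> ` sphere 0 1" using interior_subset[of "closure W"] closure_W by blast
    then obtain v0 where v0: "cmod v0 = 1" "\<kappa> v0 \<in> interior (closure W)" using p(1) by auto
    have a0: "a \<noteq> 0" using a by auto
    define s where "s = a * cnj a - 1"
    have "s = of_real ((cmod a)\<^sup>2 - 1)" using complex_norm_square[of a] by (simp add: s_def)
    moreover have "(cmod a)\<^sup>2 > 1" using a by (simp add: one_less_power)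
    ultimately have s: "s \<noteq> 0" by (metis of_real_eq_0_iff less_numeral_extra(3) diff_gt_0_iff_gt)
    define m where "m = lam * a / s"
    have m: "m \<noteq> 0" "m * s = lam * a" using lam a0 s by (auto simp: m_def)
    \<comment> \<open>A constant times a Moebius map of modulus 1 on the circle, so |e|^2 = L there.
      The choice m s = lam a makes the exponent lam u / (u - a) differ from e(u) only by a
      constant.\<close>
    define e where "e = (\<lambda>u. m * (cnj a * u - 1) / (u - a))"
    define L where "L = m * cnj m"
    have L: "L \<noteq> 0" using m by (simp add: L_def)
    have split_exponent: "lam * u / (u - a) = (lam - m * cnj a) + e u" if "u \<noteq> a" for u
    proof -
      have ua: "u - a \<noteq> 0" using that by simp
      have "((lam - m * cnj a) + e u) * (u - a) = (lam - m * cnj a) * (u - a) + m * (cnj a * u - 1)"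
        using ua by (simp add: e_def distrib_right)
      also have "\<dots> = lam * u - lam * a + m * s" by (simp add: s_def algebra_simps)
      also have "\<dots> = lam * u" using m by simp
      finally show ?thesis using ua by (simp add: divide_eq_eq)
    qed
    have en: "e u * cnj (e u) = L" if u: "cmod u = 1" for u
    proof -
      have uc: "u * cnj u = 1" using u complex_norm_square[of u] by simp
      have ua: "u - a \<noteq> 0" "cnj (u - a) \<noteq> 0" using sphere_neq[OF u] by auto
      have "cnj a * u - 1 = - u * cnj (u - a)" using uc by (simp add: algebra_simps)
      moreover have "cnj (cnj a * u - 1) = - cnj u * (u - a)" using uc by (simp add: algebra_simps)
      ultimately have "(cnj a * u - 1) * cnj (cnj a * u - 1) = (u * cnj u) * ((u - a) * cnj (u - a))"
        by (simp only:) (simp add: algebra_simps)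
      also have "\<dots> = (u - a) * cnj (u - a)" by (simp only: uc mult_1)
      finally have k: "(cnj a * u - 1) * cnj (cnj a * u - 1) = (u - a) * cnj (u - a)" .
      have "e u * cnj (e u) = L * ((cnj a * u - 1) * cnj (cnj a * u - 1)) / ((u - a) * cnj (u - a))"
        by (simp add: e_def L_def)
      then show ?thesis using k ua by simp
    qed
    \<comment> \<open>Solving e(v) e(y) = L for y gives y Q(v) = P(v). The function \<Psi> is the
      equality of the two values of \<kappa>, multiplied by Q, with y eliminated and e(y) written as
      L / e(v).\<close>
    define Q where "Q = (\<lambda>v. m\<^sup>2 * cnj a * (cnj a * v - 1) - L * (v - a))"
    define P where "P = (\<lambda>v. m\<^sup>2 * (cnj a * v - 1) - L * a * (v - a))"
    define \<Psi> where "\<Psi> = (\<lambda>v. Q v * v * exp (L * (v - a) / (m * (cnj a * v - 1))) - P v * exp (e v))"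
    define U where "U = {v. cmod v = 1 \<and> \<kappa> v \<in> interior (closure W) \<and> deriv \<kappa> v \<noteq> 0}"
    have zero: "\<Psi> v = 0" if vU: "v \<in> U" for v
    proof -
      have v: "cmod v = 1" "\<kappa> v \<in> interior (closure W)" "deriv \<kappa> v \<noteq> 0" using vU by (auto simp: U_def)
      obtain y where y: "cmod y = 1" "y \<noteq> v" "\<kappa> y = \<kappa> v" using boundary_double_point[OF v] .
      have n: "v \<noteq> 0" "v - a \<noteq> 0" "y \<noteq> 0" "y - a \<noteq> 0" using sphere_neq v(1) y(1) by auto
      have "exp (lam * y / (y - a)) * v = exp (lam * v / (v - a)) * y"
        using y(3) c n by (simp add: kmap_def field_simps)
      then have ev: "exp (e y) * v = exp (e v) * y"
        using n split_exponent[of y] split_exponent[of v] by (simp add: exp_add)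
      \<comment> \<open>Taking moduli, with |v| = |y| = 1, gives equal real parts; since |e| is
        constant on the circle, e(y) is e(v) or its conjugate. Equality would force y = v.\<close>
      have "exp (Re (e y)) = exp (Re (e v))"
        using arg_cong[OF ev, of cmod] v(1) y(1) by (simp add: norm_mult)
      then have re: "Re (e y) = Re (e v)" by simp
      have sq: "(Re (e u))\<^sup>2 + (Im (e u))\<^sup>2 = Re L" if "cmod u = 1" for u
        using arg_cong[OF en[OF that], of Re] by (simp add: power2_eq_square)
      have "(Im (e y))\<^sup>2 = (Im (e v))\<^sup>2" using sq[OF v(1)] sq[OF y(1)] re by simp
      then have "Im (e y) = Im (e v) \<or> Im (e y) = - Im (e v)" by (simp add: power2_eq_iff)
      then have "e y = e v \<or> e y = cnj (e v)" using re by (auto simp: complex_eq_iff)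
      moreover have "e y \<noteq> e v" using ev y(2) by auto
      ultimately have ec: "e y = cnj (e v)" by blast
      have prod: "e v * e y = L" using en[OF v(1)] ec by simp
      then have "(m * (cnj a * v - 1) * (m * (cnj a * y - 1))) / ((v - a) * (y - a)) = L"
        by (simp only: e_def times_divide_times_eq)
      moreover have "(v - a) * (y - a) \<noteq> 0" using n by simp
      ultimately have "m * (cnj a * v - 1) * (m * (cnj a * y - 1)) = L * ((v - a) * (y - a))"
        by (metis nonzero_divide_eq_eq)
      then have yQ: "y * Q v = P v" unfolding Q_def P_def power2_eq_square by (simp add: algebra_simps)
      have "e v \<noteq> 0" using prod L by auto
      then have "e y = L / e v" using prod by (simp add: field_simps)
      then have ey: "e y = L * (v - a) / (m * (cnj a * v - 1))" by (simp add: e_def)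
      have "Q v * v * exp (e y) = (y * Q v) * exp (e v)" using ev by (simp add: algebra_simps)
      then show ?thesis unfolding \<Psi>_def yQ ey by simp
    qed
    \<comment> \<open>A neighbourhood of \<open>v0\<close> on the circle is mapped into the interior
      of the closure. Dropping the finitely many critical points leaves an accumulation point, as
      the identity theorem requires.\<close>
    have lim: "v0 islimpt U"
    proof -
      have v0n: "v0 \<noteq> 0" "v0 \<noteq> a" using sphere_neq v0(1) by auto
      have "(\<kappa> \<longlongrightarrow> \<kappa> v0) (nhds v0)"
        using kmap_isCont[OF v0n] by (simp add: continuous_at_imp_continuous_at_within isCont_def tendsto_at_iff_tendsto_nhds)
      then have "\<forall>\<^sub>F x in nhds v0. \<kappa> x \<in> interior (closure W)"
        using topological_tendstoD open_interior v0(2) by blast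
      then obtain N where N: "open N" "v0 \<in> N" "\<And>x. x \<in> N \<Longrightarrow> \<kappa> x \<in> interior (closure W)"
        unfolding eventually_nhds by blast
      have sp: "v0 islimpt sphere 0 1"
      proof (rule connected_imp_perfect)
        show "connected (sphere (0::complex) 1)" by (rule connected_sphere) simp
        show "v0 \<in> sphere 0 1" using v0 by simp
        fix x :: complex
        have "(1::complex) \<in> sphere 0 1" "(-1::complex) \<in> sphere 0 1" by auto
        moreover have "(1::complex) \<noteq> -1" by simp
        ultimately show "sphere 0 1 \<noteq> {x}" by (metis singletonD)
      qed
      have "v0 islimpt (sphere 0 1 \<inter> N)"
      proof (rule islimptI)
        fix T assume "v0 \<in> T" "open T"
        then obtain y where "y \<in> sphere 0 1" "y \<in> T \<inter> N" "y \<noteq> v0"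
          using islimptE[OF sp, of "T \<inter> N"] N by blast
        then show "\<exists>y\<in>sphere 0 1 \<inter> N. y \<in> T \<and> y \<noteq> v0" by blast
      qed
      moreover have "sphere 0 1 \<inter> N \<subseteq> {u. u \<noteq> 0 \<and> u \<noteq> a \<and> deriv \<kappa> u = 0} \<union> U"
        using N(3) sphere_neq a by (auto simp: U_def)
      ultimately have "v0 islimpt ({u. u \<noteq> 0 \<and> u \<noteq> a \<and> deriv \<kappa> u = 0} \<union> U)" by (rule islimpt_subset)
      then show ?thesis using islimpt_Un_finite[OF finite_deriv_kmap_zeros] by blast
    qed
    \<comment> \<open>The removed points are the pole and the zero of e, where \<Psi> has its
      essential singularities. Deleting finitely many points keeps the plane connected.\<close>
    define X where "X = UNIV - {a, 1 / cnj a}"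
    have Xn: "m * (cnj a * v - 1) \<noteq> 0" "v - a \<noteq> 0" if "v \<in> X" for v
    proof -
      show "v - a \<noteq> 0" using that by (simp add: X_def)
      have "cnj a * v \<noteq> 1" using that a0 by (auto simp: X_def field_simps)
      then show "m * (cnj a * v - 1) \<noteq> 0" using m by simp
    qed
    have hol: "\<Psi> holomorphic_on X"
      unfolding \<Psi>_def Q_def P_def e_def using Xn by (intro holomorphic_intros) auto
    have oX: "open X" unfolding X_def by (intro open_Diff open_UNIV finite_imp_closed) simp
    have cX: "connected X" unfolding X_def by (rule connected_open_diff_countable) auto
    have SX: "v \<in> X" if "cmod v = 1" for v
    proof -
      have "cmod (1 / cnj a) < 1" using a by (simp add: norm_divide divide_simps)
      then show ?thesis using that a by (auto simp: X_def)
    qed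
    have van: "\<Psi> v = 0" if "v \<in> X" for v
      by (rule analytic_continuation[OF hol oX cX _ SX[OF v0(1)] lim zero that]) (use SX in \<open>auto simp: U_def\<close>)
    \<comment> \<open>The direction lam a is chosen so that e(x n) is a constant plus the positive
      integer n + 1. Then exp(e) grows without bound, while L / e tends to 0.\<close>
    define x where "x = (\<lambda>n. a + lam * a * of_real (inverse (real (Suc n))))"
    have "x \<longlonglongrightarrow> a + lam * a * of_real 0"
      unfolding x_def by (intro tendsto_intros LIMSEQ_inverse_real_of_nat)
    then have xl: "x \<longlonglongrightarrow> a" by simp
    have ex: "e (x n) = m * cnj a + of_real (real (Suc n))" for n
    proof -
      have d: "lam * a * of_real (inverse (real (Suc n))) \<noteq> 0" using lam a0 by (simp del: of_nat_Suc)
      have "m * (cnj a * x n - 1) = m * s + m * cnj a * (x n - a)" by (simp add: s_def algebra_simps)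
      then have "e (x n) = (lam * a + m * cnj a * (x n - a)) / (x n - a)" by (simp add: e_def m)
      also have "\<dots> = lam * a / (x n - a) + m * cnj a" using d by (simp add: x_def add_divide_distrib)
      also have "lam * a / (x n - a) = of_real (real (Suc n))"
        using lam a0 by (simp add: x_def field_simps del: of_nat_Suc)
      finally show ?thesis by simp
    qed
    have aX: "a \<noteq> 1 / cnj a" using s a0 by (auto simp: s_def field_simps)
    have ev: "\<forall>\<^sub>F n in sequentially. x n \<in> X"
    proof -
      have "\<forall>\<^sub>F n in sequentially. x n \<noteq> 1 / cnj a"
        using tendsto_imp_eventually_ne[OF xl aX] .
      then show ?thesis
        by eventually_elim (use lam a0 in \<open>simp add: X_def x_def del: of_nat_Suc\<close>)
    qed
    have Pl: "(\<lambda>n. P (x n)) \<longlonglongrightarrow> P a" unfolding P_def by (intro tendsto_intros xl)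
    have ex0: "(\<lambda>n. exp (- e (x n))) \<longlonglongrightarrow> 0"
    proof (rule tendsto_norm_zero_cancel)
      have "filterlim (\<lambda>n. - real (Suc n)) at_bot sequentially"
        by (simp add: filterlim_uminus_at_bot filterlim_compose[OF filterlim_real_sequentially filterlim_Suc] del: of_nat_Suc)
      from filterlim_compose[OF exp_at_bot this] have "(\<lambda>n. exp (- real (Suc n))) \<longlonglongrightarrow> 0" .
      then have "(\<lambda>n. exp (- Re (m * cnj a)) * exp (- real (Suc n))) \<longlonglongrightarrow> exp (- Re (m * cnj a)) * 0"
        by (intro tendsto_intros)
      moreover have "cmod (exp (- e (x n))) = exp (- Re (m * cnj a)) * exp (- real (Suc n))" for n
        by (simp only: ex norm_exp_eq_Re exp_add[symmetric]) (simp del: times_complex.sel)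
      ultimately show "(\<lambda>n. cmod (exp (- e (x n)))) \<longlonglongrightarrow> 0" by simp
    qed
    have "cnj a * a - 1 \<noteq> 0" using s by (simp add: s_def mult.commute)
    then have "m * (cnj a * a - 1) \<noteq> 0" using m(1) by simp
    \<comment> \<open>After division by exp(e), the identity \<Psi> = 0 forces P(a) = 0 in the
      limit; but P(a) = m^2 s is nonzero.\<close>
    then have "(\<lambda>n. Q (x n) * x n * exp (L * (x n - a) / (m * (cnj a * x n - 1))) * exp (- e (x n)))
        \<longlonglongrightarrow> Q a * a * exp (L * (a - a) / (m * (cnj a * a - 1))) * 0"
      unfolding Q_def by (intro tendsto_intros xl ex0)
    moreover have "\<forall>\<^sub>F n in sequentially.
        Q (x n) * x n * exp (L * (x n - a) / (m * (cnj a * x n - 1))) * exp (- e (x n)) = P (x n)"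
      using ev
    proof eventually_elim
      case (elim n)
      have "Q (x n) * x n * exp (L * (x n - a) / (m * (cnj a * x n - 1))) = P (x n) * exp (e (x n))"
        using van[OF elim] by (simp add: \<Psi>_def)
      then show ?case by (simp add: exp_minus)
    qed
    ultimately have "(\<lambda>n. P (x n)) \<longlonglongrightarrow> Q a * a * exp (L * (a - a) / (m * (cnj a * a - 1))) * 0"
      by (rule Lim_transform_eventually)
    then have "P a = 0" using LIMSEQ_unique[OF Pl] by simp
    moreover have "P a = m\<^sup>2 * s" by (simp add: P_def s_def mult.commute)
    ultimately show False using m(1) s by simp
  qed
qed

text \<open>After the substitution \<open>w = \<kappa>(u)\<close> the integrand has a single simple pole, at \<open>b\<close>.\<close>
lemma rs_sum_boundary_loop:
  assumes F: "continuous_on (cball 0 1) F" "F holomorphic_on ball 0 1"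
    and b: "cmod b < 1" "b \<noteq> 0" and g: "\<And>u. cmod u = 1 \<Longrightarrow> g (\<kappa> u) = u * F u"
  shows "rs_sum (\<lambda>w. g w * (\<alpha> / (w - \<kappa> b))) boundary_loop \<longlonglongrightarrow> 2 * of_real pi * \<i> * (\<alpha> * (b * F b))"
proof -
  let ?G = "\<lambda>w. g w * (\<alpha> / (w - \<kappa> b))"
  define k0 where "k0 = (\<lambda>u. of_real c * exp (lam * u / (u - a)))"
  define k where "k = (\<lambda>u. k0 u - \<kappa> b * u)"
  define D where "D = ball (0::complex) (cmod a)"
  have Da: "u \<noteq> a" if "u \<in> D" for u using that by (auto simp: D_def)
  have sub: "cball (0::complex) 1 \<subseteq> D" using a by (auto simp: D_def)
  have oD: "open D" by (simp add: D_def)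
  have bD: "b \<in> D" using b sub by auto
  have ba: "b \<noteq> a" by (rule Da[OF bD])
  have k0h: "k0 holomorphic_on D" unfolding k0_def using Da by (intro holomorphic_intros) auto
  have k: "k holomorphic_on D" unfolding k_def by (intro holomorphic_intros k0h)
  have k0k: "k0 u = u * \<kappa> u" if "u \<noteq> 0" for u using that by (simp add: k0_def kmap_def)
  have kk: "k u = u * (\<kappa> u - \<kappa> b)" if "u \<noteq> 0" for u using that k0k by (simp add: k_def algebra_simps)
  have kb: "k b = 0" using kk[OF b(2)] by simp
  have neq: "\<kappa> u \<noteq> \<kappa> b" if "u \<in> cball 0 1" "u \<noteq> 0" "u \<noteq> b" for u
  proof (cases "cmod u = 1")
    case True
    then show ?thesis by (rule kmap_sphere_disjoint[OF _ b])
  next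
    case False
    then have "u \<in> ball 0 1 - {0}" "b \<in> ball 0 1 - {0}" using that b by auto
    then show ?thesis using inj_onD[OF inj] that(3) by blast
  qed
  \<comment> \<open>With this \<open>q\<close>, \<kappa>(u) - \<kappa>(b) = (u - b) q(u) / u, and
    \<open>q\<close> has no zeros in the closed disc.\<close>
  define q where "q = (\<lambda>u. if u = b then deriv k b else (k u - k b) / (u - b))"
  have q: "q holomorphic_on D" unfolding q_def by (rule pole_lemma_open[OF k oD])
  have kq: "k u = (u - b) * q u" for u by (simp add: q_def kb)
  have "((\<lambda>u. u * (\<kappa> u - \<kappa> b)) has_field_derivative (b * deriv \<kappa> b)) (at b)"
    using kmap_deriv[OF b(2) ba] by (auto intro!: derivative_eq_intros)
  then have "(k has_field_derivative b * deriv \<kappa> b) (at b)"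
    by (rule has_field_derivative_transform_within_open[of _ _ _ "- {0}"]) (use kk b in auto)
  then have qb: "q b = b * deriv \<kappa> b" by (simp add: q_def DERIV_imp_deriv)
  have q0: "q u \<noteq> 0" if "u \<in> cball 0 1" for u
  proof (cases "u = b")
    case True
    then show ?thesis using qb b deriv_kmap_nonzero by simp
  next
    case False
    have "k u \<noteq> 0"
    proof (cases "u = 0")
      case True
      then show ?thesis using c by (simp add: k_def k0_def)
    next
      case u: False
      then show ?thesis using kk neq[OF that] False by simp
    qed
    then show ?thesis by (simp add: kq)
  qed
  \<comment> \<open>The pulled-back integrand is J(u) / (u - b). The powers of u from g(\<kappa>(u))
    = u F(u), from the derivative of \<kappa> and from the difference in the denominator leave u
    \<kappa>(u) = \<open>k0\<close> u, which is regular at 0.\<close>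
  define J where "J = (\<lambda>u. - \<alpha> * F u * k0 u * (1 + lam * a * u / (u - a)\<^sup>2) / q u)"
  define M where "M = (\<lambda>u. - \<alpha> * k0 u * (1 + lam * a * u / (u - a)\<^sup>2))"
  have mh: "M holomorphic_on D"
    unfolding M_def using Da by (intro holomorphic_intros k0h) auto
  have J: "J = (\<lambda>u. F u * M u / q u)" by (simp add: J_def M_def fun_eq_iff)
  have Jc: "continuous_on (cball 0 1) J"
  proof -
    have "continuous_on (cball 0 1) M" "continuous_on (cball 0 1) q"
      using holomorphic_on_imp_continuous_on[OF holomorphic_on_subset[OF mh sub]]
        holomorphic_on_imp_continuous_on[OF holomorphic_on_subset[OF q sub]] .
    then show ?thesis
      unfolding J using q0 by (intro continuous_on_divide continuous_on_mult F(1)) blast+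
  qed
  have Jh: "J holomorphic_on ball 0 1"
  proof -
    have "ball 0 1 \<subseteq> D" using sub ball_subset_cball by blast
    then have "M holomorphic_on ball 0 1" "q holomorphic_on ball 0 1"
      using holomorphic_on_subset[OF mh] holomorphic_on_subset[OF q] by blast+
    moreover have "q u \<noteq> 0" if "u \<in> ball 0 1" for u using that ball_subset_cball q0 by blast
    ultimately show ?thesis
      unfolding J by (intro holomorphic_on_divide holomorphic_on_mult F(2))
  qed
  have Jb: "J b = \<alpha> * (b * F b)"
  proof -
    define Y where "Y = 1 + lam * a * b / (b - a)\<^sup>2"
    have "b * (1 / b + lam * a / (b - a)\<^sup>2) = Y" using b by (simp add: Y_def distrib_left)
    then have qY: "q b = - \<kappa> b * Y" unfolding qb deriv_kmap[OF b(2) ba] by (simp add: mult.left_commute)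
    have "q b \<noteq> 0" using q0 b by simp
    then have "\<kappa> b * Y \<noteq> 0" using qY by auto
    moreover have "J b = - \<alpha> * F b * (b * \<kappa> b) * Y / (- \<kappa> b * Y)"
      unfolding J_def qY k0k[OF b(2)] by (simp add: Y_def)
    ultimately show ?thesis by (simp add: field_simps)
  qed
  have core: "?G (\<kappa> u) * deriv \<kappa> u = J u / (u - b)" if u: "cmod u = 1" for u
  proof -
    have n: "u \<noteq> 0" "u \<noteq> a" using sphere_neq[OF u] by auto
    have ub: "u - b \<noteq> 0" using u b by auto
    have qn: "q u \<noteq> 0" using q0 u by simp
    define Y where "Y = 1 + lam * a * u / (u - a)\<^sup>2"
    have Y: "1 / u + lam * a / (u - a)\<^sup>2 = Y / u" using n by (simp add: Y_def add_divide_distrib)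
    have dif: "\<kappa> u - \<kappa> b = (u - b) * q u / u" using kk[OF n(1)] kq[of u] n by (simp add: field_simps)
    have "?G (\<kappa> u) * deriv \<kappa> u = u * F u * (\<alpha> / ((u - b) * q u / u)) * (- \<kappa> u * (Y / u))"
      unfolding g[OF u] deriv_kmap[OF n] Y dif ..
    also have "\<dots> = - \<alpha> * F u * (u * \<kappa> u) * Y / q u / (u - b)"
      using n ub qn by (simp add: field_simps)
    finally show ?thesis by (simp add: J_def k0k[OF n(1)] Y_def)
  qed
  have "continuous_on {0..1} (\<lambda>t. ?G (boundary_loop t))"
  proof -
    have "continuous_on (sphere 0 1) (\<lambda>u. u * F u * (\<alpha> / (\<kappa> u - \<kappa> b)))"
    proof (intro continuous_intros)
      show "continuous_on (sphere 0 1) F" by (rule continuous_on_subset[OF F(1)]) auto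
      show "continuous_on (sphere 0 1) \<kappa>"
        using sphere_subset by (intro holomorphic_on_imp_continuous_on) (rule holomorphic_on_subset[OF kmap_holomorphic])
      show "\<forall>u\<in>sphere 0 1. \<kappa> u - \<kappa> b \<noteq> 0" using kmap_sphere_disjoint[OF _ b] by simp
    qed
    then have "continuous_on (sphere 0 1) (\<lambda>u. ?G (\<kappa> u))"
      by (rule continuous_on_eq) (use g in simp)
    moreover have "continuous_on {0..1} (circlepath 0 1)" using path_circlepath[of 0 1] by (simp add: path_def)
    moreover have "circlepath 0 1 ` {0..1} \<subseteq> sphere 0 1" using circlepath_sphere by fastforce
    ultimately have "continuous_on {0..1} (\<lambda>t. ?G (\<kappa> (circlepath 0 1 t)))" by (rule continuous_on_compose2)
    then show ?thesis by (simp add: comp_def)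
  qed
  from C1_rs_sum[OF boundary_loop_C1 this]
  have lim: "rs_sum ?G boundary_loop \<longlonglongrightarrow> integral {0..1} (\<lambda>t. ?G (boundary_loop t) *
      (deriv \<kappa> (circlepath 0 1 t) * (2 * of_real pi * \<i> * circlepath 0 1 t)))" .
  have "((\<lambda>u. J u / (u - b)) has_contour_integral (2 * of_real pi * \<i> * J b)) (circlepath 0 1)"
    using Cauchy_integral_circlepath[OF Jc Jh, of b] b by simp
  then have "((\<lambda>t. ?G (boundary_loop t) *
      (deriv \<kappa> (circlepath 0 1 t) * (2 * of_real pi * \<i> * circlepath 0 1 t))) has_integral (2 * of_real pi * \<i> * J b)) {0..1}"
    unfolding has_contour_integral_def
  proof (rule has_integral_eq[rotated])
    fix t :: real assume t: "t \<in> {0..1}"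
    have "vector_derivative (circlepath 0 1) (at t within {0..1}) =
        2 * of_real pi * \<i> * exp (2 * of_real pi * \<i> * of_real t)"
      using t by (simp add: vector_derivative_circlepath01)
    also have "exp (2 * of_real pi * \<i> * of_real t) = circlepath 0 1 t" by (simp add: circlepath)
    finally have "vector_derivative (circlepath 0 1) (at t within {0..1}) = 2 * of_real pi * \<i> * circlepath 0 1 t" .
    then show "J (circlepath 0 1 t) / (circlepath 0 1 t - b) * vector_derivative (circlepath 0 1) (at t within {0..1})
       = ?G (boundary_loop t) * (deriv \<kappa> (circlepath 0 1 t) * (2 * of_real pi * \<i> * circlepath 0 1 t))"
      using core[OF circlepath_sphere[OF t]] by (simp add: mult.assoc[symmetric])
  qed
  from integral_unique[OF this] lim show ?thesis by (simp only: Jb)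
qed

text \<open>In polar coordinates \<open>u = r cis t\<close>, \<open>cnj u = r\<^sup>2 / u\<close> on each circle, so the angular integral is a
  Cauchy integral around the reflected pole \<open>r\<^sup>2 / cnj a\<close>; as a function of \<open>ln r\<close> it is an exact derivative.\<close>
lemma angular_integral:
  assumes G: "G holomorphic_on ball 0 1" "G 0 = 0" and r: "0 < r" "r < 1"
    and b: "b = of_real (r\<^sup>2) / cnj a"
  shows "(LINT t:{0<..<2*pi}|lborel. (\<lambda>u. G u * cnj (1 + lam * a * u / (u - a)\<^sup>2)) (of_real r * cis t))
    = 2 * of_real pi * cnj lam * b * deriv G b"
proof -
  have a0: "a \<noteq> 0" "cnj a \<noteq> 0" using a by auto
  have br: "cmod b < r"
  proof -
    have "cmod b = r * (r / cmod a)" using r by (simp add: b norm_divide norm_mult power2_eq_square)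
    also have "r / cmod a < 1" using r a a0 by (simp add: divide_less_eq)
    finally show ?thesis using r by simp
  qed
  have cG: "continuous_on (cball 0 r) G" "G holomorphic_on ball 0 r"
    using r by (auto intro!: holomorphic_on_imp_continuous_on intro: holomorphic_on_subset[OF G(1)])
  \<comment> \<open>The continuation of the integrand off the circle: cnj u = b cnj a / u there,
    which sends the conjugate of lam a u / (u - a)^2 to cnj lam b u / (u - b)^2. The double pole at
    b is the source of the derivative of G.\<close>
  define R where "R = (\<lambda>u. G u * (1 + cnj lam * b * u / (u - b)\<^sup>2))"
  have ub: "u - b \<noteq> 0" if "cmod u = r" for u using that br by auto
  have eq: "G u * cnj (1 + lam * a * u / (u - a)\<^sup>2) = R u" if u: "cmod u = r" for u
  proof -
    have u0: "u \<noteq> 0" using u r by auto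
    have "u * cnj u = of_real (r\<^sup>2)" using u complex_norm_square[of u] by simp
    then have "cnj u = b * cnj a / u" using a0 u0 by (simp add: b field_simps)
    then have c1: "cnj u = cnj a * (b / u)" by simp
    have c2: "cnj u - cnj a = - cnj a * ((u - b) / u)" using u0 by (simp add: c1 field_simps)
    have "l * A * (A * (b / u)) / (- A * (d / u))\<^sup>2 = l * b * u / d\<^sup>2" if "A \<noteq> 0" "d \<noteq> 0" for l A d
      using u0 that by (simp add: field_simps power2_eq_square)
    note red = this[OF a0(2) ub[OF u]]
    have "cnj (lam * a * u / (u - a)\<^sup>2) = cnj lam * cnj a * cnj u / (cnj u - cnj a)\<^sup>2" by simp
    also have "\<dots> = cnj lam * b * u / (u - b)\<^sup>2" unfolding c2 unfolding c1 by (rule red)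
    finally show ?thesis by (simp add: R_def)
  qed
  have "((\<lambda>u. G u / (u - 0)) has_contour_integral (2 * of_real pi * \<i> * G 0)) (circlepath 0 r)"
    using r by (intro Cauchy_integral_circlepath cG) auto
  then have i1: "((\<lambda>u. G u / u) has_contour_integral 0) (circlepath 0 r)" by (simp add: G)
  have i2: "((\<lambda>u. G u / (u - b)\<^sup>2) has_contour_integral (2 * of_real pi * \<i> * deriv G b)) (circlepath 0 r)"
    using Cauchy_has_contour_integral_higher_derivative_circlepath[OF cG, of b 1] br
    by (simp add: numeral_2_eq_2)
  have "((\<lambda>u. G u / u + cnj lam * b * (G u / (u - b)\<^sup>2)) has_contour_integral
      (0 + cnj lam * b * (2 * of_real pi * \<i> * deriv G b))) (circlepath 0 r)"
    by (intro has_contour_integral_add has_contour_integral_lmul i1 i2)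
  then have I: "((\<lambda>u. R u / u) has_contour_integral (cnj lam * b * (2 * of_real pi * \<i> * deriv G b))) (circlepath 0 r)"
    unfolding add_0
  proof (rule has_contour_integral_eq)
    fix u assume "u \<in> path_image (circlepath 0 r)"
    then have u: "cmod u = r" using r by simp
    then have u0: "u \<noteq> 0" using r by auto
    have "R u / u = G u / u + (G u * (cnj lam * b * u / (u - b)\<^sup>2)) / u"
      by (simp only: R_def distrib_left add_divide_distrib mult_1_right)
    also have "(G u * (cnj lam * b * u / (u - b)\<^sup>2)) / u = cnj lam * b * (G u / (u - b)\<^sup>2)"
      using u0 by simp
    finally show "G u / u + cnj lam * b * (G u / (u - b)\<^sup>2) = R u / u" by (rule sym)
  qed
  have cR: "continuous_on (sphere 0 r) R"
    unfolding R_def using ub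
    by (intro continuous_intros continuous_on_subset[OF cG(1)]) auto
  have "(LINT t:{0<..<2*pi}|lborel. R (of_real r * cis t)) = - \<i> * (cnj lam * b * (2 * of_real pi * \<i> * deriv G b))"
    by (rule circle_lebesgue_integral[OF r(1) cR I])
  moreover have "(\<lambda>t. (\<lambda>u. G u * cnj (1 + lam * a * u / (u - a)\<^sup>2)) (of_real r * cis t)) = (\<lambda>t. R (of_real r * cis t))"
    by (rule ext, rule eq) (use r in \<open>simp add: norm_mult\<close>)
  ultimately show ?thesis by (simp only:) (simp add: algebra_simps)
qed

text \<open>Under w = \<kappa>(u) the weight meets |\<kappa>'|^2 and only the logarithmic derivative
  of \<kappa> survives, a rational function. Its square modulus splits into a holomorphic factor,
  absorbed into G, and a conjugate one treated by \<open>angular_integral\<close>. The radial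
  integrand is then the derivative of pi cnj lam G(b), and G(0) = 0 removes the lower end.\<close>

lemma area_integral_kmap:
  assumes F: "F holomorphic_on ball 0 1" "F 0 = 0"
    and f: "\<And>u. cmod u < 1 \<Longrightarrow> u \<noteq> 0 \<Longrightarrow> f (\<kappa> u) = F u"
    and int: "integrable lborel (\<lambda>w. indicator W w *\<^sub>R (f w / of_real ((cmod w)\<^sup>2)))"
    and u1: "u1 = 1 / cnj a"
  shows "(LINT w|lborel. indicator W w *\<^sub>R (f w / of_real ((cmod w)\<^sup>2)))
    = of_real pi * (cnj lam * (1 + lam * a * u1 / (u1 - a)\<^sup>2)) * F u1"
proof -
  define H where "H = (\<lambda>w. indicator W w *\<^sub>R (f w / of_real ((cmod w)\<^sup>2)))"
  define S where "S = ball (0::complex) 1 - {0}"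
  define h where "h = (\<lambda>z. indicator S z *\<^sub>R (F z * of_real ((cmod (1 / z + lam * a / (z - a)\<^sup>2))\<^sup>2)))"
  define G where "G = (\<lambda>u. F u * (1 + lam * a * u / (u - a)\<^sup>2))"
  have Hi: "integrable lborel H" using int by (simp add: H_def)
  have Hm[measurable]: "H \<in> borel_measurable borel" using borel_measurable_integrable[OF Hi] by simp
  have oS: "open S" by (simp add: S_def open_delete)
  have Sa: "S \<subseteq> - {0, a}" using a by (auto simp: S_def)
  have WS: "W = \<kappa> ` S" by (simp add: W_def S_def)
  have Wm[measurable]: "W \<in> sets borel" using W_open by simp
  have injS: "inj_on \<kappa> S" using inj by (simp add: S_def)
  note cov = conformal_change_of_variables[OF oS holomorphic_on_subset[OF kmap_holomorphic Sa] injS, folded WS]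
  note [measurable] = cov(2,3)
  have dW: "density lborel (indicator W) = density lborel (\<lambda>w. ennreal (indicator W w))"
    by (simp add: ennreal_indicator)
  have HW: "indicator W w *\<^sub>R H w = H w" for w by (simp add: H_def indicator_def)
  have hT: "((cmod (deriv \<kappa> z))\<^sup>2 * indicator S z) *\<^sub>R H (indicator S z *\<^sub>R \<kappa> z) = h z" for z
  proof (cases "z \<in> S")
    case True
    then have z: "z \<noteq> 0" "z \<noteq> a" "cmod z < 1" "\<kappa> z \<in> W" using Sa by (auto simp: S_def WS)
    have "H (\<kappa> z) = F z / of_real ((cmod (\<kappa> z))\<^sup>2)" using z f by (simp add: H_def)
    moreover have "(cmod (deriv \<kappa> z))\<^sup>2 = (cmod (\<kappa> z))\<^sup>2 * (cmod (1 / z + lam * a / (z - a)\<^sup>2))\<^sup>2"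
      using deriv_kmap[OF z(1,2)] by (simp add: norm_mult power_mult_distrib)
    ultimately show ?thesis using True kmap_nonzero[OF z(1)] by (simp add: h_def scaleR_conv_of_real)
  qed (simp add: h_def)
  have i1: "integrable (density lborel (indicator W)) H"
    unfolding dW by (subst integrable_density) (auto simp: HW Hi)
  have hi: "integrable lborel h"
    using i1 unfolding cov(1) by (subst (asm) integrable_distr_eq, simp, simp, subst (asm) integrable_density) (auto simp: hT)
  have "(LINT w|lborel. H w) = (LINT w|density lborel (indicator W). H w)"
    unfolding dW by (subst integral_density) (auto simp: HW)
  also have "\<dots> = (LINT z|lborel. h z)"
    unfolding cov(1) by (subst integral_distr, simp, simp, subst integral_density) (auto simp: hT)
  finally have Hh: "(LINT w|lborel. H w) = (LINT z|lborel. h z)" .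
  have hm: "h \<in> borel_measurable borel" using borel_measurable_integrable[OF hi] by simp
  have Gh: "G holomorphic_on ball 0 1"
    unfolding G_def using cball_neq_a by (intro holomorphic_intros F) auto
  have G0: "G 0 = 0" by (simp add: G_def F)
  \<comment> \<open>The reflected pole for the radius exp(x); it runs from 0, as x tends to minus
    infinity, to \<open>u1\<close> at x = 0.\<close>
  define b where "b = (\<lambda>x. of_real (exp (2 * x)) / cnj a)"
  define D where "D = (\<lambda>x. 2 * of_real pi * cnj lam * b x * deriv G (b x))"
  have bb: "cmod (b x) < 1" if "x \<le> 0" for x
  proof -
    have "exp (2 * x) \<le> 1" using that by simp
    then have "exp (2 * x) < cmod a" using a by linarith
    then show ?thesis using a by (simp add: b_def norm_divide divide_simps)
  qed
  have ang: "exp (2 * x) *\<^sub>R (LINT t:{0<..<2*pi}|lborel. h (exp (Complex x t))) = indicator {..<0} x *\<^sub>R D x" for x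
  proof (cases "x < 0")
    case True
    have r: "0 < exp x" "exp x < 1" using True by auto
    have bx: "b x = of_real ((exp x)\<^sup>2) / cnj a" by (simp add: b_def power2_eq_square exp_add[symmetric])
    have "of_real (exp (2 * x)) * h u = G u * cnj (1 + lam * a * u / (u - a)\<^sup>2)" if u: "cmod u = exp x" for u
    proof -
      have uS: "u \<in> S" "u \<noteq> 0" using u r by (auto simp: S_def)
      have e2: "of_real (exp (2 * x)) = u * cnj u"
        unfolding complex_norm_square[symmetric] u by (simp add: power2_eq_square exp_add[symmetric] flip: of_real_mult)
      define Y where "Y = 1 + lam * a * u / (u - a)\<^sup>2"
      have Y: "1 / u + lam * a / (u - a)\<^sup>2 = Y / u" using uS by (simp add: Y_def add_divide_distrib)
      have "h u = F u * ((Y / u) * cnj (Y / u))"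
        using uS by (simp add: h_def Y complex_norm_square[symmetric] del: complex_cnj_divide)
      then have "of_real (exp (2 * x)) * h u = F u * Y * cnj Y" using e2 uS by simp
      then show ?thesis by (simp add: G_def Y_def)
    qed
    then have "(\<lambda>t. of_real (exp (2 * x)) * h (exp (Complex x t))) =
        (\<lambda>t. (\<lambda>u. G u * cnj (1 + lam * a * u / (u - a)\<^sup>2)) (of_real (exp x) * cis t))"
      by (simp add: exp_Complex norm_mult fun_eq_iff)
    then have "(LINT t:{0<..<2*pi}|lborel. of_real (exp (2 * x)) * h (exp (Complex x t))) = D x"
      using angular_integral[OF Gh G0 r bx] by (simp only: D_def)
    moreover have "(LINT t:{0<..<2*pi}|lborel. of_real (exp (2 * x)) * h (exp (Complex x t)))
        = of_real (exp (2 * x)) * (LINT t:{0<..<2*pi}|lborel. h (exp (Complex x t)))"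
      by (rule set_integral_mult_right)
    ultimately show ?thesis using True by (simp add: scaleR_conv_of_real)
  next
    case False
    then have "h (exp (Complex x t)) = 0" for t
      by (simp add: h_def S_def exp_Complex norm_mult indicator_def)
    then show ?thesis using False by simp
  qed
  have Di: "integrable lborel (\<lambda>x. indicator {..<0} x *\<^sub>R D x)"
    and Dh: "(LINT z|lborel. h z) = (LINT x|lborel. indicator {..<0} x *\<^sub>R D x)"
    using polar_integrable[OF hi hm] by (simp_all only: ang)
  define P where "P = (\<lambda>x. of_real pi * cnj lam * G (b x))"
  have bd: "(b has_vector_derivative 2 * b x) (at x)" for x
  proof -
    have "((\<lambda>x. exp (2 * x)) has_real_derivative exp (2 * x) * 2) (at x)" by (auto intro!: derivative_eq_intros)
    then have "((\<lambda>x. complex_of_real (exp (2 * x))) has_vector_derivative of_real (exp (2 * x) * 2)) (at x)"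
      by (intro has_vector_derivative_of_real) (simp add: has_real_derivative_iff_has_vector_derivative)
    then have "((\<lambda>x. of_real (exp (2 * x)) * inverse (cnj a)) has_vector_derivative of_real (exp (2 * x) * 2) * inverse (cnj a)) (at x)"
      by (rule has_vector_derivative_mult_left)
    then show ?thesis by (simp add: b_def[abs_def] divide_inverse mult.commute mult.left_commute)
  qed
  have bc: "isCont b x" for x using bd has_vector_derivative_continuous by blast
  have Gb: "(\<lambda>x. G (b x)) \<midarrow>x\<rightarrow> G (b x)" if "x \<le> 0" for x
    using bb[OF that] holomorphic_on_imp_continuous_on[OF Gh] bc[of x]
    by (auto simp: continuous_on_eq_continuous_at isCont_def intro: isCont_tendsto_compose)
  have "(LBINT x=-\<infinity>..ereal 0. D x) = P 0 - 0"
  proof (rule interval_integral_FTC_integrable)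
    fix x assume "ereal x < ereal 0"
    then have x: "x < 0" by simp
    have bx: "b x \<in> ball 0 1" using bb[of x] x by simp
    have "(G has_field_derivative deriv G (b x)) (at (b x))" by (rule holomorphic_derivI[OF Gh open_ball bx])
    from field_vector_diff_chain_at[OF bd this]
    have "((\<lambda>x. G (b x)) has_vector_derivative 2 * b x * deriv G (b x)) (at x)" by (simp add: comp_def)
    from has_vector_derivative_mult_right[OF this, of "of_real pi * cnj lam"]
    show "(P has_vector_derivative D x) (at x)" by (simp add: P_def[abs_def] D_def mult.commute mult.left_commute)
    have "isCont (deriv G) (b x)"
      using bx holomorphic_on_imp_continuous_on[OF holomorphic_deriv[OF Gh open_ball]]
      by (simp add: continuous_on_eq_continuous_at)
    note cd = isCont_o2[OF bc this]
    show "isCont D x" unfolding D_def by (intro isCont_mult continuous_const bc cd)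
  next
    show "set_integrable lborel (einterval (- \<infinity>) (ereal 0)) D"
      using Di by (simp add: set_integrable_def)
    have "((\<lambda>x. exp (2 * x)) \<longlongrightarrow> (0::real)) at_bot"
      by (rule filterlim_compose[OF exp_at_bot]) (simp add: filterlim_tendsto_pos_mult_at_bot[OF tendsto_const _ filterlim_ident])
    then have "(b \<longlongrightarrow> of_real 0 / cnj a) at_bot"
      unfolding b_def using a by (intro tendsto_intros) auto
    then have "(b \<longlongrightarrow> 0) at_bot" by simp
    moreover have "isCont G 0" using holomorphic_on_imp_continuous_on[OF Gh] by (simp add: continuous_on_eq_continuous_at)
    ultimately have "((\<lambda>x. G (b x)) \<longlongrightarrow> G 0) at_bot" by (rule isCont_tendsto_compose[rotated])
    then have "(P \<longlongrightarrow> of_real pi * cnj lam * G 0) at_bot" unfolding P_def by (intro tendsto_intros)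
    then show "((P \<circ> real_of_ereal) \<longlongrightarrow> 0) (at_right (- \<infinity>))" by (simp add: ereal_tendsto_simps1 G0)
    have "(P \<longlongrightarrow> P 0) (at 0)" unfolding P_def using Gb[of 0] by (intro tendsto_intros) simp
    then have "(P \<longlongrightarrow> P 0) (at_left 0)" using filterlim_at_split by blast
    then show "((P \<circ> real_of_ereal) \<longlongrightarrow> P 0) (at_left (ereal 0))" by (simp only: ereal_tendsto_simps1)
  qed simp
  moreover have "(LBINT x=-\<infinity>..ereal 0. D x) = (LINT x|lborel. indicator {..<0} x *\<^sub>R D x)"
    by (simp add: interval_lebesgue_integral_def set_lebesgue_integral_def)
  moreover have "b 0 = u1" by (simp add: b_def u1)
  ultimately show ?thesis
    using Hh Dh by (simp add: P_def H_def G_def)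
qed

end

section \<open>From the exterior map to the quadrature identity\<close>

lemma continuous_on_Fin: "continuous_on S Fin"
  by (rule continuous_on_subset[of UNIV]) (auto simp: continuous_on_open_vimage vimage_def open_csph_def)

text \<open>The class \<open>L1a_rho0\<close> is defined by gauge integrability of an absolute
  value. For a nonnegative function this is Lebesgue integrability, and analyticity supplies Borel
  measurability.\<close>

lemma integrable_lborel_L1a_rho0:
  assumes op: "open \<Omega>" and f: "f \<in> L1a_rho0 \<Omega>" and n0: "0 \<notin> fin_part \<Omega>"
  shows "integrable lborel (\<lambda>w. indicator (fin_part \<Omega>) w *\<^sub>R (f (Fin w) / of_real ((cmod w)\<^sup>2)))"
proof -
  let ?U = "fin_part \<Omega>" and ?h = "\<lambda>w. f (Fin w) / of_real ((cmod w)\<^sup>2)"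
  have oU: "open ?U" by (rule open_fin_part[OF op])
  have "(\<lambda>z. f (Fin z)) holomorphic_on ?U"
    using f by (simp add: L1a_rho0_def A_class_def sph_analytic_in_def)
  then have "continuous_on ?U ?h"
    using n0 by (intro continuous_intros holomorphic_on_imp_continuous_on) auto
  then have m: "(\<lambda>w. indicator ?U w *\<^sub>R ?h w) \<in> borel_measurable borel"
    using oU by (intro borel_measurable_continuous_on_indicator) auto
  have nrm: "(\<lambda>w. norm (indicator ?U w *\<^sub>R ?h w)) = (\<lambda>w. indicator ?U w *\<^sub>R (cmod (f (Fin w)) / (cmod w)\<^sup>2))"
    by (auto simp: norm_divide norm_power indicator_def)
  have "(\<lambda>w. cmod (f (Fin w)) / (cmod w)\<^sup>2) integrable_on ?U" using f by (simp add: L1a_rho0_def)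
  then have "(\<lambda>w. cmod (f (Fin w)) / (cmod w)\<^sup>2) absolutely_integrable_on ?U"
    by (rule nonnegative_absolutely_integrable_1) simp
  then have "integrable lebesgue (\<lambda>w. norm (indicator ?U w *\<^sub>R ?h w))"
    unfolding nrm by (simp add: set_integrable_def)
  moreover have "(\<lambda>w. norm (indicator ?U w *\<^sub>R ?h w)) \<in> borel_measurable lborel"
    using m by (intro measurable_compose[OF _ borel_measurable_norm]) simp
  ultimately have "integrable lborel (\<lambda>w. norm (indicator ?U w *\<^sub>R ?h w))"
    by (simp only: integrable_completion)
  then show ?thesis using m by (subst (asm) integrable_norm_iff) auto
qed

text \<open>A nonzero value at infinity would bound |f| from below outside a disc, where |w|^-2 has
  infinite integral by \<open>not_integrable_inverse_square\<close>.\<close>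

lemma L1a_rho0_Infty:
  assumes op: "open \<Omega>" and inf: "Infty \<in> \<Omega>" and f: "f \<in> L1a_rho0 \<Omega>" and n0: "0 \<notin> fin_part \<Omega>"
  shows "f Infty = 0"
proof (rule ccontr)
  assume "f Infty \<noteq> 0"
  then have e: "cmod (f Infty) / 2 > 0" by simp
  define e where "e = cmod (f Infty) / 2"
  let ?g = "\<lambda>z. if z = 0 then f Infty else f (Fin (inverse z))"
  obtain r where r: "r > 0" "?g holomorphic_on ball 0 r"
    using f inf by (auto simp: L1a_rho0_def A_class_def sph_analytic_in_def)
  then have "isCont ?g 0" using holomorphic_on_imp_continuous_on[OF r(2)] by (simp add: continuous_on_eq_continuous_at)
  then obtain d where d: "d > 0" "\<And>z. dist z 0 < d \<Longrightarrow> dist (?g z) (?g 0) < e"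
    using e unfolding e_def continuous_at_eps_delta by blast
  obtain R0 where R0: "\<And>z. R0 < cmod z \<Longrightarrow> Fin z \<in> \<Omega>" using op inf by (auto simp: open_csph_def)
  define R where "R = max (1 / d) R0"
  have R: "R > 0" using d by (simp add: R_def less_max_iff_disj)
  have big: "w \<in> fin_part \<Omega> \<and> e \<le> cmod (f (Fin w))" if "R < cmod w" for w
  proof
    show "w \<in> fin_part \<Omega>" using that R0 by (simp add: fin_part_def R_def)
    have "cmod w > 0" using that R by linarith
    moreover have "1 / d < cmod w" using that by (simp add: R_def)
    ultimately have w: "w \<noteq> 0" "1 / d < cmod w" by auto
    then have "cmod (inverse w) < d" using d(1) by (simp add: norm_divide norm_inverse field_simps)
    then have "dist (?g (inverse w)) (?g 0) < e" by (intro d(2)) simp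
    then have "cmod (f (Fin w) - f Infty) < e" using w by (simp add: dist_norm)
    moreover have "cmod (f Infty) \<le> cmod (f (Fin w) - f Infty) + cmod (f (Fin w))"
      by (metis norm_minus_commute norm_triangle_sub add.commute)
    ultimately show "e \<le> cmod (f (Fin w))" by (simp add: e_def)
  qed
  let ?h = "\<lambda>w. indicator (fin_part \<Omega>) w *\<^sub>R (f (Fin w) / of_real ((cmod w)\<^sup>2))"
  have "(\<integral>\<^sup>+w. ennreal (e * (indicator {w. R < cmod w} w / (cmod w)\<^sup>2)) \<partial>lborel) \<le> (\<integral>\<^sup>+w. ennreal (norm (?h w)) \<partial>lborel)"
  proof (intro nn_integral_mono ennreal_leI)
    fix w
    show "e * (indicator {w. R < cmod w} w / (cmod w)\<^sup>2) \<le> norm (?h w)"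
    proof (cases "R < cmod w")
      case True
      then show ?thesis using big[OF True] by (simp add: norm_divide norm_power divide_right_mono)
    qed simp
  qed
  also have "\<dots> < \<infinity>" using integrable_lborel_L1a_rho0[OF op f n0] by (simp add: integrable_iff_bounded)
  finally have "(\<integral>\<^sup>+w. ennreal (e * (indicator {w. R < cmod w} w / (cmod w)\<^sup>2)) \<partial>lborel) < \<infinity>" .
  moreover have "(\<integral>\<^sup>+w. ennreal (e * (indicator {w. R < cmod w} w / (cmod w)\<^sup>2)) \<partial>lborel) = ennreal e * \<infinity>"
  proof -
    have e0: "0 \<le> e" using e by (simp add: e_def)
    have "(\<lambda>w::complex. ennreal (indicator {w. R < cmod w} w / (cmod w)\<^sup>2)) \<in> borel_measurable lborel" by measurable
    from nn_integral_cmult[OF this, of "ennreal e"] show ?thesis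
      unfolding not_integrable_inverse_square[OF R] by (simp only: ennreal_mult'[OF e0])
  qed
  ultimately show False using e by (simp add: ennreal_mult_top e_def)
qed

context exterior_map
begin

text \<open>\<open>cond\<close> is the relation for lam transported to the coordinate u. The
  boundary side gives \<alpha> f(\<kappa> u1) as a residue, the area side gives cnj lam (1 + ...)
  f(\<kappa> u1), and \<open>cond\<close> makes the two factors agree.\<close>

lemma quadrature_identity_image:
  assumes u1: "u1 = 1 / cnj a" and cond: "cnj lam * (1 + lam * a * u1 / (u1 - a)\<^sup>2) = \<alpha>"
    and op: "open \<Omega>" and inf: "Infty \<in> \<Omega>" and fin: "fin_part \<Omega> = W"
    and f: "f \<in> L1a_rho0 \<Omega>"
  shows "rs_sum (\<lambda>w. f (Fin w) * (\<alpha> / (w - \<kappa> u1))) boundary_loop \<longlonglongrightarrow> 2 * of_real pi * \<i> * (\<alpha> * f (Fin (\<kappa> u1)))"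
    and "((\<lambda>R. integral (fin_part \<Omega> \<inter> ball 0 R) (\<lambda>w. f (Fin w) / (of_real ((cmod w)\<^sup>2))) / of_real pi)
           \<longlongrightarrow> \<alpha> * f (Fin (\<kappa> u1))) at_top"
    and "continuous_on (\<kappa> ` sphere 0 1) (\<lambda>w. f (Fin w))"
proof -
  have u1b: "cmod u1 < 1" "u1 \<noteq> 0" using a by (auto simp: u1 norm_divide divide_simps)
  have cl: "fin_part (closure \<Omega>) = closure W" by (simp add: fin_part_closure fin)
  have W0: "0 \<notin> fin_part \<Omega>"
  proof
    assume "0 \<in> fin_part \<Omega>"
    then obtain u where u: "u \<in> ball 0 1 - {0}" "0 = \<kappa> u" unfolding fin W_def by blast
    have "u \<noteq> 0" using u(1) by blast
    from notE[OF kmap_nonzero[OF this] u(2)[symmetric]] show False .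
  qed
  have cf: "continuous_on (closure \<Omega>) f" and hf: "(\<lambda>z. f (Fin z)) holomorphic_on W"
    using f fin by (auto simp: L1a_rho0_def A_class_def sph_analytic_in_def)
  \<comment> \<open>The boundary map into the sphere, written through \<open>inversion\<close> of
    the reciprocal 1/\<kappa>, is continuous also at u = 0, where it takes the value
    \<open>Infty\<close>. The pullback F of f is thus continuous on the closed disc, and its
    singularity at 0 is removable.\<close>
  define \<Phi> where "\<Phi> = (\<lambda>u. inversion (u / (of_real c * exp (lam * u / (u - a)))))"
  define F where "F = (\<lambda>u. f (\<Phi> u))"
  have \<Phi>0: "\<Phi> 0 = Infty" by (simp add: \<Phi>_def inversion_def)
  have \<Phi>1: "\<Phi> u = Fin (\<kappa> u)" if "u \<noteq> 0" for u using that c by (simp add: \<Phi>_def inversion_def kmap_def)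
  have \<Phi>c: "continuous_on (cball 0 1) \<Phi>"
    unfolding \<Phi>_def using c cball_neq_a
    by (intro continuous_on_compose2[OF continuous_on_inversion[of UNIV]] continuous_intros) auto
  have \<Phi>s: "\<Phi> ` cball 0 1 \<subseteq> closure \<Omega>"
  proof
    fix p assume "p \<in> \<Phi> ` cball 0 1"
    then obtain u where u: "u \<in> cball 0 1" "p = \<Phi> u" by blast
    show "p \<in> closure \<Omega>"
    proof (cases "u = 0")
      case True
      then show ?thesis using inf u \<Phi>0 closure_subset by auto
    next
      case False
      then have "\<kappa> u \<in> closure W" using u closure_W_image by auto
      then show ?thesis using u \<Phi>1[OF False] unfolding cl[symmetric] by (simp add: fin_part_def)
    qed
  qed
  have Fc: "continuous_on (cball 0 1) F" unfolding F_def by (rule continuous_on_compose2[OF cf \<Phi>c \<Phi>s])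
  have Fh: "F holomorphic_on ball 0 1"
  proof (rule no_isolated_singularity[where K = "{0}"])
    have "((\<lambda>z. f (Fin z)) \<circ> \<kappa>) holomorphic_on ball 0 1 - {0}"
      using a
      by (intro holomorphic_on_compose_gen[OF holomorphic_on_subset[OF kmap_holomorphic] hf]) (auto simp: W_def)
    then show "F holomorphic_on ball 0 1 - {0}"
      by (rule holomorphic_transform) (simp add: F_def \<Phi>1)
  qed (use Fc in \<open>auto intro: continuous_on_subset\<close>)
  have F0: "F 0 = 0" unfolding F_def \<Phi>0 by (rule L1a_rho0_Infty[OF op inf f W0])
  have Fu: "f (Fin (\<kappa> u)) = F u" if "u \<noteq> 0" for u by (simp add: F_def \<Phi>1[OF that])
  \<comment> \<open>F / u, holomorphic because F(0) = 0; it provides the factorization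
    g(\<kappa>(u)) = u F(u) that \<open>rs_sum_boundary_loop\<close> asks for.\<close>
  define F1 where "F1 = (\<lambda>u. if u = 0 then deriv F 0 else (F u - F 0) / (u - 0))"
  have F1h: "F1 holomorphic_on ball 0 1" unfolding F1_def by (rule pole_lemma_open[OF Fh open_ball])
  have F1e: "F1 u = F u / u" if "u \<noteq> 0" for u using that by (simp add: F1_def F0)
  have F1c: "continuous_on (cball 0 1) F1"
    unfolding continuous_on_eq_continuous_within
  proof
    fix x :: complex assume x: "x \<in> cball 0 1"
    show "continuous (at x within cball 0 1) F1"
    proof (cases "x \<in> ball 0 1")
      case True
      then have "isCont F1 x" using holomorphic_on_imp_continuous_on[OF F1h] by (simp add: continuous_on_eq_continuous_at)
      then show ?thesis by (rule continuous_at_imp_continuous_at_within)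
    next
      case False
      then have x1: "cmod x = 1" "x \<noteq> 0" using x by auto
      have "continuous (at x within cball 0 1) F" using Fc x by (simp add: continuous_on_eq_continuous_within)
      then have "continuous (at x within cball 0 1) (\<lambda>u. F u / u)"
        using x1 by (intro continuous_at_within_divide continuous_ident) auto
      moreover have "F y / y = F1 y" if "y \<in> cball 0 1" "dist y x < 1" for y
      proof -
        have "y \<noteq> 0" using that x1 by auto
        then show ?thesis using F1e by simp
      qed
      ultimately show ?thesis by (rule continuous_transform_within[OF _ zero_less_one x])
    qed
  qed
  have "f (Fin (\<kappa> u)) = u * F1 u" if "cmod u = 1" for u
  proof -
    have "u \<noteq> 0" using that by auto
    then show ?thesis by (simp add: Fu F1e)
  qed
  from rs_sum_boundary_loop[where g = "\<lambda>w. f (Fin w)", OF F1c F1h u1b this]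
  show "rs_sum (\<lambda>w. f (Fin w) * (\<alpha> / (w - \<kappa> u1))) boundary_loop \<longlonglongrightarrow> 2 * of_real pi * \<i> * (\<alpha> * f (Fin (\<kappa> u1)))"
    using u1b by (simp add: F1e Fu)
  have int: "integrable lborel (\<lambda>w. indicator W w *\<^sub>R (f (Fin w) / of_real ((cmod w)\<^sup>2)))"
    using integrable_lborel_L1a_rho0[OF op f W0] by (simp only: fin)
  have "(LINT w|lborel. indicator W w *\<^sub>R (f (Fin w) / of_real ((cmod w)\<^sup>2))) = of_real pi * \<alpha> * F u1"
    using area_integral_kmap[where f = "\<lambda>w. f (Fin w)", OF Fh F0 Fu int u1] unfolding cond by blast
  moreover have "((\<lambda>R. integral (W \<inter> ball 0 R) (\<lambda>w. f (Fin w) / of_real ((cmod w)\<^sup>2))) \<longlongrightarrow>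
      (LINT w|lborel. indicator W w *\<^sub>R (f (Fin w) / of_real ((cmod w)\<^sup>2)))) at_top"
    by (rule tendsto_truncated_integral[OF _ int]) (use W_open in auto)
  ultimately have "((\<lambda>R. integral (W \<inter> ball 0 R) (\<lambda>w. f (Fin w) / of_real ((cmod w)\<^sup>2)) / of_real pi) \<longlongrightarrow>
      of_real pi * \<alpha> * F u1 / of_real pi) at_top"
    by (intro tendsto_divide tendsto_const) auto
  then show "((\<lambda>R. integral (fin_part \<Omega> \<inter> ball 0 R) (\<lambda>w. f (Fin w) / (of_real ((cmod w)\<^sup>2))) / of_real pi)
           \<longlongrightarrow> \<alpha> * f (Fin (\<kappa> u1))) at_top"
    using u1b by (simp add: fin Fu)
  show "continuous_on (\<kappa> ` sphere 0 1) (\<lambda>w. f (Fin w))"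
  proof (rule continuous_on_compose2[OF cf continuous_on_Fin])
    have "\<kappa> ` sphere 0 1 \<subseteq> fin_part (closure \<Omega>)" unfolding cl closure_W by blast
    then show "Fin ` \<kappa> ` sphere 0 1 \<subseteq> closure \<Omega>" by (auto simp: fin_part_def)
  qed
qed

text \<open>\<open>cond\<close> and \<alpha> \<noteq> 0 force lam \<noteq> 0, so that
  \<open>interior_closure_W\<close> applies. The explicit loop gives rectifiability, and the
  integral along any other boundary cycle is reduced to it.\<close>

theorem quadrature_domain_image:
  assumes \<alpha>: "\<alpha> \<noteq> 0" and u1: "u1 = 1 / cnj a" and cond: "cnj lam * (1 + lam * a * u1 / (u1 - a)\<^sup>2) = \<alpha>"
    and dom: "sph_domain \<Omega>" and inf: "Infty \<in> \<Omega>" and fin: "fin_part \<Omega> = W"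
  shows "\<Omega> \<in> QD0 (\<lambda>w. \<alpha> / (w - \<kappa> u1))"
proof -
  have op: "open \<Omega>" using dom by (simp add: sph_domain_def)
  have lam: "lam \<noteq> 0" using cond \<alpha> by auto
  have u1b: "cmod u1 < 1" "u1 \<noteq> 0" using a by (auto simp: u1 norm_divide divide_simps)
  let ?K = "\<kappa> ` sphere 0 1"
  have fr: "fin_part (frontier \<Omega>) = ?K" by (simp add: fin_part_frontier fin frontier_W)
  then have frF: "Fin z \<in> frontier \<Omega> \<longleftrightarrow> z \<in> ?K" for z unfolding fr[symmetric] by (simp add: fin_part_def)
  have FW: "Fin z \<in> \<Omega> \<longleftrightarrow> z \<in> W" for z unfolding fin[symmetric] by (simp add: fin_part_def)
  have infr: "Infty \<notin> frontier \<Omega>" using inf op by (simp add: frontier_def interior_open)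
  have bc: "boundary_cycle \<Omega> [boundary_loop]"
    unfolding boundary_cycle_def using infr rectifiable_boundary_loop
    by (simp add: fr path_image_boundary_loop frF FW inf winding_number_boundary_loop)
  have zfr: "Fin 0 \<notin> frontier \<Omega>"
  proof
    assume "Fin 0 \<in> frontier \<Omega>"
    then obtain v where v: "v \<in> sphere 0 1" "0 = \<kappa> v" unfolding frF by blast
    have "v \<noteq> 0" using v(1) by auto
    from notE[OF kmap_nonzero[OF this] v(2)[symmetric]] show False .
  qed
  have "\<Omega> = interior (closure \<Omega>)"
  proof (rule equalityI)
    show "\<Omega> \<subseteq> interior (closure \<Omega>)" by (rule interior_maximal[OF closure_subset op])
    have "fin_part (interior (closure \<Omega>)) = fin_part \<Omega>"
      by (simp add: fin_part_interior fin_part_closure fin interior_closure_W[OF lam])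
    then have "Fin z \<in> interior (closure \<Omega>) \<longleftrightarrow> Fin z \<in> \<Omega>" for z by (auto simp: fin_part_def set_eq_iff)
    then show "interior (closure \<Omega>) \<subseteq> \<Omega>" using inf by (metis csph.exhaust subsetI)
  qed
  moreover have "(\<lambda>w. \<alpha> / (w - \<kappa> u1)) \<in> Rat_in \<Omega>"
  proof -
    have "coprime [:\<alpha>:] [:- \<kappa> u1, 1:]" using \<alpha> by (intro is_unit_left_imp_coprime) (simp add: is_unit_const_poly_iff dvd_field_iff)
    moreover have "Fin (\<kappa> u1) \<in> \<Omega>" using u1b by (auto simp: FW W_def)
    ultimately show ?thesis
      unfolding Rat_in_def by (intro CollectI exI[of _ "[:\<alpha>:]"] exI[of _ "[:- \<kappa> u1, 1:]"]) auto
  qed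
  moreover have "\<exists>I. cycle_has_integral (\<lambda>w. f (Fin w) * (\<alpha> / (w - \<kappa> u1))) \<Gamma> I \<and>
      ((\<lambda>R. integral (fin_part \<Omega> \<inter> ball 0 R) (\<lambda>w. f (Fin w) / (of_real ((cmod w)\<^sup>2))) / of_real pi)
         \<longlongrightarrow> I / (2 * of_real pi * \<i>)) at_top"
    if \<Gamma>: "boundary_cycle \<Omega> \<Gamma>" and f: "f \<in> L1a_rho0 \<Omega>" for \<Gamma> f
  proof -
    note Q = quadrature_identity_image[OF u1 cond op inf fin f]
    let ?g = "\<lambda>w. f (Fin w) * (\<alpha> / (w - \<kappa> u1))"
    have ne: "w - \<kappa> u1 \<noteq> 0" if "w \<in> ?K" for w
      using that kmap_sphere_disjoint[OF _ u1b] by auto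
    have gc: "continuous_on ?K ?g" using ne by (intro continuous_intros Q(3)) auto
    have rect: "rectifiable_loop \<gamma>" and img: "path_image \<gamma> \<subseteq> ?K" if "\<gamma> \<in> set \<Gamma> \<union> set [boundary_loop]" for \<gamma>
    proof -
      have "(\<Union>\<gamma>\<in>set \<Gamma>. path_image \<gamma>) = ?K" "\<forall>\<gamma>\<in>set \<Gamma>. rectifiable_loop \<gamma>"
        using \<Gamma> fr by (auto simp: boundary_cycle_def)
      then show "rectifiable_loop \<gamma>" "path_image \<gamma> \<subseteq> ?K"
        using that rectifiable_boundary_loop path_image_boundary_loop by auto
    qed
    obtain I where I: "cycle_has_integral ?g \<Gamma> I"
      using cycle_has_integral_continuous[of \<Gamma> ?g] rect continuous_on_subset[OF gc img] by blast
    obtain I0 where I0: "cycle_has_integral ?g [boundary_loop] I0"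
      using cycle_has_integral_continuous[of "[boundary_loop]" ?g] rect continuous_on_subset[OF gc img] by blast
    have wind: "(\<Sum>\<gamma>\<leftarrow>\<Gamma>. winding_number \<gamma> z) = (\<Sum>\<gamma>\<leftarrow>[boundary_loop]. winding_number \<gamma> z)" if "z \<notin> ?K" for z
      using that \<Gamma> bc unfolding boundary_cycle_def frF by simp
    have "continuous_on (sphere 0 1) \<kappa>"
      using sphere_subset by (intro holomorphic_on_imp_continuous_on) (rule holomorphic_on_subset[OF kmap_holomorphic])
    then have cK: "compact ?K" by (rule compact_continuous_image) simp
    \<comment> \<open>Both cycles lie in the image of the circle, a compact null set, and have the
      same winding numbers off it.\<close>
    have "I = I0"
      by (rule cycle_integral_eq[OF rect img cK negligible_boundary wind gc I I0])
    moreover have "I0 = 2 * of_real pi * \<i> * (\<alpha> * f (Fin (\<kappa> u1)))"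
    proof (rule LIMSEQ_unique[OF _ Q(1)])
      have "cycle_sum ?g [boundary_loop] = rs_sum ?g boundary_loop" by (simp add: cycle_sum_def fun_eq_iff)
      then show "rs_sum ?g boundary_loop \<longlonglongrightarrow> I0" using cycle_has_integral_cycle_sum[OF I0] by simp
    qed
    ultimately have "I / (2 * of_real pi * \<i>) = \<alpha> * f (Fin (\<kappa> u1))" by simp
    then show ?thesis using I Q(2) by auto
  qed
  ultimately show ?thesis
    using dom bc zfr infr inf by (auto simp: QD0_def rectifiable_domain_def sph_bounded_def)
qed

end

theorem mainTheorem19:
  fixes \<alpha> w\<^sub>0 :: complex and \<Omega> :: "csph set"
  assumes "\<alpha> \<noteq> 0" and "w\<^sub>0 \<noteq> 0"
    and "sph_domain \<Omega>" and "\<not> sph_bounded \<Omega>" and "simply_connected \<Omega>"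
    and "Fin 0 \<notin> \<Omega>"
  shows "\<Omega> \<in> QD0 (\<lambda>w. \<alpha> / (w - w\<^sub>0)) \<longleftrightarrow>
    (\<exists>(c::real) (lam::complex) (z\<^sub>1::complex). c > 0 \<and> cmod z\<^sub>1 > 1 \<and>
       (let \<phi> = (\<lambda>z. of_real c * z * exp (lam / (1 - z * cnj z\<^sub>1)));
            \<Phi> = (\<lambda>p. case p of Fin z \<Rightarrow> Fin (\<phi> z) | Infty \<Rightarrow> Infty)
        in inj_on \<Phi> Dstar \<and> \<Omega> = \<Phi> ` Dstar \<and> \<phi> z\<^sub>1 = w\<^sub>0 \<and>
           lam = cnj \<alpha> * cnj w\<^sub>0 / (cnj z\<^sub>1 * cnj (deriv \<phi> z\<^sub>1))))"
    (is "?L \<longleftrightarrow> ?R")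
proof
  assume L: ?L
  obtain c :: real and lam z1 :: complex and g where c: "c > 0" and z1: "cmod z1 > 1"
    and g: "g holomorphic_on ball 0 1" "inj_on g (ball 0 1)" "g 0 = 0" "g ` ball 0 1 = inversion -` \<Omega>" "g (1 / z1) = 1 / w\<^sub>0"
    and formula: "\<And>z. cmod z > 1 \<Longrightarrow> of_real c * z * exp (lam / (1 - z * cnj z1)) = 1 / g (1 / z)"
    and lam: "lam = cnj (\<alpha> * z1 / (w\<^sub>0 * deriv g (1 / z1)))"
    by (rule quadrature_domain_imp_map[OF assms L], rule that,
      assumption, assumption, assumption, assumption, assumption, assumption, assumption, blast, assumption)
  define \<phi> where "\<phi> = (\<lambda>z. of_real c * z * exp (lam / (1 - z * cnj z1)))"
  define \<Phi> where "\<Phi> = (\<lambda>p. case p of Fin z \<Rightarrow> Fin (\<phi> z) | Infty \<Rightarrow> Infty)"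
  have \<phi>: "\<phi> z = 1 / g (1 / z)" if "cmod z > 1" for z using formula[OF that] by (simp add: \<phi>_def)
  have inv_ball: "1 / z \<in> ball 0 1 \<and> 1 / z \<noteq> 0" if "cmod z > 1" for z :: complex
    using that by (auto simp: norm_divide divide_simps)
  have g0: "g u \<noteq> 0" if "u \<in> ball 0 1" "u \<noteq> 0" for u
    using inj_onD[OF g(2), of u 0] that g(3) by auto
  \<comment> \<open>On the exterior disc the map of spheres is \<open>g\<close> conjugated by the
    inversions, so its injectivity and image are inherited from those of \<open>g\<close>.\<close>
  have \<Phi>: "\<Phi> p = inversion (g (coinversion p))" if "p \<in> Dstar" for p
  proof (cases p)
    case (Fin z)
    then have z: "cmod z > 1" using that by (auto simp: Dstar_def)
    then have "g (1 / z) \<noteq> 0" using inv_ball[OF z] g0 by blast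
    then show ?thesis using Fin \<phi>[OF z] by (simp add: \<Phi>_def inversion_def coinversion_def inverse_eq_divide)
  qed (simp add: \<Phi>_def inversion_def coinversion_def g(3))
  have co: "coinversion ` Dstar = ball 0 1"
  proof
    show "coinversion ` Dstar \<subseteq> ball 0 1"
      using inv_ball by (auto simp: Dstar_def coinversion_def inverse_eq_divide)
    show "ball 0 1 \<subseteq> coinversion ` Dstar"
    proof
      fix u :: complex assume u: "u \<in> ball 0 1"
      have "inversion u \<in> Dstar"
        using u by (auto simp: inversion_def Dstar_def norm_divide norm_inverse divide_simps)
      then show "u \<in> coinversion ` Dstar" by (metis coinversion_inversion image_eqI)
    qed
  qed
  have "inj_on (inversion \<circ> g \<circ> coinversion) Dstar"
  proof (intro comp_inj_on)
    have "p \<noteq> Fin 0" if "p \<in> Dstar" for p using that by (auto simp: Dstar_def)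
    then show "inj_on coinversion Dstar" by (metis inj_onI inversion_coinversion)
    show "inj_on inversion (g ` coinversion ` Dstar)" by (metis inj_onI coinversion_inversion)
  qed (simp add: co g(2))
  then have "inj_on \<Phi> Dstar" using inj_on_cong[of Dstar \<Phi> "inversion \<circ> g \<circ> coinversion"] \<Phi> by simp
  moreover have "\<Omega> = \<Phi> ` Dstar"
  proof -
    have "\<Phi> ` Dstar = inversion ` g ` coinversion ` Dstar" unfolding image_image by (rule image_cong) (auto simp: \<Phi>)
    also have "\<dots> = inversion ` (inversion -` \<Omega>)" by (simp only: co g(4))
    also have "\<dots> = \<Omega>"
    proof (rule image_vimage_eq[THEN trans])
      have "p \<in> range inversion" if "p \<in> \<Omega>" for p
        using that assms(6) by (metis inversion_coinversion rangeI)
      then show "\<Omega> \<inter> range inversion = \<Omega>" by blast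
    qed
    finally show ?thesis ..
  qed
  moreover have "\<phi> z1 = w\<^sub>0" using \<phi>[OF z1] g(5) by simp
  moreover have "lam = cnj \<alpha> * cnj w\<^sub>0 / (cnj z1 * cnj (deriv \<phi> z1))"
  proof -
    have z0: "z1 \<noteq> 0" using z1 by auto
    have gz: "g (1 / z1) \<noteq> 0" using g(5) assms(2) by simp
    have "(g has_field_derivative deriv g (1 / z1)) (at (1 / z1))"
      using holomorphic_derivI[OF g(1)] inv_ball[OF z1] by blast
    moreover have "((\<lambda>z. 1 / z) has_field_derivative - (1 / z1\<^sup>2)) (at z1)"
      using z0 by (auto intro!: derivative_eq_intros simp: power2_eq_square)
    ultimately have "((\<lambda>z. g (1 / z)) has_field_derivative deriv g (1 / z1) * - (1 / z1\<^sup>2)) (at z1)"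
      by (rule DERIV_chain2)
    from DERIV_divide[OF DERIV_const[of 1] this gz]
    have "((\<lambda>z. 1 / g (1 / z)) has_field_derivative deriv g (1 / z1) * w\<^sub>0\<^sup>2 / z1\<^sup>2) (at z1)"
      using assms(2) by (simp add: g(5) power2_eq_square)
    then have "(\<phi> has_field_derivative deriv g (1 / z1) * w\<^sub>0\<^sup>2 / z1\<^sup>2) (at z1)"
      by (rule has_field_derivative_transform_within_open[of _ _ _ "- cball 0 1"]) (use z1 \<phi> in auto)
    then have d: "deriv \<phi> z1 = deriv g (1 / z1) * w\<^sub>0\<^sup>2 / z1\<^sup>2" by (rule DERIV_imp_deriv)
    have "\<alpha> * w\<^sub>0 / (z1 * deriv \<phi> z1) = \<alpha> * z1 / (w\<^sub>0 * deriv g (1 / z1))"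
      unfolding d using z0 assms(2) by (simp add: power2_eq_square)
    then have "lam = cnj (\<alpha> * w\<^sub>0 / (z1 * deriv \<phi> z1))" by (simp only: lam)
    then show ?thesis by simp
  qed
  ultimately show ?R
    using c z1 unfolding Let_def \<Phi>_def \<phi>_def by blast
next
  assume ?R
  then obtain c :: real and lam z1 :: complex where c: "c > 0" and z1: "cmod z1 > 1"
    and R: "let \<phi> = (\<lambda>z. of_real c * z * exp (lam / (1 - z * cnj z1)));
            \<Phi> = (\<lambda>p. case p of Fin z \<Rightarrow> Fin (\<phi> z) | Infty \<Rightarrow> Infty)
        in inj_on \<Phi> Dstar \<and> \<Omega> = \<Phi> ` Dstar \<and> \<phi> z1 = w\<^sub>0 \<and>
           lam = cnj \<alpha> * cnj w\<^sub>0 / (cnj z1 * cnj (deriv \<phi> z1))"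
    by blast
  define \<phi> where "\<phi> = (\<lambda>z. of_real c * z * exp (lam / (1 - z * cnj z1)))"
  define \<Phi> where "\<Phi> = (\<lambda>p. case p of Fin z \<Rightarrow> Fin (\<phi> z) | Infty \<Rightarrow> Infty)"
  have inj\<Phi>: "inj_on \<Phi> Dstar" and \<Omega>: "\<Omega> = \<Phi> ` Dstar" and \<phi>z1: "\<phi> z1 = w\<^sub>0"
    and lam: "lam = cnj \<alpha> * cnj w\<^sub>0 / (cnj z1 * cnj (deriv \<phi> z1))"
    using R unfolding Let_def \<Phi>_def \<phi>_def by blast+
  \<comment> \<open>In the coordinate u = 1/z the essential singularity sits at a = cnj z1. The
    preimage \<open>u1\<close> of the pole \<open>w\<^sub>0\<close> equals 1 / cnj a, the reflection
    of a in the unit circle.\<close>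
  define a where "a = cnj z1"
  define u1 where "u1 = 1 / z1"
  have \<phi>k: "\<phi> z = kmap c a lam (1 / z)" if "z \<noteq> 0" for z
  proof -
    have "1 - z * a = (1 / z - a) * z" using that by (simp add: field_simps)
    then have e: "lam * (1 / z) / (1 / z - a) = lam / (1 - z * a)" by simp
    have "kmap c a lam (1 / z) = of_real c * exp (lam / (1 - z * a)) / (1 / z)" by (simp only: kmap_def e)
    also have "\<dots> = \<phi> z" by (simp add: \<phi>_def a_def)
    finally show ?thesis by (rule sym)
  qed
  have kD: "Fin (1 / u) \<in> Dstar \<and> \<Phi> (Fin (1 / u)) = Fin (kmap c a lam u)" if "u \<in> ball 0 1 - {0}" for u
  proof -
    have "cmod (1 / u) > 1" using that by (auto simp: norm_divide divide_simps)
    then show ?thesis using that \<phi>k[of "1 / u"] by (simp add: \<Phi>_def Dstar_def)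
  qed
  interpret exterior_map c a lam
  proof
    show "c > 0" "cmod a > 1" using c z1 by (auto simp: a_def)
    show "inj_on (kmap c a lam) (ball 0 1 - {0})"
    proof (rule inj_onI)
      fix u v assume uv: "u \<in> ball 0 1 - {0}" "v \<in> ball 0 1 - {0}" "kmap c a lam u = kmap c a lam v"
      have "\<Phi> (Fin (1 / u)) = \<Phi> (Fin (1 / v))" using kD uv by simp
      from inj_onD[OF inj\<Phi> this] kD uv(1,2) have "Fin (1 / u) = Fin (1 / v)" by blast
      then show "u = v" by simp
    qed
  qed
  have inf: "Infty \<in> \<Omega>" unfolding \<Omega> by (rule image_eqI[of _ _ Infty]) (simp_all add: \<Phi>_def Dstar_def)
  have fin: "fin_part \<Omega> = W"
  proof
    show "W \<subseteq> fin_part \<Omega>"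
    proof
      fix w assume "w \<in> W"
      then obtain u where u: "u \<in> ball 0 1 - {0}" "w = \<kappa> u" unfolding W_def by blast
      then have "Fin w \<in> \<Phi> ` Dstar" using kD[OF u(1)] by (metis image_eqI)
      then show "w \<in> fin_part \<Omega>" by (simp add: \<Omega> fin_part_def)
    qed
    show "fin_part \<Omega> \<subseteq> W"
    proof
      fix w assume "w \<in> fin_part \<Omega>"
      then obtain p where p: "p \<in> Dstar" "Fin w = \<Phi> p" by (auto simp: \<Omega> fin_part_def)
      then obtain z where z: "p = Fin z" "cmod z > 1" by (auto simp: Dstar_def \<Phi>_def)
      have "1 / z \<in> ball 0 1 - {0}" using z(2) by (auto simp: norm_divide divide_simps)
      moreover have "z \<noteq> 0" using z(2) by auto
      then have "w = \<kappa> (1 / z)" using p z \<phi>k by (simp add: \<Phi>_def)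
      ultimately show "w \<in> W" unfolding W_def by blast
    qed
  qed
  have z0: "z1 \<noteq> 0" using z1 by auto
  have u1: "u1 = 1 / cnj a" "u1 \<noteq> 0" "cmod u1 < 1" using z1 z0 by (auto simp: u1_def a_def norm_divide divide_simps)
  have ku1: "\<kappa> u1 = w\<^sub>0" using \<phi>k[OF z0] \<phi>z1 by (simp add: u1_def)
  \<comment> \<open>Minus u1 times the logarithmic derivative of \<kappa> at \<open>u1\<close>. In
    these terms \<phi>'(z1) = w0 Y / z1, and the relation for lam becomes cnj lam Y = \<alpha>, the
    hypothesis of \<open>quadrature_domain_image\<close>.\<close>
  define Y where "Y = 1 + lam * a * u1 / (u1 - a)\<^sup>2"
  have u1a: "u1 \<noteq> a" using cball_neq_a[of u1] u1 by simp
  have dk: "deriv \<kappa> u1 = - w\<^sub>0 * (Y / u1)"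
  proof -
    have "1 / u1 + lam * a / (u1 - a)\<^sup>2 = Y / u1" using u1(2) by (simp add: Y_def add_divide_distrib)
    then show ?thesis by (simp only: deriv_kmap[OF u1(2) u1a] ku1)
  qed
  have Y0: "Y \<noteq> 0" using dk deriv_kmap_nonzero[OF u1(3,2)] by auto
  have "((\<lambda>z. 1 / z) has_field_derivative - (1 / z1\<^sup>2)) (at z1)"
    using z0 by (auto intro!: derivative_eq_intros simp: power2_eq_square)
  from DERIV_chain2[OF kmap_deriv[OF u1(2) u1a, unfolded u1_def] this]
  have "((\<lambda>z. \<kappa> (1 / z)) has_field_derivative deriv \<kappa> u1 * - (1 / z1\<^sup>2)) (at z1)" by (simp add: u1_def)
  then have "(\<phi> has_field_derivative deriv \<kappa> u1 * - (1 / z1\<^sup>2)) (at z1)"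
    by (rule has_field_derivative_transform_within_open[of _ _ _ "- {0}"]) (use z0 \<phi>k in auto)
  then have "deriv \<phi> z1 = deriv \<kappa> u1 * - (1 / z1\<^sup>2)" by (rule DERIV_imp_deriv)
  also have "\<dots> = w\<^sub>0 * Y / z1" unfolding dk using z0 by (simp add: u1_def power2_eq_square)
  finally have "lam = cnj \<alpha> * cnj w\<^sub>0 / (cnj z1 * cnj (w\<^sub>0 * Y / z1))" using lam by simp
  then have "cnj lam = \<alpha> * w\<^sub>0 / (z1 * (w\<^sub>0 * Y / z1))"
    by simp
  then have "cnj lam * Y = \<alpha>" using z0 Y0 assms(2) by simp
  from quadrature_domain_image[OF assms(1) u1(1) this[unfolded Y_def] assms(3) inf fin]
  show ?L by (simp only: ku1)
qed

end
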